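(* Let $\mathcal C$ be a chorded monoidal category and let $X$ be a degenerate Hecke object of $\mathcal C$, with $h_{X,X}=\lambda\,c_{X,X}$ for a non-zero scalar $\lambda\in k$. Let $O:\mathcal C\to\mathcal C$ be the functor of tensoring by $X$ from the right, $O(Y)=Y\otimes X$; let $c$ be the natural transformation of $O\circ O$ given by $1_Y\otimes c_{X,X}:Y\otimes X^{\otimes2}\to Y\otimes X^{\otimes2}$, where $O\circ O(Y)=Y\otimes X^{\otimes2}$; and let $x:O\to O$ be the natural transformation given by $\lambda^{-1}h_{Y,X}:Y\otimes X\to Y\otimes X$. Then the triple $(O,x,c)$ defines a monoidal functor $CAS_X:\mathcal L\to\mathrm{Funct}(\mathcal C,\mathcal C)$.
   Context: $k$ is a field; categories and functors are $k$-linear, and monoidal functors are strong monoidal. $\mathrm{Funct}(\mathcal C,\mathcal C)$ is the monoidal category of endofunctors of $\mathcal C$, with composition as tensor product. A chording on a symmetric monoidal category $\mathcal C$ with symmetry $c_{X,Y}:X\otimes Y\to Y\otimes X$ is a natural collection of morphisms $h_{X,Y}:X\otimes Y\to X\otimes Y$ satisfying $$c_{X,Y}h_{Y,X}=h_{X,Y}c_{X,Y}$$ and $$h_{X,Y\otimes Z}=h_{X,Y}\otimes1_Z+(1_X\otimes c_{Y,Z})(h_{X,Z}\otimes1_Y)(1_X\otimes c_{Y,Z})^{-1},$$ where in these two formulas compositions are read from left to right (the leftmost morphism is applied first). A chorded category is a symmetric monoidal category with a chording. An object $X$ of a chorded category is a degenerate Hecke object if $h_{X,X}=\lambda\,c_{X,X}$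 for some non-zero scalar $\lambda\in k$. The degenerate affine Hecke algebra $\Lambda_n$ is the unital associative algebra generated by $t_1,\dots,t_{n-1}$ and $y_1,\dots,y_n$ subject to $t_i^2=1$, $t_it_{i+1}t_i=t_{i+1}t_it_{i+1}$, $t_it_j=t_jt_i$ for $|i-j|>1$, $y_it_i-t_iy_{i+1}=1$, $y_iy_j=y_jy_i$, and $t_iy_j=y_jt_i$ for $j\ne i,i+1$. There are algebra homomorphisms $\mu_{m,n}:\Lambda_m\otimes\Lambda_n\to\Lambda_{m+n}$, $t_i\otimes1\mapsto t_i$, $1\otimes t_j\mapsto t_{j+m}$, $y_i\otimes1\mapsto y_i$, $1\otimes y_j\mapsto y_{j+m}$. $\overline{\mathcal C}(\Lambda_* )$ is the monoidal category with objects $[n]$, $n\ge0$, no morphisms between different objects, $\mathrm{End}([n])=\Lambda_n$, $[m]\otimes[n]=[m+n]$ and tensor product of morphisms given by $\mu_{m,n}$. The degenerate affine Hecke category $\mathcal L=\mathcal C(\Lambda_* )$ is the category of $k$-linear functors from $\overline{\mathcal C}(\Lambda_* )^{op}$ to vector spaces, i.e. the direct sum $\oplus_n\mathrm{Mod}\text{-}\Lambda_n$ of categories of right modules, with the monoidal structure $M\otimes N=(M\otimes_kN)\otimes_{\Lambda_m\otimes\Lambda_n}\Lambda_{m+n}$ (Day convolution) for a $\Lambda_m$-module $M$ and a $\Lambda_n$-module $N$. That the triple $(O,x,c)$ defines the functor means that it sends the generating object $[1]$ of $\mathcal L$ (that is, $\Lambda_1$ as a module over itself) to $O$, its endomorphism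 given by $y_1\in\Lambda_1$ to $x$, and the endomorphism of its tensor square given by $t_1\in\Lambda_2$ to $c$.
   Formalization: The functor on all of L is shown when C has small colimits preserved by tensoring with X (it fails e.g. for finite-dimensional vector spaces with h = 0, X = 0); for arbitrary C the monoidal functor is shown on the subcategory of L with objects [n] and endomorphism algebras Λ_n. *)

theory Defs
  imports
    Complex_Main
    "HOL-Library.Poly_Mapping"
    "HOL-Algebra.QuotRing"
    "HOL-Algebra.Module"
begin

section \<open>Linear categories\<close>

text \<open>The ground field is the type \<open>'k::field\<close>; vector spaces with an explicit carrier are
  modules, in the sense of HOL-Algebra, over the following ring. The fields \<open>mult\<close> and \<open>one\<close> that
  a module record inherits from ring records play no role.\<close>

definition scalars :: "'k::field ring" where
  "scalars = \<lparr>carrier = UNIV, mult = (*), one = 1, zero = 0, add = (+)\<rparr>"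

abbreviation vspace :: "('k::field, 'v) module \<Rightarrow> bool" where
  "vspace V \<equiv> Module.module scalars V"

record ('o, 'm, 'k) kcat =
  Obj :: "'o set"
  Arr :: "'m set"
  Src :: "'m \<Rightarrow> 'o"
  Tgt :: "'m \<Rightarrow> 'o"
  Idt :: "'o \<Rightarrow> 'm"
  Cmp :: "'m \<Rightarrow> 'm \<Rightarrow> 'm" (infixr \<open>\<cdot>\<index>\<close> 70) \<comment> \<open>\<open>g \<cdot> f\<close> applies \<open>f\<close> first\<close>
  Plus :: "'m \<Rightarrow> 'm \<Rightarrow> 'm"
  Nul :: "'o \<Rightarrow> 'o \<Rightarrow> 'm"
  Scal :: "'k \<Rightarrow> 'm \<Rightarrow> 'm"

definition homset :: "('o, 'm, 'k, 'z) kcat_scheme \<Rightarrow> 'o \<Rightarrow> 'o \<Rightarrow> 'm set" where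
  "homset C a b = {f \<in> Arr C. Src C f = a \<and> Tgt C f = b}"

definition hom_space :: "('o, 'm, 'k, 'z) kcat_scheme \<Rightarrow> 'o \<Rightarrow> 'o \<Rightarrow> ('k, 'm) module" where
  "hom_space C a b = \<lparr>carrier = homset C a b, mult = undefined, one = undefined,
     zero = Nul C a b, add = Plus C, smult = Scal C\<rparr>"

locale klinear_category =
  fixes C :: "('o, 'm, 'k::field, 'z) kcat_scheme" (structure)
  assumes src_tgt: "f \<in> Arr C \<Longrightarrow> Src C f \<in> Obj C \<and> Tgt C f \<in> Obj C"
    and idt: "a \<in> Obj C \<Longrightarrow> Idt C a \<in> homset C a a"
    and cmp: "f \<in> homset C a b \<Longrightarrow> g \<in> homset C b c \<Longrightarrow> g \<cdot> f \<in> homset C a c"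
    and cmp_assoc: "f \<in> homset C a b \<Longrightarrow> g \<in> homset C b c \<Longrightarrow> h \<in> homset C c d \<Longrightarrow>
      (h \<cdot> g) \<cdot> f = h \<cdot> (g \<cdot> f)"
    and cmp_idt: "f \<in> homset C a b \<Longrightarrow> f \<cdot> Idt C a = f \<and> Idt C b \<cdot> f = f"
    and hom_vspace: "a \<in> Obj C \<Longrightarrow> b \<in> Obj C \<Longrightarrow> vspace (hom_space C a b)"
    and cmp_plus: "f \<in> homset C a b \<Longrightarrow> f' \<in> homset C a b \<Longrightarrow> g \<in> homset C b c \<Longrightarrow>
      g' \<in> homset C b c \<Longrightarrow>
      g \<cdot> Plus C f f' = Plus C (g \<cdot> f) (g \<cdot> f') \<and> Plus C g g' \<cdot> f = Plus C (g \<cdot> f) (g' \<cdot> f)"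
    and cmp_scal: "f \<in> homset C a b \<Longrightarrow> g \<in> homset C b c \<Longrightarrow>
      g \<cdot> Scal C s f = Scal C s (g \<cdot> f) \<and> Scal C s g \<cdot> f = Scal C s (g \<cdot> f)"

definition inverse_pair :: "('o, 'm, 'k, 'z) kcat_scheme \<Rightarrow> 'm \<Rightarrow> 'm \<Rightarrow> bool" where
  "inverse_pair C f g \<longleftrightarrow> f \<in> Arr C \<and> g \<in> homset C (Tgt C f) (Src C f) \<and>
     Cmp C g f = Idt C (Src C f) \<and> Cmp C f g = Idt C (Tgt C f)"

definition is_iso :: "('o, 'm, 'k, 'z) kcat_scheme \<Rightarrow> 'm \<Rightarrow> bool" where
  "is_iso C f \<longleftrightarrow> (\<exists>g. inverse_pair C f g)"

definition inv_arr :: "('o, 'm, 'k, 'z) kcat_scheme \<Rightarrow> 'm \<Rightarrow> 'm" where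
  "inv_arr C f = (THE g. inverse_pair C f g)"

definition op_cat :: "('o, 'm, 'k) kcat \<Rightarrow> ('o, 'm, 'k) kcat" where
  "op_cat C = \<lparr>Obj = Obj C, Arr = Arr C, Src = Tgt C, Tgt = Src C, Idt = Idt C,
     Cmp = (\<lambda>g f. Cmp C f g), Plus = Plus C, Nul = (\<lambda>a b. Nul C b a), Scal = Scal C\<rparr>"


section \<open>Linear functors and functor categories\<close>

text \<open>The maps of a functor, and the components of a natural transformation, are \<open>undefined\<close>
  outside the source category, so that equal functors and transformations are equal in HOL.\<close>

record ('o, 'm, 'p, 'n) ftor =
  OMap :: "'o \<Rightarrow> 'p"
  AMap :: "'m \<Rightarrow> 'n"

definition klinear_functor ::
  "('o, 'm, 'k, 'y) kcat_scheme \<Rightarrow> ('p, 'n, 'k, 'z) kcat_scheme \<Rightarrow> ('o, 'm, 'p, 'n) ftor \<Rightarrow> bool" where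
  "klinear_functor C D F \<longleftrightarrow>
     OMap F \<in> extensional (Obj C) \<and> AMap F \<in> extensional (Arr C) \<and>
     (\<forall>a\<in>Obj C. OMap F a \<in> Obj D \<and> AMap F (Idt C a) = Idt D (OMap F a)) \<and>
     (\<forall>f\<in>Arr C. AMap F f \<in> homset D (OMap F (Src C f)) (OMap F (Tgt C f))) \<and>
     (\<forall>f\<in>Arr C. \<forall>g\<in>Arr C. Tgt C f = Src C g \<longrightarrow>
        AMap F (Cmp C g f) = Cmp D (AMap F g) (AMap F f)) \<and>
     (\<forall>a b. \<forall>f\<in>homset C a b. \<forall>g\<in>homset C a b.
        AMap F (Plus C f g) = Plus D (AMap F f) (AMap F g)) \<and>
     (\<forall>f\<in>Arr C. \<forall>s. AMap F (Scal C s f) = Scal D s (AMap F f))"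

record ('o, 'm, 'p, 'n) ntrans =
  NSrc :: "('o, 'm, 'p, 'n) ftor"
  NTgt :: "('o, 'm, 'p, 'n) ftor"
  NAt :: "'o \<Rightarrow> 'n"

definition natural_transformation ::
  "('o, 'm, 'k, 'y) kcat_scheme \<Rightarrow> ('p, 'n, 'k, 'z) kcat_scheme \<Rightarrow> ('o, 'm, 'p, 'n) ntrans \<Rightarrow> bool"
  where
  "natural_transformation C D \<tau> \<longleftrightarrow>
     klinear_functor C D (NSrc \<tau>) \<and> klinear_functor C D (NTgt \<tau>) \<and>
     NAt \<tau> \<in> extensional (Obj C) \<and>
     (\<forall>a\<in>Obj C. NAt \<tau> a \<in> homset D (OMap (NSrc \<tau>) a) (OMap (NTgt \<tau>) a)) \<and>
     (\<forall>f\<in>Arr C. Cmp D (NAt \<tau> (Tgt C f)) (AMap (NSrc \<tau>) f) =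
        Cmp D (AMap (NTgt \<tau>) f) (NAt \<tau> (Src C f)))"

definition functor_cat ::
  "('o, 'm, 'k, 'y) kcat_scheme \<Rightarrow> ('p, 'n, 'k, 'z) kcat_scheme \<Rightarrow>
   (('o, 'm, 'p, 'n) ftor, ('o, 'm, 'p, 'n) ntrans, 'k) kcat" where
  "functor_cat C D = \<lparr>
     Obj = {F. klinear_functor C D F},
     Arr = {\<tau>. natural_transformation C D \<tau>},
     Src = NSrc,
     Tgt = NTgt,
     Idt = (\<lambda>F. \<lparr>NSrc = F, NTgt = F, NAt = (\<lambda>a\<in>Obj C. Idt D (OMap F a))\<rparr>),
     Cmp = (\<lambda>\<tau> \<sigma>. \<lparr>NSrc = NSrc \<sigma>, NTgt = NTgt \<tau>, NAt = (\<lambda>a\<in>Obj C. Cmp D (NAt \<tau> a) (NAt \<sigma> a))\<rparr>),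
     Plus = (\<lambda>\<sigma> \<tau>. \<lparr>NSrc = NSrc \<sigma>, NTgt = NTgt \<sigma>, NAt = (\<lambda>a\<in>Obj C. Plus D (NAt \<sigma> a) (NAt \<tau> a))\<rparr>),
     Nul = (\<lambda>F G. \<lparr>NSrc = F, NTgt = G, NAt = (\<lambda>a\<in>Obj C. Nul D (OMap F a) (OMap G a))\<rparr>),
     Scal = (\<lambda>s \<tau>. \<lparr>NSrc = NSrc \<tau>, NTgt = NTgt \<tau>, NAt = (\<lambda>a\<in>Obj C. Scal D s (NAt \<tau> a))\<rparr>)\<rparr>"


section \<open>Monoidal, symmetric and chorded categories\<close>

record ('o, 'm, 'k) moncat = "('o, 'm, 'k) kcat" +
  TObj :: "'o \<Rightarrow> 'o \<Rightarrow> 'o" (infixl \<open>\<star>\<index>\<close> 75)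
  TArr :: "'m \<Rightarrow> 'm \<Rightarrow> 'm" (infixl \<open>\<boxtimes>\<index>\<close> 75)
  One :: 'o
  Assoc :: "'o \<Rightarrow> 'o \<Rightarrow> 'o \<Rightarrow> 'm"
  LUnit :: "'o \<Rightarrow> 'm"
  RUnit :: "'o \<Rightarrow> 'm"

locale klinear_monoidal_category = klinear_category C
  for C :: "('o, 'm, 'k::field, 'z) moncat_scheme" (structure) +
  assumes tobj: "a \<in> Obj C \<Longrightarrow> b \<in> Obj C \<Longrightarrow> a \<star> b \<in> Obj C"
    and tarr: "f \<in> homset C a a' \<Longrightarrow> g \<in> homset C b b' \<Longrightarrow> f \<boxtimes> g \<in> homset C (a \<star> b) (a' \<star> b')"
    and tarr_idt: "a \<in> Obj C \<Longrightarrow> b \<in> Obj C \<Longrightarrow> Idt C a \<boxtimes> Idt C b = Idt C (a \<star> b)"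
    and tarr_cmp: "f \<in> homset C a a' \<Longrightarrow> f' \<in> homset C a' a'' \<Longrightarrow>
      g \<in> homset C b b' \<Longrightarrow> g' \<in> homset C b' b'' \<Longrightarrow>
      (f' \<cdot> f) \<boxtimes> (g' \<cdot> g) = (f' \<boxtimes> g') \<cdot> (f \<boxtimes> g)"
    and tarr_plus: "f \<in> homset C a a' \<Longrightarrow> f' \<in> homset C a a' \<Longrightarrow>
      g \<in> homset C b b' \<Longrightarrow> g' \<in> homset C b b' \<Longrightarrow>
      Plus C f f' \<boxtimes> g = Plus C (f \<boxtimes> g) (f' \<boxtimes> g) \<and> f \<boxtimes> Plus C g g' = Plus C (f \<boxtimes> g) (f \<boxtimes> g')"
    and tarr_scal: "f \<in> Arr C \<Longrightarrow> g \<in> Arr C \<Longrightarrow>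
      Scal C s f \<boxtimes> g = Scal C s (f \<boxtimes> g) \<and> f \<boxtimes> Scal C s g = Scal C s (f \<boxtimes> g)"
    and one: "One C \<in> Obj C"
    and assoc: "a \<in> Obj C \<Longrightarrow> b \<in> Obj C \<Longrightarrow> c \<in> Obj C \<Longrightarrow>
      Assoc C a b c \<in> homset C ((a \<star> b) \<star> c) (a \<star> (b \<star> c)) \<and> is_iso C (Assoc C a b c)"
    and lunit: "a \<in> Obj C \<Longrightarrow> LUnit C a \<in> homset C (One C \<star> a) a \<and> is_iso C (LUnit C a)"
    and runit: "a \<in> Obj C \<Longrightarrow> RUnit C a \<in> homset C (a \<star> One C) a \<and> is_iso C (RUnit C a)"
    and assoc_nat: "f \<in> homset C a a' \<Longrightarrow> g \<in> homset C b b' \<Longrightarrow> h \<in> homset C c c' \<Longrightarrow>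
      Assoc C a' b' c' \<cdot> ((f \<boxtimes> g) \<boxtimes> h) = (f \<boxtimes> (g \<boxtimes> h)) \<cdot> Assoc C a b c"
    and lunit_nat: "f \<in> homset C a b \<Longrightarrow> LUnit C b \<cdot> (Idt C (One C) \<boxtimes> f) = f \<cdot> LUnit C a"
    and runit_nat: "f \<in> homset C a b \<Longrightarrow> RUnit C b \<cdot> (f \<boxtimes> Idt C (One C)) = f \<cdot> RUnit C a"
    and pentagon: "a \<in> Obj C \<Longrightarrow> b \<in> Obj C \<Longrightarrow> c \<in> Obj C \<Longrightarrow> d \<in> Obj C \<Longrightarrow>
      Assoc C a b (c \<star> d) \<cdot> Assoc C (a \<star> b) c d =
      (Idt C a \<boxtimes> Assoc C b c d) \<cdot> Assoc C a (b \<star> c) d \<cdot> (Assoc C a b c \<boxtimes> Idt C d)"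
    and triangle: "a \<in> Obj C \<Longrightarrow> b \<in> Obj C \<Longrightarrow>
      (Idt C a \<boxtimes> LUnit C b) \<cdot> Assoc C a (One C) b = RUnit C a \<boxtimes> Idt C b"

record ('o, 'm, 'k) symcat = "('o, 'm, 'k) moncat" +
  Sym :: "'o \<Rightarrow> 'o \<Rightarrow> 'm"

locale klinear_symmetric_category = klinear_monoidal_category C
  for C :: "('o, 'm, 'k::field, 'z) symcat_scheme" (structure) +
  assumes sym: "a \<in> Obj C \<Longrightarrow> b \<in> Obj C \<Longrightarrow> Sym C a b \<in> homset C (a \<star> b) (b \<star> a)"
    and sym_nat: "f \<in> homset C a a' \<Longrightarrow> g \<in> homset C b b' \<Longrightarrow>
      Sym C a' b' \<cdot> (f \<boxtimes> g) = (g \<boxtimes> f) \<cdot> Sym C a b"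
    and sym_sym: "a \<in> Obj C \<Longrightarrow> b \<in> Obj C \<Longrightarrow> Sym C b a \<cdot> Sym C a b = Idt C (a \<star> b)"
    and hexagon: "a \<in> Obj C \<Longrightarrow> b \<in> Obj C \<Longrightarrow> c \<in> Obj C \<Longrightarrow>
      Assoc C b c a \<cdot> Sym C a (b \<star> c) \<cdot> Assoc C a b c =
      (Idt C b \<boxtimes> Sym C a c) \<cdot> Assoc C b a c \<cdot> (Sym C a b \<boxtimes> Idt C c)"

record ('o, 'm, 'k) chordcat = "('o, 'm, 'k) symcat" +
  Chord :: "'o \<Rightarrow> 'o \<Rightarrow> 'm"

text \<open>In \<open>chord_tensor\<close> the associators, suppressed in the usual strict notation
  \<open>h\<^bsub>X,Y\<otimes>Z\<^esub> = h\<^bsub>X,Y\<^esub>\<otimes>1 + (1\<otimes>c\<^bsub>Y,Z\<^esub>)(h\<^bsub>X,Z\<^esub>\<otimes>1)(1\<otimes>c\<^bsub>Y,Z\<^esub>)\<inverse>\<close> (composition from left to right),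
  are written out, and the order of composition is reversed.\<close>

locale chorded_category = klinear_symmetric_category C
  for C :: "('o, 'm, 'k::field, 'z) chordcat_scheme" (structure) +
  assumes chord: "a \<in> Obj C \<Longrightarrow> b \<in> Obj C \<Longrightarrow> Chord C a b \<in> homset C (a \<star> b) (a \<star> b)"
    and chord_nat: "f \<in> homset C a a' \<Longrightarrow> g \<in> homset C b b' \<Longrightarrow>
      Chord C a' b' \<cdot> (f \<boxtimes> g) = (f \<boxtimes> g) \<cdot> Chord C a b"
    and chord_sym: "a \<in> Obj C \<Longrightarrow> b \<in> Obj C \<Longrightarrow>
      Chord C b a \<cdot> Sym C a b = Sym C a b \<cdot> Chord C a b"
    and chord_tensor: "a \<in> Obj C \<Longrightarrow> b \<in> Obj C \<Longrightarrow> c \<in> Obj C \<Longrightarrow>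
      Chord C a (b \<star> c) =
      Plus C
        (Assoc C a b c \<cdot> (Chord C a b \<boxtimes> Idt C c) \<cdot> inv_arr C (Assoc C a b c))
        (inv_arr C (Idt C a \<boxtimes> Sym C b c) \<cdot>
         (Assoc C a c b \<cdot> (Chord C a c \<boxtimes> Idt C b) \<cdot> inv_arr C (Assoc C a c b)) \<cdot>
         (Idt C a \<boxtimes> Sym C b c))"

definition degenerate_Hecke_object :: "('o, 'm, 'k::field, 'z) chordcat_scheme \<Rightarrow> 'o \<Rightarrow> bool" where
  "degenerate_Hecke_object C X \<longleftrightarrow>
     X \<in> Obj C \<and> (\<exists>l. l \<noteq> 0 \<and> Chord C X X = Scal C l (Sym C X X))"

definition strong_monoidal_functor ::
  "('o, 'm, 'k, 'y) moncat_scheme \<Rightarrow> ('p, 'n, 'k, 'z) moncat_scheme \<Rightarrow>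
   ('o, 'm, 'p, 'n) ftor \<Rightarrow> ('o \<Rightarrow> 'o \<Rightarrow> 'n) \<Rightarrow> 'n \<Rightarrow> bool" where
  "strong_monoidal_functor C D F \<phi> \<phi>0 \<longleftrightarrow>
     klinear_functor C D F \<and>
     (\<forall>a\<in>Obj C. \<forall>b\<in>Obj C.
        \<phi> a b \<in> homset D (OMap F a \<star>\<^bsub>D\<^esub> OMap F b) (OMap F (a \<star>\<^bsub>C\<^esub> b)) \<and> is_iso D (\<phi> a b)) \<and>
     \<phi>0 \<in> homset D (One D) (OMap F (One C)) \<and> is_iso D \<phi>0 \<and>
     (\<forall>f\<in>Arr C. \<forall>g\<in>Arr C.
        \<phi> (Tgt C f) (Tgt C g) \<cdot>\<^bsub>D\<^esub> (AMap F f \<boxtimes>\<^bsub>D\<^esub> AMap F g) =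
        AMap F (f \<boxtimes>\<^bsub>C\<^esub> g) \<cdot>\<^bsub>D\<^esub> \<phi> (Src C f) (Src C g)) \<and>
     (\<forall>a\<in>Obj C. \<forall>b\<in>Obj C. \<forall>c\<in>Obj C.
        AMap F (Assoc C a b c) \<cdot>\<^bsub>D\<^esub> \<phi> (a \<star>\<^bsub>C\<^esub> b) c \<cdot>\<^bsub>D\<^esub> (\<phi> a b \<boxtimes>\<^bsub>D\<^esub> Idt D (OMap F c)) =
        \<phi> a (b \<star>\<^bsub>C\<^esub> c) \<cdot>\<^bsub>D\<^esub> (Idt D (OMap F a) \<boxtimes>\<^bsub>D\<^esub> \<phi> b c) \<cdot>\<^bsub>D\<^esub>
          Assoc D (OMap F a) (OMap F b) (OMap F c)) \<and>
     (\<forall>a\<in>Obj C.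
        AMap F (LUnit C a) \<cdot>\<^bsub>D\<^esub> \<phi> (One C) a \<cdot>\<^bsub>D\<^esub> (\<phi>0 \<boxtimes>\<^bsub>D\<^esub> Idt D (OMap F a)) = LUnit D (OMap F a) \<and>
        AMap F (RUnit C a) \<cdot>\<^bsub>D\<^esub> \<phi> a (One C) \<cdot>\<^bsub>D\<^esub> (Idt D (OMap F a) \<boxtimes>\<^bsub>D\<^esub> \<phi>0) = RUnit D (OMap F a))"


section \<open>The monoidal category of endofunctors\<close>

definition ftor_comp ::
  "('o, 'm, 'k, 'z) kcat_scheme \<Rightarrow> ('o, 'm, 'o, 'm) ftor \<Rightarrow> ('o, 'm, 'o, 'm) ftor \<Rightarrow>
   ('o, 'm, 'o, 'm) ftor" where
  "ftor_comp C F G =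
     \<lparr>OMap = compose (Obj C) (OMap F) (OMap G), AMap = compose (Arr C) (AMap F) (AMap G)\<rparr>"

definition ftor_id :: "('o, 'm, 'k, 'z) kcat_scheme \<Rightarrow> ('o, 'm, 'o, 'm) ftor" where
  "ftor_id C = \<lparr>OMap = (\<lambda>a\<in>Obj C. a), AMap = (\<lambda>f\<in>Arr C. f)\<rparr>"

text \<open>The tensor product of \<open>F\<close> and \<open>G\<close> is \<open>F \<circ> G\<close> (apply \<open>G\<close> first). This order matters: with the
  opposite one, the endomorphisms below would not satisfy \<open>y\<^sub>1t\<^sub>1 - t\<^sub>1y\<^sub>2 = 1\<close>.\<close>

definition endo_cat ::
  "('o, 'm, 'k, 'z) kcat_scheme \<Rightarrow> (('o, 'm, 'o, 'm) ftor, ('o, 'm, 'o, 'm) ntrans, 'k) moncat" where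
  "endo_cat C = kcat.extend (functor_cat C C) (moncat.fields
     (ftor_comp C)
     (\<lambda>\<sigma> \<tau>. \<lparr>NSrc = ftor_comp C (NSrc \<sigma>) (NSrc \<tau>), NTgt = ftor_comp C (NTgt \<sigma>) (NTgt \<tau>),
        NAt = (\<lambda>a\<in>Obj C. Cmp C (NAt \<sigma> (OMap (NTgt \<tau>) a)) (AMap (NSrc \<sigma>) (NAt \<tau> a)))\<rparr>)
     (ftor_id C)
     (\<lambda>F G H. Idt (functor_cat C C) (ftor_comp C F (ftor_comp C G H)))
     (\<lambda>F. Idt (functor_cat C C) F)
     (\<lambda>F. Idt (functor_cat C C) F))"


section \<open>Vector spaces on a fixed type\<close>

text \<open>All vector spaces whose carrier is a subset of the type \<open>'v\<close>. For \<open>'v\<close> infinite and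
  at least as large as the field, this is (up to equivalence) the category of vector spaces of
  dimension at most the cardinality of \<open>'v\<close>; thus \<open>'v\<close> plays the role of a universe.\<close>

record ('k, 'v) linmap =
  LSrc :: "('k, 'v) module"
  LTgt :: "('k, 'v) module"
  LFun :: "'v \<Rightarrow> 'v"

definition linear_map :: "('k::field, 'v) linmap \<Rightarrow> bool" where
  "linear_map T \<longleftrightarrow> vspace (LSrc T) \<and> vspace (LTgt T) \<and>
     LFun T \<in> carrier (LSrc T) \<rightarrow>\<^sub>E carrier (LTgt T) \<and>
     (\<forall>x\<in>carrier (LSrc T). \<forall>y\<in>carrier (LSrc T).
        LFun T (x \<oplus>\<^bsub>LSrc T\<^esub> y) = LFun T x \<oplus>\<^bsub>LTgt T\<^esub> LFun T y) \<and>
     (\<forall>s. \<forall>x\<in>carrier (LSrc T). LFun T (s \<odot>\<^bsub>LSrc T\<^esub> x) = s \<odot>\<^bsub>LTgt T\<^esub> LFun T x)"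

definition vect_cat :: "(('k::field, 'v) module, ('k, 'v) linmap, 'k) kcat" where
  "vect_cat = \<lparr>
     Obj = {V. vspace V},
     Arr = {T. linear_map T},
     Src = LSrc,
     Tgt = LTgt,
     Idt = (\<lambda>V. \<lparr>LSrc = V, LTgt = V, LFun = (\<lambda>x\<in>carrier V. x)\<rparr>),
     Cmp = (\<lambda>T S. \<lparr>LSrc = LSrc S, LTgt = LTgt T, LFun = compose (carrier (LSrc S)) (LFun T) (LFun S)\<rparr>),
     Plus = (\<lambda>S T. \<lparr>LSrc = LSrc S, LTgt = LTgt S,
        LFun = (\<lambda>x\<in>carrier (LSrc S). LFun S x \<oplus>\<^bsub>LTgt S\<^esub> LFun T x)\<rparr>),
     Nul = (\<lambda>V W. \<lparr>LSrc = V, LTgt = W, LFun = (\<lambda>x\<in>carrier V. \<zero>\<^bsub>W\<^esub>)\<rparr>),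
     Scal = (\<lambda>s T. \<lparr>LSrc = LSrc T, LTgt = LTgt T,
        LFun = (\<lambda>x\<in>carrier (LSrc T). s \<odot>\<^bsub>LTgt T\<^esub> LFun T x)\<rparr>)\<rparr>"

text \<open>Representable functors and tensor products are first constructed on other types and then
  copied to \<open>'v\<close> along a chosen injection of their carrier; \<open>vcode V\<close> is a linear isomorphism from
  \<open>V\<close> to \<open>vcopy V\<close> whenever such an injection exists.\<close>

definition vcode :: "('k, 'w) module \<Rightarrow> 'w \<Rightarrow> 'v" where
  "vcode V = (SOME e. inj_on e (carrier V))"

definition vcopy :: "('k, 'w) module \<Rightarrow> ('k, 'v) module" where
  "vcopy V = (let e = vcode V; d = inv_into (carrier V) e in
     \<lparr>carrier = e ` carrier V, mult = undefined, one = undefined, zero = e \<zero>\<^bsub>V\<^esub>,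
      add = (\<lambda>x y. e (d x \<oplus>\<^bsub>V\<^esub> d y)), smult = (\<lambda>s x. e (s \<odot>\<^bsub>V\<^esub> d x))\<rparr>)"

text \<open>The linear map \<open>V \<rightarrow> W\<close> with \<open>v g \<mapsto> w g\<close> for \<open>g \<in> G\<close>; only used when the \<open>v g\<close> span \<open>V\<close> and
  such a map exists.\<close>

definition lin_ext ::
  "('k::field, 'v) module \<Rightarrow> ('k, 'v) module \<Rightarrow> 'g set \<Rightarrow> ('g \<Rightarrow> 'v) \<Rightarrow> ('g \<Rightarrow> 'v) \<Rightarrow> ('k, 'v) linmap" where
  "lin_ext V W G v w = (THE T. T \<in> homset vect_cat V W \<and> (\<forall>g\<in>G. LFun T (v g) = w g))"


section \<open>Presheaves and Day convolution\<close>

text \<open>A presheaf on a linear category \<open>A\<close> is a linear functor from the opposite category of \<open>A\<close> to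
  vector spaces; \<open>act M u x\<close> is the right action of \<open>u : c' \<rightarrow> c\<close> on \<open>x \<in> M(c)\<close>.\<close>

type_synonym ('o, 'm, 'k, 'v) psh = "('o, 'm, ('k, 'v) module, ('k, 'v) linmap) ftor"
type_synonym ('o, 'm, 'k, 'v) psh_map = "('o, 'm, ('k, 'v) module, ('k, 'v) linmap) ntrans"

abbreviation psh_cat ::
  "('o, 'm, 'k::field, 'z) kcat_scheme \<Rightarrow> (('o, 'm, 'k, 'v) psh, ('o, 'm, 'k, 'v) psh_map, 'k) kcat" where
  "psh_cat A \<equiv> functor_cat (op_cat (kcat.truncate A)) vect_cat"

abbreviation act :: "('o, 'm, 'k, 'v) psh \<Rightarrow> 'm \<Rightarrow> 'v \<Rightarrow> 'v" where
  "act M u x \<equiv> LFun (AMap M u) x"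

abbreviation elems :: "('o, 'm, 'k, 'v) psh \<Rightarrow> 'o \<Rightarrow> 'v set" where
  "elems M c \<equiv> carrier (OMap M c)"

definition yoneda :: "('o, 'm, 'k::field, 'z) kcat_scheme \<Rightarrow> 'o \<Rightarrow> ('o, 'm, 'k, 'v) psh" where
  "yoneda A a = \<lparr>
     OMap = (\<lambda>c\<in>Obj A. vcopy (hom_space A c a)),
     AMap = (\<lambda>u\<in>Arr A. lin_ext (vcopy (hom_space A (Tgt A u) a)) (vcopy (hom_space A (Src A u) a))
        (homset A (Tgt A u) a)
        (\<lambda>f. vcode (hom_space A (Tgt A u) a) f)
        (\<lambda>f. vcode (hom_space A (Src A u) a) (f \<cdot>\<^bsub>A\<^esub> u)))\<rparr>"

definition yoneda_arr :: "('o, 'm, 'k::field, 'z) kcat_scheme \<Rightarrow> 'm \<Rightarrow> ('o, 'm, 'k, 'v) psh_map" where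
  "yoneda_arr A r = \<lparr>NSrc = yoneda A (Src A r), NTgt = yoneda A (Tgt A r),
     NAt = (\<lambda>c\<in>Obj A. lin_ext (vcopy (hom_space A c (Src A r))) (vcopy (hom_space A c (Tgt A r)))
        (homset A c (Src A r))
        (\<lambda>f. vcode (hom_space A c (Src A r)) f)
        (\<lambda>f. vcode (hom_space A c (Tgt A r)) (r \<cdot>\<^bsub>A\<^esub> f)))\<rparr>"

text \<open>Day convolution: \<open>(M \<otimes> N)(c)\<close> is the coend of \<open>M(a) \<otimes> N(b) \<otimes> A(c, a \<otimes> b)\<close> over \<open>a\<close> and \<open>b\<close>, that
  is, the vector space generated by symbols \<open>(a, b, x, y, f)\<close> with \<open>x \<in> M(a)\<close>, \<open>y \<in> N(b)\<close>,
  \<open>f : c \<rightarrow> a \<otimes> b\<close>, which are linear in \<open>x\<close>, \<open>y\<close> and \<open>f\<close> and satisfy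
  \<open>(a', b', xg, yh, f) = (a, b, x, y, (g \<otimes> h)f)\<close> for \<open>g : a' \<rightarrow> a\<close> and \<open>h : b' \<rightarrow> b\<close>.\<close>

type_synonym ('o, 'm, 'v) day_gen = "'o \<times> 'o \<times> 'v \<times> 'v \<times> 'm"

definition day_gens ::
  "('o, 'm, 'k::field, 'z) moncat_scheme \<Rightarrow> ('o, 'm, 'k, 'v) psh \<Rightarrow> ('o, 'm, 'k, 'v) psh \<Rightarrow> 'o \<Rightarrow>
   ('o, 'm, 'v) day_gen set" where
  "day_gens A M N c = {(a, b, x, y, f).
     a \<in> Obj A \<and> b \<in> Obj A \<and> x \<in> elems M a \<and> y \<in> elems N b \<and> f \<in> homset A c (a \<star>\<^bsub>A\<^esub> b)}"

abbreviation pscale :: "'k::field \<Rightarrow> ('g \<Rightarrow>\<^sub>0 'k) \<Rightarrow> ('g \<Rightarrow>\<^sub>0 'k)" where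
  "pscale s \<equiv> Poly_Mapping.map ((*) s)"

definition free_space :: "'g set \<Rightarrow> ('k::field, 'g \<Rightarrow>\<^sub>0 'k) module" where
  "free_space G = \<lparr>carrier = {p. Poly_Mapping.keys p \<subseteq> G}, mult = undefined, one = undefined,
     zero = 0, add = (+), smult = pscale\<rparr>"

definition quot_space :: "('k, 'w) module \<Rightarrow> 'w set \<Rightarrow> ('k, 'w set) module" where
  "quot_space V S = \<lparr>carrier = a_rcosets\<^bsub>V\<^esub> S, mult = undefined, one = undefined,
     zero = S, add = set_add V, smult = (\<lambda>s K. S <+>\<^bsub>V\<^esub> (\<lambda>x. s \<odot>\<^bsub>V\<^esub> x) ` K)\<rparr>"

definition day_rels ::
  "('o, 'm, 'k::field, 'z) moncat_scheme \<Rightarrow> ('o, 'm, 'k, 'v) psh \<Rightarrow> ('o, 'm, 'k, 'v) psh \<Rightarrow> 'o \<Rightarrow>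
   (('o, 'm, 'v) day_gen \<Rightarrow>\<^sub>0 'k) set" where
  "day_rels A M N c = (let e = (\<lambda>a b x y f. Poly_Mapping.single (a, b, x, y, f) (1::'k)) in
     {e a b (x \<oplus>\<^bsub>OMap M a\<^esub> x') y f - e a b x y f - e a b x' y f | a b x x' y f.
        (a, b, x, y, f) \<in> day_gens A M N c \<and> x' \<in> elems M a} \<union>
     {e a b x (y \<oplus>\<^bsub>OMap N b\<^esub> y') f - e a b x y f - e a b x y' f | a b x y y' f.
        (a, b, x, y, f) \<in> day_gens A M N c \<and> y' \<in> elems N b} \<union>
     {e a b x y (Plus A f f') - e a b x y f - e a b x y f' | a b x y f f'.
        (a, b, x, y, f) \<in> day_gens A M N c \<and> f' \<in> homset A c (a \<star>\<^bsub>A\<^esub> b)} \<union>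
     {e a b (s \<odot>\<^bsub>OMap M a\<^esub> x) y f - pscale s (e a b x y f) | a b x y f s.
        (a, b, x, y, f) \<in> day_gens A M N c} \<union>
     {e a b x (s \<odot>\<^bsub>OMap N b\<^esub> y) f - pscale s (e a b x y f) | a b x y f s.
        (a, b, x, y, f) \<in> day_gens A M N c} \<union>
     {e a b x y (Scal A s f) - pscale s (e a b x y f) | a b x y f s.
        (a, b, x, y, f) \<in> day_gens A M N c} \<union>
     {e a' b' (act M g x) (act N h y) f - e a b x y ((g \<boxtimes>\<^bsub>A\<^esub> h) \<cdot>\<^bsub>A\<^esub> f) | a b a' b' x y g h f.
        g \<in> homset A a' a \<and> h \<in> homset A b' b \<and> a \<in> Obj A \<and> b \<in> Obj A \<and> a' \<in> Obj A \<and> b' \<in> Obj A \<and>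
        x \<in> elems M a \<and> y \<in> elems N b \<and> f \<in> homset A c (a' \<star>\<^bsub>A\<^esub> b')})"

definition day_space ::
  "('o, 'm, 'k::field, 'z) moncat_scheme \<Rightarrow> ('o, 'm, 'k, 'v) psh \<Rightarrow> ('o, 'm, 'k, 'v) psh \<Rightarrow> 'o \<Rightarrow>
   ('k, (('o, 'm, 'v) day_gen \<Rightarrow>\<^sub>0 'k) set) module" where
  "day_space A M N c =
     quot_space (free_space (day_gens A M N c)) (Modules.module.span pscale (day_rels A M N c))"

text \<open>The class of a generator, as an element of the copy of the coend on the type \<open>'v\<close>.\<close>

definition day_el ::
  "('o, 'm, 'k::field, 'z) moncat_scheme \<Rightarrow> ('o, 'm, 'k, 'v) psh \<Rightarrow> ('o, 'm, 'k, 'v) psh \<Rightarrow> 'o \<Rightarrow>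
   ('o, 'm, 'v) day_gen \<Rightarrow> 'v" where
  "day_el A M N c g = vcode (day_space A M N c)
     (Modules.module.span pscale (day_rels A M N c) +>\<^bsub>free_space (day_gens A M N c)\<^esub>
        Poly_Mapping.single g 1)"

definition day ::
  "('o, 'm, 'k::field, 'z) moncat_scheme \<Rightarrow> ('o, 'm, 'k, 'v) psh \<Rightarrow> ('o, 'm, 'k, 'v) psh \<Rightarrow>
   ('o, 'm, 'k, 'v) psh" where
  "day A M N = \<lparr>
     OMap = (\<lambda>c\<in>Obj A. vcopy (day_space A M N c)),
     AMap = (\<lambda>u\<in>Arr A.
        lin_ext (vcopy (day_space A M N (Tgt A u))) (vcopy (day_space A M N (Src A u)))
        (day_gens A M N (Tgt A u))
        (day_el A M N (Tgt A u))
        (\<lambda>(a, b, x, y, f). day_el A M N (Src A u) (a, b, x, y, f \<cdot>\<^bsub>A\<^esub> u)))\<rparr>"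

text \<open>The morphism of presheaves from \<open>M \<otimes> N\<close> to \<open>P\<close> with prescribed values on generators.\<close>

definition day_map ::
  "('o, 'm, 'k::field, 'z) moncat_scheme \<Rightarrow> ('o, 'm, 'k, 'v) psh \<Rightarrow> ('o, 'm, 'k, 'v) psh \<Rightarrow>
   ('o, 'm, 'k, 'v) psh \<Rightarrow> ('o \<Rightarrow> 'g set) \<Rightarrow> ('o \<Rightarrow> 'g \<Rightarrow> ('o, 'm, 'v) day_gen) \<Rightarrow> ('o \<Rightarrow> 'g \<Rightarrow> 'v) \<Rightarrow>
   ('o, 'm, 'k, 'v) psh_map" where
  "day_map A M N P G v w = \<lparr>NSrc = day A M N, NTgt = P,
     NAt = (\<lambda>c\<in>Obj A. lin_ext (OMap (day A M N) c) (OMap P c) (G c)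
        (\<lambda>g. day_el A M N c (v c g)) (w c))\<rparr>"

definition day_arr ::
  "('o, 'm, 'k::field, 'z) moncat_scheme \<Rightarrow> ('o, 'm, 'k, 'v) psh_map \<Rightarrow> ('o, 'm, 'k, 'v) psh_map \<Rightarrow>
   ('o, 'm, 'k, 'v) psh_map" where
  "day_arr A \<sigma> \<tau> = day_map A (NSrc \<sigma>) (NSrc \<tau>) (day A (NTgt \<sigma>) (NTgt \<tau>))
     (day_gens A (NSrc \<sigma>) (NSrc \<tau>))
     (\<lambda>c g. g)
     (\<lambda>c (a, b, x, y, f).
        day_el A (NTgt \<sigma>) (NTgt \<tau>) c (a, b, LFun (NAt \<sigma> a) x, LFun (NAt \<tau> b) y, f))"

text \<open>On generators, with \<open>f : d \<rightarrow> a \<otimes> b\<close> and \<open>g : e \<rightarrow> d \<otimes> c\<close>, the associator is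
  \<open>(d, c, (a, b, x, y, f), z, g) \<mapsto> (a, b \<otimes> c, x, (b, c, y, z, 1), \<alpha>(f \<otimes> 1)g)\<close>.\<close>

definition day_assoc ::
  "('o, 'm, 'k::field, 'z) moncat_scheme \<Rightarrow> ('o, 'm, 'k, 'v) psh \<Rightarrow> ('o, 'm, 'k, 'v) psh \<Rightarrow>
   ('o, 'm, 'k, 'v) psh \<Rightarrow> ('o, 'm, 'k, 'v) psh_map" where
  "day_assoc A M N P = day_map A (day A M N) P (day A M (day A N P))
     (\<lambda>e. {(d, c, (a, b, x, y, f), z, g). d \<in> Obj A \<and> c \<in> Obj A \<and> (a, b, x, y, f) \<in> day_gens A M N d \<and>
        z \<in> elems P c \<and> g \<in> homset A e (d \<star>\<^bsub>A\<^esub> c)})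
     (\<lambda>e (d, c, q, z, g). (d, c, day_el A M N d q, z, g))
     (\<lambda>e (d, c, (a, b, x, y, f), z, g). day_el A M (day A N P) e
        (a, b \<star>\<^bsub>A\<^esub> c, x, day_el A N P (b \<star>\<^bsub>A\<^esub> c) (b, c, y, z, Idt A (b \<star>\<^bsub>A\<^esub> c)),
         Assoc A a b c \<cdot>\<^bsub>A\<^esub> (f \<boxtimes>\<^bsub>A\<^esub> Idt A c) \<cdot>\<^bsub>A\<^esub> g))"

definition day_lunit ::
  "('o, 'm, 'k::field, 'z) moncat_scheme \<Rightarrow> ('o, 'm, 'k, 'v) psh \<Rightarrow> ('o, 'm, 'k, 'v) psh_map" where
  "day_lunit A M = day_map A (yoneda A (One A)) M M
     (\<lambda>c. {(a, b, u, x, f). a \<in> Obj A \<and> b \<in> Obj A \<and> u \<in> homset A a (One A) \<and> x \<in> elems M b \<and>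
        f \<in> homset A c (a \<star>\<^bsub>A\<^esub> b)})
     (\<lambda>c (a, b, u, x, f). (a, b, vcode (hom_space A a (One A)) u, x, f))
     (\<lambda>c (a, b, u, x, f). act M (LUnit A b \<cdot>\<^bsub>A\<^esub> (u \<boxtimes>\<^bsub>A\<^esub> Idt A b) \<cdot>\<^bsub>A\<^esub> f) x)"

definition day_runit ::
  "('o, 'm, 'k::field, 'z) moncat_scheme \<Rightarrow> ('o, 'm, 'k, 'v) psh \<Rightarrow> ('o, 'm, 'k, 'v) psh_map" where
  "day_runit A M = day_map A M (yoneda A (One A)) M
     (\<lambda>c. {(a, b, x, u, f). a \<in> Obj A \<and> b \<in> Obj A \<and> x \<in> elems M a \<and> u \<in> homset A b (One A) \<and>
        f \<in> homset A c (a \<star>\<^bsub>A\<^esub> b)})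
     (\<lambda>c (a, b, x, u, f). (a, b, x, vcode (hom_space A b (One A)) u, f))
     (\<lambda>c (a, b, x, u, f). act M (RUnit A a \<cdot>\<^bsub>A\<^esub> (Idt A a \<boxtimes>\<^bsub>A\<^esub> u) \<cdot>\<^bsub>A\<^esub> f) x)"

definition day_cat ::
  "('o, 'm, 'k::field, 'z) moncat_scheme \<Rightarrow>
   (('o, 'm, 'k, 'v) psh, ('o, 'm, 'k, 'v) psh_map, 'k) moncat" where
  "day_cat A = kcat.extend (psh_cat A) (moncat.fields
     (day A) (day_arr A) (yoneda A (One A)) (day_assoc A) (day_lunit A) (day_runit A))"

text \<open>The canonical isomorphism from the tensor product of the presheaves represented by \<open>a\<close> and \<open>b\<close>
  to the presheaf represented by \<open>a \<otimes> b\<close>.\<close>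

definition yoneda_tensor ::
  "('o, 'm, 'k::field, 'z) moncat_scheme \<Rightarrow> 'o \<Rightarrow> 'o \<Rightarrow> ('o, 'm, 'k, 'v) psh_map" where
  "yoneda_tensor A a b = day_map A (yoneda A a) (yoneda A b) (yoneda A (a \<star>\<^bsub>A\<^esub> b))
     (\<lambda>c. {(p, q, u, v, f). p \<in> Obj A \<and> q \<in> Obj A \<and> u \<in> homset A p a \<and> v \<in> homset A q b \<and>
        f \<in> homset A c (p \<star>\<^bsub>A\<^esub> q)})
     (\<lambda>c (p, q, u, v, f). (p, q, vcode (hom_space A p a) u, vcode (hom_space A q b) v, f))
     (\<lambda>c (p, q, u, v, f). vcode (hom_space A c (a \<star>\<^bsub>A\<^esub> b)) ((u \<boxtimes>\<^bsub>A\<^esub> v) \<cdot>\<^bsub>A\<^esub> f))"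


section \<open>Degenerate affine Hecke algebras\<close>

datatype gen = GenT nat | GenY nat

text \<open>Words form a free monoid (written additively), so \<open>word \<Rightarrow>\<^sub>0 'k\<close> is a free associative
  algebra.\<close>

datatype word = Word (letters: "gen list")

instantiation word :: monoid_add
begin

definition zero_word :: word where "0 = Word []"

definition plus_word :: "word \<Rightarrow> word \<Rightarrow> word" where "v + w = Word (letters v @ letters w)"

instance
  by standard (auto simp: zero_word_def plus_word_def)

end

type_synonym 'k hecke = "(word \<Rightarrow>\<^sub>0 'k) set"

definition hgens :: "nat \<Rightarrow> gen set" where
  "hgens n = GenT ` {1..<n} \<union> GenY ` {1..n}"

definition free_algebra :: "nat \<Rightarrow> (word \<Rightarrow>\<^sub>0 'k::field) ring" where
  "free_algebra n = \<lparr>carrier = {p. \<forall>w\<in>Poly_Mapping.keys p. set (letters w) \<subseteq> hgens n},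
     mult = (*), one = 1, zero = 0, add = (+)\<rparr>"

definition tt :: "nat \<Rightarrow> word \<Rightarrow>\<^sub>0 'k::field" where
  "tt i = Poly_Mapping.single (Word [GenT i]) 1"

definition yy :: "nat \<Rightarrow> word \<Rightarrow>\<^sub>0 'k::field" where
  "yy i = Poly_Mapping.single (Word [GenY i]) 1"

definition hecke_rels :: "nat \<Rightarrow> (word \<Rightarrow>\<^sub>0 'k::field) set" where
  "hecke_rels n =
     {tt i * tt i - 1 | i. i \<in> {1..<n}} \<union>
     {tt i * tt (i + 1) * tt i - tt (i + 1) * tt i * tt (i + 1) | i. i \<in> {1..<n} \<and> i + 1 \<in> {1..<n}} \<union>
     {tt i * tt j - tt j * tt i | i j. i \<in> {1..<n} \<and> j \<in> {1..<n} \<and> \<bar>int i - int j\<bar> > 1} \<union>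
     {yy i * tt i - tt i * yy (i + 1) - 1 | i. i \<in> {1..<n}} \<union>
     {yy i * yy j - yy j * yy i | i j. i \<in> {1..n} \<and> j \<in> {1..n}} \<union>
     {tt i * yy j - yy j * tt i | i j. i \<in> {1..<n} \<and> j \<in> {1..n} \<and> j \<noteq> i \<and> j \<noteq> i + 1}"

definition hecke_ideal :: "nat \<Rightarrow> (word \<Rightarrow>\<^sub>0 'k::field) set" where
  "hecke_ideal n = Idl\<^bsub>free_algebra n\<^esub> (hecke_rels n)"

definition hecke_algebra :: "nat \<Rightarrow> 'k::field hecke ring" where
  "hecke_algebra n = free_algebra n Quot hecke_ideal n"

definition hcls :: "nat \<Rightarrow> (word \<Rightarrow>\<^sub>0 'k::field) \<Rightarrow> 'k hecke" where
  "hcls n p = hecke_ideal n +>\<^bsub>free_algebra n\<^esub> p"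

definition hecke_scale :: "nat \<Rightarrow> 'k::field \<Rightarrow> 'k hecke \<Rightarrow> 'k hecke" where
  "hecke_scale n s a = hcls n (Poly_Mapping.single 0 s) \<otimes>\<^bsub>hecke_algebra n\<^esub> a"

fun shift_gen :: "nat \<Rightarrow> gen \<Rightarrow> gen" where
  "shift_gen m (GenT i) = GenT (i + m)"
| "shift_gen m (GenY i) = GenY (i + m)"

definition shift :: "nat \<Rightarrow> (word \<Rightarrow>\<^sub>0 'k::field) \<Rightarrow> (word \<Rightarrow>\<^sub>0 'k)" where
  "shift m p = (\<Sum>w\<in>Poly_Mapping.keys p.
     Poly_Mapping.single (Word (map (shift_gen m) (letters w))) (Poly_Mapping.lookup p w))"

text \<open>\<open>hecke_mu m n a b\<close> is \<open>\<mu>\<^bsub>m,n\<^esub>(a \<otimes> b)\<close>: all the cosets in the union coincide.\<close>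

definition hecke_mu :: "nat \<Rightarrow> nat \<Rightarrow> 'k::field hecke \<Rightarrow> 'k hecke \<Rightarrow> 'k hecke" where
  "hecke_mu m n a b = (\<Union>p\<in>a. \<Union>q\<in>b. hcls (m + n) (p * shift m q))"


section \<open>The degenerate affine Hecke category\<close>

text \<open>The morphisms \<open>(m, n, a)\<close> from \<open>m\<close> to \<open>n\<close>: for \<open>m = n\<close>, \<open>a\<close> is an element of the \<open>n\<close>-th
  algebra; for \<open>m \<noteq> n\<close> there is only the zero morphism, for which \<open>a = {}\<close>.\<close>

type_synonym 'k hecke_arr = "nat \<times> nat \<times> 'k hecke"

definition hecke_hom :: "nat \<Rightarrow> nat \<Rightarrow> 'k::field hecke set" where
  "hecke_hom m n = (if m = n then carrier (hecke_algebra n) else {{}})"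

definition hecke_nul :: "nat \<Rightarrow> nat \<Rightarrow> 'k::field hecke_arr" where
  "hecke_nul m n = (m, n, if m = n then \<zero>\<^bsub>hecke_algebra n\<^esub> else {})"

definition hecke_bar :: "(nat, 'k::field hecke_arr, 'k) moncat" where
  "hecke_bar = \<lparr>
     Obj = UNIV,
     Arr = {(m, n, a). a \<in> hecke_hom m n},
     Src = (\<lambda>(m, n, a). m),
     Tgt = (\<lambda>(m, n, a). n),
     Idt = (\<lambda>n. (n, n, \<one>\<^bsub>hecke_algebra n\<^esub>)),
     Cmp = (\<lambda>(n', p, b) (m, n, a). if m = n \<and> n' = p then (m, p, b \<otimes>\<^bsub>hecke_algebra n\<^esub> a) else hecke_nul m p),
     Plus = (\<lambda>(m, n, a) (m', n', b). if m = n then (m, n, a \<oplus>\<^bsub>hecke_algebra n\<^esub> b) else hecke_nul m n),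
     Nul = hecke_nul,
     Scal = (\<lambda>s (m, n, a). if m = n then (m, n, hecke_scale n s a) else hecke_nul m n),
     TObj = (+),
     TArr = (\<lambda>(m, m', a) (n, n', b). if m = m' \<and> n = n' then (m + n, m' + n', hecke_mu m n a b)
        else hecke_nul (m + n) (m' + n')),
     One = 0,
     Assoc = (\<lambda>l m n. (l + m + n, l + m + n, \<one>\<^bsub>hecke_algebra (l + m + n)\<^esub>)),
     LUnit = (\<lambda>n. (n, n, \<one>\<^bsub>hecke_algebra n\<^esub>)),
     RUnit = (\<lambda>n. (n, n, \<one>\<^bsub>hecke_algebra n\<^esub>))\<rparr>"

definition hecke_y1 :: "'k::field hecke_arr" where
  "hecke_y1 = (1, 1, hcls 1 (yy 1))"

definition hecke_t1 :: "'k::field hecke_arr" where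
  "hecke_t1 = (2, 2, hcls 2 (tt 1))"

text \<open>The Hecke category consists of presheaves on \<open>hecke_bar\<close>, that is, of sequences of right modules
  over the Hecke algebras. Its object \<open>hecke_gen\<close> is the first Hecke algebra as a module over itself,
  on which \<open>hecke_x\<close> is left multiplication by \<open>y\<^sub>1\<close>; \<open>hecke_c\<close> is left multiplication by \<open>t\<^sub>1\<close> on
  the second Hecke algebra, transported to the tensor square of \<open>hecke_gen\<close>.\<close>

definition hecke_cat ::
  "((nat, 'k::field hecke_arr, 'k, 'v) psh, (nat, 'k hecke_arr, 'k, 'v) psh_map, 'k) moncat" where
  "hecke_cat = day_cat hecke_bar"

definition hecke_gen :: "(nat, 'k::field hecke_arr, 'k, 'v) psh" where
  "hecke_gen = yoneda hecke_bar 1"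

definition hecke_x :: "(nat, 'k::field hecke_arr, 'k, 'v) psh_map" where
  "hecke_x = yoneda_arr hecke_bar hecke_y1"

definition hecke_c :: "(nat, 'k::field hecke_arr, 'k, 'v) psh_map" where
  "hecke_c =
     inv_arr hecke_cat (yoneda_tensor hecke_bar 1 1) \<cdot>\<^bsub>hecke_cat\<^esub>
     yoneda_arr hecke_bar hecke_t1 \<cdot>\<^bsub>hecke_cat\<^esub> yoneda_tensor hecke_bar 1 1"


section \<open>The triple attached to a degenerate Hecke object\<close>

definition tensor_right :: "('o, 'm, 'k, 'z) moncat_scheme \<Rightarrow> 'o \<Rightarrow> ('o, 'm, 'o, 'm) ftor" where
  "tensor_right C X =
     \<lparr>OMap = (\<lambda>Y\<in>Obj C. Y \<star>\<^bsub>C\<^esub> X), AMap = (\<lambda>f\<in>Arr C. f \<boxtimes>\<^bsub>C\<^esub> Idt C X)\<rparr>"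

definition tensor_sym :: "('o, 'm, 'k, 'z) symcat_scheme \<Rightarrow> 'o \<Rightarrow> ('o, 'm, 'o, 'm) ntrans" where
  "tensor_sym C X = \<lparr>
     NSrc = ftor_comp C (tensor_right C X) (tensor_right C X),
     NTgt = ftor_comp C (tensor_right C X) (tensor_right C X),
     NAt = (\<lambda>Y\<in>Obj C. inv_arr C (Assoc C Y X X) \<cdot>\<^bsub>C\<^esub> (Idt C Y \<boxtimes>\<^bsub>C\<^esub> Sym C X X) \<cdot>\<^bsub>C\<^esub> Assoc C Y X X)\<rparr>"

definition tensor_chord ::
  "('o, 'm, 'k::field, 'z) chordcat_scheme \<Rightarrow> 'o \<Rightarrow> 'k \<Rightarrow> ('o, 'm, 'o, 'm) ntrans" where
  "tensor_chord C X l = \<lparr>NSrc = tensor_right C X, NTgt = tensor_right C X,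
     NAt = (\<lambda>Y\<in>Obj C. Scal C (inverse l) (Chord C Y X))\<rparr>"


section \<open>Small colimits\<close>

text \<open>Here small means: indexed by a subset of the type \<open>'v\<close>. Coproducts and coequalizers generate all
  small colimits.\<close>

definition is_coproduct ::
  "('o, 'm, 'k, 'z) kcat_scheme \<Rightarrow> 'i set \<Rightarrow> ('i \<Rightarrow> 'o) \<Rightarrow> 'o \<Rightarrow> ('i \<Rightarrow> 'm) \<Rightarrow> bool" where
  "is_coproduct C I d s j \<longleftrightarrow> s \<in> Obj C \<and> (\<forall>i\<in>I. j i \<in> homset C (d i) s) \<and>
     (\<forall>z\<in>Obj C. \<forall>u. (\<forall>i\<in>I. u i \<in> homset C (d i) z) \<longrightarrow>
        (\<exists>!w. w \<in> homset C s z \<and> (\<forall>i\<in>I. w \<cdot>\<^bsub>C\<^esub> j i = u i)))"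

definition is_coequalizer :: "('o, 'm, 'k, 'z) kcat_scheme \<Rightarrow> 'm \<Rightarrow> 'm \<Rightarrow> 'm \<Rightarrow> bool" where
  "is_coequalizer C f g q \<longleftrightarrow> q \<in> Arr C \<and> Src C q = Tgt C f \<and> q \<cdot>\<^bsub>C\<^esub> f = q \<cdot>\<^bsub>C\<^esub> g \<and>
     (\<forall>r\<in>Arr C. Src C r = Tgt C f \<and> r \<cdot>\<^bsub>C\<^esub> f = r \<cdot>\<^bsub>C\<^esub> g \<longrightarrow>
        (\<exists>!w. w \<in> homset C (Tgt C q) (Tgt C r) \<and> w \<cdot>\<^bsub>C\<^esub> q = r))"

definition small_cocomplete :: "'v itself \<Rightarrow> ('o, 'm, 'k, 'z) kcat_scheme \<Rightarrow> bool" where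
  "small_cocomplete _ C \<longleftrightarrow>
     (\<forall>(I::'v set) d. d ` I \<subseteq> Obj C \<longrightarrow> (\<exists>s j. is_coproduct C I d s j)) \<and>
     (\<forall>a b. \<forall>f\<in>homset C a b. \<forall>g\<in>homset C a b. \<exists>q. is_coequalizer C f g q)"

definition small_cocontinuous ::
  "'v itself \<Rightarrow> ('o, 'm, 'k, 'y) kcat_scheme \<Rightarrow> ('p, 'n, 'k, 'z) kcat_scheme \<Rightarrow>
   ('o, 'm, 'p, 'n) ftor \<Rightarrow> bool" where
  "small_cocontinuous _ C D F \<longleftrightarrow>
     (\<forall>(I::'v set) d s j. d ` I \<subseteq> Obj C \<longrightarrow> is_coproduct C I d s j \<longrightarrow>
        is_coproduct D I (\<lambda>i. OMap F (d i)) (OMap F s) (\<lambda>i. AMap F (j i))) \<and>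
     (\<forall>a b q. \<forall>f\<in>homset C a b. \<forall>g\<in>homset C a b. is_coequalizer C f g q \<longrightarrow>
        is_coequalizer D (AMap F f) (AMap F g) (AMap F q))"

end

theory Submission
  imports Defs "HOL-Library.Countable_Set" "HOL-Library.Countable"
begin

text \<open>A strict monoidal functor from \<open>hecke_bar\<close> amounts to an object \<open>O\<close> with endomorphisms \<open>x\<close> of \<open>O\<close>
  and \<open>c\<close> of \<open>O \<otimes> O\<close> such that \<open>c\<^sup>2 = 1\<close>, \<open>c\<close> satisfies the braid relation, and \<open>(x \<otimes> 1)c = c(1 \<otimes> x) + 1\<close>:
  the commutation relations among distant generators follow from the interchange law. For the functor of
  tensoring by \<open>X\<close>, the braid relation is the Yang-Baxter equation for the symmetry of \<open>X\<close>, and the last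
  relation is the chording axiom for the pair \<open>(X, Y \<otimes> X)\<close>, conjugated by the symmetry.

  The functor \<open>G\<close> so obtained extends to presheaves by weighted colimits: \<open>M\<close> goes to the universal
  endofunctor \<open>K M\<close> receiving compatible maps \<open>G a \<rightarrow> K M\<close>, one for each element of \<open>M a\<close>, which is computed
  pointwise by a coequalizer of coproducts. Composition on the right preserves these pointwise colimits,
  and composition on the left with \<open>G a\<close> preserves them because \<open>G a\<close> is cocontinuous. Hence maps out of
  \<open>K M \<circ> K N\<close> are given by families indexed by pairs of elements of \<open>M a\<close> and \<open>N b\<close>, which is also the
  universal property of \<open>K\<close> applied to the Day convolution of \<open>M\<close> and \<open>N\<close>.\<close>

text \<open>Preservation of colimits by the universal endofunctors is never established. It is
  avoided by testing maps out of a composite in a fixed order: the left factor is resolved first,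
  and only afterwards, with some \<open>G a\<close> in its place, the next one. The functors
  \<open>G a\<close> are powers of the functor of tensoring by \<open>X\<close> and are cocontinuous
  once that functor is, which explains the hypotheses of the second half of the theorem. The first
  half lives on the objects \<open>[n]\<close> and needs no colimits.

  Universal properties determine functors only up to isomorphism, whereas the theorem asks for
  equalities such as \<open>OMap CAS hecke_gen = tensor_right C X\<close>. The colimit for the
  represented presheaf is therefore chosen by hand to be that functor itself.

  Vector spaces live on the type \<open>'v\<close>. It has to be infinite and to contain a copy of
  the field, so that hom spaces, and the free spaces on the generators of a Day convolution with
  their quotients, can be copied into it. Both \<open>hecke_bar\<close> and the category of
  endofunctors are strict; nontrivial associators occur only in the chorded category and in the Day
  convolution.\<close>

abbreviation sgl :: "'a \<Rightarrow> 'b::zero \<Rightarrow> 'a \<Rightarrow>\<^sub>0 'b" where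
  "sgl \<equiv> Poly_Mapping.single"

section \<open>Vector spaces\<close>

lemma scalars_simps [simp]:
  "carrier scalars = UNIV" "x \<oplus>\<^bsub>scalars\<^esub> y = x + y" "x \<otimes>\<^bsub>scalars\<^esub> y = x * y"
  "\<one>\<^bsub>scalars\<^esub> = 1" "\<zero>\<^bsub>scalars\<^esub> = 0"
  by (simp_all add: scalars_def)

lemma cring_scalars: "cring (scalars :: 'k::field ring)"
proof (rule cringI)
  have neg: "\<exists>y. y + x = 0" for x :: 'k
    by (rule exI[of _ "- x"]) simp
  show "abelian_group (scalars :: 'k ring)"
    by (rule abelian_groupI; simp only: scalars_simps UNIV_I bex_UNIV)
      (rule add.assoc, rule add.commute, rule add_0, rule neg)
  show "Group.comm_monoid (scalars :: 'k ring)"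
    by (rule comm_monoidI; simp only: scalars_simps UNIV_I)
      (rule mult.assoc, rule mult_1, rule mult.commute)
qed (simp only: scalars_simps distrib_right)

text \<open>Additive inverses are not asked for: since the scalar 0 sends every vector to the zero
  vector, (-1) times \<open>x\<close> is an inverse of \<open>x\<close>.\<close>

lemma vspaceI:
  fixes V :: "('k::field, 'v) module"
  assumes "\<And>x y. x \<in> carrier V \<Longrightarrow> y \<in> carrier V \<Longrightarrow> x \<oplus>\<^bsub>V\<^esub> y \<in> carrier V"
    and "\<And>x y z. x \<in> carrier V \<Longrightarrow> y \<in> carrier V \<Longrightarrow> z \<in> carrier V \<Longrightarrow>
      (x \<oplus>\<^bsub>V\<^esub> y) \<oplus>\<^bsub>V\<^esub> z = x \<oplus>\<^bsub>V\<^esub> (y \<oplus>\<^bsub>V\<^esub> z)"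
    and "\<And>x y. x \<in> carrier V \<Longrightarrow> y \<in> carrier V \<Longrightarrow> x \<oplus>\<^bsub>V\<^esub> y = y \<oplus>\<^bsub>V\<^esub> x"
    and "\<zero>\<^bsub>V\<^esub> \<in> carrier V"
    and zero: "\<And>x. x \<in> carrier V \<Longrightarrow> \<zero>\<^bsub>V\<^esub> \<oplus>\<^bsub>V\<^esub> x = x"
    and sc: "\<And>s x. x \<in> carrier V \<Longrightarrow> s \<odot>\<^bsub>V\<^esub> x \<in> carrier V"
    and sl: "\<And>s t x. x \<in> carrier V \<Longrightarrow> (s + t) \<odot>\<^bsub>V\<^esub> x = s \<odot>\<^bsub>V\<^esub> x \<oplus>\<^bsub>V\<^esub> t \<odot>\<^bsub>V\<^esub> x"
    and "\<And>s x y. x \<in> carrier V \<Longrightarrow> y \<in> carrier V \<Longrightarrow> s \<odot>\<^bsub>V\<^esub> (x \<oplus>\<^bsub>V\<^esub> y) = s \<odot>\<^bsub>V\<^esub> x \<oplus>\<^bsub>V\<^esub> s \<odot>\<^bsub>V\<^esub> y"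
    and "\<And>s t x. x \<in> carrier V \<Longrightarrow> (s * t) \<odot>\<^bsub>V\<^esub> x = s \<odot>\<^bsub>V\<^esub> (t \<odot>\<^bsub>V\<^esub> x)"
    and one: "\<And>x. x \<in> carrier V \<Longrightarrow> 1 \<odot>\<^bsub>V\<^esub> x = x"
    and z: "\<And>x. x \<in> carrier V \<Longrightarrow> 0 \<odot>\<^bsub>V\<^esub> x = \<zero>\<^bsub>V\<^esub>"
  shows "vspace V"
proof (rule Module.moduleI[OF cring_scalars])
  have neg: "\<exists>y\<in>carrier V. y \<oplus>\<^bsub>V\<^esub> x = \<zero>\<^bsub>V\<^esub>" if "x \<in> carrier V" for x
    using sl[OF that, of "-1" 1] one[OF that] z[OF that] sc[OF that] by (intro bexI[of _ "(-1) \<odot>\<^bsub>V\<^esub> x"]) auto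
  show "abelian_group V"
    by (rule abelian_groupI) (use assms neg in auto)
qed (use assms in auto)

context
  fixes V :: "('k::field, 'v) module"
  assumes V: "vspace V"
begin

interpretation V: Module.module "scalars :: 'k ring" V by (rule V)

lemma vs_add_closed: "x \<in> carrier V \<Longrightarrow> y \<in> carrier V \<Longrightarrow> x \<oplus>\<^bsub>V\<^esub> y \<in> carrier V"
  by simp

lemma vs_zero_closed: "\<zero>\<^bsub>V\<^esub> \<in> carrier V"
  by simp

lemma vs_smult_closed: "x \<in> carrier V \<Longrightarrow> s \<odot>\<^bsub>V\<^esub> x \<in> carrier V"
  by simp

lemma vs_zero_left: "x \<in> carrier V \<Longrightarrow> \<zero>\<^bsub>V\<^esub> \<oplus>\<^bsub>V\<^esub> x = x"
  by simp

lemma vs_add_assoc: "x \<in> carrier V \<Longrightarrow> y \<in> carrier V \<Longrightarrow> z \<in> carrier V \<Longrightarrow>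
    (x \<oplus>\<^bsub>V\<^esub> y) \<oplus>\<^bsub>V\<^esub> z = x \<oplus>\<^bsub>V\<^esub> (y \<oplus>\<^bsub>V\<^esub> z)"
  by (rule V.M.a_assoc)

lemma vs_add_comm: "x \<in> carrier V \<Longrightarrow> y \<in> carrier V \<Longrightarrow> x \<oplus>\<^bsub>V\<^esub> y = y \<oplus>\<^bsub>V\<^esub> x"
  by (rule V.M.a_comm)

lemma vs_zero_right: "x \<in> carrier V \<Longrightarrow> x \<oplus>\<^bsub>V\<^esub> \<zero>\<^bsub>V\<^esub> = x"
  by simp

lemma vs_smult_add_left: "x \<in> carrier V \<Longrightarrow> (s + t) \<odot>\<^bsub>V\<^esub> x = s \<odot>\<^bsub>V\<^esub> x \<oplus>\<^bsub>V\<^esub> t \<odot>\<^bsub>V\<^esub> x"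
  using V.smult_l_distr[of s t x] by simp

lemma vs_smult_add_right:
  "x \<in> carrier V \<Longrightarrow> y \<in> carrier V \<Longrightarrow> s \<odot>\<^bsub>V\<^esub> (x \<oplus>\<^bsub>V\<^esub> y) = s \<odot>\<^bsub>V\<^esub> x \<oplus>\<^bsub>V\<^esub> s \<odot>\<^bsub>V\<^esub> y"
  by (simp add: V.smult_r_distr)

lemma vs_smult_smult: "x \<in> carrier V \<Longrightarrow> (s * t) \<odot>\<^bsub>V\<^esub> x = s \<odot>\<^bsub>V\<^esub> (t \<odot>\<^bsub>V\<^esub> x)"
  using V.smult_assoc1[of s t x] by simp

lemma vs_smult_one: "x \<in> carrier V \<Longrightarrow> 1 \<odot>\<^bsub>V\<^esub> x = x"
  using V.smult_one[of x] by simp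

lemma vs_smult_zero: "x \<in> carrier V \<Longrightarrow> 0 \<odot>\<^bsub>V\<^esub> x = \<zero>\<^bsub>V\<^esub>"
  using V.smult_l_null[of x] by simp

lemma vs_zero_smult: "s \<odot>\<^bsub>V\<^esub> \<zero>\<^bsub>V\<^esub> = \<zero>\<^bsub>V\<^esub>"
  using V.smult_r_null[of s] by simp

lemma vs_cancel: "x \<in> carrier V \<Longrightarrow> y \<in> carrier V \<Longrightarrow> z \<in> carrier V \<Longrightarrow>
    x \<oplus>\<^bsub>V\<^esub> y = z \<oplus>\<^bsub>V\<^esub> y \<longleftrightarrow> x = z"
  by simp

end

lemmas vs_closed = vs_add_closed vs_zero_closed vs_smult_closed

text \<open>Unlike for \<open>linear_map\<close>, source and target may live on different types and
  the values outside the carrier are free. Maps between a space and its copy, and maps from a Day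
  convolution to a hom space, are handled in this form.\<close>

definition linf :: "('k::field, 'a) module \<Rightarrow> ('k, 'b) module \<Rightarrow> ('a \<Rightarrow> 'b) \<Rightarrow> bool" where
  "linf V W T \<longleftrightarrow> (\<forall>x\<in>carrier V. T x \<in> carrier W) \<and>
     (\<forall>x\<in>carrier V. \<forall>y\<in>carrier V. T (x \<oplus>\<^bsub>V\<^esub> y) = T x \<oplus>\<^bsub>W\<^esub> T y) \<and>
     (\<forall>s. \<forall>x\<in>carrier V. T (s \<odot>\<^bsub>V\<^esub> x) = s \<odot>\<^bsub>W\<^esub> T x)"

lemma linfI:
  assumes "\<And>x. x \<in> carrier V \<Longrightarrow> T x \<in> carrier W"
    and "\<And>x y. x \<in> carrier V \<Longrightarrow> y \<in> carrier V \<Longrightarrow> T (x \<oplus>\<^bsub>V\<^esub> y) = T x \<oplus>\<^bsub>W\<^esub> T y"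
    and "\<And>s x. x \<in> carrier V \<Longrightarrow> T (s \<odot>\<^bsub>V\<^esub> x) = s \<odot>\<^bsub>W\<^esub> T x"
  shows "linf V W T"
  using assms by (simp add: linf_def)

lemma linf_closed: "linf V W T \<Longrightarrow> x \<in> carrier V \<Longrightarrow> T x \<in> carrier W"
  and linf_add: "linf V W T \<Longrightarrow> x \<in> carrier V \<Longrightarrow> y \<in> carrier V \<Longrightarrow> T (x \<oplus>\<^bsub>V\<^esub> y) = T x \<oplus>\<^bsub>W\<^esub> T y"
  and linf_smult: "linf V W T \<Longrightarrow> x \<in> carrier V \<Longrightarrow> T (s \<odot>\<^bsub>V\<^esub> x) = s \<odot>\<^bsub>W\<^esub> T x"
  by (simp_all add: linf_def)

lemma linf_zero: "vspace V \<Longrightarrow> vspace W \<Longrightarrow> linf V W T \<Longrightarrow> T \<zero>\<^bsub>V\<^esub> = \<zero>\<^bsub>W\<^esub>"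
  using linf_smult[of V W T "\<zero>\<^bsub>V\<^esub>" 0] by (simp add: vs_smult_zero vs_zero_closed linf_closed)

lemma linf_comp: "linf U V S \<Longrightarrow> linf V W T \<Longrightarrow> linf U W (\<lambda>x. T (S x))"
  by (simp add: linf_def)

lemma linf_cong: "linf V W T \<Longrightarrow> vspace V \<Longrightarrow> (\<And>x. x \<in> carrier V \<Longrightarrow> T x = T' x) \<Longrightarrow> linf V W T'"
  by (rule linfI) (simp_all add: linf_def vs_closed)

lemma linf_inverse:
  assumes "vspace V" "linf V W T" "\<And>x. x \<in> carrier V \<Longrightarrow> S (T x) = x"
    and surj: "\<And>y. y \<in> carrier W \<Longrightarrow> \<exists>x\<in>carrier V. y = T x"
  shows "linf W V S"
proof (rule linfI)
  fix y assume "y \<in> carrier W"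
  then obtain x where "x \<in> carrier V" "y = T x" using surj by meson
  then show "S y \<in> carrier V" using assms(3) by simp
next
  fix y y' assume "y \<in> carrier W" "y' \<in> carrier W"
  then obtain x x' where "x \<in> carrier V" "x' \<in> carrier V" "y = T x" "y' = T x'"
    using surj by meson
  then show "S (y \<oplus>\<^bsub>W\<^esub> y') = S y \<oplus>\<^bsub>V\<^esub> S y'"
    using assms by (simp add: linf_add[symmetric] vs_closed)
next
  fix s y assume "y \<in> carrier W"
  then obtain x where "x \<in> carrier V" "y = T x" using surj by meson
  then show "S (s \<odot>\<^bsub>W\<^esub> y) = s \<odot>\<^bsub>V\<^esub> S y"
    using assms by (simp add: linf_smult[symmetric] vs_closed)
qed

text \<open>Transport of structure. A linear surjection is enough, because every axiom for the
  target is the image of the same axiom for the source; hence the lemma serves for quotients as well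
  as for copies.\<close>

lemma vspace_iso:
  fixes V :: "('k::field, 'a) module" and W :: "('k, 'b) module"
  assumes V: "vspace V" and T: "linf V W T" and surj: "\<And>y. y \<in> carrier W \<Longrightarrow> \<exists>x\<in>carrier V. y = T x"
    and z: "\<zero>\<^bsub>W\<^esub> = T \<zero>\<^bsub>V\<^esub>"
  shows "vspace W"
proof -
  have [simp]: "T x \<oplus>\<^bsub>W\<^esub> T y = T (x \<oplus>\<^bsub>V\<^esub> y)" if "x \<in> carrier V" "y \<in> carrier V" for x y
    using T that by (simp add: linf_add)
  have [simp]: "s \<odot>\<^bsub>W\<^esub> T x = T (s \<odot>\<^bsub>V\<^esub> x)" if "x \<in> carrier V" for x s
    using T that by (simp add: linf_smult)
  have [simp]: "x \<oplus>\<^bsub>V\<^esub> (y \<oplus>\<^bsub>V\<^esub> z) = y \<oplus>\<^bsub>V\<^esub> (x \<oplus>\<^bsub>V\<^esub> z)"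
    if "x \<in> carrier V" "y \<in> carrier V" "z \<in> carrier V" for x y z
    using that by (metis vs_add_assoc[OF V] vs_add_comm[OF V])
  note [simp] = vs_closed[OF V] vs_zero_left[OF V] vs_smult_one[OF V] vs_smult_zero[OF V] linf_closed[OF T]
  show ?thesis
    by (rule vspaceI; (drule surj)?; (drule surj)?; (drule surj)?;
        auto simp: z vs_add_assoc[OF V] vs_zero_right[OF V] vs_add_comm[OF V] vs_smult_add_left[OF V] vs_smult_add_right[OF V]
          vs_smult_smult[OF V])
qed

subsection \<open>Copies of vector spaces\<close>

lemma vcode_inj: "inj_on (e :: 'w \<Rightarrow> 'v) (carrier V) \<Longrightarrow> inj_on (vcode V :: 'w \<Rightarrow> 'v) (carrier V)"
  unfolding vcode_def by (rule someI[where P = "\<lambda>e. inj_on e (carrier V)"])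

context
  fixes V :: "('k::field, 'w) module" and e :: "'w \<Rightarrow> 'v"
  assumes V: "vspace V" and e: "inj_on e (carrier V)"
begin

lemma vcopy_carrier: "carrier (vcopy V :: ('k, 'v) module) = vcode V ` carrier V"
  by (simp add: vcopy_def Let_def)

lemma vcode_linf: "linf V (vcopy V :: ('k, 'v) module) (vcode V)"
  using inv_into_f_f[OF vcode_inj[OF e]] by (intro linfI) (simp_all add: vcopy_def Let_def)

lemma vspace_vcopy: "vspace (vcopy V :: ('k, 'v) module)"
  by (rule vspace_iso[OF V vcode_linf]) (auto simp: vcopy_carrier, simp add: vcopy_def Let_def)

lemma vdecode: "x \<in> carrier V \<Longrightarrow> inv_into (carrier V) (vcode V :: 'w \<Rightarrow> 'v) (vcode V x) = x"
  by (rule inv_into_f_f[OF vcode_inj[OF e]])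

lemma vdecode_linf: "linf (vcopy V :: ('k, 'v) module) V (inv_into (carrier V) (vcode V))"
  by (rule linf_inverse[OF V vcode_linf vdecode]) (auto simp: vcopy_carrier)

end

subsection \<open>Linear maps\<close>

lemma homset_vect:
  "T \<in> homset vect_cat V W \<longleftrightarrow> vspace V \<and> vspace W \<and> LSrc T = V \<and> LTgt T = W \<and>
     linf V W (LFun T) \<and> LFun T \<in> extensional (carrier V)"
  by (auto simp: homset_def vect_cat_def linear_map_def linf_def PiE_def Pi_def)

lemma linmap_eqI:
  assumes "S \<in> homset vect_cat V W" "T \<in> homset vect_cat V W"
    and "\<And>x. x \<in> carrier V \<Longrightarrow> LFun S x = LFun T x"
  shows "S = T"
proof -
  have "LFun S = LFun T" using assms by (auto simp: homset_vect intro: extensionalityI)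
  then show ?thesis using assms by (cases S, cases T) (auto simp: homset_vect)
qed

text \<open>\<open>lin_ext\<close> is a definite description, so it can be evaluated only after
  existence and uniqueness are settled. Existence is the given map \<open>T\<close>. Uniqueness is
  the last assumption, where spanning is expressed as the principle that linear maps agreeing on all
  \<open>v g\<close> agree, so that no span has to be computed.\<close>

lemma lin_ext_eq:
  assumes VW: "vspace V" "vspace W" and T: "linf V W T"
    and val: "\<And>g. g \<in> G \<Longrightarrow> v g \<in> carrier V \<and> T (v g) = w g"
    and span: "\<And>T T' x. linf V W T \<Longrightarrow> linf V W T' \<Longrightarrow> (\<And>g. g \<in> G \<Longrightarrow> T (v g) = T' (v g)) \<Longrightarrow>
      x \<in> carrier V \<Longrightarrow> T x = T' x"
  shows lin_ext_homset: "lin_ext V W G v w \<in> homset vect_cat V W"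
    and lin_ext_apply: "\<And>x. x \<in> carrier V \<Longrightarrow> LFun (lin_ext V W G v w) x = T x"
    and lin_ext_gen: "\<And>g. g \<in> G \<Longrightarrow> LFun (lin_ext V W G v w) (v g) = w g"
proof -
  let ?P = "\<lambda>S. S \<in> homset vect_cat V W \<and> (\<forall>g\<in>G. LFun S (v g) = w g)"
  let ?T = "\<lparr>LSrc = V, LTgt = W, LFun = restrict T (carrier V)\<rparr>"
  have P: "?P ?T"
    using val by (auto simp: homset_vect VW intro: linf_cong[OF T VW(1)])
  have "S = ?T" if "?P S" for S
  proof (rule linmap_eqI[of _ V W])
    fix x assume x: "x \<in> carrier V"
    have "LFun S x = T x"
      by (rule span[OF _ T _ x]) (use that val in \<open>simp_all add: homset_vect\<close>)
    then show "LFun S x = LFun ?T x" using x by simp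
  qed (rule conjunct1[OF that], rule conjunct1[OF P])
  then have "lin_ext V W G v w = ?T"
    unfolding lin_ext_def using P by (intro the_equality) auto
  then show "lin_ext V W G v w \<in> homset vect_cat V W"
    and "\<And>x. x \<in> carrier V \<Longrightarrow> LFun (lin_ext V W G v w) x = T x"
    and "\<And>g. g \<in> G \<Longrightarrow> LFun (lin_ext V W G v w) (v g) = w g"
    using P val by auto
qed

subsection \<open>Free spaces and their quotients\<close>

lemma free_space_simps [simp]:
  "p \<in> carrier (free_space G) \<longleftrightarrow> Poly_Mapping.keys p \<subseteq> G"
  "p \<oplus>\<^bsub>free_space G\<^esub> q = p + q" "s \<odot>\<^bsub>free_space G\<^esub> p = pscale s p" "\<zero>\<^bsub>free_space G\<^esub> = 0"
  by (simp_all add: free_space_def)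

lemma lookup_pscale [simp]: "Poly_Mapping.lookup (pscale s p) g = s * Poly_Mapping.lookup p g"
  by (simp add: map.rep_eq when_def)

lemma keys_pscale: "Poly_Mapping.keys (pscale s p) \<subseteq> Poly_Mapping.keys p"
  by (auto simp: in_keys_iff)

lemma pscale_simps:
  "pscale s (p + q) = pscale s p + pscale s q" "pscale (s + t) p = pscale s p + pscale t p"
  "pscale (s * t) p = pscale s (pscale t p)" "pscale 1 p = p" "pscale 0 p = 0" "pscale s 0 = 0"
  by (auto intro!: poly_mapping_eqI simp: lookup_add algebra_simps)

lemma vector_space_pscale: "vector_space (pscale :: 'k::field \<Rightarrow> ('g \<Rightarrow>\<^sub>0 'k) \<Rightarrow> ('g \<Rightarrow>\<^sub>0 'k))"
  by unfold_locales (auto simp: pscale_simps)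

lemma vspace_free: "vspace (free_space G :: ('k::field, 'g \<Rightarrow>\<^sub>0 'k) module)"
proof (rule vspaceI)
  fix x y :: "'g \<Rightarrow>\<^sub>0 'k" assume "x \<in> carrier (free_space G)" "y \<in> carrier (free_space G)"
  then show "x \<oplus>\<^bsub>free_space G\<^esub> y \<in> carrier (free_space G)" using keys_add[of x y] by auto
next
  fix s and x :: "'g \<Rightarrow>\<^sub>0 'k" assume "x \<in> carrier (free_space G)"
  then show "s \<odot>\<^bsub>free_space G\<^esub> x \<in> carrier (free_space G)" using keys_pscale[of s x] by auto
qed (auto simp: pscale_simps algebra_simps)

lemma free_space_induct [consumes 1, case_names zero add]:
  fixes p :: "'g \<Rightarrow>\<^sub>0 'k::field"
  assumes "Poly_Mapping.keys p \<subseteq> G" "P 0"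
    and step: "\<And>s g q. g \<in> G \<Longrightarrow> Poly_Mapping.keys q \<subseteq> G \<Longrightarrow> P q \<Longrightarrow> P (pscale s (sgl g 1) + q)"
  shows "P p"
  using assms(1)
proof (induction "card (Poly_Mapping.keys p)" arbitrary: p)
  case 0 then show ?case using assms(2) by simp
next
  case (Suc n)
  then obtain g where g: "g \<in> Poly_Mapping.keys p" by fastforce
  \<comment> \<open>Cancelling the term at \<open>g\<close> removes \<open>g\<close> from the
    support and leaves the other coefficients alone, so the induction on the size of the support
    applies to \<open>q\<close>.\<close>
  define q where "q = p + sgl g (- Poly_Mapping.lookup p g)"
  have k: "Poly_Mapping.keys q = Poly_Mapping.keys p - {g}"
    by (auto simp: q_def in_keys_iff lookup_add lookup_single when_def split: if_splits)
  have "P q" using Suc g by (intro Suc(1)) (auto simp: k)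
  moreover have "p = pscale (Poly_Mapping.lookup p g) (sgl g 1) + q"
    by (rule poly_mapping_eqI) (simp add: q_def lookup_add lookup_single when_def)
  ultimately show ?case using step[of g q "Poly_Mapping.lookup p g"] g Suc(3) k by auto
qed

lemma linf_free_eq:
  fixes W :: "('k::field, 'w) module" and T T' :: "('g \<Rightarrow>\<^sub>0 'k) \<Rightarrow> 'w"
  assumes W: "vspace W" and T: "linf (free_space G) W T" "linf (free_space G) W T'"
    and eq: "\<And>g. g \<in> G \<Longrightarrow> T (sgl g 1) = T' (sgl g 1)"
    and p: "Poly_Mapping.keys (p :: 'g \<Rightarrow>\<^sub>0 'k) \<subseteq> G"
  shows "T p = T' p"
  using p
proof (induction rule: free_space_induct)
  case zero
  then show ?case using linf_zero[OF vspace_free W T(1)] linf_zero[OF vspace_free W T(2)] by simp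
next
  case (add s g q)
  have "Poly_Mapping.keys (pscale s (sgl g (1::'k))) \<subseteq> G"
    using keys_pscale[of s "sgl g (1::'k)"] add by auto
  then show ?case
    using linf_add[OF T(1), of "pscale s (sgl g 1)" q] linf_add[OF T(2), of "pscale s (sgl g 1)" q]
      linf_smult[OF T(1), of "sgl g 1" s] linf_smult[OF T(2), of "sgl g 1" s] add eq
    by simp
qed

lemma free_ext:
  fixes W :: "('k::field, 'w) module"
  assumes W: "vspace W" and w: "\<And>g. g \<in> (G :: 'g set) \<Longrightarrow> w g \<in> carrier W"
  shows "\<exists>T :: ('g \<Rightarrow>\<^sub>0 'k) \<Rightarrow> 'w. linf (free_space G) W T \<and> (\<forall>g\<in>G. T (sgl g 1) = w g)"
proof -
  interpret W: Module.module "scalars :: 'k ring" W by (rule W)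
  define T where "T p = finsum W (\<lambda>g. Poly_Mapping.lookup p g \<odot>\<^bsub>W\<^esub> w g) (Poly_Mapping.keys p)"
    for p :: "'g \<Rightarrow>\<^sub>0 'k"
  \<comment> \<open>Indices with coefficient 0 do not change the sum, so \<open>p\<close>,
    \<open>q\<close> and \<open>p + q\<close> can all be summed over one common set.\<close>
  have T: "T p = finsum W (\<lambda>g. Poly_Mapping.lookup p g \<odot>\<^bsub>W\<^esub> w g) K"
    if "finite K" "Poly_Mapping.keys p \<subseteq> K" "K \<subseteq> G" for p :: "'g \<Rightarrow>\<^sub>0 'k" and K
    unfolding T_def
    by (rule W.add.finprod_mono_neutral_cong_left)
       (use that w in \<open>auto simp: in_keys_iff vs_smult_zero[OF W] W.smult_closed\<close>)
  have "linf (free_space G) W T"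
  proof (rule linfI)
    fix p :: "'g \<Rightarrow>\<^sub>0 'k" assume "p \<in> carrier (free_space G)"
    then show "T p \<in> carrier W" unfolding T_def by (intro W.finsum_closed) (use w in auto)
  next
    fix p q :: "'g \<Rightarrow>\<^sub>0 'k" assume pq: "p \<in> carrier (free_space G)" "q \<in> carrier (free_space G)"
    let ?K = "Poly_Mapping.keys p \<union> Poly_Mapping.keys q"
    have "T (p + q) = finsum W (\<lambda>g. Poly_Mapping.lookup p g \<odot>\<^bsub>W\<^esub> w g \<oplus>\<^bsub>W\<^esub> Poly_Mapping.lookup q g \<odot>\<^bsub>W\<^esub> w g) ?K"
      by (subst T[of ?K]) (use pq w keys_add[of p q] in
          \<open>auto simp: lookup_add intro!: W.finsum_cong' vs_smult_add_left[OF W]\<close>)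
    also have "\<dots> = T p \<oplus>\<^bsub>W\<^esub> T q"
      by (subst W.finsum_addf) (use pq w in \<open>auto simp: T[of ?K]\<close>)
    finally show "T (p \<oplus>\<^bsub>free_space G\<^esub> q) = T p \<oplus>\<^bsub>W\<^esub> T q" by simp
  next
    fix s and p :: "'g \<Rightarrow>\<^sub>0 'k" assume p: "p \<in> carrier (free_space G)"
    have "T (pscale s p) = finsum W (\<lambda>g. s \<odot>\<^bsub>W\<^esub> (Poly_Mapping.lookup p g \<odot>\<^bsub>W\<^esub> w g)) (Poly_Mapping.keys p)"
      by (subst T[of "Poly_Mapping.keys p"]) (use p w keys_pscale[of s p] in
          \<open>auto intro!: W.finsum_cong' vs_smult_smult[OF W]\<close>)
    also have "\<dots> = s \<odot>\<^bsub>W\<^esub> T p"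
      unfolding T_def by (rule W.finsum_smult_ldistr[symmetric]) (use p w in auto)
    finally show "T (s \<odot>\<^bsub>free_space G\<^esub> p) = s \<odot>\<^bsub>W\<^esub> T p" by simp
  qed
  moreover have "T (sgl g 1) = w g" if "g \<in> G" for g
    using that w vs_smult_one[OF W] by (subst T[of "{g}"]) auto
  ultimately show ?thesis by blast
qed

text \<open>The vector space with generators \<open>G\<close> and relations \<open>R\<close>, copied
  to the type \<open>'v\<close>. The map \<open>e\<close> witnesses that the quotient fits into
  \<open>'v\<close>, which makes the function picked by \<open>vcode\<close> injective as
  well.\<close>

locale presentation =
  fixes G :: "'g set" and R :: "('g \<Rightarrow>\<^sub>0 'k::field) set" and e :: "('g \<Rightarrow>\<^sub>0 'k) set \<Rightarrow> 'v"
  assumes R: "r \<in> R \<Longrightarrow> Poly_Mapping.keys r \<subseteq> G"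
    and e: "inj_on e (carrier (quot_space (free_space G) (Modules.module.span pscale R)))"
begin

sublocale pm: vector_space "pscale :: 'k \<Rightarrow> ('g \<Rightarrow>\<^sub>0 'k) \<Rightarrow> ('g \<Rightarrow>\<^sub>0 'k)"
  by (rule vector_space_pscale)

abbreviation "S \<equiv> Modules.module.span pscale R"
abbreviation "F \<equiv> free_space G :: ('k, 'g \<Rightarrow>\<^sub>0 'k) module"
abbreviation "Q \<equiv> quot_space F S"
abbreviation "V \<equiv> vcopy Q :: ('k, 'v) module"

definition el :: "('g \<Rightarrow>\<^sub>0 'k) \<Rightarrow> 'v" where
  "el p = vcode Q (S +>\<^bsub>F\<^esub> p)"

lemma coset: "S +>\<^bsub>F\<^esub> p = (\<lambda>r. r + p) ` S"
  by (auto simp: a_r_coset_def' image_def)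

lemma coset_eq: "S +>\<^bsub>F\<^esub> p = S +>\<^bsub>F\<^esub> q \<longleftrightarrow> p - q \<in> S"
proof
  assume "S +>\<^bsub>F\<^esub> p = S +>\<^bsub>F\<^esub> q"
  then have "0 + p \<in> (\<lambda>r. r + q) ` S" unfolding coset by (metis image_eqI pm.span_zero)
  then show "p - q \<in> S" by auto
next
  assume pq: "p - q \<in> S"
  have "r + p \<in> (\<lambda>r. r + q) ` S" "r + q \<in> (\<lambda>r. r + p) ` S" if "r \<in> S" for r
    using pm.span_add[OF that pq] pm.span_diff[OF that pq]
    by (simp_all add: image_iff bexI[of _ "r + (p - q)"] bexI[of _ "r - (p - q)"])
  then show "S +>\<^bsub>F\<^esub> p = S +>\<^bsub>F\<^esub> q" unfolding coset by auto
qed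

lemma coset_linf: "linf F Q (\<lambda>p. S +>\<^bsub>F\<^esub> p)"
proof (rule linfI)
  fix p assume "p \<in> carrier F" then show "S +>\<^bsub>F\<^esub> p \<in> carrier Q"
    by (auto simp: quot_space_def A_RCOSETS_def')
next
  fix p q
  have "r + p + (r' + q) \<in> (\<lambda>r. r + (p + q)) ` S" if "r \<in> S" "r' \<in> S" for r r'
    using pm.span_add[OF that] by (auto simp: image_iff algebra_simps intro!: bexI[of _ "r + r'"])
  moreover have "\<exists>r'\<in>S. \<exists>r''\<in>S. r + (p + q) = r' + p + (r'' + q)" if "r \<in> S" for r
    using that pm.span_zero[of R] by (intro bexI[of _ r] bexI[of _ 0]) auto
  ultimately show "S +>\<^bsub>F\<^esub> (p \<oplus>\<^bsub>F\<^esub> q) = (S +>\<^bsub>F\<^esub> p) \<oplus>\<^bsub>Q\<^esub> (S +>\<^bsub>F\<^esub> q)"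
    unfolding coset by (auto simp: quot_space_def set_add_def')
next
  fix s p
  have "r + pscale s (r' + p) \<in> (\<lambda>r. r + pscale s p) ` S" if "r \<in> S" "r' \<in> S" for r r'
    using pm.span_add[OF that(1) pm.span_scale[OF that(2), of s]]
    by (auto simp: image_iff algebra_simps pscale_simps)
  moreover have "\<exists>r'\<in>S. \<exists>r''\<in>S. r + pscale s p = r' + pscale s (r'' + p)" if "r \<in> S" for r
    using that pm.span_zero[of R] by (intro bexI[of _ r] bexI[of _ 0]) auto
  ultimately show "S +>\<^bsub>F\<^esub> (s \<odot>\<^bsub>F\<^esub> p) = s \<odot>\<^bsub>Q\<^esub> (S +>\<^bsub>F\<^esub> p)"
    unfolding coset by (auto simp: quot_space_def set_add_def')
qed

lemma quot_surj: "K \<in> carrier Q \<Longrightarrow> \<exists>p\<in>carrier F. K = S +>\<^bsub>F\<^esub> p"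
  by (auto simp: quot_space_def A_RCOSETS_def')

lemma vspace_quot: "vspace Q"
proof (rule vspace_iso[OF vspace_free coset_linf quot_surj])
  have "\<zero>\<^bsub>Q\<^esub> = S" by (simp add: quot_space_def)
  then show "\<zero>\<^bsub>Q\<^esub> = S +>\<^bsub>F\<^esub> \<zero>\<^bsub>F\<^esub>" by (simp add: coset)
qed

lemma vspace_V: "vspace V"
  by (rule vspace_vcopy[OF vspace_quot e])

lemma el_linf: "linf F V el"
  unfolding el_def by (rule linf_comp[OF coset_linf vcode_linf[OF vspace_quot e]])

lemma el_surj: "x \<in> carrier V \<Longrightarrow> \<exists>p\<in>carrier F. x = el p"
  using quot_surj by (auto simp: el_def vcopy_carrier[OF vspace_quot e])

lemma el_eq: "p \<in> carrier F \<Longrightarrow> q \<in> carrier F \<Longrightarrow> el p = el q \<longleftrightarrow> p - q \<in> S"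
  unfolding el_def coset_eq[symmetric]
  by (metis vdecode[OF vspace_quot e] linf_closed[OF coset_linf])

lemma el_rel: "r \<in> R \<Longrightarrow> el r = \<zero>\<^bsub>V\<^esub>"
  using el_eq[of r 0] R[of r] linf_zero[OF vspace_free vspace_V el_linf] pm.span_base[of r R] by simp

text \<open>\<open>T\<close> vanishes on the whole span of the relations, so its value at a
  representative chosen for \<open>x\<close> does not depend on the choice.\<close>

lemma el_ext:
  assumes W: "vspace W" and T: "linf F W T" and rel: "\<And>r. r \<in> R \<Longrightarrow> T r = \<zero>\<^bsub>W\<^esub>"
  shows "\<exists>T'. linf V W T' \<and> (\<forall>p\<in>carrier F. T' (el p) = T p)"
proof -
  \<comment> \<open>The support is controlled in the same induction because \<open>T\<close> is
    known to be additive only inside the free space on \<open>G\<close>.\<close>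
  have ker: "Poly_Mapping.keys r \<subseteq> G \<and> T r = \<zero>\<^bsub>W\<^esub>" if "r \<in> S" for r
    using that
  proof (induction rule: pm.span_induct_alt)
    case base then show ?case using linf_zero[OF vspace_free W T] by simp
  next
    case (step c x y)
    have x: "pscale c x \<in> carrier F" "x \<in> carrier F" using R[OF step(1)] keys_pscale[of c x] by auto
    then show ?case
      using linf_add[OF T x(1), of y] linf_smult[OF T x(2), of c] step rel[OF step(1)] keys_add[of "pscale c x" y]
      by (auto simp: vs_zero_smult[OF W] vs_zero_left[OF W] vs_zero_closed[OF W])
  qed
  define T' where "T' x = T (SOME p. p \<in> carrier F \<and> x = el p)" for x
  have T': "T' (el p) = T p" if p: "p \<in> carrier F" for p
  proof -
    let ?q = "SOME q. q \<in> carrier F \<and> el p = el q"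
    have q: "?q \<in> carrier F \<and> el p = el ?q" by (rule someI[of _ p]) (use p in auto)
    then have "p - ?q \<in> S" using el_eq p by auto
    then have "T (p - ?q) = \<zero>\<^bsub>W\<^esub>" "p - ?q \<in> carrier F" using ker by auto
    then have "T ((p - ?q) + ?q) = T ?q"
      using linf_add[OF T, of "p - ?q" ?q] q linf_closed[OF T, of ?q] by (simp add: vs_zero_left[OF W])
    then show ?thesis by (simp add: T'_def)
  qed
  have "linf V W T'"
  proof (rule linfI)
    fix x assume "x \<in> carrier V" then show "T' x \<in> carrier W"
      using el_surj T' linf_closed[OF T] by metis
  next
    fix x y assume "x \<in> carrier V" "y \<in> carrier V"
    then obtain p q where "p \<in> carrier F" "q \<in> carrier F" "x = el p" "y = el q" using el_surj by meson
    then show "T' (x \<oplus>\<^bsub>V\<^esub> y) = T' x \<oplus>\<^bsub>W\<^esub> T' y"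
      by (metis T' linf_add[OF T] linf_add[OF el_linf] vs_add_closed[OF vspace_free])
  next
    fix s x assume "x \<in> carrier V"
    then obtain p where "p \<in> carrier F" "x = el p" using el_surj by meson
    then show "T' (s \<odot>\<^bsub>V\<^esub> x) = s \<odot>\<^bsub>W\<^esub> T' x"
      by (metis T' linf_smult[OF T] linf_smult[OF el_linf] vs_smult_closed[OF vspace_free])
  qed
  then show ?thesis using T' by blast
qed

lemma el_span:
  assumes W: "vspace W" and T: "linf V W T" "linf V W T'"
    and eq: "\<And>g. g \<in> G \<Longrightarrow> T (el (sgl g 1)) = T' (el (sgl g 1))"
    and x: "x \<in> carrier V"
  shows "T x = T' x"
proof -
  obtain p where "p \<in> carrier F" "x = el p" using el_surj[OF x] by blast
  then show ?thesis
    using linf_free_eq[OF W linf_comp[OF el_linf T(1)] linf_comp[OF el_linf T(2)] eq, of p] by simp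
qed

end

section \<open>Smallness\<close>

definition small :: "'v itself \<Rightarrow> 'a set \<Rightarrow> bool" where
  "small _ A \<longleftrightarrow> (\<exists>e :: 'a \<Rightarrow> 'v. inj_on e A)"

lemma smallI: "inj_on (e :: 'a \<Rightarrow> 'v) A \<Longrightarrow> small TYPE('v) A"
  unfolding small_def by blast

lemma small_subset: "small TYPE('v) B \<Longrightarrow> A \<subseteq> B \<Longrightarrow> small TYPE('v) A"
  unfolding small_def by (meson inj_on_subset)

lemma small_UNIV: "small TYPE('v) (A :: 'v set)"
  by (rule smallI[of id]) simp

lemma small_inj: "inj_on f A \<Longrightarrow> small TYPE('v) (f ` A) \<Longrightarrow> small TYPE('v) A"
  unfolding small_def by (meson comp_inj_on)

lemma small_image: "small TYPE('v) A \<Longrightarrow> small TYPE('v) (f ` A)"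
  by (rule small_inj[OF inj_on_inv_into[of "f ` A" f A]]) (auto intro: small_subset inv_into_into)

locale universe =
  fixes U :: "'v itself"
  assumes infinite_U: "infinite (UNIV :: 'v set)"
begin

lemma small_countable: "countable A \<Longrightarrow> small TYPE('v) A"
proof -
  assume "countable A"
  moreover obtain f :: "nat \<Rightarrow> 'v" where "inj f" using infinite_U infinite_countable_subset by blast
  ultimately have "inj_on (f \<circ> to_nat_on A) A" by (intro comp_inj_on) (auto intro: inj_on_subset)
  then show ?thesis by (rule smallI)
qed

text \<open>An infinite set has as many elements as its square; products of small sets are small for
  this reason.\<close>

lemma pairing: "\<exists>p :: 'v \<times> 'v \<Rightarrow> 'v. inj p"
proof -
  have "(card_of (UNIV \<times> UNIV :: ('v \<times> 'v) set), card_of (UNIV :: 'v set)) \<in> ordIso"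
    by (rule card_of_Times_same_infinite[OF infinite_U])
  then have "(card_of (UNIV \<times> UNIV :: ('v \<times> 'v) set), card_of (UNIV :: 'v set)) \<in> ordLeq" by (rule ordIso_imp_ordLeq)
  then show ?thesis by (auto simp: card_of_ordLeq[symmetric])
qed

lemma small_Times: "small TYPE('v) A \<Longrightarrow> small TYPE('v) B \<Longrightarrow> small TYPE('v) (A \<times> B)"
proof -
  assume "small TYPE('v) A" "small TYPE('v) B"
  then obtain e :: "'a \<Rightarrow> 'v" and e' :: "'b \<Rightarrow> 'v" where "inj_on e A" "inj_on e' B" by (auto simp: small_def)
  moreover obtain p :: "'v \<times> 'v \<Rightarrow> 'v" where "inj p" using pairing by blast
  ultimately have "inj_on (p \<circ> map_prod e e') (A \<times> B)"
    by (intro comp_inj_on map_prod_inj_on) (auto intro: inj_on_subset)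
  then show ?thesis by (rule smallI)
qed

text \<open>Folding an injective pairing along a list determines the list once its length is known.
  The length has to be recorded because the empty list is coded by an arbitrary element, which may
  also be a value of the pairing.\<close>

lemma small_lists: "small TYPE('v) (UNIV :: 'v list set)"
proof -
  obtain p :: "'v \<times> 'v \<Rightarrow> 'v" where p: "inj p" using pairing by blast
  define f where "f xs = foldr (\<lambda>x y. p (x, y)) xs undefined" for xs
  have f: "xs = ys" if "length xs = length ys" "f xs = f ys" for xs ys
    using that
  proof (induction xs ys rule: list_induct2)
    case Nil then show ?case by simp
  next
    case (Cons x xs y ys) then show ?case using p by (auto simp: f_def dest!: injD)
  qed
  have "inj (\<lambda>xs :: 'v list. (length xs, f xs))" using f by (auto simp: inj_on_def)
  moreover have "small TYPE('v) (UNIV :: (nat \<times> 'v) set)"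
    using small_Times[OF small_countable[of "UNIV :: nat set"] small_UNIV[of UNIV]] by simp
  ultimately show ?thesis by (rule small_inj[OF _ small_subset]) auto
qed

text \<open>A finitely supported function is recovered from any list that enumerates its graph over
  the support, so lists of pairs of a generator and a scalar are enough to code it.\<close>

lemma small_free:
  assumes G: "small TYPE('v) G" and k: "small TYPE('v) (UNIV :: 'k::field set)"
  shows "small TYPE('v) {p :: 'g \<Rightarrow>\<^sub>0 'k. Poly_Mapping.keys p \<subseteq> G}"
proof -
  obtain e :: "'g \<times> 'k \<Rightarrow> 'v" where e: "inj_on e (G \<times> UNIV)"
    using small_Times[OF G k] by (auto simp: small_def)
  define l where "l p = (SOME xs. set xs = (\<lambda>g. (g, Poly_Mapping.lookup p g)) ` Poly_Mapping.keys p)" for p :: "'g \<Rightarrow>\<^sub>0 'k"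
  have l: "set (l p) = (\<lambda>g. (g, Poly_Mapping.lookup p g)) ` Poly_Mapping.keys p" for p
    unfolding l_def by (rule someI_ex) (simp add: finite_list)
  have mem: "(g, c) \<in> set (l p) \<longleftrightarrow> c = Poly_Mapping.lookup p g \<and> c \<noteq> 0" for g c p
    by (auto simp: l in_keys_iff)
  have eq: "p = q" if "set (l p) = set (l q)" for p q
  proof (rule poly_mapping_eqI)
    show "Poly_Mapping.lookup p g = Poly_Mapping.lookup q g" for g using that mem by metis
  qed
  have sub: "set (l p) \<subseteq> G \<times> UNIV" if "Poly_Mapping.keys p \<subseteq> G" for p
    unfolding l using that by auto
  have "inj_on (\<lambda>p. map e (l p)) {p. Poly_Mapping.keys p \<subseteq> G}"
  proof (rule inj_onI, unfold mem_Collect_eq)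
    fix p q assume p: "Poly_Mapping.keys p \<subseteq> G" and q: "Poly_Mapping.keys q \<subseteq> G" and m: "map e (l p) = map e (l q)"
    have "l p = l q"
      by (rule map_inj_on[OF m inj_on_subset[OF e]]) (use sub[OF p] sub[OF q] in blast)
    then show "p = q" by (intro eq arg_cong[of _ _ set])
  qed
  then show ?thesis by (rule small_inj[OF _ small_subset[OF small_lists subset_UNIV]])
qed

end


section \<open>Linear and strict monoidal categories\<close>

lemma in_homset [simp]: "f \<in> homset C a b \<longleftrightarrow> f \<in> Arr C \<and> Src C f = a \<and> Tgt C f = b"
  by (auto simp: homset_def)

lemma hom_space_simps [simp]:
  "carrier (hom_space C a b) = homset C a b" "f \<oplus>\<^bsub>hom_space C a b\<^esub> g = Plus C f g"
  "s \<odot>\<^bsub>hom_space C a b\<^esub> f = Scal C s f" "\<zero>\<^bsub>hom_space C a b\<^esub> = Nul C a b"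
  by (simp_all add: hom_space_def)

context klinear_category
begin

lemma obj_arr [simp]:
  "f \<in> Arr C \<Longrightarrow> Src C f \<in> Obj C" "f \<in> Arr C \<Longrightarrow> Tgt C f \<in> Obj C"
  using src_tgt by auto

lemma idt_arr [simp]:
  "a \<in> Obj C \<Longrightarrow> Idt C a \<in> Arr C" "a \<in> Obj C \<Longrightarrow> Src C (Idt C a) = a" "a \<in> Obj C \<Longrightarrow> Tgt C (Idt C a) = a"
  using idt[of a] by auto

lemma cmp_arr [simp]:
  assumes "f \<in> Arr C" "g \<in> Arr C" "Src C g = Tgt C f"
  shows "g \<cdot> f \<in> Arr C" "Src C (g \<cdot> f) = Src C f" "Tgt C (g \<cdot> f) = Tgt C g"
  using cmp[of f "Src C f" "Tgt C f" g "Tgt C g"] assms by auto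

lemma cmp_assoc' [simp]:
  "f \<in> Arr C \<Longrightarrow> g \<in> Arr C \<Longrightarrow> h \<in> Arr C \<Longrightarrow> Src C g = Tgt C f \<Longrightarrow> Src C h = Tgt C g \<Longrightarrow>
    (h \<cdot> g) \<cdot> f = h \<cdot> (g \<cdot> f)"
  by (rule cmp_assoc) auto

lemma cmp_idt' [simp]:
  "f \<in> Arr C \<Longrightarrow> Src C f = a \<Longrightarrow> f \<cdot> Idt C a = f" "f \<in> Arr C \<Longrightarrow> Tgt C f = a \<Longrightarrow> Idt C a \<cdot> f = f"
  using cmp_idt[of f "Src C f" "Tgt C f"] by auto

lemma plus_arr [simp]:
  assumes "f \<in> Arr C" "g \<in> Arr C" "Src C g = Src C f" "Tgt C g = Tgt C f"
  shows "Plus C f g \<in> Arr C" "Src C (Plus C f g) = Src C f" "Tgt C (Plus C f g) = Tgt C f"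
  using vs_add_closed[OF hom_vspace, of "Src C f" "Tgt C f" f g] assms by auto

lemma scal_arr [simp]:
  assumes "f \<in> Arr C"
  shows "Scal C s f \<in> Arr C" "Src C (Scal C s f) = Src C f" "Tgt C (Scal C s f) = Tgt C f"
  using vs_smult_closed[OF hom_vspace, of "Src C f" "Tgt C f" f s] assms by auto

lemma nul_arr [simp]:
  assumes "a \<in> Obj C" "b \<in> Obj C"
  shows "Nul C a b \<in> Arr C" "Src C (Nul C a b) = a" "Tgt C (Nul C a b) = b"
  using vs_zero_closed[OF hom_vspace, of a b] assms by auto

lemma cmp_plus_right:
  "f \<in> Arr C \<Longrightarrow> f' \<in> Arr C \<Longrightarrow> g \<in> Arr C \<Longrightarrow> Src C f' = Src C f \<Longrightarrow> Tgt C f' = Tgt C f \<Longrightarrow> Src C g = Tgt C f \<Longrightarrow>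
    g \<cdot> Plus C f f' = Plus C (g \<cdot> f) (g \<cdot> f')"
  using cmp_plus[of f "Src C f" "Tgt C f" f' g "Tgt C g" g] by auto

lemma cmp_plus_left:
  "f \<in> Arr C \<Longrightarrow> g \<in> Arr C \<Longrightarrow> g' \<in> Arr C \<Longrightarrow> Src C g' = Src C g \<Longrightarrow> Tgt C g' = Tgt C g \<Longrightarrow> Src C g = Tgt C f \<Longrightarrow>
    Plus C g g' \<cdot> f = Plus C (g \<cdot> f) (g' \<cdot> f)"
  using cmp_plus[of f "Src C f" "Tgt C f" f g "Tgt C g" g'] by auto

lemma cmp_scal_right: "f \<in> Arr C \<Longrightarrow> g \<in> Arr C \<Longrightarrow> Src C g = Tgt C f \<Longrightarrow> g \<cdot> Scal C s f = Scal C s (g \<cdot> f)"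
  and cmp_scal_left: "f \<in> Arr C \<Longrightarrow> g \<in> Arr C \<Longrightarrow> Src C g = Tgt C f \<Longrightarrow> Scal C s g \<cdot> f = Scal C s (g \<cdot> f)"
  using cmp_scal[of f "Src C f" "Tgt C f" g "Tgt C g" s] by auto

lemmas cmp_linear = cmp_plus_right cmp_plus_left cmp_scal_right cmp_scal_left

lemma hom_vspace': "f \<in> Arr C \<Longrightarrow> vspace (hom_space C (Src C f) (Tgt C f))"
  by (rule hom_vspace) auto

lemma inverse_pair_unique:
  assumes "inverse_pair C f g" "inverse_pair C f h"
  shows "g = h"
proof -
  have "g = g \<cdot> (f \<cdot> h)" using assms by (auto simp: inverse_pair_def)
  also have "\<dots> = (g \<cdot> f) \<cdot> h" using assms by (subst cmp_assoc') (auto simp: inverse_pair_def)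
  also have "\<dots> = h" using assms by (auto simp: inverse_pair_def)
  finally show ?thesis .
qed

lemma inv_arr_eq: "inverse_pair C f g \<Longrightarrow> inv_arr C f = g"
  unfolding inv_arr_def by (rule the_equality) (auto intro: inverse_pair_unique)

lemma inv_arr_simps [simp]:
  assumes "is_iso C f"
  shows "inv_arr C f \<in> Arr C" "Src C (inv_arr C f) = Tgt C f" "Tgt C (inv_arr C f) = Src C f"
    "inv_arr C f \<cdot> f = Idt C (Src C f)" "f \<cdot> inv_arr C f = Idt C (Tgt C f)"
  using assms inv_arr_eq by (auto simp: is_iso_def inverse_pair_def)

end

lemma is_isoI:
  assumes "f \<in> homset C a b" "g \<in> homset C b a" "Cmp C g f = Idt C a" "Cmp C f g = Idt C b"
  shows "is_iso C f" "inverse_pair C f g"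
  using assms by (auto simp: is_iso_def inverse_pair_def)

text \<open>The unit and associativity laws are equations of objects and arrows, stated with
  \<open>Src\<close> and \<open>Tgt\<close> instead of \<open>homset\<close> so that they can be
  used as rewrite rules. The instances are \<open>hecke_bar\<close> and the category of
  endofunctors.\<close>

locale strict_monoidal = klinear_category C
  for C :: "('o, 'm, 'k::field, 'z) moncat_scheme" (structure) +
  assumes tobj [simp]: "a \<in> Obj C \<Longrightarrow> b \<in> Obj C \<Longrightarrow> a \<star> b \<in> Obj C"
    and tarr [simp]: "f \<in> Arr C \<Longrightarrow> g \<in> Arr C \<Longrightarrow> f \<boxtimes> g \<in> Arr C"
      "f \<in> Arr C \<Longrightarrow> g \<in> Arr C \<Longrightarrow> Src C (f \<boxtimes> g) = Src C f \<star> Src C g"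
      "f \<in> Arr C \<Longrightarrow> g \<in> Arr C \<Longrightarrow> Tgt C (f \<boxtimes> g) = Tgt C f \<star> Tgt C g"
    and tarr_idt [simp]: "a \<in> Obj C \<Longrightarrow> b \<in> Obj C \<Longrightarrow> Idt C a \<boxtimes> Idt C b = Idt C (a \<star> b)"
    and tarr_cmp: "f \<in> Arr C \<Longrightarrow> f' \<in> Arr C \<Longrightarrow> g \<in> Arr C \<Longrightarrow> g' \<in> Arr C \<Longrightarrow>
      Src C f' = Tgt C f \<Longrightarrow> Src C g' = Tgt C g \<Longrightarrow> (f' \<boxtimes> g') \<cdot> (f \<boxtimes> g) = (f' \<cdot> f) \<boxtimes> (g' \<cdot> g)"
    and tarr_plus_left: "f \<in> Arr C \<Longrightarrow> f' \<in> Arr C \<Longrightarrow> g \<in> Arr C \<Longrightarrow> Src C f' = Src C f \<Longrightarrow> Tgt C f' = Tgt C f \<Longrightarrow>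
      Plus C f f' \<boxtimes> g = Plus C (f \<boxtimes> g) (f' \<boxtimes> g)"
    and tarr_plus_right: "f \<in> Arr C \<Longrightarrow> g \<in> Arr C \<Longrightarrow> g' \<in> Arr C \<Longrightarrow> Src C g' = Src C g \<Longrightarrow> Tgt C g' = Tgt C g \<Longrightarrow>
      f \<boxtimes> Plus C g g' = Plus C (f \<boxtimes> g) (f \<boxtimes> g')"
    and tarr_scal_left: "f \<in> Arr C \<Longrightarrow> g \<in> Arr C \<Longrightarrow> Scal C s f \<boxtimes> g = Scal C s (f \<boxtimes> g)"
    and tarr_scal_right: "f \<in> Arr C \<Longrightarrow> g \<in> Arr C \<Longrightarrow> f \<boxtimes> Scal C s g = Scal C s (f \<boxtimes> g)"
    and one [simp]: "One C \<in> Obj C"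
    and tobj_assoc [simp]: "a \<in> Obj C \<Longrightarrow> b \<in> Obj C \<Longrightarrow> c \<in> Obj C \<Longrightarrow> (a \<star> b) \<star> c = a \<star> (b \<star> c)"
    and tarr_assoc [simp]: "f \<in> Arr C \<Longrightarrow> g \<in> Arr C \<Longrightarrow> h \<in> Arr C \<Longrightarrow> (f \<boxtimes> g) \<boxtimes> h = f \<boxtimes> (g \<boxtimes> h)"
    and tobj_one [simp]: "a \<in> Obj C \<Longrightarrow> One C \<star> a = a" "a \<in> Obj C \<Longrightarrow> a \<star> One C = a"
    and tarr_one [simp]: "f \<in> Arr C \<Longrightarrow> Idt C (One C) \<boxtimes> f = f" "f \<in> Arr C \<Longrightarrow> f \<boxtimes> Idt C (One C) = f"
    and assoc_idt [simp]: "a \<in> Obj C \<Longrightarrow> b \<in> Obj C \<Longrightarrow> c \<in> Obj C \<Longrightarrow> Assoc C a b c = Idt C (a \<star> (b \<star> c))"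
    and unit_idt [simp]: "a \<in> Obj C \<Longrightarrow> LUnit C a = Idt C a" "a \<in> Obj C \<Longrightarrow> RUnit C a = Idt C a"
begin

lemmas tarr_linear = tarr_plus_left tarr_plus_right tarr_scal_left tarr_scal_right

end


section \<open>Functors and natural transformations\<close>

lemma klinear_functorD:
  assumes F: "klinear_functor C D F"
  shows "OMap F \<in> extensional (Obj C)" "AMap F \<in> extensional (Arr C)"
    and "a \<in> Obj C \<Longrightarrow> OMap F a \<in> Obj D"
    and "a \<in> Obj C \<Longrightarrow> AMap F (Idt C a) = Idt D (OMap F a)"
    and "f \<in> Arr C \<Longrightarrow> AMap F f \<in> homset D (OMap F (Src C f)) (OMap F (Tgt C f))"
    and "f \<in> Arr C \<Longrightarrow> g \<in> Arr C \<Longrightarrow> Tgt C f = Src C g \<Longrightarrow> AMap F (Cmp C g f) = Cmp D (AMap F g) (AMap F f)"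
    and "f \<in> Arr C \<Longrightarrow> g \<in> Arr C \<Longrightarrow> Src C g = Src C f \<Longrightarrow> Tgt C g = Tgt C f \<Longrightarrow>
      AMap F (Plus C f g) = Plus D (AMap F f) (AMap F g)"
    and "f \<in> Arr C \<Longrightarrow> AMap F (Scal C s f) = Scal D s (AMap F f)"
proof -
  note F' = F[unfolded klinear_functor_def]
  show "OMap F \<in> extensional (Obj C)" "AMap F \<in> extensional (Arr C)"
    "a \<in> Obj C \<Longrightarrow> OMap F a \<in> Obj D" "a \<in> Obj C \<Longrightarrow> AMap F (Idt C a) = Idt D (OMap F a)"
    "f \<in> Arr C \<Longrightarrow> AMap F f \<in> homset D (OMap F (Src C f)) (OMap F (Tgt C f))"
    "f \<in> Arr C \<Longrightarrow> g \<in> Arr C \<Longrightarrow> Tgt C f = Src C g \<Longrightarrow> AMap F (Cmp C g f) = Cmp D (AMap F g) (AMap F f)"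
    "f \<in> Arr C \<Longrightarrow> AMap F (Scal C s f) = Scal D s (AMap F f)"
    using F' by blast+
  have "\<forall>a b. \<forall>f\<in>homset C a b. \<forall>g\<in>homset C a b. AMap F (Plus C f g) = Plus D (AMap F f) (AMap F g)"
    using F' by blast
  then show "f \<in> Arr C \<Longrightarrow> g \<in> Arr C \<Longrightarrow> Src C g = Src C f \<Longrightarrow> Tgt C g = Tgt C f \<Longrightarrow>
      AMap F (Plus C f g) = Plus D (AMap F f) (AMap F g)"
    by simp
qed

lemma klinear_functorI:
  assumes "OMap F \<in> extensional (Obj C)" "AMap F \<in> extensional (Arr C)"
    and "\<And>a. a \<in> Obj C \<Longrightarrow> OMap F a \<in> Obj D"
    and "\<And>a. a \<in> Obj C \<Longrightarrow> AMap F (Idt C a) = Idt D (OMap F a)"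
    and "\<And>f. f \<in> Arr C \<Longrightarrow> AMap F f \<in> homset D (OMap F (Src C f)) (OMap F (Tgt C f))"
    and "\<And>f g. f \<in> Arr C \<Longrightarrow> g \<in> Arr C \<Longrightarrow> Src C g = Tgt C f \<Longrightarrow> AMap F (Cmp C g f) = Cmp D (AMap F g) (AMap F f)"
    and "\<And>f g. f \<in> Arr C \<Longrightarrow> g \<in> Arr C \<Longrightarrow> Src C g = Src C f \<Longrightarrow> Tgt C g = Tgt C f \<Longrightarrow>
      AMap F (Plus C f g) = Plus D (AMap F f) (AMap F g)"
    and "\<And>f s. f \<in> Arr C \<Longrightarrow> AMap F (Scal C s f) = Scal D s (AMap F f)"
  shows "klinear_functor C D F"
  unfolding klinear_functor_def
  by (intro conjI ballI allI impI; (rule assms)?; simp add: assms(3))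

lemma natural_transformationD:
  assumes "natural_transformation C D \<tau>"
  shows "klinear_functor C D (NSrc \<tau>)" "klinear_functor C D (NTgt \<tau>)" "NAt \<tau> \<in> extensional (Obj C)"
    and "a \<in> Obj C \<Longrightarrow> NAt \<tau> a \<in> homset D (OMap (NSrc \<tau>) a) (OMap (NTgt \<tau>) a)"
    and "f \<in> Arr C \<Longrightarrow> Cmp D (NAt \<tau> (Tgt C f)) (AMap (NSrc \<tau>) f) = Cmp D (AMap (NTgt \<tau>) f) (NAt \<tau> (Src C f))"
  using assms unfolding natural_transformation_def by blast+

lemma natural_transformationI:
  assumes "klinear_functor C D (NSrc \<tau>)" "klinear_functor C D (NTgt \<tau>)" "NAt \<tau> \<in> extensional (Obj C)"
    and "\<And>a. a \<in> Obj C \<Longrightarrow> NAt \<tau> a \<in> homset D (OMap (NSrc \<tau>) a) (OMap (NTgt \<tau>) a)"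
    and "\<And>f. f \<in> Arr C \<Longrightarrow>
      Cmp D (NAt \<tau> (Tgt C f)) (AMap (NSrc \<tau>) f) = Cmp D (AMap (NTgt \<tau>) f) (NAt \<tau> (Src C f))"
  shows "natural_transformation C D \<tau>"
  using assms unfolding natural_transformation_def by blast


section \<open>Presheaves\<close>

definition presheaf :: "('o, 'm, 'k::field, 'z) kcat_scheme \<Rightarrow> ('o, 'm, 'k, 'v) psh \<Rightarrow> bool" where
  "presheaf A M \<longleftrightarrow> klinear_functor (op_cat (kcat.truncate A)) vect_cat M"

definition presheaf_map :: "('o, 'm, 'k::field, 'z) kcat_scheme \<Rightarrow> ('o, 'm, 'k, 'v) psh_map \<Rightarrow> bool" where
  "presheaf_map A \<sigma> \<longleftrightarrow> natural_transformation (op_cat (kcat.truncate A)) vect_cat \<sigma>"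

abbreviation app :: "('o, 'm, 'k, 'v) psh_map \<Rightarrow> 'o \<Rightarrow> 'v \<Rightarrow> 'v" where
  "app \<sigma> c x \<equiv> LFun (NAt \<sigma> c) x"

lemma op_cat_simps [simp]:
  "Obj (op_cat (kcat.truncate A)) = Obj A" "Arr (op_cat (kcat.truncate A)) = Arr A"
  "Src (op_cat (kcat.truncate A)) = Tgt A" "Tgt (op_cat (kcat.truncate A)) = Src A"
  "Idt (op_cat (kcat.truncate A)) = Idt A" "Cmp (op_cat (kcat.truncate A)) g f = Cmp A f g"
  "Plus (op_cat (kcat.truncate A)) = Plus A" "Scal (op_cat (kcat.truncate A)) = Scal A"
  by (simp_all add: op_cat_def kcat.truncate_def)

lemma vect_cat_simps [simp]:
  "V \<in> Obj vect_cat \<longleftrightarrow> vspace V" "Src vect_cat = LSrc" "Tgt vect_cat = LTgt"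
  "LSrc (Idt vect_cat V) = V" "LTgt (Idt vect_cat V) = V" "LFun (Idt vect_cat V) = (\<lambda>x\<in>carrier V. x)"
  "LSrc (Cmp vect_cat T S) = LSrc S" "LTgt (Cmp vect_cat T S) = LTgt T"
  "LFun (Cmp vect_cat T S) = compose (carrier (LSrc S)) (LFun T) (LFun S)"
  "LSrc (Plus vect_cat S T) = LSrc S" "LTgt (Plus vect_cat S T) = LTgt S"
  "LFun (Plus vect_cat S T) = (\<lambda>x\<in>carrier (LSrc S). LFun S x \<oplus>\<^bsub>LTgt S\<^esub> LFun T x)"
  "LSrc (Scal vect_cat s T) = LSrc T" "LTgt (Scal vect_cat s T) = LTgt T"
  "LFun (Scal vect_cat s T) = (\<lambda>x\<in>carrier (LSrc T). s \<odot>\<^bsub>LTgt T\<^esub> LFun T x)"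
  by (simp_all add: vect_cat_def)

lemma linmap_eq_iff:
  "S \<in> homset vect_cat V W \<Longrightarrow> LSrc T = V \<Longrightarrow> LTgt T = W \<Longrightarrow> LFun T \<in> extensional (carrier V) \<Longrightarrow>
    S = T \<longleftrightarrow> (\<forall>x\<in>carrier V. LFun S x = LFun T x)"
  by (cases S; cases T) (auto simp: homset_vect intro: extensionalityI simp del: in_homset)

context klinear_category
begin

context
  fixes M :: "('o, 'm, 'k, 'v) psh"
  assumes M: "presheaf C M"
begin

lemmas psh_functor = klinear_functorD[OF M[unfolded presheaf_def], unfolded op_cat_simps vect_cat_simps(1)]

lemmas psh_vspace = psh_functor(3)

lemma psh_hom: "u \<in> Arr C \<Longrightarrow> AMap M u \<in> homset vect_cat (OMap M (Tgt C u)) (OMap M (Src C u))"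
  by (rule psh_functor(5))

lemma psh_arr [simp]: "u \<in> Arr C \<Longrightarrow> LSrc (AMap M u) = OMap M (Tgt C u)" "u \<in> Arr C \<Longrightarrow> LTgt (AMap M u) = OMap M (Src C u)"
  using psh_hom[of u] by simp_all

lemma psh_linf: "u \<in> Arr C \<Longrightarrow> linf (OMap M (Tgt C u)) (OMap M (Src C u)) (act M u)"
  using psh_hom[of u] by (simp add: homset_vect del: in_homset)

lemma act_closed: "u \<in> Arr C \<Longrightarrow> x \<in> elems M (Tgt C u) \<Longrightarrow> act M u x \<in> elems M (Src C u)"
  by (rule linf_closed[OF psh_linf])

lemma act_add: "u \<in> Arr C \<Longrightarrow> x \<in> elems M (Tgt C u) \<Longrightarrow> y \<in> elems M (Tgt C u) \<Longrightarrow>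
    act M u (x \<oplus>\<^bsub>OMap M (Tgt C u)\<^esub> y) = act M u x \<oplus>\<^bsub>OMap M (Src C u)\<^esub> act M u y"
  by (rule linf_add[OF psh_linf])

lemma act_smult: "u \<in> Arr C \<Longrightarrow> x \<in> elems M (Tgt C u) \<Longrightarrow>
    act M u (s \<odot>\<^bsub>OMap M (Tgt C u)\<^esub> x) = s \<odot>\<^bsub>OMap M (Src C u)\<^esub> act M u x"
  by (rule linf_smult[OF psh_linf])

lemma act_idt: "a \<in> Obj C \<Longrightarrow> x \<in> elems M a \<Longrightarrow> act M (Idt C a) x = x"
  by (simp add: psh_functor(4))

lemma act_cmp: "u \<in> Arr C \<Longrightarrow> v \<in> Arr C \<Longrightarrow> Src C v = Tgt C u \<Longrightarrow> x \<in> elems M (Tgt C v) \<Longrightarrow>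
    act M (v \<cdot> u) x = act M u (act M v x)"
  using psh_functor(6)[of v u] by (simp add: compose_def)

lemma act_plus: "u \<in> Arr C \<Longrightarrow> v \<in> Arr C \<Longrightarrow> Src C v = Src C u \<Longrightarrow> Tgt C v = Tgt C u \<Longrightarrow> x \<in> elems M (Tgt C u) \<Longrightarrow>
    act M (Plus C u v) x = act M u x \<oplus>\<^bsub>OMap M (Src C u)\<^esub> act M v x"
  using psh_functor(7)[of u v] by simp

lemma act_scal: "u \<in> Arr C \<Longrightarrow> x \<in> elems M (Tgt C u) \<Longrightarrow>
    act M (Scal C s u) x = s \<odot>\<^bsub>OMap M (Src C u)\<^esub> act M u x"
  using psh_functor(8)[of u s] by simp

end

lemma presheafI:
  fixes M :: "('o, 'm, 'k, 'v) psh"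
  assumes ext: "OMap M \<in> extensional (Obj C)" "AMap M \<in> extensional (Arr C)"
    and vs: "\<And>a. a \<in> Obj C \<Longrightarrow> vspace (OMap M a)"
    and hom: "\<And>u. u \<in> Arr C \<Longrightarrow> AMap M u \<in> homset vect_cat (OMap M (Tgt C u)) (OMap M (Src C u))"
    and idt: "\<And>a x. a \<in> Obj C \<Longrightarrow> x \<in> elems M a \<Longrightarrow> act M (Idt C a) x = x"
    and cmp: "\<And>u v x. u \<in> Arr C \<Longrightarrow> v \<in> Arr C \<Longrightarrow> Src C v = Tgt C u \<Longrightarrow> x \<in> elems M (Tgt C v) \<Longrightarrow>
      act M (v \<cdot> u) x = act M u (act M v x)"
    and plus: "\<And>u v x. u \<in> Arr C \<Longrightarrow> v \<in> Arr C \<Longrightarrow> Src C v = Src C u \<Longrightarrow> Tgt C v = Tgt C u \<Longrightarrow>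
      x \<in> elems M (Tgt C u) \<Longrightarrow> act M (Plus C u v) x = act M u x \<oplus>\<^bsub>OMap M (Src C u)\<^esub> act M v x"
    and scal: "\<And>u s x. u \<in> Arr C \<Longrightarrow> x \<in> elems M (Tgt C u) \<Longrightarrow>
      act M (Scal C s u) x = s \<odot>\<^bsub>OMap M (Src C u)\<^esub> act M u x"
  shows "presheaf C M"
proof -
  have h: "AMap M u \<in> Arr vect_cat" "LSrc (AMap M u) = OMap M (Tgt C u)" "LTgt (AMap M u) = OMap M (Src C u)"
    if "u \<in> Arr C" for u using hom[OF that] by auto
  have i: "AMap M (Idt C a) = Idt vect_cat (OMap M a)" if "a \<in> Obj C" for a
    using hom[of "Idt C a"] that by (subst linmap_eq_iff[of _ "OMap M a" "OMap M a"]) (auto simp: idt)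
  have c: "AMap M (v \<cdot> u) = Cmp vect_cat (AMap M u) (AMap M v)" if "u \<in> Arr C" "v \<in> Arr C" "Src C v = Tgt C u" for u v
    using hom[of "v \<cdot> u"] that
    by (subst linmap_eq_iff[of _ "OMap M (Tgt C v)" "OMap M (Src C u)"]) (auto simp: cmp h compose_def)
  have p: "AMap M (Plus C u v) = Plus vect_cat (AMap M u) (AMap M v)"
    if "u \<in> Arr C" "v \<in> Arr C" "Src C v = Src C u" "Tgt C v = Tgt C u" for u v
    using hom[of "Plus C u v"] that
    by (subst linmap_eq_iff[of _ "OMap M (Tgt C u)" "OMap M (Src C u)"]) (auto simp: plus h)
  have s: "AMap M (Scal C s u) = Scal vect_cat s (AMap M u)" if "u \<in> Arr C" for u s
    using hom[of "Scal C s u"] that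
    by (subst linmap_eq_iff[of _ "OMap M (Tgt C u)" "OMap M (Src C u)"]) (auto simp: scal h)
  show ?thesis
    unfolding presheaf_def
    by (rule klinear_functorI, unfold op_cat_simps vect_cat_simps(1)) (simp_all add: ext vs h i c p s)
qed

context
  fixes \<sigma> :: "('o, 'm, 'k, 'v) psh_map"
  assumes \<sigma>: "presheaf_map C \<sigma>"
begin

lemmas psh_map_nat =
  natural_transformationD[OF \<sigma>[unfolded presheaf_map_def], unfolded op_cat_simps, folded presheaf_def]

lemmas psh_map_psh = psh_map_nat(1,2) and psh_map_hom = psh_map_nat(4)

lemma psh_map_arr [simp]: "a \<in> Obj C \<Longrightarrow> LSrc (NAt \<sigma> a) = OMap (NSrc \<sigma>) a" "a \<in> Obj C \<Longrightarrow> LTgt (NAt \<sigma> a) = OMap (NTgt \<sigma>) a"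
  using psh_map_hom[of a] by simp_all

lemma app_linf: "a \<in> Obj C \<Longrightarrow> linf (OMap (NSrc \<sigma>) a) (OMap (NTgt \<sigma>) a) (app \<sigma> a)"
  using psh_map_hom[of a] by (simp add: homset_vect del: in_homset)

lemma app_closed: "a \<in> Obj C \<Longrightarrow> x \<in> elems (NSrc \<sigma>) a \<Longrightarrow> app \<sigma> a x \<in> elems (NTgt \<sigma>) a"
  by (rule linf_closed[OF app_linf])

lemma app_act: "u \<in> Arr C \<Longrightarrow> x \<in> elems (NSrc \<sigma>) (Tgt C u) \<Longrightarrow>
    app \<sigma> (Src C u) (act (NSrc \<sigma>) u x) = act (NTgt \<sigma>) u (app \<sigma> (Tgt C u) x)"
  using arg_cong[OF psh_map_nat(5)[of u], of "\<lambda>T. LFun T x"] psh_arr[OF psh_map_psh(1), of u]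
  by (simp add: compose_def)

end

lemma presheaf_mapI:
  fixes \<sigma> :: "('o, 'm, 'k, 'v) psh_map"
  assumes psh: "presheaf C (NSrc \<sigma>)" "presheaf C (NTgt \<sigma>)"
    and ext: "NAt \<sigma> \<in> extensional (Obj C)"
    and hom: "\<And>a. a \<in> Obj C \<Longrightarrow> NAt \<sigma> a \<in> homset vect_cat (OMap (NSrc \<sigma>) a) (OMap (NTgt \<sigma>) a)"
    and nat: "\<And>u x. u \<in> Arr C \<Longrightarrow> x \<in> elems (NSrc \<sigma>) (Tgt C u) \<Longrightarrow>
      app \<sigma> (Src C u) (act (NSrc \<sigma>) u x) = act (NTgt \<sigma>) u (app \<sigma> (Tgt C u) x)"
  shows "presheaf_map C \<sigma>"
proof -
  have h: "NAt \<sigma> a \<in> Arr vect_cat" "LSrc (NAt \<sigma> a) = OMap (NSrc \<sigma>) a" "LTgt (NAt \<sigma> a) = OMap (NTgt \<sigma>) a"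
    if "a \<in> Obj C" for a using hom[OF that] by auto
  have "Cmp vect_cat (NAt \<sigma> (Src C u)) (AMap (NSrc \<sigma>) u) = Cmp vect_cat (AMap (NTgt \<sigma>) u) (NAt \<sigma> (Tgt C u))"
    if "u \<in> Arr C" for u
    using that nat[OF that] psh_arr[OF psh(1) that] psh_arr[OF psh(2) that] h
    by (simp add: vect_cat_def compose_def cong: restrict_cong)
  then show ?thesis
    unfolding presheaf_map_def
    by (intro natural_transformationI, unfold op_cat_simps) (use psh ext h in \<open>simp_all add: presheaf_def\<close>)
qed

lemma psh_map_eqI:
  assumes "presheaf_map C \<sigma>" "presheaf_map C \<tau>" "NSrc \<sigma> = NSrc \<tau>" "NTgt \<sigma> = NTgt \<tau>"
    and "\<And>a x. a \<in> Obj C \<Longrightarrow> x \<in> elems (NSrc \<sigma>) a \<Longrightarrow> app \<sigma> a x = app \<tau> a x"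
  shows "\<sigma> = \<tau>"
proof -
  have "NAt \<sigma> a = NAt \<tau> a" if "a \<in> Obj C" for a
    using linmap_eqI[OF psh_map_hom[OF assms(1) that]] psh_map_hom[OF assms(2) that] assms(3-5) that by simp
  moreover have "NAt \<sigma> \<in> extensional (Obj C)" "NAt \<tau> \<in> extensional (Obj C)"
    by (rule psh_map_nat(3)[OF assms(1)], rule psh_map_nat(3)[OF assms(2)])
  ultimately have "NAt \<sigma> = NAt \<tau>" by (intro extensionalityI) auto
  then show ?thesis using assms(3,4) by (cases \<sigma>; cases \<tau>) auto
qed

end


section \<open>Representable presheaves\<close>

locale small_category = klinear_category A + universe U
  for A :: "('o, 'm, 'k::field, 'z) kcat_scheme" and U :: "'v itself" +
  assumes small_obj: "small TYPE('v) (Obj A)" and small_arr: "small TYPE('v) (Arr A)"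
    and small_field: "small TYPE('v) (UNIV :: 'k set)"
begin

abbreviation yon :: "'o \<Rightarrow> ('o, 'm, 'k, 'v) psh" where
  "yon \<equiv> yoneda A"

abbreviation yarr :: "'m \<Rightarrow> ('o, 'm, 'k, 'v) psh_map" where
  "yarr \<equiv> yoneda_arr A"

abbreviation code :: "'o \<Rightarrow> 'o \<Rightarrow> 'm \<Rightarrow> 'v" where
  "code c a \<equiv> vcode (hom_space A c a)"

abbreviation decode :: "'o \<Rightarrow> 'o \<Rightarrow> 'v \<Rightarrow> 'm" where
  "decode c a \<equiv> inv_into (homset A c a) (code c a)"

context
  fixes c a assumes ca: "c \<in> Obj A" "a \<in> Obj A"
begin

lemma hom_inj: "\<exists>e :: 'm \<Rightarrow> 'v. inj_on e (carrier (hom_space A c a))"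
  using small_subset[OF small_arr, of "homset A c a"] by (auto simp: small_def simp del: in_homset) (auto simp: homset_def)

lemma yon_vspace: "vspace (vcopy (hom_space A c a) :: ('k, 'v) module)"
  using hom_inj vspace_vcopy[OF hom_vspace[OF ca]] by blast

lemma code_linf: "linf (hom_space A c a) (vcopy (hom_space A c a)) (code c a)"
  using hom_inj vcode_linf[OF hom_vspace[OF ca]] by blast

lemma decode_linf: "linf (vcopy (hom_space A c a)) (hom_space A c a) (decode c a)"
  using hom_inj vdecode_linf[OF hom_vspace[OF ca]] by (metis hom_space_simps(1))

lemma yon_carrier: "carrier (vcopy (hom_space A c a) :: ('k, 'v) module) = code c a ` homset A c a"
  using hom_inj vcopy_carrier[OF hom_vspace[OF ca]] by (metis hom_space_simps(1))

end

lemma decode_code [simp]: "f \<in> Arr A \<Longrightarrow> Src A f = c \<Longrightarrow> Tgt A f = a \<Longrightarrow> decode c a (code c a f) = f"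
  using hom_inj[of c a] vdecode[OF hom_vspace, of c a] by (metis hom_space_simps(1) in_homset obj_arr)

lemma code_closed: "f \<in> Arr A \<Longrightarrow> code (Src A f) (Tgt A f) f \<in> carrier (vcopy (hom_space A (Src A f) (Tgt A f)))"
  by (subst yon_carrier) auto

lemma yon_simps [simp]: "c \<in> Obj A \<Longrightarrow> OMap (yon a) c = vcopy (hom_space A c a)"
  by (simp add: yoneda_def)

lemma cmp_linf_left: "r \<in> Arr A \<Longrightarrow> linf (hom_space A c (Src A r)) (hom_space A c (Tgt A r)) (\<lambda>f. Cmp A r f)"
  by (rule linfI) (simp_all add: cmp_linear)

lemma cmp_linf_right: "u \<in> Arr A \<Longrightarrow> linf (hom_space A (Tgt A u) a) (hom_space A (Src A u) a) (\<lambda>f. Cmp A f u)"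
  by (rule linfI) (simp_all add: cmp_linear)

text \<open>One statement for two uses: composition on the right, which is the action on a
  represented presheaf, and composition on the left, which is the map of represented presheaves
  induced by an arrow.\<close>

lemma yon_lin_ext:
  assumes obj: "c \<in> Obj A" "a \<in> Obj A" "c' \<in> Obj A" "a' \<in> Obj A"
    and F: "linf (hom_space A c a) (hom_space A c' a') F"
  shows "lin_ext (vcopy (hom_space A c a)) (vcopy (hom_space A c' a')) (homset A c a) (code c a) (\<lambda>f. code c' a' (F f))
      \<in> homset vect_cat (vcopy (hom_space A c a)) (vcopy (hom_space A c' a'))" (is "?E \<in> homset _ ?V ?W")
    and "f \<in> homset A c a \<Longrightarrow> LFun (lin_ext (vcopy (hom_space A c a)) (vcopy (hom_space A c' a')) (homset A c a) (code c a)
      (\<lambda>f. code c' a' (F f))) (code c a f) = code c' a' (F f)"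
proof -
  let ?T = "\<lambda>x. code c' a' (F (decode c a x))"
  have T: "linf ?V ?W ?T"
    by (rule linf_comp[OF linf_comp[OF decode_linf F] code_linf]) (use obj in auto)
  have val: "code c a f \<in> carrier ?V \<and> ?T (code c a f) = code c' a' (F f)" if "f \<in> homset A c a" for f
    using that code_closed[of f] by auto
  have span: "T x = T' x" if "\<And>f. f \<in> homset A c a \<Longrightarrow> T (code c a f) = T' (code c a f)" "x \<in> carrier ?V"
    for T T' :: "'v \<Rightarrow> 'v" and x
    using that(2) unfolding yon_carrier[OF obj(1,2)] by (elim imageE) (simp only: that(1))
  note vs = yon_vspace[OF obj(1,2)] yon_vspace[OF obj(3,4)]
  show "?E \<in> homset vect_cat ?V ?W"
    apply (rule lin_ext_homset[where T = ?T], (rule vs T)+, erule val)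
    subgoal for T T' x by (rule span[of T T' x])
    done
  show "LFun ?E (code c a f) = code c' a' (F f)" if "f \<in> homset A c a"
    apply (rule lin_ext_gen[where T = ?T], (rule vs T)+, erule val)
    subgoal for T T' x by (rule span[of T T' x])
    by (rule that)
qed

lemma yon_act:
  assumes a: "a \<in> Obj A" and u: "u \<in> Arr A"
  shows "AMap (yon a) u \<in> homset vect_cat (OMap (yon a) (Tgt A u)) (OMap (yon a) (Src A u))" (is ?h)
    and "f \<in> homset A (Tgt A u) a \<Longrightarrow> act (yon a) u (code (Tgt A u) a f) = code (Src A u) a (Cmp A f u)"
  unfolding yoneda_def using a u yon_lin_ext[OF _ _ _ _ cmp_linf_right[OF u, of a]] by (simp_all del: in_homset)

lemma yon_presheaf: "a \<in> Obj A \<Longrightarrow> presheaf A (yon a)"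
proof (rule presheafI)
  fix u v x assume a: "a \<in> Obj A" and uv: "u \<in> Arr A" "v \<in> Arr A" "Src A v = Tgt A u" and x: "x \<in> elems (yon a) (Tgt A v)"
  then obtain f where "f \<in> homset A (Tgt A v) a" "x = code (Tgt A v) a f" by (auto simp: yon_carrier)
  then show "act (yon a) (Cmp A v u) x = act (yon a) u (act (yon a) v x)"
    using yon_act(2)[OF a, of "Cmp A v u" f] yon_act(2)[OF a, of v f] yon_act(2)[OF a, of u "Cmp A f v"] uv by simp
next
  fix b x assume a: "a \<in> Obj A" and b: "b \<in> Obj A" and x: "x \<in> elems (yon a) b"
  then obtain f where "f \<in> homset A b a" "x = code b a f" by (auto simp: yon_carrier)
  then show "act (yon a) (Idt A b) x = x" using yon_act(2)[OF a, of "Idt A b" f] b by simp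
next
  fix u v x assume a: "a \<in> Obj A" and uv: "u \<in> Arr A" "v \<in> Arr A" "Src A v = Src A u" "Tgt A v = Tgt A u"
    and x: "x \<in> elems (yon a) (Tgt A u)"
  then obtain f where f: "f \<in> homset A (Tgt A u) a" "x = code (Tgt A u) a f" by (auto simp: yon_carrier)
  then show "act (yon a) (Plus A u v) x = act (yon a) u x \<oplus>\<^bsub>OMap (yon a) (Src A u)\<^esub> act (yon a) v x"
    using yon_act(2)[OF a, of "Plus A u v" f] yon_act(2)[OF a, of u f] yon_act(2)[OF a, of v f] uv a
      linf_add[OF code_linf[of "Src A u" a], of "Cmp A f u" "Cmp A f v"] by (simp add: cmp_linear)
next
  fix u s x assume a: "a \<in> Obj A" and u: "u \<in> Arr A" and x: "x \<in> elems (yon a) (Tgt A u)"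
  then obtain f where f: "f \<in> homset A (Tgt A u) a" "x = code (Tgt A u) a f" by (auto simp: yon_carrier)
  then show "act (yon a) (Scal A s u) x = s \<odot>\<^bsub>OMap (yon a) (Src A u)\<^esub> act (yon a) u x"
    using yon_act(2)[OF a, of "Scal A s u" f] yon_act(2)[OF a, of u f] u a
      linf_smult[OF code_linf[of "Src A u" a], of "Cmp A f u" s] by (simp add: cmp_linear)
qed (use yon_vspace yon_act(1) in \<open>auto simp: yoneda_def simp del: in_homset\<close>)

lemma yarr_app:
  assumes r: "r \<in> Arr A"
  shows yarr_map: "presheaf_map A (yarr r)"
    and "c \<in> Obj A \<Longrightarrow> f \<in> homset A c (Src A r) \<Longrightarrow> app (yarr r) c (code c (Src A r) f) = code c (Tgt A r) (Cmp A r f)"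
proof -
  have *: "NAt (yarr r) c \<in> homset vect_cat (vcopy (hom_space A c (Src A r))) (vcopy (hom_space A c (Tgt A r))) \<and>
      (\<forall>f \<in> homset A c (Src A r). app (yarr r) c (code c (Src A r) f) = code c (Tgt A r) (Cmp A r f))"
    if c: "c \<in> Obj A" for c
    unfolding yoneda_arr_def using c r yon_lin_ext[OF _ _ _ _ cmp_linf_left[OF r, of c]] by (simp del: in_homset)
  then show 2: "c \<in> Obj A \<Longrightarrow> f \<in> homset A c (Src A r) \<Longrightarrow>
      app (yarr r) c (code c (Src A r) f) = code c (Tgt A r) (Cmp A r f)" for c f by blast
  have st: "NSrc (yarr r) = yon (Src A r)" "NTgt (yarr r) = yon (Tgt A r)" by (simp_all add: yoneda_arr_def)
  show "presheaf_map A (yarr r)"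
  proof (rule presheaf_mapI, unfold st)
    fix u x assume u: "u \<in> Arr A" and x: "x \<in> elems (yon (Src A r)) (Tgt A u)"
    then obtain f where "f \<in> homset A (Tgt A u) (Src A r)" "x = code (Tgt A u) (Src A r) f" using r by (auto simp: yon_carrier)
    then show "app (yarr r) (Src A u) (act (yon (Src A r)) u x) = act (yon (Tgt A r)) u (app (yarr r) (Tgt A u) x)"
      using u r by (simp add: yon_act(2) 2)
  qed (use r * yon_presheaf in \<open>auto simp: yoneda_arr_def simp del: in_homset\<close>)
qed

end


section \<open>Day convolution\<close>

lemma in_day_gens [simp]:
  "(a, b, x, y, f) \<in> day_gens A M N c \<longleftrightarrow>
    a \<in> Obj A \<and> b \<in> Obj A \<and> x \<in> elems M a \<and> y \<in> elems N b \<and> f \<in> Arr A \<and> Src A f = c \<and> Tgt A f = a \<star>\<^bsub>A\<^esub> b"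
  by (simp add: day_gens_def)

text \<open>The data that define a linear map from the coend to \<open>W\<close>: values in
  \<open>W\<close>, followed by one clause for each of the seven families of relations in
  \<open>day_rels\<close>, namely additivity and homogeneity in three slots and balancing over
  \<open>A\<close>.\<close>

definition day_multi where
  "day_multi A M N c W w \<longleftrightarrow>
     (\<forall>g\<in>day_gens A M N c. w g \<in> carrier W) \<and>
     (\<forall>a b x x' y f. (a, b, x, y, f) \<in> day_gens A M N c \<longrightarrow> x' \<in> elems M a \<longrightarrow>
        w (a, b, x \<oplus>\<^bsub>OMap M a\<^esub> x', y, f) = w (a, b, x, y, f) \<oplus>\<^bsub>W\<^esub> w (a, b, x', y, f)) \<and>
     (\<forall>a b x y y' f. (a, b, x, y, f) \<in> day_gens A M N c \<longrightarrow> y' \<in> elems N b \<longrightarrow>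
        w (a, b, x, y \<oplus>\<^bsub>OMap N b\<^esub> y', f) = w (a, b, x, y, f) \<oplus>\<^bsub>W\<^esub> w (a, b, x, y', f)) \<and>
     (\<forall>a b x y f f'. (a, b, x, y, f) \<in> day_gens A M N c \<longrightarrow> f' \<in> homset A c (a \<star>\<^bsub>A\<^esub> b) \<longrightarrow>
        w (a, b, x, y, Plus A f f') = w (a, b, x, y, f) \<oplus>\<^bsub>W\<^esub> w (a, b, x, y, f')) \<and>
     (\<forall>a b x y f s. (a, b, x, y, f) \<in> day_gens A M N c \<longrightarrow>
        w (a, b, s \<odot>\<^bsub>OMap M a\<^esub> x, y, f) = s \<odot>\<^bsub>W\<^esub> w (a, b, x, y, f)) \<and>
     (\<forall>a b x y f s. (a, b, x, y, f) \<in> day_gens A M N c \<longrightarrow>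
        w (a, b, x, s \<odot>\<^bsub>OMap N b\<^esub> y, f) = s \<odot>\<^bsub>W\<^esub> w (a, b, x, y, f)) \<and>
     (\<forall>a b x y f s. (a, b, x, y, f) \<in> day_gens A M N c \<longrightarrow>
        w (a, b, x, y, Scal A s f) = s \<odot>\<^bsub>W\<^esub> w (a, b, x, y, f)) \<and>
     (\<forall>x y g h f. g \<in> Arr A \<longrightarrow> h \<in> Arr A \<longrightarrow> x \<in> elems M (Tgt A g) \<longrightarrow> y \<in> elems N (Tgt A h) \<longrightarrow>
        f \<in> homset A c (Src A g \<star>\<^bsub>A\<^esub> Src A h) \<longrightarrow>
        w (Src A g, Src A h, act M g x, act N h y, f) = w (Tgt A g, Tgt A h, x, y, Cmp A (g \<boxtimes>\<^bsub>A\<^esub> h) f))"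

text \<open>Translates relations, which are differences in a free space, into equations between
  images of generators. Read from left to right it gives the identities among classes in the coend;
  read from right to left it shows that a multilinear family kills the relations.\<close>

lemma lin_rel:
  fixes W :: "('k::field, 'w) module"
  assumes W: "vspace W" and T: "linf (free_space G) W T" and g: "g1 \<in> G" "g2 \<in> G"
  shows lin_rel_add: "g3 \<in> G \<Longrightarrow> T (sgl g1 1 - sgl g2 1 - sgl g3 1) = \<zero>\<^bsub>W\<^esub> \<longleftrightarrow>
      T (sgl g1 1) = T (sgl g2 1) \<oplus>\<^bsub>W\<^esub> T (sgl g3 1)" (is "_ \<Longrightarrow> T ?p = _ \<longleftrightarrow> _")
    and lin_rel_smult: "T (sgl g1 1 - pscale s (sgl g2 1)) = \<zero>\<^bsub>W\<^esub> \<longleftrightarrow>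
      T (sgl g1 1) = s \<odot>\<^bsub>W\<^esub> T (sgl g2 1)" (is "T ?q = _ \<longleftrightarrow> _")
    and lin_rel_eq: "T (sgl g1 1 - sgl g2 1) = \<zero>\<^bsub>W\<^esub> \<longleftrightarrow>
      T (sgl g1 1) = T (sgl g2 1)" (is "T ?r = _ \<longleftrightarrow> _")
proof -
  \<comment> \<open>Adding the subtracted terms back turns the vanishing of an image into an
    equation between two images.\<close>
  have *: "T r = \<zero>\<^bsub>W\<^esub> \<longleftrightarrow> T (r + p) = T p" if "r \<in> carrier (free_space G)" "p \<in> carrier (free_space G)" for r p
    using linf_add[OF T that] linf_closed[OF T] that vs_cancel[OF W, of "T r" "T p" "\<zero>\<^bsub>W\<^esub>"]
      vs_zero_left[OF W] vs_zero_closed[OF W] by auto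
  let ?F = "carrier (free_space G :: ('k, 'a \<Rightarrow>\<^sub>0 'k) module)"
  have c: "sgl h t \<in> ?F" if "h \<in> G" for h t using that by simp
  have cl: "p - q \<in> ?F" "p + q \<in> ?F" "pscale s p \<in> ?F" if "p \<in> ?F" "q \<in> ?F" for p q s
    using that keys_diff[of p q] keys_add[of p q] keys_pscale[of s p] by auto
  note [simp del] = free_space_simps(1)
  show "T ?p = \<zero>\<^bsub>W\<^esub> \<longleftrightarrow> T (sgl g1 1) = T (sgl g2 1) \<oplus>\<^bsub>W\<^esub> T (sgl g3 1)" if "g3 \<in> G"
    using *[of ?p "sgl g2 1 + sgl g3 1"] linf_add[OF T c c, OF g(2) that] g that
    by (simp add: c cl)
  show "T ?q = \<zero>\<^bsub>W\<^esub> \<longleftrightarrow> T (sgl g1 1) = s \<odot>\<^bsub>W\<^esub> T (sgl g2 1)"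
    using *[of ?q "pscale s (sgl g2 1)"] linf_smult[OF T c, OF g(2), of s 1] g by (simp add: c cl)
  show "T ?r = \<zero>\<^bsub>W\<^esub> \<longleftrightarrow> T (sgl g1 1) = T (sgl g2 1)"
    using *[of ?r "sgl g2 1"] g by (simp add: c cl)
qed

lemma day_rels_cases:
  assumes "r \<in> day_rels A M N c"
  obtains (a) a b x x' y f where "(a, b, x, y, f) \<in> day_gens A M N c" "x' \<in> elems M a"
      "r = sgl (a, b, x \<oplus>\<^bsub>OMap M a\<^esub> x', y, f) 1 - sgl (a, b, x, y, f) 1
        - sgl (a, b, x', y, f) 1"
    | (b) a b x y y' f where "(a, b, x, y, f) \<in> day_gens A M N c" "y' \<in> elems N b"
      "r = sgl (a, b, x, y \<oplus>\<^bsub>OMap N b\<^esub> y', f) 1 - sgl (a, b, x, y, f) 1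
        - sgl (a, b, x, y', f) 1"
    | (c) a b x y f f' where "(a, b, x, y, f) \<in> day_gens A M N c" "f' \<in> homset A c (a \<star>\<^bsub>A\<^esub> b)"
      "r = sgl (a, b, x, y, Plus A f f') 1 - sgl (a, b, x, y, f) 1
        - sgl (a, b, x, y, f') 1"
    | (d) a b x y f s where "(a, b, x, y, f) \<in> day_gens A M N c"
      "r = sgl (a, b, s \<odot>\<^bsub>OMap M a\<^esub> x, y, f) 1 - pscale s (sgl (a, b, x, y, f) 1)"
    | (e) a b x y f s where "(a, b, x, y, f) \<in> day_gens A M N c"
      "r = sgl (a, b, x, s \<odot>\<^bsub>OMap N b\<^esub> y, f) 1 - pscale s (sgl (a, b, x, y, f) 1)"
    | (f) a b x y f s where "(a, b, x, y, f) \<in> day_gens A M N c"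
      "r = sgl (a, b, x, y, Scal A s f) 1 - pscale s (sgl (a, b, x, y, f) 1)"
    | (g) x y g h f where "g \<in> Arr A" "h \<in> Arr A" "Src A g \<in> Obj A" "Src A h \<in> Obj A" "Tgt A g \<in> Obj A" "Tgt A h \<in> Obj A"
      "x \<in> elems M (Tgt A g)" "y \<in> elems N (Tgt A h)" "f \<in> homset A c (Src A g \<star>\<^bsub>A\<^esub> Src A h)"
      "r = sgl (Src A g, Src A h, act M g x, act N h y, f) 1
        - sgl (Tgt A g, Tgt A h, x, y, Cmp A (g \<boxtimes>\<^bsub>A\<^esub> h) f) 1"
  using assms unfolding day_rels_def Let_def
  apply (elim UnE)
  subgoal by (elim CollectE exE conjE) (rule that(1))
  subgoal by (elim CollectE exE conjE) (rule that(2))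
  subgoal by (elim CollectE exE conjE) (rule that(3))
  subgoal by (elim CollectE exE conjE) (rule that(4))
  subgoal by (elim CollectE exE conjE) (rule that(5))
  subgoal by (elim CollectE exE conjE) (rule that(6))
  subgoal by (elim CollectE exE conjE) (rule that(7), simp_all)
  done

lemma day_relsI:
  shows "(a, b, x, y, f) \<in> day_gens A M N c \<Longrightarrow> x' \<in> elems M a \<Longrightarrow>
      sgl (a, b, x \<oplus>\<^bsub>OMap M a\<^esub> x', y, f) 1 - sgl (a, b, x, y, f) 1
        - sgl (a, b, x', y, f) 1 \<in> day_rels A M N c"
    and "(a, b, x, y, f) \<in> day_gens A M N c \<Longrightarrow> y' \<in> elems N b \<Longrightarrow>
      sgl (a, b, x, y \<oplus>\<^bsub>OMap N b\<^esub> y', f) 1 - sgl (a, b, x, y, f) 1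
        - sgl (a, b, x, y', f) 1 \<in> day_rels A M N c"
    and "(a, b, x, y, f) \<in> day_gens A M N c \<Longrightarrow> f' \<in> homset A c (a \<star>\<^bsub>A\<^esub> b) \<Longrightarrow>
      sgl (a, b, x, y, Plus A f f') 1 - sgl (a, b, x, y, f) 1
        - sgl (a, b, x, y, f') 1 \<in> day_rels A M N c"
    and "(a, b, x, y, f) \<in> day_gens A M N c \<Longrightarrow>
      sgl (a, b, s \<odot>\<^bsub>OMap M a\<^esub> x, y, f) 1 - pscale s (sgl (a, b, x, y, f) 1)
        \<in> day_rels A M N c"
    and "(a, b, x, y, f) \<in> day_gens A M N c \<Longrightarrow>
      sgl (a, b, x, s \<odot>\<^bsub>OMap N b\<^esub> y, f) 1 - pscale s (sgl (a, b, x, y, f) 1)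
        \<in> day_rels A M N c"
    and "(a, b, x, y, f) \<in> day_gens A M N c \<Longrightarrow>
      sgl (a, b, x, y, Scal A s f) 1 - pscale s (sgl (a, b, x, y, f) 1)
        \<in> day_rels A M N c"
    and "g \<in> homset A a' a \<Longrightarrow> h \<in> homset A b' b \<Longrightarrow> a \<in> Obj A \<Longrightarrow> b \<in> Obj A \<Longrightarrow> a' \<in> Obj A \<Longrightarrow> b' \<in> Obj A \<Longrightarrow>
      x \<in> elems M a \<Longrightarrow> y \<in> elems N b \<Longrightarrow> f \<in> homset A c (a' \<star>\<^bsub>A\<^esub> b') \<Longrightarrow>
      sgl (a', b', act M g x, act N h y, f) 1
        - sgl (a, b, x, y, Cmp A (g \<boxtimes>\<^bsub>A\<^esub> h) f) 1 \<in> day_rels A M N c"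
  unfolding day_rels_def Let_def
  subgoal by (rule UnI1)+ (intro CollectI exI conjI, rule refl)
  subgoal by (rule UnI1, rule UnI1, rule UnI1, rule UnI1, rule UnI1, rule UnI2) (intro CollectI exI conjI, rule refl)
  subgoal by (rule UnI1, rule UnI1, rule UnI1, rule UnI1, rule UnI2) (intro CollectI exI conjI, rule refl)
  subgoal by (rule UnI1, rule UnI1, rule UnI1, rule UnI2) (intro CollectI exI conjI, rule refl)
  subgoal by (rule UnI1, rule UnI1, rule UnI2) (intro CollectI exI conjI, rule refl)
  subgoal by (rule UnI1, rule UnI2) (intro CollectI exI conjI, rule refl)
  subgoal by (rule UnI2) (intro CollectI exI conjI, rule refl)
  done

lemma day_multiD:
  assumes "day_multi A M N c W w"
  shows "g \<in> day_gens A M N c \<Longrightarrow> w g \<in> carrier W"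
    and "(a, b, x, y, f) \<in> day_gens A M N c \<Longrightarrow> x' \<in> elems M a \<Longrightarrow>
        w (a, b, x \<oplus>\<^bsub>OMap M a\<^esub> x', y, f) = w (a, b, x, y, f) \<oplus>\<^bsub>W\<^esub> w (a, b, x', y, f)"
    and "(a, b, x, y, f) \<in> day_gens A M N c \<Longrightarrow> y' \<in> elems N b \<Longrightarrow>
        w (a, b, x, y \<oplus>\<^bsub>OMap N b\<^esub> y', f) = w (a, b, x, y, f) \<oplus>\<^bsub>W\<^esub> w (a, b, x, y', f)"
    and "(a, b, x, y, f) \<in> day_gens A M N c \<Longrightarrow> f' \<in> homset A c (a \<star>\<^bsub>A\<^esub> b) \<Longrightarrow>
        w (a, b, x, y, Plus A f f') = w (a, b, x, y, f) \<oplus>\<^bsub>W\<^esub> w (a, b, x, y, f')"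
    and "(a, b, x, y, f) \<in> day_gens A M N c \<Longrightarrow> w (a, b, s \<odot>\<^bsub>OMap M a\<^esub> x, y, f) = s \<odot>\<^bsub>W\<^esub> w (a, b, x, y, f)"
    and "(a, b, x, y, f) \<in> day_gens A M N c \<Longrightarrow> w (a, b, x, s \<odot>\<^bsub>OMap N b\<^esub> y, f) = s \<odot>\<^bsub>W\<^esub> w (a, b, x, y, f)"
    and "(a, b, x, y, f) \<in> day_gens A M N c \<Longrightarrow> w (a, b, x, y, Scal A s f) = s \<odot>\<^bsub>W\<^esub> w (a, b, x, y, f)"
    and "g1 \<in> Arr A \<Longrightarrow> h1 \<in> Arr A \<Longrightarrow> x \<in> elems M (Tgt A g1) \<Longrightarrow> y \<in> elems N (Tgt A h1) \<Longrightarrow>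
        f \<in> homset A c (Src A g1 \<star>\<^bsub>A\<^esub> Src A h1) \<Longrightarrow>
        w (Src A g1, Src A h1, act M g1 x, act N h1 y, f) = w (Tgt A g1, Tgt A h1, x, y, Cmp A (g1 \<boxtimes>\<^bsub>A\<^esub> h1) f)"
proof -
  note * = assms[unfolded day_multi_def]
  note r1 = conjunct2[OF *] note r2 = conjunct2[OF r1] note r3 = conjunct2[OF r2] note r4 = conjunct2[OF r3]
  note r5 = conjunct2[OF r4] note r6 = conjunct2[OF r5] note r7 = conjunct2[OF r6]
  show "g \<in> day_gens A M N c \<Longrightarrow> w g \<in> carrier W"
    using conjunct1[OF *] by blast
  show "(a, b, x, y, f) \<in> day_gens A M N c \<Longrightarrow> x' \<in> elems M a \<Longrightarrow>
        w (a, b, x \<oplus>\<^bsub>OMap M a\<^esub> x', y, f) = w (a, b, x, y, f) \<oplus>\<^bsub>W\<^esub> w (a, b, x', y, f)"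
    using conjunct1[OF r1] by blast
  show "(a, b, x, y, f) \<in> day_gens A M N c \<Longrightarrow> y' \<in> elems N b \<Longrightarrow>
        w (a, b, x, y \<oplus>\<^bsub>OMap N b\<^esub> y', f) = w (a, b, x, y, f) \<oplus>\<^bsub>W\<^esub> w (a, b, x, y', f)"
    using conjunct1[OF r2] by blast
  show "(a, b, x, y, f) \<in> day_gens A M N c \<Longrightarrow> f' \<in> homset A c (a \<star>\<^bsub>A\<^esub> b) \<Longrightarrow>
        w (a, b, x, y, Plus A f f') = w (a, b, x, y, f) \<oplus>\<^bsub>W\<^esub> w (a, b, x, y, f')"
    using conjunct1[OF r3] by blast
  show "(a, b, x, y, f) \<in> day_gens A M N c \<Longrightarrow> w (a, b, s \<odot>\<^bsub>OMap M a\<^esub> x, y, f) = s \<odot>\<^bsub>W\<^esub> w (a, b, x, y, f)"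
    using conjunct1[OF r4] by blast
  show "(a, b, x, y, f) \<in> day_gens A M N c \<Longrightarrow> w (a, b, x, s \<odot>\<^bsub>OMap N b\<^esub> y, f) = s \<odot>\<^bsub>W\<^esub> w (a, b, x, y, f)"
    using conjunct1[OF r5] by blast
  show "(a, b, x, y, f) \<in> day_gens A M N c \<Longrightarrow> w (a, b, x, y, Scal A s f) = s \<odot>\<^bsub>W\<^esub> w (a, b, x, y, f)"
    using conjunct1[OF r6] by blast
  show "g1 \<in> Arr A \<Longrightarrow> h1 \<in> Arr A \<Longrightarrow> x \<in> elems M (Tgt A g1) \<Longrightarrow> y \<in> elems N (Tgt A h1) \<Longrightarrow>
        f \<in> homset A c (Src A g1 \<star>\<^bsub>A\<^esub> Src A h1) \<Longrightarrow>
        w (Src A g1, Src A h1, act M g1 x, act N h1 y, f) = w (Tgt A g1, Tgt A h1, x, y, Cmp A (g1 \<boxtimes>\<^bsub>A\<^esub> h1) f)"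
    using r7 by blast
qed

lemma day_multiI:
  assumes "\<And>a b x y f. (a, b, x, y, f) \<in> day_gens A M N c \<Longrightarrow> w (a, b, x, y, f) \<in> carrier W"
    and "\<And>a b x x' y f. (a, b, x, y, f) \<in> day_gens A M N c \<Longrightarrow> x' \<in> elems M a \<Longrightarrow>
        w (a, b, x \<oplus>\<^bsub>OMap M a\<^esub> x', y, f) = w (a, b, x, y, f) \<oplus>\<^bsub>W\<^esub> w (a, b, x', y, f)"
    and "\<And>a b x y y' f. (a, b, x, y, f) \<in> day_gens A M N c \<Longrightarrow> y' \<in> elems N b \<Longrightarrow>
        w (a, b, x, y \<oplus>\<^bsub>OMap N b\<^esub> y', f) = w (a, b, x, y, f) \<oplus>\<^bsub>W\<^esub> w (a, b, x, y', f)"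
    and "\<And>a b x y f f'. (a, b, x, y, f) \<in> day_gens A M N c \<Longrightarrow> f' \<in> homset A c (a \<star>\<^bsub>A\<^esub> b) \<Longrightarrow>
        w (a, b, x, y, Plus A f f') = w (a, b, x, y, f) \<oplus>\<^bsub>W\<^esub> w (a, b, x, y, f')"
    and "\<And>a b x y f s. (a, b, x, y, f) \<in> day_gens A M N c \<Longrightarrow> w (a, b, s \<odot>\<^bsub>OMap M a\<^esub> x, y, f) = s \<odot>\<^bsub>W\<^esub> w (a, b, x, y, f)"
    and "\<And>a b x y f s. (a, b, x, y, f) \<in> day_gens A M N c \<Longrightarrow> w (a, b, x, s \<odot>\<^bsub>OMap N b\<^esub> y, f) = s \<odot>\<^bsub>W\<^esub> w (a, b, x, y, f)"
    and "\<And>a b x y f s. (a, b, x, y, f) \<in> day_gens A M N c \<Longrightarrow> w (a, b, x, y, Scal A s f) = s \<odot>\<^bsub>W\<^esub> w (a, b, x, y, f)"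
    and "\<And>g h x y f. g \<in> Arr A \<Longrightarrow> h \<in> Arr A \<Longrightarrow> x \<in> elems M (Tgt A g) \<Longrightarrow> y \<in> elems N (Tgt A h) \<Longrightarrow>
        f \<in> homset A c (Src A g \<star>\<^bsub>A\<^esub> Src A h) \<Longrightarrow>
        w (Src A g, Src A h, act M g x, act N h y, f) = w (Tgt A g, Tgt A h, x, y, Cmp A (g \<boxtimes>\<^bsub>A\<^esub> h) f)"
  shows "day_multi A M N c W w"
  unfolding day_multi_def
  apply (intro conjI)
  subgoal using assms(1) by auto
  subgoal using assms(2) by blast
  subgoal using assms(3) by blast
  subgoal using assms(4) by blast
  subgoal using assms(5) by blast
  subgoal using assms(6) by blast
  subgoal using assms(7) by blast
  subgoal using assms(8) by blast
  done

locale small_monoidal = strict_monoidal A + small_category A U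
  for A :: "('o, 'm, 'k::field, 'z) moncat_scheme" (structure) and U :: "'v itself"
begin

abbreviation D :: "('o, 'm, 'k, 'v) psh \<Rightarrow> ('o, 'm, 'k, 'v) psh \<Rightarrow> ('o, 'm, 'k, 'v) psh" where
  "D \<equiv> day A"

abbreviation E :: "('o, 'm, 'k, 'v) psh \<Rightarrow> ('o, 'm, 'k, 'v) psh \<Rightarrow> 'o \<Rightarrow> ('o, 'm, 'v) day_gen \<Rightarrow> 'v" where
  "E \<equiv> day_el A"

lemma day_obj: "c \<in> Obj A \<Longrightarrow> OMap (D M N) c = vcopy (day_space A M N c)"
  by (simp add: day_def)

context
  fixes M N :: "('o, 'm, 'k, 'v) psh" and c :: 'o
  assumes M: "presheaf A M" and N: "presheaf A N" and c: "c \<in> Obj A"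
begin

lemma day_gens_closed:
  assumes "(a, b, x, y, f) \<in> day_gens A M N c"
  shows "x' \<in> elems M a \<Longrightarrow> (a, b, x', y, f) \<in> day_gens A M N c"
    and "x' \<in> elems M a \<Longrightarrow> (a, b, x \<oplus>\<^bsub>OMap M a\<^esub> x', y, f) \<in> day_gens A M N c"
    and "y' \<in> elems N b \<Longrightarrow> (a, b, x, y', f) \<in> day_gens A M N c"
    and "y' \<in> elems N b \<Longrightarrow> (a, b, x, y \<oplus>\<^bsub>OMap N b\<^esub> y', f) \<in> day_gens A M N c"
    and "f' \<in> homset A c (a \<star> b) \<Longrightarrow> (a, b, x, y, f') \<in> day_gens A M N c"
    and "f' \<in> homset A c (a \<star> b) \<Longrightarrow> (a, b, x, y, Plus A f f') \<in> day_gens A M N c"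
    and "(a, b, s \<odot>\<^bsub>OMap M a\<^esub> x, y, f) \<in> day_gens A M N c"
    and "(a, b, x, s \<odot>\<^bsub>OMap N b\<^esub> y, f) \<in> day_gens A M N c"
    and "(a, b, x, y, Scal A s f) \<in> day_gens A M N c"
  using assms vs_closed[OF psh_vspace[OF M, of a]] vs_closed[OF psh_vspace[OF N, of b]] by auto

lemma day_gens_bal:
  assumes "g \<in> Arr A" "h \<in> Arr A" "x \<in> elems M (Tgt A g)" "y \<in> elems N (Tgt A h)"
    "f \<in> homset A c (Src A g \<star> Src A h)"
  shows "(Src A g, Src A h, act M g x, act N h y, f) \<in> day_gens A M N c"
    "(Tgt A g, Tgt A h, x, y, (g \<boxtimes> h) \<cdot> f) \<in> day_gens A M N c"
  using assms by (simp_all add: act_closed[OF M] act_closed[OF N])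

text \<open>Smallness enters here: the generators form a subset of a product of small sets, so the
  free space on them and its quotient fit into \<open>'v\<close>.\<close>

lemma day_presentation:
  obtains e :: "(('o, 'm, 'v) day_gen \<Rightarrow>\<^sub>0 'k) set \<Rightarrow> 'v"
  where "presentation (day_gens A M N c) (day_rels A M N c) e"
proof -
  let ?G = "day_gens A M N c"
  let ?S = "Modules.module.span pscale (day_rels A M N c)"
  have k3: "Poly_Mapping.keys (sgl g1 (1::'k) - sgl g2 1 - sgl g3 1) \<subseteq> ?G"
    if "g1 \<in> ?G" "g2 \<in> ?G" "g3 \<in> ?G" for g1 g2 g3
    using that keys_diff[of "sgl g1 (1::'k) - sgl g2 1" "sgl g3 1"]
      keys_diff[of "sgl g1 (1::'k)" "sgl g2 1"] by auto
  have ks: "Poly_Mapping.keys (sgl g1 (1::'k) - pscale s (sgl g2 1)) \<subseteq> ?G"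
    if "g1 \<in> ?G" "g2 \<in> ?G" for g1 g2 s
    using that keys_diff[of "sgl g1 (1::'k)" "pscale s (sgl g2 1)"]
      keys_pscale[of s "sgl g2 (1::'k)"] by auto
  have k2: "Poly_Mapping.keys (sgl g1 (1::'k) - sgl g2 1) \<subseteq> ?G"
    if "g1 \<in> ?G" "g2 \<in> ?G" for g1 g2
    using that keys_diff[of "sgl g1 (1::'k)" "sgl g2 1"] by auto
  have keys: "Poly_Mapping.keys r \<subseteq> ?G" if "r \<in> day_rels A M N c" for r
    using that
  proof (cases rule: day_rels_cases)
    case (a a b x x' y f)
    show ?thesis unfolding a(3) by (rule k3) (rule day_gens_closed(2)[OF a(1,2)] a(1) day_gens_closed(1)[OF a(1,2)])+
  next
    case (b a b x y y' f)
    show ?thesis unfolding b(3) by (rule k3) (rule day_gens_closed(4)[OF b(1,2)] b(1) day_gens_closed(3)[OF b(1,2)])+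
  next
    case (c a b x y f f')
    show ?thesis unfolding c(3) by (rule k3) (rule day_gens_closed(6)[OF c(1,2)] c(1) day_gens_closed(5)[OF c(1,2)])+
  next
    case (d a b x y f s)
    show ?thesis unfolding d(2) by (rule ks) (rule day_gens_closed(7)[OF d(1)] d(1))+
  next
    case (e a b x y f s)
    show ?thesis unfolding e(2) by (rule ks) (rule day_gens_closed(8)[OF e(1)] e(1))+
  next
    case (f a b x y f s)
    show ?thesis unfolding f(2) by (rule ks) (rule day_gens_closed(9)[OF f(1)] f(1))+
  next
    case (g x y g h f)
    note * = g(1,2,7,8,9)
    show ?thesis unfolding g(10) by (rule k2) (rule day_gens_bal[OF *])+
  qed
  have "small TYPE('v) (Obj A \<times> Obj A \<times> (UNIV :: 'v set) \<times> (UNIV :: 'v set) \<times> Arr A)"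
    by (intro small_Times small_obj small_arr small_UNIV)
  then have "small TYPE('v) ?G"
    by (rule small_subset) (auto simp: day_gens_def)
  then have "small TYPE('v) {p :: ('o, 'm, 'v) day_gen \<Rightarrow>\<^sub>0 'k. Poly_Mapping.keys p \<subseteq> ?G}"
    by (rule small_free[OF _ small_field])
  then have "small TYPE('v) ((\<lambda>p. ?S +>\<^bsub>free_space ?G\<^esub> p) ` carrier (free_space ?G))"
    by (intro small_image) (simp add: free_space_def)
  moreover have "carrier (quot_space (free_space ?G) ?S) = (\<lambda>p. ?S +>\<^bsub>free_space ?G\<^esub> p) ` carrier (free_space ?G)"
    by (auto simp: quot_space_def A_RCOSETS_def')
  ultimately show ?thesis
    using that keys by (auto simp: small_def presentation_def)
qed

lemma day_vspace: "vspace (OMap (D M N) c)"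
proof -
  obtain e :: "_ \<Rightarrow> 'v" where "presentation (day_gens A M N c) (day_rels A M N c) e" by (rule day_presentation)
  then show ?thesis unfolding day_obj[OF c] day_space_def by (rule presentation.vspace_V)
qed

lemma day_el_multi: "day_multi A M N c (OMap (D M N) c) (E M N c)"
proof -
  obtain e :: "_ \<Rightarrow> 'v" where "presentation (day_gens A M N c) (day_rels A M N c) e" by (rule day_presentation)
  then interpret P: presentation "day_gens A M N c" "day_rels A M N c" e .
  have E: "E M N c g = P.el (sgl g 1)" for g
    by (simp add: day_el_def P.el_def day_space_def)
  have W: "OMap (D M N) c = P.V" by (simp add: day_obj[OF c] day_space_def)
  note rel = P.el_rel[OF day_relsI(1)] P.el_rel[OF day_relsI(2)] P.el_rel[OF day_relsI(3)] P.el_rel[OF day_relsI(4)]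
    P.el_rel[OF day_relsI(5)] P.el_rel[OF day_relsI(6)] P.el_rel[OF day_relsI(7)]
  note add = lin_rel_add[OF P.vspace_V P.el_linf, THEN iffD1]
  note smult = lin_rel_smult[OF P.vspace_V P.el_linf, THEN iffD1]
  note eq = lin_rel_eq[OF P.vspace_V P.el_linf, THEN iffD1]
  show ?thesis unfolding W
  proof (rule day_multiI, unfold E)
    fix a b x y f assume g: "(a, b, x, y, f) \<in> day_gens A M N c"
    then show "P.el (sgl (a, b, x, y, f) 1) \<in> carrier P.V"
      by (intro linf_closed[OF P.el_linf]) simp
    show "P.el (sgl (a, b, x \<oplus>\<^bsub>OMap M a\<^esub> x', y, f) 1) =
        P.el (sgl (a, b, x, y, f) 1) \<oplus>\<^bsub>P.V\<^esub> P.el (sgl (a, b, x', y, f) 1)"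
      if "x' \<in> elems M a" for x'
      by (rule add[OF _ _ _ rel(1)]) (fact day_gens_closed(1,2)[OF g that] g that)+
    show "P.el (sgl (a, b, x, y \<oplus>\<^bsub>OMap N b\<^esub> y', f) 1) =
        P.el (sgl (a, b, x, y, f) 1) \<oplus>\<^bsub>P.V\<^esub> P.el (sgl (a, b, x, y', f) 1)"
      if "y' \<in> elems N b" for y'
      by (rule add[OF _ _ _ rel(2)]) (fact day_gens_closed(3,4)[OF g that] g that)+
    show "P.el (sgl (a, b, x, y, Plus A f f') 1) =
        P.el (sgl (a, b, x, y, f) 1) \<oplus>\<^bsub>P.V\<^esub> P.el (sgl (a, b, x, y, f') 1)"
      if "f' \<in> homset A c (a \<star> b)" for f'
      by (rule add[OF _ _ _ rel(3)]) (fact day_gens_closed(5,6)[OF g that] g that)+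
    show "P.el (sgl (a, b, s \<odot>\<^bsub>OMap M a\<^esub> x, y, f) 1) =
        s \<odot>\<^bsub>P.V\<^esub> P.el (sgl (a, b, x, y, f) 1)" for s
      by (rule smult[OF _ _ rel(4)]) (fact day_gens_closed(7)[OF g] g)+
    show "P.el (sgl (a, b, x, s \<odot>\<^bsub>OMap N b\<^esub> y, f) 1) =
        s \<odot>\<^bsub>P.V\<^esub> P.el (sgl (a, b, x, y, f) 1)" for s
      by (rule smult[OF _ _ rel(5)]) (fact day_gens_closed(8)[OF g] g)+
    show "P.el (sgl (a, b, x, y, Scal A s f) 1) =
        s \<odot>\<^bsub>P.V\<^esub> P.el (sgl (a, b, x, y, f) 1)" for s
      by (rule smult[OF _ _ rel(6)]) (fact day_gens_closed(9)[OF g] g)+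
  next
    fix g h x y f assume *: "g \<in> Arr A" "h \<in> Arr A" "x \<in> elems M (Tgt A g)" "y \<in> elems N (Tgt A h)"
      "f \<in> homset A c (Src A g \<star> Src A h)"
    show "P.el (sgl (Src A g, Src A h, act M g x, act N h y, f) 1) =
        P.el (sgl (Tgt A g, Tgt A h, x, y, (g \<boxtimes> h) \<cdot> f) 1)"
      by (rule eq[OF day_gens_bal[OF *] rel(7)[of g _ _ h]]) (use * in simp_all)
  qed
qed

lemmas day_el_rel = day_multiD[OF day_el_multi]

text \<open>The existence half of the universal property of the coend; \<open>day_span\<close> is
  the uniqueness half. The target may live on any type, because it is later taken to be a hom space
  of the target category.\<close>

lemma day_univ:
  fixes W :: "('k, 'w) module"
  assumes W: "vspace W" and w: "day_multi A M N c W w"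
  shows "\<exists>T. linf (OMap (D M N) c) W T \<and> (\<forall>g\<in>day_gens A M N c. T (E M N c g) = w g)"
proof -
  obtain e :: "_ \<Rightarrow> 'v" where "presentation (day_gens A M N c) (day_rels A M N c) e" by (rule day_presentation)
  then interpret P: presentation "day_gens A M N c" "day_rels A M N c" e .
  have E: "E M N c g = P.el (sgl g 1)" for g
    by (simp add: day_el_def P.el_def day_space_def)
  have W': "OMap (D M N) c = P.V" by (simp add: day_obj[OF c] day_space_def)
  have "\<exists>T. linf P.F W T \<and> (\<forall>g\<in>day_gens A M N c. T (sgl g 1) = w g)"
    by (rule free_ext[OF W]) (rule day_multiD(1)[OF w])
  then obtain T where T: "linf P.F W T" and Tw': "\<forall>g\<in>day_gens A M N c. T (sgl g 1) = w g"
    by (elim exE conjE)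
  note Tw = bspec[OF Tw']
  note add = lin_rel_add[OF W T, THEN iffD2] and smult = lin_rel_smult[OF W T, THEN iffD2] and eq = lin_rel_eq[OF W T, THEN iffD2]
  have "T r = \<zero>\<^bsub>W\<^esub>" if "r \<in> day_rels A M N c" for r
    using that
  proof (cases rule: day_rels_cases)
    case (a a b x x' y f)
    show ?thesis unfolding a(3)
      by (rule add, (rule day_gens_closed(2)[OF a(1,2)] a(1) day_gens_closed(1)[OF a(1,2)])+)
         (simp only: Tw[OF day_gens_closed(2)[OF a(1,2)]] Tw[OF a(1)] Tw[OF day_gens_closed(1)[OF a(1,2)]] day_multiD(2)[OF w a(1,2)])
  next
    case (b a b x y y' f)
    show ?thesis unfolding b(3)
      by (rule add, (rule day_gens_closed(4)[OF b(1,2)] b(1) day_gens_closed(3)[OF b(1,2)])+)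
         (simp only: Tw[OF day_gens_closed(4)[OF b(1,2)]] Tw[OF b(1)] Tw[OF day_gens_closed(3)[OF b(1,2)]] day_multiD(3)[OF w b(1,2)])
  next
    case (c a b x y f f')
    show ?thesis unfolding c(3)
      by (rule add, (rule day_gens_closed(6)[OF c(1,2)] c(1) day_gens_closed(5)[OF c(1,2)])+)
         (simp only: Tw[OF day_gens_closed(6)[OF c(1,2)]] Tw[OF c(1)] Tw[OF day_gens_closed(5)[OF c(1,2)]] day_multiD(4)[OF w c(1,2)])
  next
    case (d a b x y f s)
    show ?thesis unfolding d(2)
      by (rule smult, (rule day_gens_closed(7)[OF d(1)] d(1))+)
         (simp only: Tw[OF day_gens_closed(7)[OF d(1)]] Tw[OF d(1)] day_multiD(5)[OF w d(1)])
  next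
    case (e a b x y f s)
    show ?thesis unfolding e(2)
      by (rule smult, (rule day_gens_closed(8)[OF e(1)] e(1))+)
         (simp only: Tw[OF day_gens_closed(8)[OF e(1)]] Tw[OF e(1)] day_multiD(6)[OF w e(1)])
  next
    case (f a b x y f s)
    show ?thesis unfolding f(2)
      by (rule smult, (rule day_gens_closed(9)[OF f(1)] f(1))+)
         (simp only: Tw[OF day_gens_closed(9)[OF f(1)]] Tw[OF f(1)] day_multiD(7)[OF w f(1)])
  next
    case (g x y g h f)
    note * = g(1,2,7,8,9)
    show ?thesis unfolding g(10)
      by (rule eq, (rule day_gens_bal[OF *])+)
         (simp only: Tw[OF day_gens_bal(1)[OF *]] Tw[OF day_gens_bal(2)[OF *]] day_multiD(8)[OF w *])
  qed
  then obtain T' where "linf P.V W T'" "\<forall>p\<in>carrier P.F. T' (P.el p) = T p"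
    using P.el_ext[OF W T] by blast
  then show ?thesis unfolding W' E using Tw by (intro exI[of _ T']) auto
qed

lemma day_span:
  fixes W :: "('k, 'w) module"
  assumes W: "vspace W" and T: "linf (OMap (D M N) c) W T" "linf (OMap (D M N) c) W T'"
    and eq: "\<And>a b x y f. (a, b, x, y, f) \<in> day_gens A M N c \<Longrightarrow> T (E M N c (a, b, x, y, f)) = T' (E M N c (a, b, x, y, f))"
    and z: "z \<in> elems (D M N) c"
  shows "T z = T' z"
proof -
  obtain e :: "_ \<Rightarrow> 'v" where "presentation (day_gens A M N c) (day_rels A M N c) e" by (rule day_presentation)
  then interpret P: presentation "day_gens A M N c" "day_rels A M N c" e .
  have E: "E M N c g = P.el (sgl g 1)" for g
    by (simp add: day_el_def P.el_def day_space_def)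
  have W': "OMap (D M N) c = P.V" by (simp add: day_obj[OF c] day_space_def)
  show ?thesis
    by (rule P.el_span[OF W T[unfolded W'] _ z[unfolded W']]) (use eq[unfolded E] in auto)
qed

end

end


text \<open>With \<open>linf_scale\<close> this makes both sides of an additivity or homogeneity law
  linear maps, as a comparison on generators by \<open>day_span\<close> requires.\<close>

lemma linf_plus:
  assumes W: "vspace W" and S: "linf V W S" and T: "linf V W T"
  shows "linf V W (\<lambda>x. S x \<oplus>\<^bsub>W\<^esub> T x)"
proof (rule linfI)
  fix x y assume "x \<in> carrier V" "y \<in> carrier V"
  note c = this[THEN linf_closed[OF S]] this[THEN linf_closed[OF T]] vs_add_closed[OF W]
  have "(S x \<oplus>\<^bsub>W\<^esub> S y) \<oplus>\<^bsub>W\<^esub> (T x \<oplus>\<^bsub>W\<^esub> T y) = (S x \<oplus>\<^bsub>W\<^esub> T x) \<oplus>\<^bsub>W\<^esub> (S y \<oplus>\<^bsub>W\<^esub> T y)"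
    using c by (metis vs_add_assoc[OF W] vs_add_comm[OF W])
  then show "S (x \<oplus>\<^bsub>V\<^esub> y) \<oplus>\<^bsub>W\<^esub> T (x \<oplus>\<^bsub>V\<^esub> y) = (S x \<oplus>\<^bsub>W\<^esub> T x) \<oplus>\<^bsub>W\<^esub> (S y \<oplus>\<^bsub>W\<^esub> T y)"
    using \<open>x \<in> carrier V\<close> \<open>y \<in> carrier V\<close> by (simp add: linf_add[OF S] linf_add[OF T])
next
  fix s x assume "x \<in> carrier V"
  then show "S (s \<odot>\<^bsub>V\<^esub> x) \<oplus>\<^bsub>W\<^esub> T (s \<odot>\<^bsub>V\<^esub> x) = s \<odot>\<^bsub>W\<^esub> (S x \<oplus>\<^bsub>W\<^esub> T x)"
    by (simp add: linf_smult[OF S] linf_smult[OF T] linf_closed[OF S] linf_closed[OF T] vs_smult_add_right[OF W])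
qed (simp add: linf_closed[OF S] linf_closed[OF T] vs_add_closed[OF W])

lemma linf_scale:
  assumes W: "vspace W" and T: "linf V W T"
  shows "linf V W (\<lambda>x. s \<odot>\<^bsub>W\<^esub> T x)"
  by (rule linfI)
     (simp_all add: linf_add[OF T] linf_smult[OF T] linf_closed[OF T] vs_smult_closed[OF W] vs_smult_add_right[OF W]
        mult.commute flip: vs_smult_smult[OF W])

context small_category
begin

lemma decode_arr:
  assumes "c \<in> Obj A" "a \<in> Obj A" "x \<in> carrier (vcopy (hom_space A c a))"
  shows "decode c a x \<in> Arr A" "Src A (decode c a x) = c" "Tgt A (decode c a x) = a" "code c a (decode c a x) = x"
  using linf_closed[OF decode_linf, OF assms] assms(3) by (auto simp: yon_carrier[OF assms(1,2)])

lemma decode_act: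
  assumes "a \<in> Obj A" "u \<in> Arr A" "x \<in> carrier (vcopy (hom_space A (Tgt A u) a))"
  shows "decode (Src A u) a (act (yon a) u x) = Cmp A (decode (Tgt A u) a x) u"
proof -
  obtain f where "f \<in> homset A (Tgt A u) a" "x = code (Tgt A u) a f" using assms by (auto simp: yon_carrier)
  then show ?thesis using yon_act(2)[of a u f] assms by simp
qed

lemma decode_add:
  assumes "c \<in> Obj A" "a \<in> Obj A" "x \<in> carrier (vcopy (hom_space A c a))" "y \<in> carrier (vcopy (hom_space A c a))"
  shows "decode c a (x \<oplus>\<^bsub>vcopy (hom_space A c a)\<^esub> y) = Plus A (decode c a x) (decode c a y)"
  using linf_add[OF decode_linf, OF assms] by simp

lemma decode_smult:
  assumes "c \<in> Obj A" "a \<in> Obj A" "x \<in> carrier (vcopy (hom_space A c a))"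
  shows "decode c a (s \<odot>\<^bsub>vcopy (hom_space A c a)\<^esub> x) = Scal A s (decode c a x)"
  using linf_smult[OF decode_linf, OF assms] by simp

lemma code_add: "f \<in> Arr A \<Longrightarrow> g \<in> Arr A \<Longrightarrow> Src A f = c \<Longrightarrow> Tgt A f = a \<Longrightarrow> Src A g = c \<Longrightarrow> Tgt A g = a \<Longrightarrow>
    code c a (Plus A f g) = code c a f \<oplus>\<^bsub>vcopy (hom_space A c a)\<^esub> code c a g"
  using linf_add[OF code_linf[of c a], of f g] by auto

lemma code_smult: "f \<in> Arr A \<Longrightarrow> Src A f = c \<Longrightarrow> Tgt A f = a \<Longrightarrow>
    code c a (Scal A s f) = s \<odot>\<^bsub>vcopy (hom_space A c a)\<^esub> code c a f"
  using linf_smult[OF code_linf[of c a], of f s] by auto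

lemma code_closed': "f \<in> Arr A \<Longrightarrow> Src A f = c \<Longrightarrow> Tgt A f = a \<Longrightarrow> code c a f \<in> carrier (vcopy (hom_space A c a))"
  using code_closed by auto

end

section \<open>Maps out of a Day convolution\<close>

context small_monoidal
begin

text \<open>The structure maps of the Day convolution are prescribed on a family \<open>v\<close> of
  generators with its own parametrisation: a represented slot is parametrised by arrows rather than
  by their codes, and for the associator the family is properly restricted. Here \<open>w\<close>
  extends the prescription to all generators, and the last hypothesis says that the family still
  determines linear maps.\<close>

lemma day_lin_ext:
  fixes M N :: "('o, 'm, 'k, 'v) psh" and W :: "('k, 'v) module"
  assumes MNc: "presheaf A M" "presheaf A N" "c \<in> Obj A" and W: "vspace W"
    and w: "day_multi A M N c W w"
    and v: "\<And>g. g \<in> G \<Longrightarrow> v g \<in> day_gens A M N c \<and> w (v g) = w' g"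
    and span: "\<forall>T T'. linf (OMap (D M N) c) W T \<longrightarrow> linf (OMap (D M N) c) W T' \<longrightarrow>
      (\<forall>g\<in>G. T (E M N c (v g)) = T' (E M N c (v g))) \<longrightarrow> (\<forall>h\<in>day_gens A M N c. T (E M N c h) = T' (E M N c h))"
  shows "lin_ext (OMap (D M N) c) W G (\<lambda>g. E M N c (v g)) w' \<in> homset vect_cat (OMap (D M N) c) W" (is ?A)
    and "h \<in> day_gens A M N c \<Longrightarrow> LFun (lin_ext (OMap (D M N) c) W G (\<lambda>g. E M N c (v g)) w') (E M N c h) = w h" (is "_ \<Longrightarrow> ?B")
proof -
  obtain T where T: "linf (OMap (D M N) c) W T" and Tw: "\<forall>g\<in>day_gens A M N c. T (E M N c g) = w g"
    using day_univ[OF MNc W w] by blast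
  have val: "E M N c (v g) \<in> elems (D M N) c \<and> T (E M N c (v g)) = w' g" if "g \<in> G" for g
    using v[OF that] Tw day_el_rel(1)[OF MNc] by auto
  have span': "S x = S' x" if S: "linf (OMap (D M N) c) W S" "linf (OMap (D M N) c) W S'"
    "\<And>g. g \<in> G \<Longrightarrow> S (E M N c (v g)) = S' (E M N c (v g))" "x \<in> elems (D M N) c" for S S' x
    by (rule day_span[OF MNc W S(1,2) _ S(4)]) (use span S in blast)
  show ?A
    apply (rule lin_ext_homset[where T = T, OF day_vspace[OF MNc] W T], erule val)
    subgoal for S S' x by (rule span'[of S S' x])
    done
  show ?B if h: "h \<in> day_gens A M N c"
    apply (subst lin_ext_apply[where T = T, OF day_vspace[OF MNc] W T], erule val)
    subgoal for S S' x by (rule span'[of S S' x])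
    using h Tw day_el_rel(1)[OF MNc] by auto
qed

lemma day_act:
  fixes M N :: "('o, 'm, 'k, 'v) psh"
  assumes MN: "presheaf A M" "presheaf A N" and u: "u \<in> Arr A"
  shows "AMap (D M N) u \<in> homset vect_cat (OMap (D M N) (Tgt A u)) (OMap (D M N) (Src A u))" (is ?A)
    and "(a, b, x, y, f) \<in> day_gens A M N (Tgt A u) \<Longrightarrow>
      act (D M N) u (E M N (Tgt A u) (a, b, x, y, f)) = E M N (Src A u) (a, b, x, y, f \<cdot> u)" (is "_ \<Longrightarrow> ?B")
proof -
  let ?w = "\<lambda>(a, b, x, y, f). E M N (Src A u) (a, b, x, y, f \<cdot> u)"
  note rel = day_el_rel[OF MN obj_arr(1)[OF u]]
  have w: "day_multi A M N (Tgt A u) (OMap (D M N) (Src A u)) ?w"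
    by (rule day_multiI, unfold prod.case)
       (use u in \<open>simp_all add: rel cmp_linear\<close>)
  have "AMap (D M N) u = lin_ext (OMap (D M N) (Tgt A u)) (OMap (D M N) (Src A u))
      (day_gens A M N (Tgt A u)) (\<lambda>g. E M N (Tgt A u) g) ?w"
    using u by (simp add: day_def)
  then show ?A "(a, b, x, y, f) \<in> day_gens A M N (Tgt A u) \<Longrightarrow> ?B"
    using day_lin_ext[OF MN obj_arr(2)[OF u] day_vspace[OF MN obj_arr(1)[OF u]] w,
        of "day_gens A M N (Tgt A u)" "\<lambda>g. g" ?w] by (simp_all del: in_homset in_day_gens)
qed

text \<open>Each law compares two linear maps out of the coend, so it may be checked on generators,
  where it is a law of composition in \<open>A\<close> followed by linearity in the last
  slot.\<close>

lemma day_presheaf: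
  fixes M N :: "('o, 'm, 'k, 'v) psh"
  assumes MN: "presheaf A M" "presheaf A N"
  shows "presheaf A (D M N)"
proof (rule presheafI)
  note span = day_span[OF MN]
  have lin: "linf (OMap (D M N) (Tgt A u)) (OMap (D M N) (Src A u)) (act (D M N) u)" if "u \<in> Arr A" for u
    using day_act(1)[OF MN that] by (simp add: homset_vect del: in_homset)
  fix a z assume a: "a \<in> Obj A" and z: "z \<in> elems (D M N) a"
  show "act (D M N) (Idt A a) z = z"
    by (rule span[OF a day_vspace[OF MN a] _ _ _ z, of "act (D M N) (Idt A a)" "\<lambda>z. z"])
       (use a lin[of "Idt A a"] day_act(2)[OF MN, of "Idt A a"] in \<open>simp_all add: linf_def\<close>)
next
  have lin: "linf (OMap (D M N) (Tgt A u)) (OMap (D M N) (Src A u)) (act (D M N) u)" if "u \<in> Arr A" for u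
    using day_act(1)[OF MN that] by (simp add: homset_vect del: in_homset)
  fix u v z assume uv: "u \<in> Arr A" "v \<in> Arr A" "Src A v = Tgt A u" and z: "z \<in> elems (D M N) (Tgt A v)"
  show "act (D M N) (v \<cdot> u) z = act (D M N) u (act (D M N) v z)"
  proof (rule day_span[OF MN _ day_vspace[OF MN obj_arr(1)[OF uv(1)]] _ _ _ z])
    show "linf (OMap (D M N) (Tgt A v)) (OMap (D M N) (Src A u)) (act (D M N) (v \<cdot> u))"
      using lin[of "v \<cdot> u"] uv by simp
    show "linf (OMap (D M N) (Tgt A v)) (OMap (D M N) (Src A u)) (\<lambda>z. act (D M N) u (act (D M N) v z))"
      by (rule linf_comp[OF lin[OF uv(2)]], unfold uv(3), rule lin[OF uv(1)])
    fix a b x y f assume "(a, b, x, y, f) \<in> day_gens A M N (Tgt A v)"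
    then show "act (D M N) (v \<cdot> u) (E M N (Tgt A v) (a, b, x, y, f)) = act (D M N) u (act (D M N) v (E M N (Tgt A v) (a, b, x, y, f)))"
      using uv day_act(2)[OF MN, of "v \<cdot> u" a b x y f] day_act(2)[OF MN, of v a b x y f] day_act(2)[OF MN, of u a b x y "f \<cdot> v"]
      by simp
  qed (use uv in simp_all)
next
  have lin: "linf (OMap (D M N) (Tgt A u)) (OMap (D M N) (Src A u)) (act (D M N) u)" if "u \<in> Arr A" for u
    using day_act(1)[OF MN that] by (simp add: homset_vect del: in_homset)
  fix u v z assume uv: "u \<in> Arr A" "v \<in> Arr A" "Src A v = Src A u" "Tgt A v = Tgt A u" and z: "z \<in> elems (D M N) (Tgt A u)"
  note W = day_vspace[OF MN obj_arr(1)[OF uv(1)]]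
  note rel = day_el_rel[OF MN obj_arr(1)[OF uv(1)]]
  show "act (D M N) (Plus A u v) z = act (D M N) u z \<oplus>\<^bsub>OMap (D M N) (Src A u)\<^esub> act (D M N) v z"
  proof (rule day_span[OF MN _ W _ _ _ z])
    show "linf (OMap (D M N) (Tgt A u)) (OMap (D M N) (Src A u)) (act (D M N) (Plus A u v))"
      using lin[of "Plus A u v"] uv by simp
    show "linf (OMap (D M N) (Tgt A u)) (OMap (D M N) (Src A u))
        (\<lambda>z. act (D M N) u z \<oplus>\<^bsub>OMap (D M N) (Src A u)\<^esub> act (D M N) v z)"
      by (rule linf_plus[OF W]) (use lin[of u] lin[of v] uv in simp_all)
    fix a b x y f assume "(a, b, x, y, f) \<in> day_gens A M N (Tgt A u)"
    then show "act (D M N) (Plus A u v) (E M N (Tgt A u) (a, b, x, y, f)) =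
        act (D M N) u (E M N (Tgt A u) (a, b, x, y, f)) \<oplus>\<^bsub>OMap (D M N) (Src A u)\<^esub> act (D M N) v (E M N (Tgt A u) (a, b, x, y, f))"
      using uv day_act(2)[OF MN, of "Plus A u v" a b x y f] day_act(2)[OF MN, of v a b x y f] day_act(2)[OF MN, of u a b x y f]
      by (simp add: cmp_linear rel)
  qed (use uv lin in simp_all)
next
  have lin: "linf (OMap (D M N) (Tgt A u)) (OMap (D M N) (Src A u)) (act (D M N) u)" if "u \<in> Arr A" for u
    using day_act(1)[OF MN that] by (simp add: homset_vect del: in_homset)
  fix u s z assume u: "u \<in> Arr A" and z: "z \<in> elems (D M N) (Tgt A u)"
  note W = day_vspace[OF MN obj_arr(1)[OF u]]
  note rel = day_el_rel[OF MN obj_arr(1)[OF u]]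
  show "act (D M N) (Scal A s u) z = s \<odot>\<^bsub>OMap (D M N) (Src A u)\<^esub> act (D M N) u z"
  proof (rule day_span[OF MN _ W _ _ _ z])
    show "linf (OMap (D M N) (Tgt A u)) (OMap (D M N) (Src A u)) (act (D M N) (Scal A s u))"
      using lin[of "Scal A s u"] u by simp
    show "linf (OMap (D M N) (Tgt A u)) (OMap (D M N) (Src A u)) (\<lambda>z. s \<odot>\<^bsub>OMap (D M N) (Src A u)\<^esub> act (D M N) u z)"
      by (rule linf_scale[OF W lin[OF u]])
    fix a b x y f assume "(a, b, x, y, f) \<in> day_gens A M N (Tgt A u)"
    then show "act (D M N) (Scal A s u) (E M N (Tgt A u) (a, b, x, y, f)) =
        s \<odot>\<^bsub>OMap (D M N) (Src A u)\<^esub> act (D M N) u (E M N (Tgt A u) (a, b, x, y, f))"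
      using u day_act(2)[OF MN, of "Scal A s u" a b x y f] day_act(2)[OF MN, of u a b x y f]
      by (simp add: cmp_linear rel)
  qed (use u lin in simp_all)
next
  show "OMap (D M N) \<in> extensional (Obj A)" "AMap (D M N) \<in> extensional (Arr A)" by (simp_all add: day_def)
qed (use day_vspace[OF MN] day_act(1)[OF MN] in simp_all)

lemma day_map:
  fixes M N P :: "('o, 'm, 'k, 'v) psh"
  assumes MN: "presheaf A M" "presheaf A N" and P: "presheaf A P"
    and w: "\<And>c. c \<in> Obj A \<Longrightarrow> day_multi A M N c (OMap P c) (w c)"
    and nat: "\<And>u a b x y f. u \<in> Arr A \<Longrightarrow> (a, b, x, y, f) \<in> day_gens A M N (Tgt A u) \<Longrightarrow>
      w (Src A u) (a, b, x, y, f \<cdot> u) = act P u (w (Tgt A u) (a, b, x, y, f))"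
    and v: "\<And>c g. c \<in> Obj A \<Longrightarrow> g \<in> G c \<Longrightarrow> v c g \<in> day_gens A M N c \<and> w c (v c g) = w' c g"
    and span: "\<And>c. c \<in> Obj A \<Longrightarrow> \<forall>T T'. linf (OMap (D M N) c) (OMap P c) T \<longrightarrow> linf (OMap (D M N) c) (OMap P c) T' \<longrightarrow>
      (\<forall>g\<in>G c. T (E M N c (v c g)) = T' (E M N c (v c g))) \<longrightarrow> (\<forall>h\<in>day_gens A M N c. T (E M N c h) = T' (E M N c h))"
  shows "presheaf_map A (day_map A M N P G v w')"
    and "c \<in> Obj A \<Longrightarrow> (a, b, x, y, f) \<in> day_gens A M N c \<Longrightarrow>
      app (day_map A M N P G v w') c (E M N c (a, b, x, y, f)) = w c (a, b, x, y, f)"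
proof -
  let ?\<sigma> = "day_map A M N P G v w'"
  have st: "NSrc ?\<sigma> = D M N" "NTgt ?\<sigma> = P" by (simp_all add: day_map_def)
  have hom: "NAt ?\<sigma> c \<in> homset vect_cat (OMap (D M N) c) (OMap P c)" if c: "c \<in> Obj A" for c
    unfolding day_map_def using c
      day_lin_ext(1)[OF MN c psh_vspace[OF P c] w[OF c] v[OF c] span[OF c]]
    by (simp del: in_homset)
  show val: "app ?\<sigma> c (E M N c (a, b, x, y, f)) = w c (a, b, x, y, f)"
    if c: "c \<in> Obj A" and g: "(a, b, x, y, f) \<in> day_gens A M N c" for c a b x y f
    unfolding day_map_def using c g
      day_lin_ext(2)[OF MN c psh_vspace[OF P c] w[OF c] v[OF c] span[OF c]]
    by (simp del: in_homset in_day_gens)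
  have lin: "linf (OMap (D M N) c) (OMap P c) (app ?\<sigma> c)" if "c \<in> Obj A" for c
    using hom[OF that] by (simp add: homset_vect del: in_homset)
  show "presheaf_map A ?\<sigma>"
  proof (rule presheaf_mapI, unfold st)
    fix u z assume u: "u \<in> Arr A" and z: "z \<in> elems (D M N) (Tgt A u)"
    show "app ?\<sigma> (Src A u) (act (D M N) u z) = act P u (app ?\<sigma> (Tgt A u) z)"
    proof (rule day_span[OF MN _ psh_vspace[OF P obj_arr(1)[OF u]] _ _ _ z])
      show "linf (OMap (D M N) (Tgt A u)) (OMap P (Src A u)) (\<lambda>z. app ?\<sigma> (Src A u) (act (D M N) u z))"
        by (rule linf_comp[OF psh_linf[OF day_presheaf[OF MN] u] lin]) (simp add: u)
      show "linf (OMap (D M N) (Tgt A u)) (OMap P (Src A u)) (\<lambda>z. act P u (app ?\<sigma> (Tgt A u) z))"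
        by (rule linf_comp[OF lin psh_linf[OF P u]]) (simp add: u)
      fix a b x y f assume g: "(a, b, x, y, f) \<in> day_gens A M N (Tgt A u)"
      then have g': "(a, b, x, y, f \<cdot> u) \<in> day_gens A M N (Src A u)" using u by simp
      show "app ?\<sigma> (Src A u) (act (D M N) u (E M N (Tgt A u) (a, b, x, y, f))) =
          act P u (app ?\<sigma> (Tgt A u) (E M N (Tgt A u) (a, b, x, y, f)))"
        using u by (simp add: day_act(2)[OF MN u g] val[OF _ g] val[OF _ g'] nat[OF u g] del: in_day_gens)
    qed (use u in simp_all)
  qed (use hom day_presheaf[OF MN] P in \<open>simp_all add: day_map_def del: in_homset\<close>)
qed

end


text \<open>The easy way to meet the spanning hypothesis of \<open>day_map\<close>: the family
  already reaches every generator. For the associator it does not, and a separate argument is given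
  there.\<close>

lemma span_surj:
  "(\<And>h. h \<in> H \<Longrightarrow> \<exists>g\<in>G. h = v g) \<Longrightarrow>
    \<forall>T T'. P T \<longrightarrow> Q T' \<longrightarrow> (\<forall>g\<in>G. T (e (v g)) = T' (e (v g))) \<longrightarrow> (\<forall>h\<in>H. T (e h) = T' (e h))"
  by blast

context small_monoidal
begin

lemma day_arr:
  fixes \<sigma> \<tau> :: "('o, 'm, 'k, 'v) psh_map"
  assumes \<sigma>: "presheaf_map A \<sigma>" and \<tau>: "presheaf_map A \<tau>"
  shows "presheaf_map A (day_arr A \<sigma> \<tau>)"
    and "c \<in> Obj A \<Longrightarrow> (a, b, x, y, f) \<in> day_gens A (NSrc \<sigma>) (NSrc \<tau>) c \<Longrightarrow>
      app (day_arr A \<sigma> \<tau>) c (E (NSrc \<sigma>) (NSrc \<tau>) c (a, b, x, y, f)) =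
      E (NTgt \<sigma>) (NTgt \<tau>) c (a, b, app \<sigma> a x, app \<tau> b y, f)"
proof -
  note MN = psh_map_psh(1)[OF \<sigma>] psh_map_psh(1)[OF \<tau>] and MN' = psh_map_psh(2)[OF \<sigma>] psh_map_psh(2)[OF \<tau>]
  let ?w = "\<lambda>c (a, b, x, y, f). E (NTgt \<sigma>) (NTgt \<tau>) c (a, b, app \<sigma> a x, app \<tau> b y, f)"
  note ac = app_closed[OF \<sigma>] app_closed[OF \<tau>]
  have w: "day_multi A (NSrc \<sigma>) (NSrc \<tau>) c (OMap (D (NTgt \<sigma>) (NTgt \<tau>)) c) (?w c)" if c: "c \<in> Obj A" for c
    apply (rule day_multiI; unfold prod.case)
    subgoal by (rule day_el_rel(1)[OF MN' c]) (simp add: ac)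
    subgoal for a b x x' y f using linf_add[OF app_linf[OF \<sigma>], of a x x'] by (simp add: day_el_rel(2)[OF MN' c] ac)
    subgoal for a b x y y' f using linf_add[OF app_linf[OF \<tau>], of b y y'] by (simp add: day_el_rel(3)[OF MN' c] ac)
    subgoal by (simp add: day_el_rel(4)[OF MN' c] ac)
    subgoal for a b x y f s using linf_smult[OF app_linf[OF \<sigma>], of a x s] by (simp add: day_el_rel(5)[OF MN' c] ac)
    subgoal for a b x y f s using linf_smult[OF app_linf[OF \<tau>], of b y s] by (simp add: day_el_rel(6)[OF MN' c] ac)
    subgoal by (simp add: day_el_rel(7)[OF MN' c] ac)
    subgoal by (simp add: day_el_rel(8)[OF MN' c] app_act[OF \<sigma>] app_act[OF \<tau>] ac)
    done
  have nat: "?w (Src A u) (a, b, x, y, f \<cdot> u) = act (D (NTgt \<sigma>) (NTgt \<tau>)) u (?w (Tgt A u) (a, b, x, y, f))"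
    if "u \<in> Arr A" "(a, b, x, y, f) \<in> day_gens A (NSrc \<sigma>) (NSrc \<tau>) (Tgt A u)" for u a b x y f
    using that by (simp add: day_act(2)[OF MN'] ac)
  note * = day_map[OF MN day_presheaf[OF MN'] w nat, of "day_gens A (NSrc \<sigma>) (NSrc \<tau>)" "\<lambda>c g. g" ?w, folded day_arr_def]
  show "presheaf_map A (day_arr A \<sigma> \<tau>)" by (rule *(1)) auto
  show "c \<in> Obj A \<Longrightarrow> (a, b, x, y, f) \<in> day_gens A (NSrc \<sigma>) (NSrc \<tau>) c \<Longrightarrow>
      app (day_arr A \<sigma> \<tau>) c (E (NSrc \<sigma>) (NSrc \<tau>) c (a, b, x, y, f)) =
      E (NTgt \<sigma>) (NTgt \<tau>) c (a, b, app \<sigma> a x, app \<tau> b y, f)"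
    by (subst *(2)) auto
qed

lemma day_arr_src_tgt [simp]:
  "NSrc (day_arr A \<sigma> \<tau>) = D (NSrc \<sigma>) (NSrc \<tau>)" "NTgt (day_arr A \<sigma> \<tau>) = D (NTgt \<sigma>) (NTgt \<tau>)"
  by (simp_all add: day_arr_def day_map_def)

lemma day_lunit:
  fixes M :: "('o, 'm, 'k, 'v) psh"
  assumes M: "presheaf A M"
  shows "presheaf_map A (day_lunit A M)"
    and "c \<in> Obj A \<Longrightarrow> (a, b, x, y, f) \<in> day_gens A (yon (One A)) M c \<Longrightarrow>
      app (day_lunit A M) c (E (yon (One A)) M c (a, b, x, y, f)) = act M ((decode a (One A) x \<boxtimes> Idt A b) \<cdot> f) y"
proof -
  note MN = yon_presheaf[OF one] M
  let ?w = "\<lambda>c (a, b, x, y, f). act M ((decode a (One A) x \<boxtimes> Idt A b) \<cdot> f) y"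
  let ?G = "\<lambda>c. {(a, b, u, x, f). a \<in> Obj A \<and> b \<in> Obj A \<and> u \<in> homset A a (One A) \<and> x \<in> elems M b \<and> f \<in> homset A c (a \<star> b)}"
  let ?v = "\<lambda>c (a, b, u, x, f). (a, b, code a (One A) u, x, f)"
  note d = decode_arr[OF _ one] decode_add[OF _ one] decode_smult[OF _ one] tarr_linear cmp_linear
  have w: "day_multi A (yon (One A)) M c (OMap M c) (?w c)" if c: "c \<in> Obj A" for c
    apply (rule day_multiI; unfold prod.case)
    subgoal for a b x y f using act_closed[OF M, of "(decode a (One A) x \<boxtimes> Idt A b) \<cdot> f" y] by (auto simp: d)
    subgoal for a b x x' y f
      using act_plus[OF M, of "(decode a (One A) x \<boxtimes> Idt A b) \<cdot> f" "(decode a (One A) x' \<boxtimes> Idt A b) \<cdot> f" y] by (auto simp: d)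
    subgoal for a b x y y' f using act_add[OF M, of "(decode a (One A) x \<boxtimes> Idt A b) \<cdot> f" y y'] by (auto simp: d)
    subgoal for a b x y f f'
      using act_plus[OF M, of "(decode a (One A) x \<boxtimes> Idt A b) \<cdot> f" "(decode a (One A) x \<boxtimes> Idt A b) \<cdot> f'" y] by (auto simp: d)
    subgoal for a b x y f s using act_scal[OF M, of "(decode a (One A) x \<boxtimes> Idt A b) \<cdot> f" y s] by (auto simp: d)
    subgoal for a b x y f s using act_smult[OF M, of "(decode a (One A) x \<boxtimes> Idt A b) \<cdot> f" y s] by (auto simp: d)
    subgoal for a b x y f s using act_scal[OF M, of "(decode a (One A) x \<boxtimes> Idt A b) \<cdot> f" y s] by (auto simp: d)
    subgoal for g h x y f
    proof -
      assume *: "g \<in> Arr A" "h \<in> Arr A" "x \<in> elems (yon (One A)) (Tgt A g)" "y \<in> elems M (Tgt A h)"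
        "f \<in> homset A c (Src A g \<star> Src A h)"
      let ?x = "decode (Tgt A g) (One A) x"
      have x: "?x \<in> Arr A" "Src A ?x = Tgt A g" "Tgt A ?x = One A" using * by (simp_all add: d)
      \<comment> \<open>Since the unit is strict, \<open>h\<close> equals
        \<open>Idt A (One A) \<boxtimes> h\<close>, and the interchange law slides it past the arrow
        \<open>?x \<cdot> g\<close> into the unit.\<close>
      have "h \<cdot> (((?x \<cdot> g) \<boxtimes> Idt A (Src A h)) \<cdot> f) = ((Idt A (One A) \<boxtimes> h) \<cdot> ((?x \<cdot> g) \<boxtimes> Idt A (Src A h))) \<cdot> f"
        using * x by simp
      also have "\<dots> = ((?x \<boxtimes> Idt A (Tgt A h)) \<cdot> (g \<boxtimes> h)) \<cdot> f"
        using * x by (subst (1 2) tarr_cmp) simp_all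
      finally have "h \<cdot> (((?x \<cdot> g) \<boxtimes> Idt A (Src A h)) \<cdot> f) = (?x \<boxtimes> Idt A (Tgt A h)) \<cdot> ((g \<boxtimes> h) \<cdot> f)"
        using * x by simp
      then show ?thesis
        using act_cmp[OF M, of "((?x \<cdot> g) \<boxtimes> Idt A (Src A h)) \<cdot> f" h y] * x decode_act[OF one *(1), of x] by simp
    qed
    done
  have nat: "?w (Src A u) (a, b, x, y, f \<cdot> u) = act M u (?w (Tgt A u) (a, b, x, y, f))"
    if "u \<in> Arr A" "(a, b, x, y, f) \<in> day_gens A (yon (One A)) M (Tgt A u)" for u a b x y f
    using that act_cmp[OF M, of u "(decode a (One A) x \<boxtimes> Idt A b) \<cdot> f" y] by (auto simp: d)
  have v: "?v c g \<in> day_gens A (yon (One A)) M c \<and> ?w c (?v c g) =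
      (case g of (a, b, u, x, f) \<Rightarrow> act M (LUnit A b \<cdot> (u \<boxtimes> Idt A b) \<cdot> f) x)" if "c \<in> Obj A" "g \<in> ?G c" for c g
    using that by (auto simp: code_closed')
  have surj: "\<exists>g\<in>?G c. h = ?v c g" if "c \<in> Obj A" "h \<in> day_gens A (yon (One A)) M c" for c h
  proof -
    obtain a b x y f where h: "h = (a, b, x, y, f)" by (cases h)
    show ?thesis using that unfolding h
      by (intro bexI[of _ "(a, b, decode a (One A) x, y, f)"]) (auto simp: d)
  qed
  note * = day_map[OF MN M, where w = ?w and G = ?G and v = ?v and w' = "\<lambda>c (a, b, u, x, f). act M (LUnit A b \<cdot> (u \<boxtimes> Idt A b) \<cdot> f) x", folded day_lunit_def]
  show "presheaf_map A (day_lunit A M)"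
    by (rule *(1); (rule w nat v span_surj[OF surj]; assumption))
  have val: "app (day_lunit A M) c (E (yon (One A)) M c (a, b, x, y, f)) = ?w c (a, b, x, y, f)"
    if "c \<in> Obj A" "(a, b, x, y, f) \<in> day_gens A (yon (One A)) M c" for c a b x y f
    by (rule *(2); (rule w nat v span_surj[OF surj] that; assumption?))
  show "c \<in> Obj A \<Longrightarrow> (a, b, x, y, f) \<in> day_gens A (yon (One A)) M c \<Longrightarrow>
      app (day_lunit A M) c (E (yon (One A)) M c (a, b, x, y, f)) = act M ((decode a (One A) x \<boxtimes> Idt A b) \<cdot> f) y"
    by (simp only: val prod.case)
qed

lemma day_runit:
  fixes M :: "('o, 'm, 'k, 'v) psh"
  assumes M: "presheaf A M"
  shows "presheaf_map A (day_runit A M)"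
    and "c \<in> Obj A \<Longrightarrow> (a, b, x, y, f) \<in> day_gens A M (yon (One A)) c \<Longrightarrow>
      app (day_runit A M) c (E M (yon (One A)) c (a, b, x, y, f)) = act M ((Idt A a \<boxtimes> decode b (One A) y) \<cdot> f) x"
proof -
  note MN = M yon_presheaf[OF one]
  let ?w = "\<lambda>c (a, b, x, y, f). act M ((Idt A a \<boxtimes> decode b (One A) y) \<cdot> f) x"
  let ?G = "\<lambda>c. {(a, b, x, u, f). a \<in> Obj A \<and> b \<in> Obj A \<and> x \<in> elems M a \<and> u \<in> homset A b (One A) \<and> f \<in> homset A c (a \<star> b)}"
  let ?v = "\<lambda>c (a, b, x, u, f). (a, b, x, code b (One A) u, f)"
  note d = decode_arr[OF _ one] decode_add[OF _ one] decode_smult[OF _ one] tarr_linear cmp_linear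
  have w: "day_multi A M (yon (One A)) c (OMap M c) (?w c)" if c: "c \<in> Obj A" for c
    apply (rule day_multiI; unfold prod.case)
    subgoal for a b x y f using act_closed[OF M, of "(Idt A a \<boxtimes> decode b (One A) y) \<cdot> f" x] by (auto simp: d)
    subgoal for a b x x' y f using act_add[OF M, of "(Idt A a \<boxtimes> decode b (One A) y) \<cdot> f" x x'] by (auto simp: d)
    subgoal for a b x y y' f
      using act_plus[OF M, of "(Idt A a \<boxtimes> decode b (One A) y) \<cdot> f" "(Idt A a \<boxtimes> decode b (One A) y') \<cdot> f" x] by (auto simp: d)
    subgoal for a b x y f f'
      using act_plus[OF M, of "(Idt A a \<boxtimes> decode b (One A) y) \<cdot> f" "(Idt A a \<boxtimes> decode b (One A) y) \<cdot> f'" x] by (auto simp: d)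
    subgoal for a b x y f s using act_smult[OF M, of "(Idt A a \<boxtimes> decode b (One A) y) \<cdot> f" x s] by (auto simp: d)
    subgoal for a b x y f s using act_scal[OF M, of "(Idt A a \<boxtimes> decode b (One A) y) \<cdot> f" x s] by (auto simp: d)
    subgoal for a b x y f s using act_scal[OF M, of "(Idt A a \<boxtimes> decode b (One A) y) \<cdot> f" x s] by (auto simp: d)
    subgoal for g h x y f
    proof -
      assume *: "g \<in> Arr A" "h \<in> Arr A" "x \<in> elems M (Tgt A g)" "y \<in> elems (yon (One A)) (Tgt A h)"
        "f \<in> homset A c (Src A g \<star> Src A h)"
      let ?y = "decode (Tgt A h) (One A) y"
      have y: "?y \<in> Arr A" "Src A ?y = Tgt A h" "Tgt A ?y = One A" using * by (simp_all add: d)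
      have "g \<cdot> ((Idt A (Src A g) \<boxtimes> (?y \<cdot> h)) \<cdot> f) = ((g \<boxtimes> Idt A (One A)) \<cdot> (Idt A (Src A g) \<boxtimes> (?y \<cdot> h))) \<cdot> f"
        using * y by simp
      also have "\<dots> = ((Idt A (Tgt A g) \<boxtimes> ?y) \<cdot> (g \<boxtimes> h)) \<cdot> f"
        using * y by (subst (1 2) tarr_cmp) simp_all
      finally have "g \<cdot> ((Idt A (Src A g) \<boxtimes> (?y \<cdot> h)) \<cdot> f) = (Idt A (Tgt A g) \<boxtimes> ?y) \<cdot> ((g \<boxtimes> h) \<cdot> f)"
        using * y by simp
      then show ?thesis
        using act_cmp[OF M, of "(Idt A (Src A g) \<boxtimes> (?y \<cdot> h)) \<cdot> f" g x] * y decode_act[OF one *(2), of y] by simp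
    qed
    done
  have nat: "?w (Src A u) (a, b, x, y, f \<cdot> u) = act M u (?w (Tgt A u) (a, b, x, y, f))"
    if "u \<in> Arr A" "(a, b, x, y, f) \<in> day_gens A M (yon (One A)) (Tgt A u)" for u a b x y f
    using that act_cmp[OF M, of u "(Idt A a \<boxtimes> decode b (One A) y) \<cdot> f" x] by (auto simp: d)
  have v: "?v c g \<in> day_gens A M (yon (One A)) c \<and> ?w c (?v c g) =
      (case g of (a, b, x, u, f) \<Rightarrow> act M (RUnit A a \<cdot> (Idt A a \<boxtimes> u) \<cdot> f) x)" if "c \<in> Obj A" "g \<in> ?G c" for c g
    using that by (auto simp: code_closed')
  have surj: "\<exists>g\<in>?G c. h = ?v c g" if "c \<in> Obj A" "h \<in> day_gens A M (yon (One A)) c" for c h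
  proof -
    obtain a b x y f where h: "h = (a, b, x, y, f)" by (cases h)
    show ?thesis using that unfolding h
      by (intro bexI[of _ "(a, b, x, decode b (One A) y, f)"]) (auto simp: d)
  qed
  note * = day_map[OF MN M, where w = ?w and G = ?G and v = ?v and w' = "\<lambda>c (a, b, x, u, f). act M (RUnit A a \<cdot> (Idt A a \<boxtimes> u) \<cdot> f) x", folded day_runit_def]
  show "presheaf_map A (day_runit A M)"
    by (rule *(1); (rule w nat v span_surj[OF surj]; assumption))
  have val: "app (day_runit A M) c (E M (yon (One A)) c (a, b, x, y, f)) = ?w c (a, b, x, y, f)"
    if "c \<in> Obj A" "(a, b, x, y, f) \<in> day_gens A M (yon (One A)) c" for c a b x y f
    by (rule *(2); (rule w nat v span_surj[OF surj] that; assumption?))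
  show "c \<in> Obj A \<Longrightarrow> (a, b, x, y, f) \<in> day_gens A M (yon (One A)) c \<Longrightarrow>
      app (day_runit A M) c (E M (yon (One A)) c (a, b, x, y, f)) = act M ((Idt A a \<boxtimes> decode b (One A) y) \<cdot> f) x"
    by (simp only: val prod.case)
qed

lemma yoneda_tensor:
  assumes ab: "p \<in> Obj A" "q \<in> Obj A"
  defines "T \<equiv> yoneda_tensor A p q :: ('o, 'm, 'k, 'v) psh_map"
  shows "presheaf_map A T"
    and "c \<in> Obj A \<Longrightarrow> (a, b, x, y, f) \<in> day_gens A (yon p) (yon q) c \<Longrightarrow>
      app T c (E (yon p) (yon q) c (a, b, x, y, f)) = code c (p \<star> q) ((decode a p x \<boxtimes> decode b q y) \<cdot> f)"
proof -
  note MN = yon_presheaf[OF ab(1)] yon_presheaf[OF ab(2)] and P = yon_presheaf[OF tobj[OF ab]]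
  let ?w = "\<lambda>c (a, b, x, y, f). code c (p \<star> q) ((decode a p x \<boxtimes> decode b q y) \<cdot> f)"
  let ?G = "\<lambda>c. {(a, b, u, v, f). a \<in> Obj A \<and> b \<in> Obj A \<and> u \<in> homset A a p \<and> v \<in> homset A b q \<and> f \<in> homset A c (a \<star> b)}"
  let ?v = "\<lambda>c (a, b, u, v, f). (a, b, code a p u, code b q v, f)"
  note d = decode_arr[OF _ ab(1)] decode_add[OF _ ab(1)] decode_smult[OF _ ab(1)]
    decode_arr[OF _ ab(2)] decode_add[OF _ ab(2)] decode_smult[OF _ ab(2)] tarr_linear cmp_linear code_add code_smult ab
  have w: "day_multi A (yon p) (yon q) c (OMap (yon (p \<star> q)) c) (?w c)" if c: "c \<in> Obj A" for c
  proof (rule day_multiI; unfold prod.case)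
    fix g h x y f
    assume *: "g \<in> Arr A" "h \<in> Arr A" "x \<in> elems (yon p) (Tgt A g)" "y \<in> elems (yon q) (Tgt A h)"
        "f \<in> homset A c (Src A g \<star> Src A h)"
    let ?x = "decode (Tgt A g) p x" and ?y = "decode (Tgt A h) q y"
    have x: "?x \<in> Arr A" "Src A ?x = Tgt A g" "Tgt A ?x = p" "?y \<in> Arr A" "Src A ?y = Tgt A h" "Tgt A ?y = q"
      using * by (simp_all add: d)
    then have "((?x \<cdot> g) \<boxtimes> (?y \<cdot> h)) \<cdot> f = (?x \<boxtimes> ?y) \<cdot> (g \<boxtimes> h) \<cdot> f"
      using * by (simp add: tarr_cmp[symmetric])
    then show "code c (p \<star> q) ((decode (Src A g) p (act (yon p) g x) \<boxtimes> decode (Src A h) q (act (yon q) h y)) \<cdot> f) =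
        code c (p \<star> q) ((decode (Tgt A g) p x \<boxtimes> decode (Tgt A h) q y) \<cdot> (g \<boxtimes> h) \<cdot> f)"
      using decode_act[OF ab(1) *(1), of x] decode_act[OF ab(2) *(2), of y] * by simp
  qed (use c in \<open>auto simp: d code_closed'\<close>)
  have nat: "?w (Src A u) (a, b, x, y, f \<cdot> u) = act (yon (p \<star> q)) u (?w (Tgt A u) (a, b, x, y, f))"
    if "u \<in> Arr A" "(a, b, x, y, f) \<in> day_gens A (yon p) (yon q) (Tgt A u)" for u a b x y f
    using that ab by (auto simp: yon_act(2)[OF tobj[OF ab]] d)
  have v: "?v c g \<in> day_gens A (yon p) (yon q) c \<and> ?w c (?v c g) =
      (case g of (a, b, u, v, f) \<Rightarrow> code c (p \<star> q) ((u \<boxtimes> v) \<cdot> f))" if "c \<in> Obj A" "g \<in> ?G c" for c g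
    using that by (auto simp: code_closed')
  have surj: "\<exists>g\<in>?G c. h = ?v c g" if "c \<in> Obj A" "h \<in> day_gens A (yon p) (yon q) c" for c h
  proof -
    obtain a b x y f where h: "h = (a, b, x, y, f)" by (cases h)
    show ?thesis using that unfolding h
      by (intro bexI[of _ "(a, b, decode a p x, decode b q y, f)"]) (auto simp: d)
  qed
  note * = day_map[OF MN P, where w = ?w and G = ?G and v = ?v and w' = "\<lambda>c (a, b, u, v, f). code c (p \<star> q) ((u \<boxtimes> v) \<cdot> f)", folded yoneda_tensor_def, folded T_def]
  show "presheaf_map A T"
    by (rule *(1); (rule w nat v span_surj[OF surj]; assumption))
  have val: "app T c (E (yon p) (yon q) c (a, b, x, y, f)) = ?w c (a, b, x, y, f)"
    if "c \<in> Obj A" "(a, b, x, y, f) \<in> day_gens A (yon p) (yon q) c" for c a b x y f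
    by (rule *(2); (rule w nat v span_surj[OF surj] that; assumption?))
  show "c \<in> Obj A \<Longrightarrow> (a, b, x, y, f) \<in> day_gens A (yon p) (yon q) c \<Longrightarrow>
      app T c (E (yon p) (yon q) c (a, b, x, y, f)) = code c (p \<star> q) ((decode a p x \<boxtimes> decode b q y) \<cdot> f)"
    by (simp only: val prod.case)
qed

lemma day_el_linf:
  fixes M N :: "('o, 'm, 'k, 'v) psh"
  assumes MNc: "presheaf A M" "presheaf A N" "c \<in> Obj A" and "a \<in> Obj A" "b \<in> Obj A" "f \<in> homset A c (a \<star> b)"
  shows "y \<in> elems N b \<Longrightarrow> linf (OMap M a) (OMap (D M N) c) (\<lambda>x. E M N c (a, b, x, y, f))"
    and "x \<in> elems M a \<Longrightarrow> linf (OMap N b) (OMap (D M N) c) (\<lambda>y. E M N c (a, b, x, y, f))"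
  using assms(4-6) by (simp_all add: linf_def day_el_rel[OF MNc])

text \<open>The formula is known only on generators whose first slot is itself a generator of the
  inner convolution, so well-definedness has two stages. For fixed outer data the formula is
  multilinear in the inner generator, which yields a linear map \<open>L\<close>; then
  \<open>L\<close> is shown to depend multilinearly on the outer data and to be balanced.\<close>

lemma day_assoc:
  fixes M N P :: "('o, 'm, 'k, 'v) psh"
  assumes M: "presheaf A M" and N: "presheaf A N" and P: "presheaf A P"
  shows "presheaf_map A (day_assoc A M N P)"
    and "e \<in> Obj A \<Longrightarrow> (a, b, x, y, f) \<in> day_gens A M N d \<Longrightarrow> d \<in> Obj A \<Longrightarrow> c \<in> Obj A \<Longrightarrow> z \<in> elems P c \<Longrightarrow>
      g \<in> homset A e (d \<star> c) \<Longrightarrow>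
      app (day_assoc A M N P) e (E (D M N) P e (d, c, E M N d (a, b, x, y, f), z, g)) =
      E M (D N P) e (a, b \<star> c, x, E N P (b \<star> c) (b, c, y, z, Idt A (b \<star> c)), (f \<boxtimes> Idt A c) \<cdot> g)"
proof -
  note MN = day_presheaf[OF M N] and NP = day_presheaf[OF N P]
  note MNP = day_presheaf[OF M NP]
  define w where "w e d c z g = (\<lambda>(a, b, x, y, f).
    E M (D N P) e (a, b \<star> c, x, E N P (b \<star> c) (b, c, y, z, Idt A (b \<star> c)), (f \<boxtimes> Idt A c) \<cdot> g))" for e d c :: 'o and z g
  have inner: "E N P (b \<star> c) (b, c, y, z, Idt A (b \<star> c)) \<in> elems (D N P) (b \<star> c)"
    if "b \<in> Obj A" "c \<in> Obj A" "y \<in> elems N b" "z \<in> elems P c" for b c y z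
    using that by (intro day_el_rel(1)[OF N P]) simp_all
  \<comment> \<open>Restricting the universal generator along \<open>h \<boxtimes> k\<close> gives
    the universal generator of the restricted vectors. This lets arrows of \<open>A\<close> pass in
    and out of the inner convolution of \<open>N\<close> and \<open>P\<close>.\<close>
  have push: "act (D N P) (h \<boxtimes> k) (E N P (Tgt A h \<star> Tgt A k) (Tgt A h, Tgt A k, y, z, Idt A (Tgt A h \<star> Tgt A k))) =
      E N P (Src A h \<star> Src A k) (Src A h, Src A k, act N h y, act P k z, Idt A (Src A h \<star> Src A k))"
    if "h \<in> Arr A" "k \<in> Arr A" "y \<in> elems N (Tgt A h)" "z \<in> elems P (Tgt A k)" for h k y z
    using that day_act(2)[OF N P, of "h \<boxtimes> k" "Tgt A h" "Tgt A k" y z "Idt A (Tgt A h \<star> Tgt A k)"]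
      day_el_rel(8)[OF N P, of "Src A h \<star> Src A k" h k y z "Idt A (Src A h \<star> Src A k)"] by simp
  have multi: "day_multi A M N d (OMap (D M (D N P)) e) (w e d c z g)"
    if ed: "e \<in> Obj A" "d \<in> Obj A" "c \<in> Obj A" "z \<in> elems P c" "g \<in> homset A e (d \<star> c)" for e d c z g
  proof (rule day_multiI; unfold w_def prod.case)
    note rel = day_el_rel[OF M NP ed(1)]
    fix a b x y f assume "(a, b, x, y, f) \<in> day_gens A M N d"
    then have g: "a \<in> Obj A" "b \<in> Obj A" "x \<in> elems M a" "y \<in> elems N b" "f \<in> Arr A" "Src A f = d" "Tgt A f = a \<star> b" by auto
    note reli = day_el_rel[OF N P tobj[OF g(2) ed(3)]]
    note s = g ed inner rel tarr_linear cmp_linear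
    show "E M (D N P) e (a, b \<star> c, x, E N P (b \<star> c) (b, c, y, z, Idt A (b \<star> c)), (f \<boxtimes> Idt A c) \<cdot> g) \<in> elems (D M (D N P)) e"
      by (rule rel(1)) (use s in simp)
    show "E M (D N P) e (a, b \<star> c, x \<oplus>\<^bsub>OMap M a\<^esub> x', E N P (b \<star> c) (b, c, y, z, Idt A (b \<star> c)), (f \<boxtimes> Idt A c) \<cdot> g) =
        E M (D N P) e (a, b \<star> c, x, E N P (b \<star> c) (b, c, y, z, Idt A (b \<star> c)), (f \<boxtimes> Idt A c) \<cdot> g) \<oplus>\<^bsub>OMap (D M (D N P)) e\<^esub>
        E M (D N P) e (a, b \<star> c, x', E N P (b \<star> c) (b, c, y, z, Idt A (b \<star> c)), (f \<boxtimes> Idt A c) \<cdot> g)"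
      if "x' \<in> elems M a" for x' by (rule rel(2)) (use s that in simp_all)
    show "E M (D N P) e (a, b \<star> c, x, E N P (b \<star> c) (b, c, y \<oplus>\<^bsub>OMap N b\<^esub> y', z, Idt A (b \<star> c)), (f \<boxtimes> Idt A c) \<cdot> g) =
        E M (D N P) e (a, b \<star> c, x, E N P (b \<star> c) (b, c, y, z, Idt A (b \<star> c)), (f \<boxtimes> Idt A c) \<cdot> g) \<oplus>\<^bsub>OMap (D M (D N P)) e\<^esub>
        E M (D N P) e (a, b \<star> c, x, E N P (b \<star> c) (b, c, y', z, Idt A (b \<star> c)), (f \<boxtimes> Idt A c) \<cdot> g)"
      if y': "y' \<in> elems N b" for y'
      by (subst reli(2)) (use s y' in \<open>simp_all\<close>)
    show "E M (D N P) e (a, b \<star> c, x, E N P (b \<star> c) (b, c, y, z, Idt A (b \<star> c)), (Plus A f f' \<boxtimes> Idt A c) \<cdot> g) =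
        E M (D N P) e (a, b \<star> c, x, E N P (b \<star> c) (b, c, y, z, Idt A (b \<star> c)), (f \<boxtimes> Idt A c) \<cdot> g) \<oplus>\<^bsub>OMap (D M (D N P)) e\<^esub>
        E M (D N P) e (a, b \<star> c, x, E N P (b \<star> c) (b, c, y, z, Idt A (b \<star> c)), (f' \<boxtimes> Idt A c) \<cdot> g)"
      if "f' \<in> homset A d (a \<star> b)" for f' using s that by simp
    show "E M (D N P) e (a, b \<star> c, s \<odot>\<^bsub>OMap M a\<^esub> x, E N P (b \<star> c) (b, c, y, z, Idt A (b \<star> c)), (f \<boxtimes> Idt A c) \<cdot> g) =
        s \<odot>\<^bsub>OMap (D M (D N P)) e\<^esub> E M (D N P) e (a, b \<star> c, x, E N P (b \<star> c) (b, c, y, z, Idt A (b \<star> c)), (f \<boxtimes> Idt A c) \<cdot> g)" for s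
      by (rule rel(5)) (use s in simp)
    show "E M (D N P) e (a, b \<star> c, x, E N P (b \<star> c) (b, c, s \<odot>\<^bsub>OMap N b\<^esub> y, z, Idt A (b \<star> c)), (f \<boxtimes> Idt A c) \<cdot> g) =
        s \<odot>\<^bsub>OMap (D M (D N P)) e\<^esub> E M (D N P) e (a, b \<star> c, x, E N P (b \<star> c) (b, c, y, z, Idt A (b \<star> c)), (f \<boxtimes> Idt A c) \<cdot> g)" for s
      by (subst reli(5)) (use s in \<open>simp_all\<close>)
    show "E M (D N P) e (a, b \<star> c, x, E N P (b \<star> c) (b, c, y, z, Idt A (b \<star> c)), (Scal A s f \<boxtimes> Idt A c) \<cdot> g) =
        s \<odot>\<^bsub>OMap (D M (D N P)) e\<^esub> E M (D N P) e (a, b \<star> c, x, E N P (b \<star> c) (b, c, y, z, Idt A (b \<star> c)), (f \<boxtimes> Idt A c) \<cdot> g)" for s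
      using s by simp
  next
    fix h k x y f
    assume *: "h \<in> Arr A" "k \<in> Arr A" "x \<in> elems M (Tgt A h)" "y \<in> elems N (Tgt A k)" "f \<in> homset A d (Src A h \<star> Src A k)"
    have "E M (D N P) e (Src A h, Src A k \<star> c, act M h x, E N P (Src A k \<star> c) (Src A k, c, act N k y, z, Idt A (Src A k \<star> c)), (f \<boxtimes> Idt A c) \<cdot> g)
      = E M (D N P) e (Src A h, Src A (k \<boxtimes> Idt A c), act M h x,
          act (D N P) (k \<boxtimes> Idt A c) (E N P (Tgt A k \<star> c) (Tgt A k, c, y, z, Idt A (Tgt A k \<star> c))), (f \<boxtimes> Idt A c) \<cdot> g)"
      using push[of k "Idt A c" y z] * ed by (simp add: act_idt[OF P])
    also have "\<dots> = E M (D N P) e (Tgt A h, Tgt A (k \<boxtimes> Idt A c), x, E N P (Tgt A k \<star> c) (Tgt A k, c, y, z, Idt A (Tgt A k \<star> c)),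
        (h \<boxtimes> (k \<boxtimes> Idt A c)) \<cdot> (f \<boxtimes> Idt A c) \<cdot> g)"
      by (rule day_el_rel(8)[OF M NP ed(1)]) (use * ed inner[of "Tgt A k" c y z] in simp_all)
    also have "(h \<boxtimes> (k \<boxtimes> Idt A c)) \<cdot> (f \<boxtimes> Idt A c) \<cdot> g = (((h \<boxtimes> k) \<cdot> f) \<boxtimes> Idt A c) \<cdot> g"
    proof -
      have "(h \<boxtimes> (k \<boxtimes> Idt A c)) \<cdot> (f \<boxtimes> Idt A c) \<cdot> g = (((h \<boxtimes> k) \<boxtimes> Idt A c) \<cdot> (f \<boxtimes> Idt A c)) \<cdot> g"
        using * ed by simp
      also have "((h \<boxtimes> k) \<boxtimes> Idt A c) \<cdot> (f \<boxtimes> Idt A c) = ((h \<boxtimes> k) \<cdot> f) \<boxtimes> Idt A c"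
        using * ed by (subst tarr_cmp) simp_all
      finally show ?thesis .
    qed
    finally show "E M (D N P) e (Src A h, Src A k \<star> c, act M h x, E N P (Src A k \<star> c) (Src A k, c, act N k y, z, Idt A (Src A k \<star> c)), (f \<boxtimes> Idt A c) \<cdot> g)
      = E M (D N P) e (Tgt A h, Tgt A k \<star> c, x, E N P (Tgt A k \<star> c) (Tgt A k, c, y, z, Idt A (Tgt A k \<star> c)), (((h \<boxtimes> k) \<cdot> f) \<boxtimes> Idt A c) \<cdot> g)"
      using * ed by simp
  qed
  \<comment> \<open>The end of the first stage: the map on the slot in \<open>D M N\<close> while
    \<open>d\<close>, \<open>c\<close>, \<open>z\<close> and \<open>g\<close> are held
    fixed.\<close>
  define L where "L e d c z g = (SOME T. linf (OMap (D M N) d) (OMap (D M (D N P)) e) T \<and>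
    (\<forall>q\<in>day_gens A M N d. T (E M N d q) = w e d c z g q))" for e d c z g
  have L: "linf (OMap (D M N) d) (OMap (D M (D N P)) e) (L e d c z g)"
    "q \<in> day_gens A M N d \<Longrightarrow> L e d c z g (E M N d q) = w e d c z g q"
    if ed: "e \<in> Obj A" "d \<in> Obj A" "c \<in> Obj A" "z \<in> elems P c" "g \<in> homset A e (d \<star> c)" for e d c z g q
    using someI_ex[OF day_univ[OF M N ed(2) psh_vspace[OF MNP ed(1)] multi[OF ed]]] unfolding L_def by blast+
  define W where "W e = (\<lambda>(d, c, p, z, g). L e d c z g p)" for e
  \<comment> \<open>All properties of \<open>L\<close> in its outer arguments are obtained by
    recognising \<open>L\<close> as another linear map that agrees with it on inner
    generators.\<close>
  have Leq: "L e d c z g p = T p"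
    if ed: "e \<in> Obj A" "d \<in> Obj A" "c \<in> Obj A" "z \<in> elems P c" "g \<in> homset A e (d \<star> c)"
      and T: "linf (OMap (D M N) d) (OMap (D M (D N P)) e) T" and p: "p \<in> elems (D M N) d"
      and eq: "\<And>a b x y f. (a, b, x, y, f) \<in> day_gens A M N d \<Longrightarrow> w e d c z g (a, b, x, y, f) = T (E M N d (a, b, x, y, f))"
    for e d c z g T p
    by (rule day_span[OF M N ed(2) psh_vspace[OF MNP ed(1)] L(1)[OF ed] T _ p]) (simp only: L(2)[OF ed] eq)
  have Wm: "day_multi A (D M N) P e (OMap (D M (D N P)) e) (W e)" if e: "e \<in> Obj A" for e
  proof (rule day_multiI; unfold W_def prod.case)
    note rel = day_el_rel[OF M NP e] and vs = psh_vspace[OF MNP e]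
    fix d c p z g assume "(d, c, p, z, g) \<in> day_gens A (D M N) P e"
    then have g: "e \<in> Obj A" "d \<in> Obj A" "c \<in> Obj A" "z \<in> elems P c" "g \<in> homset A e (d \<star> c)" and p: "p \<in> elems (D M N) d"
      using e by auto
    note reli = day_el_rel[OF N P tobj[OF _ g(3)]]
    note Lg = L[OF g] and s = g inner rel tarr_linear cmp_linear
    show "L e d c z g p \<in> elems (D M (D N P)) e" by (rule linf_closed[OF Lg(1) p])
    show "L e d c z g (p \<oplus>\<^bsub>OMap (D M N) d\<^esub> p') = L e d c z g p \<oplus>\<^bsub>OMap (D M (D N P)) e\<^esub> L e d c z g p'"
      if "p' \<in> elems (D M N) d" for p' by (rule linf_add[OF Lg(1) p that])
    show "L e d c z g (r \<odot>\<^bsub>OMap (D M N) d\<^esub> p) = r \<odot>\<^bsub>OMap (D M (D N P)) e\<^esub> L e d c z g p" for r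
      by (rule linf_smult[OF Lg(1) p])
    show "L e d c (z \<oplus>\<^bsub>OMap P c\<^esub> z') g p = L e d c z g p \<oplus>\<^bsub>OMap (D M (D N P)) e\<^esub> L e d c z' g p"
      if z': "z' \<in> elems P c" for z'
    proof (rule Leq[OF g(1-3) _ g(5) linf_plus[OF vs Lg(1) L(1)[OF g(1-3) z' g(5)]] p])
      show "z \<oplus>\<^bsub>OMap P c\<^esub> z' \<in> elems P c" using vs_add_closed[OF psh_vspace[OF P g(3)] g(4) z'] .
      fix a b x y f assume q: "(a, b, x, y, f) \<in> day_gens A M N d"
      show "w e d c (z \<oplus>\<^bsub>OMap P c\<^esub> z') g (a, b, x, y, f) =
          L e d c z g (E M N d (a, b, x, y, f)) \<oplus>\<^bsub>OMap (D M (D N P)) e\<^esub> L e d c z' g (E M N d (a, b, x, y, f))"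
        unfolding Lg(2)[OF q] L(2)[OF g(1-3) z' g(5) q] using q s z' by (simp add: w_def reli)
    qed
    show "L e d c z (Plus A g g') p = L e d c z g p \<oplus>\<^bsub>OMap (D M (D N P)) e\<^esub> L e d c z g' p"
      if g': "g' \<in> homset A e (d \<star> c)" for g'
    proof (rule Leq[OF g(1-4) _ linf_plus[OF vs Lg(1) L(1)[OF g(1-4) g']] p])
      show "Plus A g g' \<in> homset A e (d \<star> c)" using g g' by simp
      fix a b x y f assume q: "(a, b, x, y, f) \<in> day_gens A M N d"
      show "w e d c z (Plus A g g') (a, b, x, y, f) =
          L e d c z g (E M N d (a, b, x, y, f)) \<oplus>\<^bsub>OMap (D M (D N P)) e\<^esub> L e d c z g' (E M N d (a, b, x, y, f))"
        unfolding Lg(2)[OF q] L(2)[OF g(1-4) g' q] using q s g' by (simp add: w_def)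
    qed
    show "L e d c (r \<odot>\<^bsub>OMap P c\<^esub> z) g p = r \<odot>\<^bsub>OMap (D M (D N P)) e\<^esub> L e d c z g p" for r
    proof (rule Leq[OF g(1-3) _ g(5) linf_scale[OF vs Lg(1)] p])
      show "r \<odot>\<^bsub>OMap P c\<^esub> z \<in> elems P c" using vs_smult_closed[OF psh_vspace[OF P g(3)] g(4)] .
      fix a b x y f assume q: "(a, b, x, y, f) \<in> day_gens A M N d"
      show "w e d c (r \<odot>\<^bsub>OMap P c\<^esub> z) g (a, b, x, y, f) =
          r \<odot>\<^bsub>OMap (D M (D N P)) e\<^esub> L e d c z g (E M N d (a, b, x, y, f))"
        unfolding Lg(2)[OF q] using q s by (simp add: w_def reli)
    qed
    show "L e d c z (Scal A r g) p = r \<odot>\<^bsub>OMap (D M (D N P)) e\<^esub> L e d c z g p" for r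
    proof (rule Leq[OF g(1-4) _ linf_scale[OF vs Lg(1)] p])
      show "Scal A r g \<in> homset A e (d \<star> c)" using g by simp
      fix a b x y f assume q: "(a, b, x, y, f) \<in> day_gens A M N d"
      show "w e d c z (Scal A r g) (a, b, x, y, f) =
          r \<odot>\<^bsub>OMap (D M (D N P)) e\<^esub> L e d c z g (E M N d (a, b, x, y, f))"
        unfolding Lg(2)[OF q] using q s by (simp add: w_def)
    qed
  next
    fix u v p z g
    assume *: "u \<in> Arr A" "v \<in> Arr A" "p \<in> elems (D M N) (Tgt A u)" "z \<in> elems P (Tgt A v)" "g \<in> homset A e (Src A u \<star> Src A v)"
    have 1: "e \<in> Obj A" "Src A u \<in> Obj A" "Src A v \<in> Obj A" "act P v z \<in> elems P (Src A v)" "g \<in> homset A e (Src A u \<star> Src A v)"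
      using * e act_closed[OF P] by simp_all
    have 2: "e \<in> Obj A" "Tgt A u \<in> Obj A" "Tgt A v \<in> Obj A" "z \<in> elems P (Tgt A v)" "(u \<boxtimes> v) \<cdot> g \<in> homset A e (Tgt A u \<star> Tgt A v)"
      using * e by simp_all
    show "L e (Src A u) (Src A v) (act P v z) g (act (D M N) u p) = L e (Tgt A u) (Tgt A v) z ((u \<boxtimes> v) \<cdot> g) p"
    proof (rule Leq[OF 2 linf_comp[OF psh_linf[OF MN *(1)] L(1)[OF 1]] *(3), symmetric])
      fix a b x y f assume q: "(a, b, x, y, f) \<in> day_gens A M N (Tgt A u)"
      then have q': "(a, b, x, y, f \<cdot> u) \<in> day_gens A M N (Src A u)"
        and g: "a \<in> Obj A" "b \<in> Obj A" "x \<in> elems M a" "y \<in> elems N b" "f \<in> Arr A" "Src A f = Tgt A u" "Tgt A f = a \<star> b"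
        using * by simp_all
      have "w e (Src A u) (Src A v) (act P v z) g (a, b, x, y, f \<cdot> u) =
          E M (D N P) e (Src A (Idt A a), Src A (Idt A b \<boxtimes> v), act M (Idt A a) x,
            act (D N P) (Idt A b \<boxtimes> v) (E N P (b \<star> Tgt A v) (b, Tgt A v, y, z, Idt A (b \<star> Tgt A v))),
            ((f \<cdot> u) \<boxtimes> Idt A (Src A v)) \<cdot> g)"
        using push[of "Idt A b" v y z] g * by (simp add: w_def act_idt[OF M] act_idt[OF N])
      also have "\<dots> = E M (D N P) e (Tgt A (Idt A a), Tgt A (Idt A b \<boxtimes> v), x,
            E N P (b \<star> Tgt A v) (b, Tgt A v, y, z, Idt A (b \<star> Tgt A v)),
            (Idt A a \<boxtimes> (Idt A b \<boxtimes> v)) \<cdot> ((f \<cdot> u) \<boxtimes> Idt A (Src A v)) \<cdot> g)"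
        by (rule day_el_rel(8)[OF M NP e]) (use * g inner[of b "Tgt A v" y z] in simp_all)
      also have "(Idt A a \<boxtimes> (Idt A b \<boxtimes> v)) \<cdot> ((f \<cdot> u) \<boxtimes> Idt A (Src A v)) \<cdot> g = (f \<boxtimes> Idt A (Tgt A v)) \<cdot> (u \<boxtimes> v) \<cdot> g"
      proof -
        have "(Idt A a \<boxtimes> (Idt A b \<boxtimes> v)) \<cdot> ((f \<cdot> u) \<boxtimes> Idt A (Src A v)) \<cdot> g =
            ((Idt A (a \<star> b) \<boxtimes> v) \<cdot> ((f \<cdot> u) \<boxtimes> Idt A (Src A v))) \<cdot> g"
          using * g by (simp del: tarr_assoc add: tarr_assoc[symmetric])
        also have "(Idt A (a \<star> b) \<boxtimes> v) \<cdot> ((f \<cdot> u) \<boxtimes> Idt A (Src A v)) = (f \<boxtimes> Idt A (Tgt A v)) \<cdot> (u \<boxtimes> v)"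
          using * g by (subst (1 2) tarr_cmp) simp_all
        finally show ?thesis using * g by simp
      qed
      finally have "w e (Src A u) (Src A v) (act P v z) g (a, b, x, y, f \<cdot> u) = w e (Tgt A u) (Tgt A v) z ((u \<boxtimes> v) \<cdot> g) (a, b, x, y, f)"
        using * g by (simp add: w_def)
      then show "w e (Tgt A u) (Tgt A v) z ((u \<boxtimes> v) \<cdot> g) (a, b, x, y, f) =
          L e (Src A u) (Src A v) (act P v z) g (act (D M N) u (E M N (Tgt A u) (a, b, x, y, f)))"
        by (simp add: day_act(2)[OF M N *(1) q] L(2)[OF 1 q'])
    qed
  qed
  have nat: "W (Src A u) (d, c, p, z, g \<cdot> u) = act (D M (D N P)) u (W (Tgt A u) (d, c, p, z, g))"
    if u: "u \<in> Arr A" and q: "(d, c, p, z, g) \<in> day_gens A (D M N) P (Tgt A u)" for u d c p z g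
  proof -
    have 1: "Tgt A u \<in> Obj A" "d \<in> Obj A" "c \<in> Obj A" "z \<in> elems P c" "g \<in> homset A (Tgt A u) (d \<star> c)"
      and 2: "Src A u \<in> Obj A" "d \<in> Obj A" "c \<in> Obj A" "z \<in> elems P c" "g \<cdot> u \<in> homset A (Src A u) (d \<star> c)"
      and p: "p \<in> elems (D M N) d"
      using u q by simp_all
    show ?thesis unfolding W_def prod.case
    proof (rule Leq[OF 2 linf_comp[OF L(1)[OF 1] psh_linf[OF MNP u]] p])
      fix a b x y f assume q: "(a, b, x, y, f) \<in> day_gens A M N d"
      then show "w (Src A u) d c z (g \<cdot> u) (a, b, x, y, f) = act (D M (D N P)) u (L (Tgt A u) d c z g (E M N d (a, b, x, y, f)))"
        unfolding L(2)[OF 1 q] using 1 u by (simp add: w_def day_act(2)[OF M NP] inner)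
    qed
  qed
  let ?G = "\<lambda>e. {(d, c, (a, b, x, y, f), z, g). d \<in> Obj A \<and> c \<in> Obj A \<and> (a, b, x, y, f) \<in> day_gens A M N d \<and>
        z \<in> elems P c \<and> g \<in> homset A e (d \<star> c)}"
  let ?v = "\<lambda>e (d, c, q, z, g). (d, c, E M N d q, z, g)"
  let ?w' = "\<lambda>e (d, c, (a, b, x, y, f), z, g). E M (D N P) e
        (a, b \<star> c, x, E N P (b \<star> c) (b, c, y, z, Idt A (b \<star> c)), Assoc A a b c \<cdot> (f \<boxtimes> Idt A c) \<cdot> g)"
  have v: "?v e h \<in> day_gens A (D M N) P e \<and> W e (?v e h) = ?w' e h" if e: "e \<in> Obj A" and h: "h \<in> ?G e" for e h
  proof -
    obtain d c a b x y f z g where h': "h = (d, c, (a, b, x, y, f), z, g)" by (metis surj_pair)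
    then have 1: "d \<in> Obj A" "c \<in> Obj A" "(a, b, x, y, f) \<in> day_gens A M N d" "z \<in> elems P c" "g \<in> homset A e (d \<star> c)"
      using h by auto
    show ?thesis unfolding h' prod.case W_def
      using L(2)[OF e 1(1,2,4,5,3)] day_el_rel(1)[OF M N 1(1,3)] 1 by (simp add: w_def)
  qed
  \<comment> \<open>A class in the outer convolution is linear in its first slot, and that slot is
    determined linearly by inner generators; hence generators with a decomposed first slot determine
    every linear map.\<close>
  have span: "\<forall>T T'. linf (OMap (D (D M N) P) e) (OMap (D M (D N P)) e) T \<longrightarrow> linf (OMap (D (D M N) P) e) (OMap (D M (D N P)) e) T' \<longrightarrow>
      (\<forall>g\<in>?G e. T (E (D M N) P e (?v e g)) = T' (E (D M N) P e (?v e g))) \<longrightarrow>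
      (\<forall>h\<in>day_gens A (D M N) P e. T (E (D M N) P e h) = T' (E (D M N) P e h))" if e: "e \<in> Obj A" for e
  proof (intro allI impI ballI)
    fix T T' h
    assume T: "linf (OMap (D (D M N) P) e) (OMap (D M (D N P)) e) T" "linf (OMap (D (D M N) P) e) (OMap (D M (D N P)) e) T'"
      and eq: "\<forall>g\<in>?G e. T (E (D M N) P e (?v e g)) = T' (E (D M N) P e (?v e g))" and h: "h \<in> day_gens A (D M N) P e"
    obtain d c p z g where h': "h = (d, c, p, z, g)" by (metis surj_pair)
    then have 1: "d \<in> Obj A" "c \<in> Obj A" "g \<in> homset A e (d \<star> c)" "z \<in> elems P c" "p \<in> elems (D M N) d" using h by auto
    note lin = day_el_linf(1)[OF MN P e 1(1-4)]
    show "T (E (D M N) P e h) = T' (E (D M N) P e h)" unfolding h'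
    proof (rule day_span[OF M N 1(1) psh_vspace[OF MNP e] linf_comp[OF lin T(1)] linf_comp[OF lin T(2)] _ 1(5)])
      fix a b x y f assume "(a, b, x, y, f) \<in> day_gens A M N d"
      then show "T (E (D M N) P e (d, c, E M N d (a, b, x, y, f), z, g)) = T' (E (D M N) P e (d, c, E M N d (a, b, x, y, f), z, g))"
        using bspec[OF eq, of "(d, c, (a, b, x, y, f), z, g)"] 1 by simp
    qed
  qed
  note * = day_map[OF MN P MNP, where w = W and G = ?G and v = ?v and w' = ?w', folded day_assoc_def]
  show "presheaf_map A (day_assoc A M N P)" by (rule *(1); (rule Wm nat v span; assumption))
  show "app (day_assoc A M N P) e (E (D M N) P e (d, c, E M N d (a, b, x, y, f), z, g)) =
      E M (D N P) e (a, b \<star> c, x, E N P (b \<star> c) (b, c, y, z, Idt A (b \<star> c)), (f \<boxtimes> Idt A c) \<cdot> g)"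
    if e: "e \<in> Obj A" and q: "(a, b, x, y, f) \<in> day_gens A M N d" and d: "d \<in> Obj A" "c \<in> Obj A" "z \<in> elems P c"
      "g \<in> homset A e (d \<star> c)"
  proof -
    have "app (day_assoc A M N P) e (E (D M N) P e (d, c, E M N d (a, b, x, y, f), z, g)) = W e (d, c, E M N d (a, b, x, y, f), z, g)"
      by (rule *(2); (rule Wm nat v span e; assumption?)?) (use day_el_rel(1)[OF M N d(1) q] d in simp)
    then show ?thesis unfolding W_def prod.case L(2)[OF e d q] by (simp add: w_def)
  qed
qed

end


section \<open>Weighted colimits\<close>

text \<open>Equivalently a map of presheaves from \<open>M\<close> to the presheaf of arrows from
  \<open>ko -\<close> to \<open>z\<close>. The diagram is given by two bare functions rather than by
  a functor, so that it can be tensored with fixed objects or evaluated at an object without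
  packaging the result.\<close>

definition wcocone ::
  "('o, 'm, 'k::field, 'y) kcat_scheme \<Rightarrow> ('p, 'n, 'k, 'z) kcat_scheme \<Rightarrow> ('o \<Rightarrow> 'p) \<Rightarrow> ('m \<Rightarrow> 'n) \<Rightarrow>
   ('o, 'm, 'k, 'v) psh \<Rightarrow> 'p \<Rightarrow> ('o \<Rightarrow> 'v \<Rightarrow> 'n) \<Rightarrow> bool" where
  "wcocone A B ko ka M z \<theta> \<longleftrightarrow> z \<in> Obj B \<and>
     (\<forall>a\<in>Obj A. linf (OMap M a) (hom_space B (ko a) z) (\<theta> a)) \<and>
     (\<forall>u\<in>Arr A. \<forall>x\<in>elems M (Tgt A u). \<theta> (Src A u) (act M u x) = Cmp B (\<theta> (Tgt A u) x) (ka u))"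

definition wcolim ::
  "('o, 'm, 'k::field, 'y) kcat_scheme \<Rightarrow> ('p, 'n, 'k, 'z) kcat_scheme \<Rightarrow> ('o \<Rightarrow> 'p) \<Rightarrow> ('m \<Rightarrow> 'n) \<Rightarrow>
   ('o, 'm, 'k, 'v) psh \<Rightarrow> 'p \<Rightarrow> ('o \<Rightarrow> 'v \<Rightarrow> 'n) \<Rightarrow> bool" where
  "wcolim A B ko ka M z \<theta> \<longleftrightarrow> wcocone A B ko ka M z \<theta> \<and>
     (\<forall>z' \<theta>'. wcocone A B ko ka M z' \<theta>' \<longrightarrow>
        (\<exists>!h. h \<in> homset B z z' \<and> (\<forall>a\<in>Obj A. \<forall>x\<in>elems M a. Cmp B h (\<theta> a x) = \<theta>' a x)))"

lemma wcoconeI: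
  assumes "z \<in> Obj B"
    and "\<And>a. a \<in> Obj A \<Longrightarrow> linf (OMap M a) (hom_space B (ko a) z) (\<theta> a)"
    and "\<And>u x. u \<in> Arr A \<Longrightarrow> x \<in> elems M (Tgt A u) \<Longrightarrow> \<theta> (Src A u) (act M u x) = Cmp B (\<theta> (Tgt A u) x) (ka u)"
  shows "wcocone A B ko ka M z \<theta>"
  using assms by (simp add: wcocone_def)

lemma wcoconeD:
  assumes "wcocone A B ko ka M z \<theta>"
  shows "z \<in> Obj B"
    and "a \<in> Obj A \<Longrightarrow> linf (OMap M a) (hom_space B (ko a) z) (\<theta> a)"
    and "u \<in> Arr A \<Longrightarrow> x \<in> elems M (Tgt A u) \<Longrightarrow> \<theta> (Src A u) (act M u x) = Cmp B (\<theta> (Tgt A u) x) (ka u)"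
  using assms by (simp_all add: wcocone_def)

lemma wcoconeD':
  assumes "wcocone A B ko ka M z \<theta>" "a \<in> Obj A" "x \<in> elems M a"
  shows "\<theta> a x \<in> Arr B" "Src B (\<theta> a x) = ko a" "Tgt B (\<theta> a x) = z"
    and "y \<in> elems M a \<Longrightarrow> \<theta> a (x \<oplus>\<^bsub>OMap M a\<^esub> y) = Plus B (\<theta> a x) (\<theta> a y)"
    and "\<theta> a (s \<odot>\<^bsub>OMap M a\<^esub> x) = Scal B s (\<theta> a x)"
  using linf_closed[OF wcoconeD(2)[OF assms(1,2)] assms(3)] linf_add[OF wcoconeD(2)[OF assms(1,2)] assms(3)]
    linf_smult[OF wcoconeD(2)[OF assms(1,2)] assms(3)] by auto

lemma wcolim_cocone: "wcolim A B ko ka M z \<theta> \<Longrightarrow> wcocone A B ko ka M z \<theta>"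
  by (simp add: wcolim_def)

lemma wcolim_factor:
  assumes "wcolim A B ko ka M z \<theta>" "wcocone A B ko ka M z' \<theta>'"
  shows "\<exists>!h. h \<in> homset B z z' \<and> (\<forall>a\<in>Obj A. \<forall>x\<in>elems M a. Cmp B h (\<theta> a x) = \<theta>' a x)"
  using assms unfolding wcolim_def by blast

lemma wcocone_cong:
  assumes "\<And>a. a \<in> Obj A \<Longrightarrow> ko a = ko' a" "\<And>u. u \<in> Arr A \<Longrightarrow> ka u = ka' u"
    and "\<And>a x. a \<in> Obj A \<Longrightarrow> x \<in> elems M a \<Longrightarrow> \<theta> a x = \<theta>' a x"
    and "klinear_category A" "presheaf A M"
  shows "wcocone A B ko ka M z \<theta> \<longleftrightarrow> wcocone A B ko' ka' M z \<theta>'"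
proof -
  interpret A: klinear_category A by fact
  have "linf (OMap M a) (hom_space B (ko a) z) (\<theta> a) \<longleftrightarrow> linf (OMap M a) (hom_space B (ko' a) z) (\<theta>' a)" if "a \<in> Obj A" for a
    using linf_cong[OF _ A.psh_vspace[OF assms(5) that], of "hom_space B (ko a) z" "\<theta> a" "\<theta>' a"]
      linf_cong[OF _ A.psh_vspace[OF assms(5) that], of "hom_space B (ko a) z" "\<theta>' a" "\<theta> a"] assms(1,3)[OF that] by auto
  then show ?thesis unfolding wcocone_def using assms(2,3) by (simp add: A.act_closed[OF assms(5)])
qed

text \<open>Needed to simplify a colimit in which a tensor factor is the unit or an endofunctor is
  evaluated: the equations used there hold for objects and arrows of the category, not as identities
  of functions.\<close>

lemma wcolim_cong:
  assumes "wcolim A B ko ka M z \<theta>"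
    and "\<And>a. a \<in> Obj A \<Longrightarrow> ko a = ko' a" "\<And>u. u \<in> Arr A \<Longrightarrow> ka u = ka' u"
    and "\<And>a x. a \<in> Obj A \<Longrightarrow> x \<in> elems M a \<Longrightarrow> \<theta> a x = \<theta>' a x"
    and A: "klinear_category A" "presheaf A M"
  shows "wcolim A B ko' ka' M z \<theta>'"
proof -
  have 1: "wcocone A B ko ka M z' \<theta>'' \<longleftrightarrow> wcocone A B ko' ka' M z' \<theta>''" for z' \<theta>''
    by (rule wcocone_cong) (use assms in auto)
  have 2: "wcocone A B ko' ka' M z \<theta> \<longleftrightarrow> wcocone A B ko' ka' M z \<theta>'"
    by (rule wcocone_cong) (use assms in auto)
  show ?thesis using assms(1) unfolding wcolim_def 1 2 by (simp add: assms(4))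
qed

text \<open>The legs of a colimit are jointly epic: composing them with \<open>f\<close> gives a
  cocone, and both \<open>f\<close> and \<open>g\<close> are factorisations of it.\<close>

lemma wcolim_epi:
  assumes B: "klinear_category B" and c: "wcolim A B ko ka M z \<theta>" and ka: "\<And>u. u \<in> Arr A \<Longrightarrow> ka u \<in> homset B (ko (Src A u)) (ko (Tgt A u))"
    and A: "klinear_category A"
    and fg: "f \<in> homset B z z'" "g \<in> homset B z z'"
    and eq: "\<And>a x. a \<in> Obj A \<Longrightarrow> x \<in> elems M a \<Longrightarrow> Cmp B f (\<theta> a x) = Cmp B g (\<theta> a x)"
  shows "f = g"
proof -
  interpret B: klinear_category B by fact
  interpret A: klinear_category A by fact
  note t = wcoconeD'[OF wcolim_cocone[OF c]]
  have "wcocone A B ko ka M z' (\<lambda>a x. Cmp B f (\<theta> a x))"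
  proof (rule wcoconeI)
    show "linf (OMap M a) (hom_space B (ko a) z') (\<lambda>x. Cmp B f (\<theta> a x))" if "a \<in> Obj A" for a
      using that t[OF that] fg by (auto simp: linf_def B.cmp_linear)
    show "Cmp B f (\<theta> (Src A u) (act M u x)) = Cmp B (Cmp B f (\<theta> (Tgt A u) x)) (ka u)"
      if "u \<in> Arr A" "x \<in> elems M (Tgt A u)" for u x
      using that ka[OF that(1)] wcoconeD(3)[OF wcolim_cocone[OF c] that] t[of "Tgt A u" x] fg by simp
  qed (use fg in auto)
  from wcolim_factor[OF c this] show ?thesis using fg eq by metis
qed


section \<open>The functor induced on presheaves\<close>

lemma day_cat_simps [simp]:
  "M \<in> Obj (day_cat A) \<longleftrightarrow> presheaf A M" "\<sigma> \<in> Arr (day_cat A) \<longleftrightarrow> presheaf_map A \<sigma>"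
  "Src (day_cat A) = NSrc" "Tgt (day_cat A) = NTgt" "TObj (day_cat A) = day A" "TArr (day_cat A) = day_arr A"
  "One (day_cat A) = yoneda A (One A)" "Assoc (day_cat A) = day_assoc A"
  "LUnit (day_cat A) = day_lunit A" "RUnit (day_cat A) = day_runit A"
  by (simp_all add: day_cat_def kcat.defs moncat.defs functor_cat_def presheaf_def presheaf_map_def)

lemma day_cat_arr [simp]:
  "NSrc (Idt (day_cat A) M) = M" "NTgt (Idt (day_cat A) M) = M"
  "c \<in> Obj A \<Longrightarrow> NAt (Idt (day_cat A) M) c = Idt vect_cat (OMap M c)"
  "NSrc (Cmp (day_cat A) \<tau> \<sigma>) = NSrc \<sigma>" "NTgt (Cmp (day_cat A) \<tau> \<sigma>) = NTgt \<tau>"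
  "c \<in> Obj A \<Longrightarrow> NAt (Cmp (day_cat A) \<tau> \<sigma>) c = Cmp vect_cat (NAt \<tau> c) (NAt \<sigma> c)"
  "NSrc (Plus (day_cat A) \<sigma> \<tau>) = NSrc \<sigma>" "NTgt (Plus (day_cat A) \<sigma> \<tau>) = NTgt \<sigma>"
  "c \<in> Obj A \<Longrightarrow> NAt (Plus (day_cat A) \<sigma> \<tau>) c = Plus vect_cat (NAt \<sigma> c) (NAt \<tau> c)"
  "NSrc (Scal (day_cat A) s \<sigma>) = NSrc \<sigma>" "NTgt (Scal (day_cat A) s \<sigma>) = NTgt \<sigma>"
  "c \<in> Obj A \<Longrightarrow> NAt (Scal (day_cat A) s \<sigma>) c = Scal vect_cat s (NAt \<sigma> c)"
  "NAt (Idt (day_cat A) M) \<in> extensional (Obj A)" "NAt (Cmp (day_cat A) \<tau> \<sigma>) \<in> extensional (Obj A)"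
  "NAt (Plus (day_cat A) \<sigma> \<tau>) \<in> extensional (Obj A)" "NAt (Scal (day_cat A) s \<sigma>) \<in> extensional (Obj A)"
  by (simp_all add: day_cat_def kcat.defs moncat.defs functor_cat_def op_cat_def)

lemma vect_hom:
  assumes "S \<in> homset vect_cat V W"
  shows "T \<in> homset vect_cat U V \<Longrightarrow> Cmp vect_cat S T \<in> homset vect_cat U W"
    and "T \<in> homset vect_cat V W \<Longrightarrow> Plus vect_cat S T \<in> homset vect_cat V W"
    and "Scal vect_cat s S \<in> homset vect_cat V W"
    and "vspace U \<Longrightarrow> Idt vect_cat U \<in> homset vect_cat U U"
proof -
  note S = assms[unfolded homset_vect]
  show "Cmp vect_cat S T \<in> homset vect_cat U W" if "T \<in> homset vect_cat U V"
    using S that linf_cong[OF linf_comp[of U V "LFun T" W "LFun S"], of "compose (carrier U) (LFun S) (LFun T)"]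
    by (simp add: homset_vect compose_eq compose_extensional del: in_homset)
  show "Plus vect_cat S T \<in> homset vect_cat V W" if "T \<in> homset vect_cat V W"
    using S that linf_cong[OF linf_plus[of W V "LFun S" "LFun T"], of "\<lambda>x\<in>carrier V. LFun S x \<oplus>\<^bsub>W\<^esub> LFun T x"]
    by (simp add: homset_vect del: in_homset)
  show "Scal vect_cat s S \<in> homset vect_cat V W"
    using S linf_cong[OF linf_scale[of W V "LFun S" s], of "\<lambda>x\<in>carrier V. s \<odot>\<^bsub>W\<^esub> LFun S x"]
    by (simp add: homset_vect del: in_homset)
  show "Idt vect_cat U \<in> homset vect_cat U U" if "vspace U"
    using that vs_closed[OF that] by (simp add: homset_vect linf_def del: in_homset)
qed

lemma day_idt:
  fixes M :: "('o, 'm, 'k::field, 'v) psh" and A :: "('o, 'm, 'k, 'z) moncat_scheme"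
  assumes M: "presheaf A M" and A: "klinear_category A"
  shows "presheaf_map A (Idt (day_cat A) M)"
proof -
  interpret A: klinear_category A by fact
  show ?thesis
    by (rule A.presheaf_mapI)
      (use M A.psh_vspace[OF M] in \<open>simp_all add: vect_hom(4)[OF A.psh_hom[OF M A.idt_arr(1)]] A.act_closed del: in_homset\<close>)
qed

lemma
  fixes \<sigma> \<tau> :: "('o, 'm, 'k::field, 'v) psh_map" and A :: "('o, 'm, 'k, 'z) moncat_scheme"
  assumes A: "klinear_category A" and \<sigma>: "presheaf_map A \<sigma>"
  shows day_cmp: "presheaf_map A \<tau> \<Longrightarrow> NSrc \<tau> = NTgt \<sigma> \<Longrightarrow> presheaf_map A (Cmp (day_cat A) \<tau> \<sigma>)"
    and day_plus: "presheaf_map A \<tau> \<Longrightarrow> NSrc \<tau> = NSrc \<sigma> \<Longrightarrow> NTgt \<tau> = NTgt \<sigma> \<Longrightarrow> presheaf_map A (Plus (day_cat A) \<sigma> \<tau>)"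
    and day_scal: "presheaf_map A (Scal (day_cat A) s \<sigma>)"
    and app_cmp: "presheaf_map A \<tau> \<Longrightarrow> NSrc \<tau> = NTgt \<sigma> \<Longrightarrow> a \<in> Obj A \<Longrightarrow> x \<in> elems (NSrc \<sigma>) a \<Longrightarrow>
      app (Cmp (day_cat A) \<tau> \<sigma>) a x = app \<tau> a (app \<sigma> a x)"
    and app_plus: "presheaf_map A \<tau> \<Longrightarrow> NSrc \<tau> = NSrc \<sigma> \<Longrightarrow> NTgt \<tau> = NTgt \<sigma> \<Longrightarrow> a \<in> Obj A \<Longrightarrow> x \<in> elems (NSrc \<sigma>) a \<Longrightarrow>
      app (Plus (day_cat A) \<sigma> \<tau>) a x = app \<sigma> a x \<oplus>\<^bsub>OMap (NTgt \<sigma>) a\<^esub> app \<tau> a x"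
    and app_scal: "a \<in> Obj A \<Longrightarrow> x \<in> elems (NSrc \<sigma>) a \<Longrightarrow>
      app (Scal (day_cat A) s \<sigma>) a x = s \<odot>\<^bsub>OMap (NTgt \<sigma>) a\<^esub> app \<sigma> a x"
proof -
  interpret A: klinear_category A by fact
  note st = A.psh_map_arr[OF \<sigma>] and psh = A.psh_map_psh[OF \<sigma>] and hom = A.psh_map_hom[OF \<sigma>] and nat = A.app_act[OF \<sigma>]
    and cl = A.app_closed[OF \<sigma>]
  note simps = st A.act_closed[OF psh(1)] nat cl
  show cm: "app (Cmp (day_cat A) \<tau> \<sigma>) a x = app \<tau> a (app \<sigma> a x)"
    if "presheaf_map A \<tau>" "NSrc \<tau> = NTgt \<sigma>" "a \<in> Obj A" "x \<in> elems (NSrc \<sigma>) a" for a x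
    using that by (simp add: st compose_def)
  show pl: "app (Plus (day_cat A) \<sigma> \<tau>) a x = app \<sigma> a x \<oplus>\<^bsub>OMap (NTgt \<sigma>) a\<^esub> app \<tau> a x"
    if "presheaf_map A \<tau>" "NSrc \<tau> = NSrc \<sigma>" "NTgt \<tau> = NTgt \<sigma>" "a \<in> Obj A" "x \<in> elems (NSrc \<sigma>) a" for a x
    using that by (simp add: st)
  show sc: "app (Scal (day_cat A) s \<sigma>) a x = s \<odot>\<^bsub>OMap (NTgt \<sigma>) a\<^esub> app \<sigma> a x"
    if "a \<in> Obj A" "x \<in> elems (NSrc \<sigma>) a" for a x
    using that by (simp add: st)
  show "presheaf_map A (Cmp (day_cat A) \<tau> \<sigma>)" if \<tau>: "presheaf_map A \<tau>" "NSrc \<tau> = NTgt \<sigma>"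
  proof (rule A.presheaf_mapI, unfold day_cat_arr(4,5))
    fix a assume a: "a \<in> Obj A"
    show "NAt (Cmp (day_cat A) \<tau> \<sigma>) a \<in> homset vect_cat (OMap (NSrc \<sigma>) a) (OMap (NTgt \<tau>) a)"
      using vect_hom(1)[OF A.psh_map_hom[OF \<tau>(1) a], unfolded \<tau>(2), OF hom[OF a]] a by (simp del: in_homset)
  next
    fix u x assume u: "u \<in> Arr A" "x \<in> elems (NSrc \<sigma>) (Tgt A u)"
    then show "app (Cmp (day_cat A) \<tau> \<sigma>) (Src A u) (act (NSrc \<sigma>) u x) = act (NTgt \<tau>) u (app (Cmp (day_cat A) \<tau> \<sigma>) (Tgt A u) x)"
      using A.app_act[OF \<tau>(1) u(1), of "app \<sigma> (Tgt A u) x"] by (simp add: cm[OF \<tau>] simps \<tau> del: day_cat_arr)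
  qed (use psh A.psh_map_psh[OF \<tau>(1)] in simp_all)
  show "presheaf_map A (Plus (day_cat A) \<sigma> \<tau>)" if \<tau>: "presheaf_map A \<tau>" "NSrc \<tau> = NSrc \<sigma>" "NTgt \<tau> = NTgt \<sigma>"
  proof (rule A.presheaf_mapI, unfold day_cat_arr(7,8))
    fix a assume a: "a \<in> Obj A"
    show "NAt (Plus (day_cat A) \<sigma> \<tau>) a \<in> homset vect_cat (OMap (NSrc \<sigma>) a) (OMap (NTgt \<sigma>) a)"
      using vect_hom(2)[OF hom[OF a] A.psh_map_hom[OF \<tau>(1) a, unfolded \<tau>]] a by (simp del: in_homset)
  next
    fix u x assume u: "u \<in> Arr A" "x \<in> elems (NSrc \<sigma>) (Tgt A u)"
    then show "app (Plus (day_cat A) \<sigma> \<tau>) (Src A u) (act (NSrc \<sigma>) u x) = act (NTgt \<sigma>) u (app (Plus (day_cat A) \<sigma> \<tau>) (Tgt A u) x)"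
      using A.app_act[OF \<tau>(1) u(1), of x] A.app_closed[OF \<tau>(1), of "Tgt A u" x]
        A.act_add[OF psh(2) u(1), of "app \<sigma> (Tgt A u) x" "app \<tau> (Tgt A u) x"]
      by (simp add: pl[OF \<tau>] simps \<tau> del: day_cat_arr)
  qed (use psh in simp_all)
  show "presheaf_map A (Scal (day_cat A) s \<sigma>)"
  proof (rule A.presheaf_mapI, unfold day_cat_arr(10,11))
    fix a assume a: "a \<in> Obj A"
    show "NAt (Scal (day_cat A) s \<sigma>) a \<in> homset vect_cat (OMap (NSrc \<sigma>) a) (OMap (NTgt \<sigma>) a)"
      using vect_hom(3)[OF hom[OF a]] a by (simp del: in_homset)
  next
    fix u x assume u: "u \<in> Arr A" "x \<in> elems (NSrc \<sigma>) (Tgt A u)"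
    then show "app (Scal (day_cat A) s \<sigma>) (Src A u) (act (NSrc \<sigma>) u x) = act (NTgt \<sigma>) u (app (Scal (day_cat A) s \<sigma>) (Tgt A u) x)"
      using A.act_smult[OF psh(2) u(1), of "app \<sigma> (Tgt A u) x" s] by (simp add: sc simps del: day_cat_arr)
  qed (use psh in simp_all)
qed


text \<open>For each presheaf \<open>M\<close>, the object \<open>F M\<close> with the legs
  \<open>th M\<close> is the colimit of \<open>G\<close> weighted by \<open>M\<close>. The
  assumption \<open>colim\<close> makes it stable under tensoring with some \<open>G n\<close> on
  the left and, at the same time, with any object on the right. The left factor is restricted to
  values of \<open>G\<close>, which is all that can be said about composition with endofunctors
  here.\<close>

locale cas = small_monoidal A U + B: strict_monoidal B
  for A :: "('o, 'm, 'k::field, 'z) moncat_scheme" (structure) and U :: "'v itself"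
    and B :: "('p, 'n, 'k, 'y) moncat_scheme" +
  fixes G :: "('o, 'm, 'p, 'n) ftor" and F :: "('o, 'm, 'k, 'v) psh \<Rightarrow> 'p"
    and th :: "('o, 'm, 'k, 'v) psh \<Rightarrow> 'o \<Rightarrow> 'v \<Rightarrow> 'n"
  assumes G: "klinear_functor A B G"
    and G_tobj [simp]: "a \<in> Obj A \<Longrightarrow> b \<in> Obj A \<Longrightarrow> OMap G (a \<star> b) = OMap G a \<star>\<^bsub>B\<^esub> OMap G b"
    and G_tarr: "f \<in> Arr A \<Longrightarrow> g \<in> Arr A \<Longrightarrow> AMap G (f \<boxtimes> g) = AMap G f \<boxtimes>\<^bsub>B\<^esub> AMap G g"
    and G_one [simp]: "OMap G (One A) = One B"
    and F_obj [simp]: "presheaf A M \<Longrightarrow> F M \<in> Obj B"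
    and th_hom: "presheaf A M \<Longrightarrow> a \<in> Obj A \<Longrightarrow> x \<in> elems M a \<Longrightarrow> th M a x \<in> homset B (OMap G a) (F M)"
    and colim: "presheaf A M \<Longrightarrow> n \<in> Obj A \<Longrightarrow> Z \<in> Obj B \<Longrightarrow>
      wcolim A B (\<lambda>a. OMap G n \<star>\<^bsub>B\<^esub> (OMap G a \<star>\<^bsub>B\<^esub> Z)) (\<lambda>u. Idt B (OMap G n) \<boxtimes>\<^bsub>B\<^esub> (AMap G u \<boxtimes>\<^bsub>B\<^esub> Idt B Z)) M
        (OMap G n \<star>\<^bsub>B\<^esub> (F M \<star>\<^bsub>B\<^esub> Z)) (\<lambda>a x. Idt B (OMap G n) \<boxtimes>\<^bsub>B\<^esub> (th M a x \<boxtimes>\<^bsub>B\<^esub> Idt B Z))"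
begin

abbreviation comp (infixr "\<bullet>" 70) where "g \<bullet> f \<equiv> Cmp B g f"
abbreviation tens (infixr "\<diamondop>" 75) where "f \<diamondop> g \<equiv> TArr B f g"
abbreviation tobj (infixr "\<otimes>\<otimes>" 75) where "a \<otimes>\<otimes> b \<equiv> TObj B a b"
abbreviation Go where "Go \<equiv> OMap G"
abbreviation Ga where "Ga \<equiv> AMap G"
abbreviation I where "I \<equiv> Idt B"

lemma G_simps [simp]:
  "a \<in> Obj A \<Longrightarrow> Go a \<in> Obj B" "a \<in> Obj A \<Longrightarrow> Ga (Idt A a) = I (Go a)"
  "f \<in> Arr A \<Longrightarrow> Ga f \<in> Arr B" "f \<in> Arr A \<Longrightarrow> Src B (Ga f) = Go (Src A f)" "f \<in> Arr A \<Longrightarrow> Tgt B (Ga f) = Go (Tgt A f)"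
  "f \<in> Arr A \<Longrightarrow> g \<in> Arr A \<Longrightarrow> Src A g = Tgt A f \<Longrightarrow> Ga (g \<cdot> f) = Ga g \<bullet> Ga f"
  using klinear_functorD[OF G] by auto

lemma G_linear:
  "f \<in> Arr A \<Longrightarrow> g \<in> Arr A \<Longrightarrow> Src A g = Src A f \<Longrightarrow> Tgt A g = Tgt A f \<Longrightarrow> Ga (Plus A f g) = Plus B (Ga f) (Ga g)"
  "f \<in> Arr A \<Longrightarrow> Ga (Scal A s f) = Scal B s (Ga f)"
  using klinear_functorD[OF G] by auto

lemma th_simps [simp]:
  assumes "presheaf A M" "a \<in> Obj A" "x \<in> elems M a"
  shows "th M a x \<in> Arr B" "Src B (th M a x) = Go a" "Tgt B (th M a x) = F M"
  using th_hom[OF assms] by auto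

lemmas klin = klinear_category_axioms B.klinear_category_axioms

lemma colim_right:
  assumes "presheaf A M" "n \<in> Obj A"
  shows "wcolim A B (\<lambda>a. Go n \<otimes>\<otimes> Go a) (\<lambda>u. I (Go n) \<diamondop> Ga u) M (Go n \<otimes>\<otimes> F M) (\<lambda>a x. I (Go n) \<diamondop> th M a x)"
  using wcolim_cong[OF colim[OF assms, of "One B"], of "\<lambda>a. Go n \<otimes>\<otimes> Go a" "\<lambda>u. I (Go n) \<diamondop> Ga u" "\<lambda>a x. I (Go n) \<diamondop> th M a x"]
    assms klin by simp

lemma colim_left:
  assumes "presheaf A M" "Z \<in> Obj B"
  shows "wcolim A B (\<lambda>a. Go a \<otimes>\<otimes> Z) (\<lambda>u. Ga u \<diamondop> I Z) M (F M \<otimes>\<otimes> Z) (\<lambda>a x. th M a x \<diamondop> I Z)"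
  using wcolim_cong[OF colim[OF assms(1) one assms(2)], of "\<lambda>a. Go a \<otimes>\<otimes> Z" "\<lambda>u. Ga u \<diamondop> I Z" "\<lambda>a x. th M a x \<diamondop> I Z"]
    assms klin by simp

lemma colim1: "presheaf A M \<Longrightarrow> wcolim A B Go Ga M (F M) (th M)"
  using wcolim_cong[OF colim_left[of M "One B"], of Go Ga "th M"] klin by simp

lemmas th_cocone = wcolim_cocone[OF colim1]

lemma th_add: "presheaf A M \<Longrightarrow> a \<in> Obj A \<Longrightarrow> x \<in> elems M a \<Longrightarrow> y \<in> elems M a \<Longrightarrow>
    th M a (x \<oplus>\<^bsub>OMap M a\<^esub> y) = Plus B (th M a x) (th M a y)"
  by (rule wcoconeD'(4)[OF th_cocone])

lemma th_smult: "presheaf A M \<Longrightarrow> a \<in> Obj A \<Longrightarrow> x \<in> elems M a \<Longrightarrow> th M a (s \<odot>\<^bsub>OMap M a\<^esub> x) = Scal B s (th M a x)"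
  by (rule wcoconeD'(5)[OF th_cocone])

lemma th_act: "presheaf A M \<Longrightarrow> u \<in> Arr A \<Longrightarrow> x \<in> elems M (Tgt A u) \<Longrightarrow> th M (Src A u) (act M u x) = th M (Tgt A u) x \<bullet> Ga u"
  by (rule wcoconeD(3)[OF th_cocone])

lemma epi_gen:
  assumes M: "presheaf A M" "n \<in> Obj A" "Z \<in> Obj B"
    and fg: "f \<in> homset B (Go n \<otimes>\<otimes> (F M \<otimes>\<otimes> Z)) W" "g \<in> homset B (Go n \<otimes>\<otimes> (F M \<otimes>\<otimes> Z)) W"
    and eq: "\<And>a x. a \<in> Obj A \<Longrightarrow> x \<in> elems M a \<Longrightarrow> f \<bullet> (I (Go n) \<diamondop> (th M a x \<diamondop> I Z)) = g \<bullet> (I (Go n) \<diamondop> (th M a x \<diamondop> I Z))"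
  shows "f = g"
  by (rule wcolim_epi[OF klin(2) colim[OF M] _ klin(1) fg]) (use M in simp, rule eq)

lemma epi_right:
  assumes "presheaf A M" "n \<in> Obj A" "f \<in> homset B (Go n \<otimes>\<otimes> F M) W" "g \<in> homset B (Go n \<otimes>\<otimes> F M) W"
    and "\<And>a x. a \<in> Obj A \<Longrightarrow> x \<in> elems M a \<Longrightarrow> f \<bullet> (I (Go n) \<diamondop> th M a x) = g \<bullet> (I (Go n) \<diamondop> th M a x)"
  shows "f = g"
  by (rule wcolim_epi[OF klin(2) colim_right[OF assms(1,2)] _ klin(1) assms(3,4)]) (use assms(2) in simp, rule assms(5))

lemma epi_left:
  assumes "presheaf A M" "Z \<in> Obj B" "f \<in> homset B (F M \<otimes>\<otimes> Z) W" "g \<in> homset B (F M \<otimes>\<otimes> Z) W"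
    and "\<And>a x. a \<in> Obj A \<Longrightarrow> x \<in> elems M a \<Longrightarrow> f \<bullet> (th M a x \<diamondop> I Z) = g \<bullet> (th M a x \<diamondop> I Z)"
  shows "f = g"
  by (rule wcolim_epi[OF klin(2) colim_left[OF assms(1,2)] _ klin(1) assms(3,4)]) (use assms(2) in simp, rule assms(5))

lemma epi1:
  assumes "presheaf A M" "f \<in> homset B (F M) W" "g \<in> homset B (F M) W"
    and "\<And>a x. a \<in> Obj A \<Longrightarrow> x \<in> elems M a \<Longrightarrow> f \<bullet> th M a x = g \<bullet> th M a x"
  shows "f = g"
  by (rule wcolim_epi[OF klin(2) colim1[OF assms(1)] _ klin(1) assms(2,3)]) (simp, rule assms(4))

text \<open>The order matters. The left factor is resolved first, with
  \<open>F N \<otimes>\<otimes> Z\<close> as the object on the right; then \<open>N\<close> is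
  resolved with \<open>Go a\<close> on the left, where \<open>colim\<close> applies. Resolving
  \<open>N\<close> first would put \<open>F M\<close> on the left.\<close>

lemma epi2:
  assumes M: "presheaf A M" and N: "presheaf A N" and Z: "Z \<in> Obj B"
    and fg: "f \<in> homset B (F M \<otimes>\<otimes> (F N \<otimes>\<otimes> Z)) W" "g \<in> homset B (F M \<otimes>\<otimes> (F N \<otimes>\<otimes> Z)) W"
    and eq: "\<And>a b x y. a \<in> Obj A \<Longrightarrow> b \<in> Obj A \<Longrightarrow> x \<in> elems M a \<Longrightarrow> y \<in> elems N b \<Longrightarrow>
      f \<bullet> (th M a x \<diamondop> (th N b y \<diamondop> I Z)) = g \<bullet> (th M a x \<diamondop> (th N b y \<diamondop> I Z))"
  shows "f = g"
proof (rule epi_left[OF M _ fg])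
  show "F N \<otimes>\<otimes> Z \<in> Obj B" using N Z by simp
  fix a x assume a: "a \<in> Obj A" "x \<in> elems M a"
  show "f \<bullet> (th M a x \<diamondop> I (F N \<otimes>\<otimes> Z)) = g \<bullet> (th M a x \<diamondop> I (F N \<otimes>\<otimes> Z))"
  proof (rule epi_gen[OF N a(1) Z])
    fix b y assume b: "b \<in> Obj A" "y \<in> elems N b"
    have "(th M a x \<diamondop> I (F N \<otimes>\<otimes> Z)) \<bullet> (I (Go a) \<diamondop> (th N b y \<diamondop> I Z)) = th M a x \<diamondop> (th N b y \<diamondop> I Z)"
      using M N Z a b by (subst B.tarr_cmp) simp_all
    then show "(f \<bullet> (th M a x \<diamondop> I (F N \<otimes>\<otimes> Z))) \<bullet> (I (Go a) \<diamondop> (th N b y \<diamondop> I Z)) =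
        (g \<bullet> (th M a x \<diamondop> I (F N \<otimes>\<otimes> Z))) \<bullet> (I (Go a) \<diamondop> (th N b y \<diamondop> I Z))"
      using M N Z a b fg eq[OF a(1) b(1) a(2) b(2)] by simp
  qed (use M N Z a fg in simp_all)
qed

lemma epi2':
  assumes M: "presheaf A M" and N: "presheaf A N"
    and fg: "f \<in> homset B (F M \<otimes>\<otimes> F N) W" "g \<in> homset B (F M \<otimes>\<otimes> F N) W"
    and eq: "\<And>a b x y. a \<in> Obj A \<Longrightarrow> b \<in> Obj A \<Longrightarrow> x \<in> elems M a \<Longrightarrow> y \<in> elems N b \<Longrightarrow>
      f \<bullet> (th M a x \<diamondop> th N b y) = g \<bullet> (th M a x \<diamondop> th N b y)"
  shows "f = g"
  by (rule epi2[OF M N B.one]) (use assms in simp_all)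

text \<open>Once two factors are resolved, the object to the left of \<open>F P\<close> is the
  product of \<open>Go a\<close> and \<open>Go b\<close>. It equals \<open>Go (a \<star> b)\<close>
  and is thus again a left factor of the kind that \<open>colim\<close> admits.\<close>

lemma epi3:
  assumes M: "presheaf A M" and N: "presheaf A N" and P: "presheaf A P"
    and fg: "f \<in> homset B (F M \<otimes>\<otimes> (F N \<otimes>\<otimes> F P)) W" "g \<in> homset B (F M \<otimes>\<otimes> (F N \<otimes>\<otimes> F P)) W"
    and eq: "\<And>a b c x y z. a \<in> Obj A \<Longrightarrow> b \<in> Obj A \<Longrightarrow> c \<in> Obj A \<Longrightarrow> x \<in> elems M a \<Longrightarrow> y \<in> elems N b \<Longrightarrow> z \<in> elems P c \<Longrightarrow>
      f \<bullet> (th M a x \<diamondop> (th N b y \<diamondop> th P c z)) = g \<bullet> (th M a x \<diamondop> (th N b y \<diamondop> th P c z))"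
  shows "f = g"
proof (rule epi2[OF M N F_obj[OF P] fg])
  fix a b x y assume a: "a \<in> Obj A" "b \<in> Obj A" "x \<in> elems M a" "y \<in> elems N b"
  show "f \<bullet> (th M a x \<diamondop> (th N b y \<diamondop> I (F P))) = g \<bullet> (th M a x \<diamondop> (th N b y \<diamondop> I (F P)))"
  proof (rule epi_right[OF P, of "a \<star> b"])
    fix c z assume c: "c \<in> Obj A" "z \<in> elems P c"
    have "(th M a x \<diamondop> (th N b y \<diamondop> I (F P))) \<bullet> (I (Go (a \<star> b)) \<diamondop> th P c z) =
        ((th M a x \<diamondop> th N b y) \<diamondop> I (F P)) \<bullet> (I (Go (a \<star> b)) \<diamondop> th P c z)"
      using M N P a c by simp
    also have "\<dots> = (th M a x \<diamondop> th N b y) \<diamondop> th P c z"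
      using M N P a c by (subst B.tarr_cmp) simp_all
    also have "\<dots> = th M a x \<diamondop> (th N b y \<diamondop> th P c z)"
      using M N P a c by simp
    finally show "(f \<bullet> (th M a x \<diamondop> (th N b y \<diamondop> I (F P)))) \<bullet> (I (Go (a \<star> b)) \<diamondop> th P c z) =
        (g \<bullet> (th M a x \<diamondop> (th N b y \<diamondop> I (F P)))) \<bullet> (I (Go (a \<star> b)) \<diamondop> th P c z)"
      using M N P a c fg eq by simp
  qed (use M N P a fg in simp_all)
qed

definition amap :: "('o, 'm, 'k, 'v) psh_map \<Rightarrow> 'n" where
  "amap \<sigma> = (THE h. h \<in> homset B (F (NSrc \<sigma>)) (F (NTgt \<sigma>)) \<and>
     (\<forall>a\<in>Obj A. \<forall>x\<in>elems (NSrc \<sigma>) a. h \<bullet> th (NSrc \<sigma>) a x = th (NTgt \<sigma>) a (app \<sigma> a x)))"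

definition CAS :: "(('o, 'm, 'k, 'v) psh, ('o, 'm, 'k, 'v) psh_map, 'p, 'n) ftor" where
  "CAS = \<lparr>OMap = (\<lambda>M\<in>Obj (day_cat A). F M), AMap = (\<lambda>\<sigma>\<in>Arr (day_cat A). amap \<sigma>)\<rparr>"

lemma CAS_simps [simp]: "presheaf A M \<Longrightarrow> OMap CAS M = F M" "presheaf_map A \<sigma> \<Longrightarrow> AMap CAS \<sigma> = amap \<sigma>"
  by (simp_all add: CAS_def)

context
  fixes \<sigma> :: "('o, 'm, 'k, 'v) psh_map"
  assumes \<sigma>: "presheaf_map A \<sigma>"
begin

lemma amap_prop:
  "amap \<sigma> \<in> homset B (F (NSrc \<sigma>)) (F (NTgt \<sigma>)) \<and>
     (\<forall>a\<in>Obj A. \<forall>x\<in>elems (NSrc \<sigma>) a. amap \<sigma> \<bullet> th (NSrc \<sigma>) a x = th (NTgt \<sigma>) a (app \<sigma> a x))"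
proof -
  note psh = psh_map_psh[OF \<sigma>] and cl = app_closed[OF \<sigma>]
  have "wcocone A B Go Ga (NSrc \<sigma>) (F (NTgt \<sigma>)) (\<lambda>a x. th (NTgt \<sigma>) a (app \<sigma> a x))"
  proof (rule wcoconeI)
    fix a assume "a \<in> Obj A"
    then show "linf (OMap (NSrc \<sigma>) a) (hom_space B (Go a) (F (NTgt \<sigma>))) (\<lambda>x. th (NTgt \<sigma>) a (app \<sigma> a x))"
      by (intro linf_comp[OF app_linf[OF \<sigma>] wcoconeD(2)[OF th_cocone[OF psh(2)]]])
  qed (use psh cl in \<open>simp_all add: app_act[OF \<sigma>] th_act\<close>)
  from wcolim_factor[OF colim1[OF psh(1)] this] show ?thesis unfolding amap_def by (rule theI')
qed

lemma amap_simps [simp]: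
  "amap \<sigma> \<in> Arr B" "Src B (amap \<sigma>) = F (NSrc \<sigma>)" "Tgt B (amap \<sigma>) = F (NTgt \<sigma>)"
  using amap_prop by auto

lemma amap_th: "a \<in> Obj A \<Longrightarrow> x \<in> elems (NSrc \<sigma>) a \<Longrightarrow> amap \<sigma> \<bullet> th (NSrc \<sigma>) a x = th (NTgt \<sigma>) a (app \<sigma> a x)"
  using amap_prop by blast

lemma amap_eqI:
  assumes "h \<in> homset B (F (NSrc \<sigma>)) (F (NTgt \<sigma>))"
    and "\<And>a x. a \<in> Obj A \<Longrightarrow> x \<in> elems (NSrc \<sigma>) a \<Longrightarrow> h \<bullet> th (NSrc \<sigma>) a x = th (NTgt \<sigma>) a (app \<sigma> a x)"
  shows "amap \<sigma> = h"
  by (rule epi1[OF psh_map_psh(1)[OF \<sigma>] _ assms(1)]) (simp_all add: amap_th assms(2))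

end

lemma amap_cmp:
  assumes \<sigma>: "presheaf_map A \<sigma>" and \<tau>: "presheaf_map A \<tau>" "NSrc \<tau> = NTgt \<sigma>"
  shows "amap (Cmp (day_cat A) \<tau> \<sigma>) = amap \<tau> \<bullet> amap \<sigma>"
proof (rule amap_eqI[OF day_cmp[OF klin(1) \<sigma> \<tau>]])
  fix a x assume "a \<in> Obj A" "x \<in> elems (NSrc (Cmp (day_cat A) \<tau> \<sigma>)) a"
  then show "(amap \<tau> \<bullet> amap \<sigma>) \<bullet> th (NSrc (Cmp (day_cat A) \<tau> \<sigma>)) a x =
      th (NTgt (Cmp (day_cat A) \<tau> \<sigma>)) a (app (Cmp (day_cat A) \<tau> \<sigma>) a x)"
    using \<tau> app_closed[OF \<sigma>, of a x] amap_th[OF \<tau>(1), of a "app \<sigma> a x"] psh_map_psh[OF \<sigma>]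
    by (simp add: \<sigma> amap_th[OF \<sigma>] app_cmp[OF klin(1) \<sigma> \<tau>] del: day_cat_arr(3,6,9,12))
qed (use \<sigma> \<tau> in simp)

text \<open>Each law is an equation between arrows out of a colimit and is tested on the legs, where
  it becomes the corresponding law for maps of presheaves together with the linearity of the
  legs.\<close>

lemma CAS_functor: "klinear_functor (day_cat A) B CAS"
proof (rule klinear_functorI)
  fix M :: "('o, 'm, 'k, 'v) psh" assume "M \<in> Obj (day_cat A)"
  then have M: "presheaf A M" by simp
  have "amap (Idt (day_cat A) M) = I (F M)"
    by (rule amap_eqI[OF day_idt[OF M klin(1)]]) (use M in simp_all)
  then show "AMap CAS (Idt (day_cat A) M) = I (OMap CAS M)" using M day_idt[OF M klin(1)] by simp
next
  fix \<sigma> \<tau> :: "('o, 'm, 'k, 'v) psh_map" assume "\<sigma> \<in> Arr (day_cat A)" "\<tau> \<in> Arr (day_cat A)" "Src (day_cat A) \<tau> = Tgt (day_cat A) \<sigma>"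
  then have *: "presheaf_map A \<sigma>" "presheaf_map A \<tau>" "NSrc \<tau> = NTgt \<sigma>" by simp_all
  then show "AMap CAS (Cmp (day_cat A) \<tau> \<sigma>) = AMap CAS \<tau> \<bullet> AMap CAS \<sigma>"
    using amap_cmp[OF *] day_cmp[OF klin(1) *] by simp
next
  fix \<sigma> \<tau> :: "('o, 'm, 'k, 'v) psh_map" assume "\<sigma> \<in> Arr (day_cat A)" "\<tau> \<in> Arr (day_cat A)" "Src (day_cat A) \<tau> = Src (day_cat A) \<sigma>" "Tgt (day_cat A) \<tau> = Tgt (day_cat A) \<sigma>"
  then have *: "presheaf_map A \<sigma>" "presheaf_map A \<tau>" "NSrc \<tau> = NSrc \<sigma>" "NTgt \<tau> = NTgt \<sigma>" by simp_all
  have "amap (Plus (day_cat A) \<sigma> \<tau>) = Plus B (amap \<sigma>) (amap \<tau>)"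
  proof (rule amap_eqI[OF day_plus[OF klin(1) *]])
    fix a x assume "a \<in> Obj A" "x \<in> elems (NSrc (Plus (day_cat A) \<sigma> \<tau>)) a"
    then show "Plus B (amap \<sigma>) (amap \<tau>) \<bullet> th (NSrc (Plus (day_cat A) \<sigma> \<tau>)) a x =
        th (NTgt (Plus (day_cat A) \<sigma> \<tau>)) a (app (Plus (day_cat A) \<sigma> \<tau>) a x)"
      using *(1,3,4) app_closed[OF *(1), of a x] app_closed[OF *(2), of a x] psh_map_psh[OF *(1)] amap_th[OF *(2), of a x]
        amap_simps[OF *(2)]
      by (simp add: amap_th B.cmp_linear th_add app_plus[OF klin(1) *] del: day_cat_arr(3,6,9,12))
  qed (use * in simp)
  then show "AMap CAS (Plus (day_cat A) \<sigma> \<tau>) = Plus B (AMap CAS \<sigma>) (AMap CAS \<tau>)"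
    using day_plus[OF klin(1) *] * by simp
next
  fix \<sigma> :: "('o, 'm, 'k, 'v) psh_map" and s assume "\<sigma> \<in> Arr (day_cat A)"
  then have *: "presheaf_map A \<sigma>" by simp
  have "amap (Scal (day_cat A) s \<sigma>) = Scal B s (amap \<sigma>)"
  proof (rule amap_eqI[OF day_scal[OF klin(1) *]])
    fix a x assume "a \<in> Obj A" "x \<in> elems (NSrc (Scal (day_cat A) s \<sigma>)) a"
    then show "Scal B s (amap \<sigma>) \<bullet> th (NSrc (Scal (day_cat A) s \<sigma>)) a x =
        th (NTgt (Scal (day_cat A) s \<sigma>)) a (app (Scal (day_cat A) s \<sigma>) a x)"
      using * app_closed[OF *, of a x] psh_map_psh[OF *]
      by (simp add: amap_th B.cmp_linear th_smult app_scal[OF klin(1) *] del: day_cat_arr(3,6,9,12))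
  qed (use * in simp)
  then show "AMap CAS (Scal (day_cat A) s \<sigma>) = Scal B s (AMap CAS \<sigma>)"
    using day_scal[OF klin(1) *] * by simp
qed (simp_all add: psh_map_psh, simp_all add: CAS_def)

section \<open>Compatibility with the tensor product\<close>

definition tau :: "('o, 'm, 'k, 'v) psh \<Rightarrow> ('o, 'm, 'k, 'v) psh \<Rightarrow> 'o \<Rightarrow> 'o \<Rightarrow> 'v \<Rightarrow> 'v \<Rightarrow> 'n" where
  "tau M N a b x y = th (D M N) (a \<star> b) (E M N (a \<star> b) (a, b, x, y, Idt A (a \<star> b)))"

definition phi :: "('o, 'm, 'k, 'v) psh \<Rightarrow> ('o, 'm, 'k, 'v) psh \<Rightarrow> 'n" where
  "phi M N = (THE h. h \<in> homset B (F M \<otimes>\<otimes> F N) (F (D M N)) \<and>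
     (\<forall>a\<in>Obj A. \<forall>b\<in>Obj A. \<forall>x\<in>elems M a. \<forall>y\<in>elems N b. h \<bullet> (th M a x \<diamondop> th N b y) = tau M N a b x y))"

definition phi0 :: 'n where
  "phi0 = th (yon (One A)) (One A) (code (One A) (One A) (Idt A (One A)))"

context
  fixes M N :: "('o, 'm, 'k, 'v) psh"
  assumes M: "presheaf A M" and N: "presheaf A N"
begin

lemma E_closed:
  "c \<in> Obj A \<Longrightarrow> a \<in> Obj A \<Longrightarrow> b \<in> Obj A \<Longrightarrow> x \<in> elems M a \<Longrightarrow> y \<in> elems N b \<Longrightarrow> f \<in> Arr A \<Longrightarrow> Src A f = c \<Longrightarrow>
    Tgt A f = a \<star> b \<Longrightarrow> E M N c (a, b, x, y, f) \<in> elems (D M N) c"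
  by (rule day_el_rel(1)[OF M N]) simp_all

text \<open>The generator with an arbitrary \<open>f\<close> is the restriction along
  \<open>f\<close> of the generator with the identity, so \<open>tau\<close> determines every leg at
  a generator.\<close>

lemma th_E:
  assumes "a \<in> Obj A" "b \<in> Obj A" "x \<in> elems M a" "y \<in> elems N b" "f \<in> Arr A" "Tgt A f = a \<star> b"
  shows "th (D M N) (Src A f) (E M N (Src A f) (a, b, x, y, f)) = tau M N a b x y \<bullet> Ga f"
  using day_act(2)[OF M N, of f a b x y "Idt A (a \<star> b)"]
    th_act[OF day_presheaf[OF M N], of f "E M N (a \<star> b) (a, b, x, y, Idt A (a \<star> b))"] assms
  by (simp add: tau_def E_closed)

lemma tau_simps [simp]:
  assumes "a \<in> Obj A" "b \<in> Obj A" "x \<in> elems M a" "y \<in> elems N b"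
  shows "tau M N a b x y \<in> Arr B" "Src B (tau M N a b x y) = Go a \<otimes>\<otimes> Go b" "Tgt B (tau M N a b x y) = F (D M N)"
  using assms day_presheaf[OF M N] by (simp_all add: tau_def E_closed)

lemma tau_bilinear:
  assumes "a \<in> Obj A" "b \<in> Obj A" "x \<in> elems M a" "y \<in> elems N b"
  shows "x' \<in> elems M a \<Longrightarrow> tau M N a b (x \<oplus>\<^bsub>OMap M a\<^esub> x') y = Plus B (tau M N a b x y) (tau M N a b x' y)"
    and "y' \<in> elems N b \<Longrightarrow> tau M N a b x (y \<oplus>\<^bsub>OMap N b\<^esub> y') = Plus B (tau M N a b x y) (tau M N a b x y')"
    and "tau M N a b (s \<odot>\<^bsub>OMap M a\<^esub> x) y = Scal B s (tau M N a b x y)"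
    and "tau M N a b x (s \<odot>\<^bsub>OMap N b\<^esub> y) = Scal B s (tau M N a b x y)"
  using assms day_presheaf[OF M N] day_el_rel[OF M N, of "a \<star> b"]
  by (simp_all add: tau_def th_add th_smult E_closed)

lemma tau_act:
  assumes "g \<in> Arr A" "h \<in> Arr A" "x \<in> elems M (Tgt A g)" "y \<in> elems N (Tgt A h)"
  shows "tau M N (Src A g) (Src A h) (act M g x) (act N h y) = tau M N (Tgt A g) (Tgt A h) x y \<bullet> (Ga g \<diamondop> Ga h)"
  using assms day_el_rel(8)[OF M N, of "Src A g \<star> Src A h" g h x y "Idt A (Src A g \<star> Src A h)"]
    th_E[of "Tgt A g" "Tgt A h" x y "g \<boxtimes> h"]
  by (simp add: tau_def[of _ _ "Src A g"] G_tarr)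

text \<open>The two colimits are used one after the other: the colimit for \<open>N\<close>,
  tensored with \<open>Go a\<close> on the left, gives a map for every vector \<open>x\<close> of
  \<open>M a\<close>; these maps form a cocone on \<open>M\<close> tensored with \<open>F N\<close>
  on the right.\<close>

lemma phi_ex: "\<exists>h. h \<in> homset B (F M \<otimes>\<otimes> F N) (F (D M N)) \<and>
     (\<forall>a\<in>Obj A. \<forall>b\<in>Obj A. \<forall>x\<in>elems M a. \<forall>y\<in>elems N b. h \<bullet> (th M a x \<diamondop> th N b y) = tau M N a b x y)"
proof -
  note MN = day_presheaf[OF M N]
  \<comment> \<open>What the wanted map must become after composition with
    \<open>th M a x \<diamondop> I (F N)\<close>.\<close>
  define \<psi> where "\<psi> a x = (THE h. h \<in> homset B (Go a \<otimes>\<otimes> F N) (F (D M N)) \<and>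
    (\<forall>b\<in>Obj A. \<forall>y\<in>elems N b. h \<bullet> (I (Go a) \<diamondop> th N b y) = tau M N a b x y))" for a x
  have \<psi>_prop: "\<psi> a x \<in> homset B (Go a \<otimes>\<otimes> F N) (F (D M N)) \<and>
      (\<forall>b\<in>Obj A. \<forall>y\<in>elems N b. \<psi> a x \<bullet> (I (Go a) \<diamondop> th N b y) = tau M N a b x y)"
    if a: "a \<in> Obj A" "x \<in> elems M a" for a x
  proof -
    have "wcocone A B (\<lambda>b. Go a \<otimes>\<otimes> Go b) (\<lambda>u. I (Go a) \<diamondop> Ga u) N (F (D M N)) (\<lambda>b. tau M N a b x)"
    proof (rule wcoconeI)
      fix b assume "b \<in> Obj A"
      then show "linf (OMap N b) (hom_space B (Go a \<otimes>\<otimes> Go b) (F (D M N))) (tau M N a b x)"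
        using a by (simp add: linf_def tau_bilinear)
    next
      fix u y assume "u \<in> Arr A" "y \<in> elems N (Tgt A u)"
      then show "tau M N a (Src A u) x (act N u y) = tau M N a (Tgt A u) x y \<bullet> (I (Go a) \<diamondop> Ga u)"
        using tau_act[of "Idt A a" u x y] a by (simp add: act_idt[OF M])
    qed (use MN in simp)
    from wcolim_factor[OF colim_right[OF N a(1)] this] show ?thesis unfolding \<psi>_def by (rule theI')
  qed
  have \<psi>: "\<psi> a x \<in> Arr B" "Src B (\<psi> a x) = Go a \<otimes>\<otimes> F N" "Tgt B (\<psi> a x) = F (D M N)"
    "b \<in> Obj A \<Longrightarrow> y \<in> elems N b \<Longrightarrow> \<psi> a x \<bullet> (I (Go a) \<diamondop> th N b y) = tau M N a b x y"
    if "a \<in> Obj A" "x \<in> elems M a" for a x b y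
    using \<psi>_prop[OF that] by auto
  have "wcocone A B (\<lambda>a. Go a \<otimes>\<otimes> F N) (\<lambda>u. Ga u \<diamondop> I (F N)) M (F (D M N)) \<psi>"
  proof (rule wcoconeI)
    fix a assume a: "a \<in> Obj A"
    note vs = vs_closed[OF psh_vspace[OF M a]]
    show "linf (OMap M a) (hom_space B (Go a \<otimes>\<otimes> F N) (F (D M N))) (\<psi> a)"
    proof (rule linfI)
      fix x y assume x: "x \<in> elems M a" "y \<in> elems M a"
      have "\<psi> a (x \<oplus>\<^bsub>OMap M a\<^esub> y) = Plus B (\<psi> a x) (\<psi> a y)"
        by (rule epi_right[OF N a, where W = "F (D M N)"])
          (use x a vs N in \<open>simp_all add: \<psi> B.cmp_linear tau_bilinear\<close>)
      then show "\<psi> a (x \<oplus>\<^bsub>OMap M a\<^esub> y) = \<psi> a x \<oplus>\<^bsub>hom_space B (Go a \<otimes>\<otimes> F N) (F (D M N))\<^esub> \<psi> a y" by simp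
    next
      fix s x assume x: "x \<in> elems M a"
      have "\<psi> a (s \<odot>\<^bsub>OMap M a\<^esub> x) = Scal B s (\<psi> a x)"
        by (rule epi_right[OF N a, where W = "F (D M N)"])
          (use x a vs N in \<open>simp_all add: \<psi> B.cmp_linear tau_bilinear\<close>)
      then show "\<psi> a (s \<odot>\<^bsub>OMap M a\<^esub> x) = s \<odot>\<^bsub>hom_space B (Go a \<otimes>\<otimes> F N) (F (D M N))\<^esub> \<psi> a x" by simp
    qed (use a in \<open>simp add: \<psi>\<close>)
  next
    fix u x assume u: "u \<in> Arr A" "x \<in> elems M (Tgt A u)"
    note cl = act_closed[OF M u]
    show "\<psi> (Src A u) (act M u x) = \<psi> (Tgt A u) x \<bullet> (Ga u \<diamondop> I (F N))"
    proof (rule epi_right[OF N obj_arr(1)[OF u(1)], where W = "F (D M N)"])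
      fix b y assume b: "b \<in> Obj A" "y \<in> elems N b"
      \<comment> \<open>\<open>Ga u\<close> acts on the first factor and \<open>th N b y\<close> on
        the second, so the interchange law swaps them; what remains is the balancing property
        \<open>tau_act\<close>.\<close>
      have "(\<psi> (Tgt A u) x \<bullet> (Ga u \<diamondop> I (F N))) \<bullet> (I (Go (Src A u)) \<diamondop> th N b y) =
          \<psi> (Tgt A u) x \<bullet> ((Ga u \<diamondop> I (F N)) \<bullet> (I (Go (Src A u)) \<diamondop> th N b y))"
        using u b N by (simp add: \<psi>)
      also have "(Ga u \<diamondop> I (F N)) \<bullet> (I (Go (Src A u)) \<diamondop> th N b y) = (I (Go (Tgt A u)) \<diamondop> th N b y) \<bullet> (Ga u \<diamondop> I (Go b))"
        using u b N by (subst (1 2) B.tarr_cmp) simp_all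
      also have "\<psi> (Tgt A u) x \<bullet> ((I (Go (Tgt A u)) \<diamondop> th N b y) \<bullet> (Ga u \<diamondop> I (Go b))) =
          (\<psi> (Tgt A u) x \<bullet> (I (Go (Tgt A u)) \<diamondop> th N b y)) \<bullet> (Ga u \<diamondop> I (Go b))"
        using u b N by (subst B.cmp_assoc') (simp_all add: \<psi>(1-3))
      also have "\<dots> = tau M N (Src A u) b (act M u x) y"
        using u b tau_act[of u "Idt A b" x y] by (simp add: \<psi>(4) act_idt[OF N])
      finally show "\<psi> (Src A u) (act M u x) \<bullet> (I (Go (Src A u)) \<diamondop> th N b y) =
          (\<psi> (Tgt A u) x \<bullet> (Ga u \<diamondop> I (F N))) \<bullet> (I (Go (Src A u)) \<diamondop> th N b y)"
        using \<psi>(4)[OF _ cl b] u by simp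
    qed (use u cl N in \<open>simp_all add: \<psi>\<close>)
  qed (use MN in simp)
  from wcolim_factor[OF colim_left[OF M F_obj[OF N]] this]
  obtain h where h: "h \<in> homset B (F M \<otimes>\<otimes> F N) (F (D M N))"
    and hth: "\<And>a x. a \<in> Obj A \<Longrightarrow> x \<in> elems M a \<Longrightarrow> h \<bullet> (th M a x \<diamondop> I (F N)) = \<psi> a x" by blast
  have "h \<bullet> (th M a x \<diamondop> th N b y) = tau M N a b x y"
    if "a \<in> Obj A" "b \<in> Obj A" "x \<in> elems M a" "y \<in> elems N b" for a b x y
  proof -
    have "th M a x \<diamondop> th N b y = (th M a x \<diamondop> I (F N)) \<bullet> (I (Go a) \<diamondop> th N b y)"
      using that M N by (subst B.tarr_cmp) simp_all
    then have "h \<bullet> (th M a x \<diamondop> th N b y) = (h \<bullet> (th M a x \<diamondop> I (F N))) \<bullet> (I (Go a) \<diamondop> th N b y)"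
      using that M N h by simp
    then show ?thesis using that by (simp add: hth \<psi>)
  qed
  then show ?thesis using h by blast
qed

lemma phi_prop: "phi M N \<in> homset B (F M \<otimes>\<otimes> F N) (F (D M N)) \<and>
     (\<forall>a\<in>Obj A. \<forall>b\<in>Obj A. \<forall>x\<in>elems M a. \<forall>y\<in>elems N b. phi M N \<bullet> (th M a x \<diamondop> th N b y) = tau M N a b x y)"
  unfolding phi_def
proof (rule theI')
  show "\<exists>!h. h \<in> homset B (F M \<otimes>\<otimes> F N) (F (D M N)) \<and>
     (\<forall>a\<in>Obj A. \<forall>b\<in>Obj A. \<forall>x\<in>elems M a. \<forall>y\<in>elems N b. h \<bullet> (th M a x \<diamondop> th N b y) = tau M N a b x y)"
    by (rule ex_ex1I[OF phi_ex]) (rule epi2'[OF M N], auto)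
qed

lemma phi_simps [simp]: "phi M N \<in> Arr B" "Src B (phi M N) = F M \<otimes>\<otimes> F N" "Tgt B (phi M N) = F (D M N)"
  using phi_prop by auto

lemma phi_th: "a \<in> Obj A \<Longrightarrow> b \<in> Obj A \<Longrightarrow> x \<in> elems M a \<Longrightarrow> y \<in> elems N b \<Longrightarrow>
    phi M N \<bullet> (th M a x \<diamondop> th N b y) = tau M N a b x y"
  using phi_prop by blast

text \<open>The inverse comes from the other universal property. The assignment sending
  \<open>(a, b, x, y, f)\<close> to \<open>(th M a x \<diamondop> th N b y) \<bullet> Ga f\<close>
  is multilinear and balanced, so it factors through the coend, and the resulting linear maps form a
  cocone on \<open>D M N\<close>.\<close>

lemma phi_iso: "is_iso B (phi M N)"
proof -
  note MN = day_presheaf[OF M N]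
  define w where "w c = (\<lambda>(a, b, x, y, f). (th M a x \<diamondop> th N b y) \<bullet> Ga f)" for c :: 'o
  let ?W = "\<lambda>c. hom_space B (Go c) (F M \<otimes>\<otimes> F N)"
  have W: "vspace (?W c)" if "c \<in> Obj A" for c using that M N by (intro B.hom_vspace) simp_all
  have w: "day_multi A M N c (?W c) (w c)" if c: "c \<in> Obj A" for c
  proof (rule day_multiI; unfold w_def prod.case)
    fix g h x y f
    assume *: "g \<in> Arr A" "h \<in> Arr A" "x \<in> elems M (Tgt A g)" "y \<in> elems N (Tgt A h)" "f \<in> homset A c (Src A g \<star> Src A h)"
    have "(th M (Src A g) (act M g x) \<diamondop> th N (Src A h) (act N h y)) \<bullet> Ga f =
        ((th M (Tgt A g) x \<bullet> Ga g) \<diamondop> (th N (Tgt A h) y \<bullet> Ga h)) \<bullet> Ga f"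
      using * M N by (simp add: th_act)
    also have "\<dots> = ((th M (Tgt A g) x \<diamondop> th N (Tgt A h) y) \<bullet> (Ga g \<diamondop> Ga h)) \<bullet> Ga f"
      using * M N by (subst B.tarr_cmp) simp_all
    also have "\<dots> = (th M (Tgt A g) x \<diamondop> th N (Tgt A h) y) \<bullet> Ga ((g \<boxtimes> h) \<cdot> f)"
      using * M N by (simp add: G_tarr)
    finally show "(th M (Src A g) (act M g x) \<diamondop> th N (Src A h) (act N h y)) \<bullet> Ga f =
        (th M (Tgt A g) x \<diamondop> th N (Tgt A h) y) \<bullet> Ga ((g \<boxtimes> h) \<cdot> f)" .
  qed (use c M N in \<open>auto simp: th_add th_smult B.tarr_linear B.cmp_linear G_linear\<close>)
  define T where "T c = (SOME T. linf (OMap (D M N) c) (?W c) T \<and> (\<forall>g\<in>day_gens A M N c. T (E M N c g) = w c g))" for c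
  have T: "linf (OMap (D M N) c) (?W c) (T c)" "g \<in> day_gens A M N c \<Longrightarrow> T c (E M N c g) = w c g" if "c \<in> Obj A" for c g
    using someI_ex[OF day_univ[OF M N that W[OF that] w[OF that]]] unfolding T_def by blast+
  \<comment> \<open>The linear maps are chosen independently for each \<open>c\<close>; they fit
    together because naturality can be tested on generators, where their values are known.\<close>
  have "wcocone A B Go Ga (D M N) (F M \<otimes>\<otimes> F N) T"
  proof (rule wcoconeI)
    fix u z assume u: "u \<in> Arr A" and z: "z \<in> elems (D M N) (Tgt A u)"
    show "T (Src A u) (act (D M N) u z) = T (Tgt A u) z \<bullet> Ga u"
    proof (rule day_span[OF M N _ W[OF obj_arr(1)[OF u]] _ _ _ z])
      show "linf (OMap (D M N) (Tgt A u)) (?W (Src A u)) (\<lambda>z. T (Src A u) (act (D M N) u z))"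
        by (rule linf_comp[OF psh_linf[OF MN u] T(1)]) (simp add: u)
      have "linf (?W (Tgt A u)) (?W (Src A u)) (\<lambda>h. h \<bullet> Ga u)"
        using u by (simp add: linf_def B.cmp_linear)
      then show "linf (OMap (D M N) (Tgt A u)) (?W (Src A u)) (\<lambda>z. T (Tgt A u) z \<bullet> Ga u)"
        by (intro linf_comp[OF T(1)[OF obj_arr(2)[OF u]]])
      fix a b x y f assume q: "(a, b, x, y, f) \<in> day_gens A M N (Tgt A u)"
      then show "T (Src A u) (act (D M N) u (E M N (Tgt A u) (a, b, x, y, f))) = T (Tgt A u) (E M N (Tgt A u) (a, b, x, y, f)) \<bullet> Ga u"
        using u M N by (simp add: day_act(2)[OF M N] T(2) w_def)
    qed (use u in simp)
  qed (use T(1) M N in simp_all)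
  from wcolim_factor[OF colim1[OF MN] this]
  obtain h where h: "h \<in> homset B (F (D M N)) (F M \<otimes>\<otimes> F N)"
    and hth: "\<And>c z. c \<in> Obj A \<Longrightarrow> z \<in> elems (D M N) c \<Longrightarrow> h \<bullet> th (D M N) c z = T c z" by blast
  have htau: "h \<bullet> tau M N a b x y = th M a x \<diamondop> th N b y"
    if "a \<in> Obj A" "b \<in> Obj A" "x \<in> elems M a" "y \<in> elems N b" for a b x y
    using that M N unfolding tau_def by (simp add: hth E_closed T(2) w_def)
  have 1: "h \<bullet> phi M N = I (F M \<otimes>\<otimes> F N)"
  proof (rule epi2'[OF M N])
    fix a b x y assume "a \<in> Obj A" "b \<in> Obj A" "x \<in> elems M a" "y \<in> elems N b"
    then show "(h \<bullet> phi M N) \<bullet> (th M a x \<diamondop> th N b y) = I (F M \<otimes>\<otimes> F N) \<bullet> (th M a x \<diamondop> th N b y)"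
      using h M N by (simp add: phi_th htau)
  qed (use h M N in simp_all)
  \<comment> \<open>The two sides are tested on the legs. Both composites depend linearly on
    \<open>z\<close>, so it suffices to let \<open>z\<close> be a generator.\<close>
  have 2: "phi M N \<bullet> h = I (F (D M N))"
  proof (rule epi1[OF MN])
    fix c z assume c: "c \<in> Obj A" and z: "z \<in> elems (D M N) c"
    let ?V = "hom_space B (Go c) (F (D M N))"
    show "(phi M N \<bullet> h) \<bullet> th (D M N) c z = I (F (D M N)) \<bullet> th (D M N) c z"
    proof (rule day_span[OF M N c _ _ _ _ z])
      show "vspace ?V" using c MN by (intro B.hom_vspace) simp_all
      show "linf (OMap (D M N) c) ?V (\<lambda>z. (phi M N \<bullet> h) \<bullet> th (D M N) c z)" "linf (OMap (D M N) c) ?V (\<lambda>z. I (F (D M N)) \<bullet> th (D M N) c z)"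
        using c h MN vs_closed[OF psh_vspace[OF MN c]] by (simp_all add: linf_def th_add th_smult B.cmp_linear)
      fix a b x y f assume q: "(a, b, x, y, f) \<in> day_gens A M N c"
      then have q': "a \<in> Obj A" "b \<in> Obj A" "x \<in> elems M a" "y \<in> elems N b" "f \<in> Arr A" "Src A f = c" "Tgt A f = a \<star> b" by auto
      have "(phi M N \<bullet> h) \<bullet> th (D M N) c (E M N c (a, b, x, y, f)) = phi M N \<bullet> ((th M a x \<diamondop> th N b y) \<bullet> Ga f)"
        using h MN q' c by (simp add: hth E_closed T(2) w_def)
      also have "\<dots> = (phi M N \<bullet> (th M a x \<diamondop> th N b y)) \<bullet> Ga f"
        using q' M N by simp
      also have "\<dots> = th (D M N) c (E M N c (a, b, x, y, f))"
        using th_E[OF q'(1-5,7)] q' by (simp add: phi_th)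
      finally show "(phi M N \<bullet> h) \<bullet> th (D M N) c (E M N c (a, b, x, y, f)) = I (F (D M N)) \<bullet> th (D M N) c (E M N c (a, b, x, y, f))"
        using q' c MN by (simp add: E_closed)
    qed
  qed (use h MN in simp_all)
  show ?thesis by (rule is_isoI(1)[OF _ h 1 2]) simp
qed

end

lemma phi_nat:
  fixes \<sigma> \<tau> :: "('o, 'm, 'k, 'v) psh_map"
  assumes \<sigma>: "presheaf_map A \<sigma>" and \<tau>: "presheaf_map A \<tau>"
  shows "phi (NTgt \<sigma>) (NTgt \<tau>) \<bullet> (amap \<sigma> \<diamondop> amap \<tau>) = amap (day_arr A \<sigma> \<tau>) \<bullet> phi (NSrc \<sigma>) (NSrc \<tau>)"
proof (rule epi2'[OF psh_map_psh(1)[OF \<sigma>] psh_map_psh(1)[OF \<tau>]])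
  note MN = psh_map_psh(1)[OF \<sigma>] psh_map_psh(1)[OF \<tau>] and MN' = psh_map_psh(2)[OF \<sigma>] psh_map_psh(2)[OF \<tau>]
  note ar = day_arr[OF \<sigma> \<tau>] and cl = app_closed[OF \<sigma>] app_closed[OF \<tau>]
  fix a b x y assume *: "a \<in> Obj A" "b \<in> Obj A" "x \<in> elems (NSrc \<sigma>) a" "y \<in> elems (NSrc \<tau>) b"
  have "(phi (NTgt \<sigma>) (NTgt \<tau>) \<bullet> (amap \<sigma> \<diamondop> amap \<tau>)) \<bullet> (th (NSrc \<sigma>) a x \<diamondop> th (NSrc \<tau>) b y) =
      phi (NTgt \<sigma>) (NTgt \<tau>) \<bullet> ((amap \<sigma> \<bullet> th (NSrc \<sigma>) a x) \<diamondop> (amap \<tau> \<bullet> th (NSrc \<tau>) b y))"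
    using * \<sigma> \<tau> MN MN' by (simp add: B.tarr_cmp)
  also have "\<dots> = tau (NTgt \<sigma>) (NTgt \<tau>) a b (app \<sigma> a x) (app \<tau> b y)"
    using * \<sigma> \<tau> by (simp add: amap_th phi_th[OF MN'] cl)
  also have "\<dots> = amap (day_arr A \<sigma> \<tau>) \<bullet> tau (NSrc \<sigma>) (NSrc \<tau>) a b x y"
    using * amap_th[OF ar(1), of "a \<star> b"] ar(2)[of "a \<star> b" a b x y "Idt A (a \<star> b)"] by (simp add: tau_def E_closed[OF MN])
  finally show "(phi (NTgt \<sigma>) (NTgt \<tau>) \<bullet> (amap \<sigma> \<diamondop> amap \<tau>)) \<bullet> (th (NSrc \<sigma>) a x \<diamondop> th (NSrc \<tau>) b y) =
      (amap (day_arr A \<sigma> \<tau>) \<bullet> phi (NSrc \<sigma>) (NSrc \<tau>)) \<bullet> (th (NSrc \<sigma>) a x \<diamondop> th (NSrc \<tau>) b y)"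
    using * MN ar(1) amap_simps[OF ar(1)] by (simp add: phi_th)
qed (use \<sigma> \<tau> psh_map_psh[OF \<sigma>] psh_map_psh[OF \<tau>] amap_simps[OF day_arr(1)[OF \<sigma> \<tau>]] in simp_all)

text \<open>On a triple of vectors both sides give the leg of \<open>D M (D N P)\<close> at the
  generator \<open>(a, b \<star> c, x, e, 1)\<close>, with \<open>e\<close> the universal generator
  for \<open>y\<close> and \<open>z\<close>; by \<open>epi3\<close> such triples are enough.\<close>

lemma phi_assoc:
  fixes M N P :: "('o, 'm, 'k, 'v) psh"
  assumes M: "presheaf A M" and N: "presheaf A N" and P: "presheaf A P"
  shows "amap (day_assoc A M N P) \<bullet> (phi (D M N) P \<bullet> (phi M N \<diamondop> I (F P))) =
      phi M (D N P) \<bullet> (I (F M) \<diamondop> phi N P)"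
proof (rule epi3[OF M N P])
  note MN = day_presheaf[OF M N] and NP = day_presheaf[OF N P]
  note as = day_assoc[OF M N P] and am = amap_simps[OF day_assoc(1)[OF M N P]]
  have st: "NSrc (day_assoc A M N P) = D (D M N) P" "NTgt (day_assoc A M N P) = D M (D N P)"
    by (simp_all add: day_assoc_def day_map_def)
  show "amap (day_assoc A M N P) \<bullet> (phi (D M N) P \<bullet> (phi M N \<diamondop> I (F P))) \<in> homset B (F M \<otimes>\<otimes> (F N \<otimes>\<otimes> F P)) (F (D M (D N P)))"
    using M N P MN NP am by (simp add: st)
  show "phi M (D N P) \<bullet> (I (F M) \<diamondop> phi N P) \<in> homset B (F M \<otimes>\<otimes> (F N \<otimes>\<otimes> F P)) (F (D M (D N P)))"
    using M N P NP by simp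
  fix a b c x y z assume *: "a \<in> Obj A" "b \<in> Obj A" "c \<in> Obj A" "x \<in> elems M a" "y \<in> elems N b" "z \<in> elems P c"
  let ?e = "E M N (a \<star> b) (a, b, x, y, Idt A (a \<star> b))" and ?e' = "E N P (b \<star> c) (b, c, y, z, Idt A (b \<star> c))"
  have e: "?e \<in> elems (D M N) (a \<star> b)" "?e' \<in> elems (D N P) (b \<star> c)"
    using * by (simp_all add: E_closed[OF M N] E_closed[OF N P])
  have "(phi M N \<diamondop> I (F P)) \<bullet> (th M a x \<diamondop> (th N b y \<diamondop> th P c z)) = (phi M N \<diamondop> I (F P)) \<bullet> ((th M a x \<diamondop> th N b y) \<diamondop> th P c z)"
    using * M N P by simp
  also have "\<dots> = th (D M N) (a \<star> b) ?e \<diamondop> th P c z"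
    using * M N P by (subst B.tarr_cmp) (simp_all add: phi_th tau_def)
  finally have 1: "(phi M N \<diamondop> I (F P)) \<bullet> (th M a x \<diamondop> (th N b y \<diamondop> th P c z)) = th (D M N) (a \<star> b) ?e \<diamondop> th P c z" .
  have "(amap (day_assoc A M N P) \<bullet> (phi (D M N) P \<bullet> (phi M N \<diamondop> I (F P)))) \<bullet> (th M a x \<diamondop> (th N b y \<diamondop> th P c z)) =
      amap (day_assoc A M N P) \<bullet> (phi (D M N) P \<bullet> ((phi M N \<diamondop> I (F P)) \<bullet> (th M a x \<diamondop> (th N b y \<diamondop> th P c z))))"
    using * M N P MN am by (simp add: st)
  also have "\<dots> = amap (day_assoc A M N P) \<bullet> tau (D M N) P (a \<star> b) c ?e z"
    unfolding 1 using * P MN e by (simp add: phi_th)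
  also have "\<dots> = th (D M (D N P)) (a \<star> (b \<star> c)) (E M (D N P) (a \<star> (b \<star> c)) (a, b \<star> c, x, ?e', Idt A (a \<star> (b \<star> c))))"
    using * e as(2)[of "a \<star> (b \<star> c)" a b x y "Idt A (a \<star> b)" "a \<star> b" c z "Idt A (a \<star> (b \<star> c))"]
      amap_th[OF as(1), of "a \<star> (b \<star> c)" "E (D M N) P (a \<star> (b \<star> c)) (a \<star> b, c, ?e, z, Idt A (a \<star> (b \<star> c)))"]
    by (simp add: tau_def st E_closed[OF MN P])
  also have "\<dots> = phi M (D N P) \<bullet> (th M a x \<diamondop> tau N P b c y z)"
    using * e M NP by (simp add: tau_def phi_th)
  also have "th M a x \<diamondop> tau N P b c y z = (I (F M) \<diamondop> phi N P) \<bullet> (th M a x \<diamondop> (th N b y \<diamondop> th P c z))"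
    using * M N P by (subst B.tarr_cmp) (simp_all add: phi_th)
  finally show "(amap (day_assoc A M N P) \<bullet> (phi (D M N) P \<bullet> (phi M N \<diamondop> I (F P)))) \<bullet> (th M a x \<diamondop> (th N b y \<diamondop> th P c z)) =
      (phi M (D N P) \<bullet> (I (F M) \<diamondop> phi N P)) \<bullet> (th M a x \<diamondop> (th N b y \<diamondop> th P c z))"
    using * M N P NP by simp
qed

section \<open>Values on representable presheaves\<close>

lemma code_idt [simp]: "a \<in> Obj A \<Longrightarrow> code a a (Idt A a) \<in> carrier (vcopy (hom_space A a a))"
  by (rule code_closed') simp_all

text \<open>The leg at the universal element of the represented presheaf. It identifies
  \<open>Go q\<close> with the colimit \<open>F (yon q)\<close>, see \<open>iota_iso\<close>, and is
  the isomorphism through which the images of the generators are computed.\<close>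

definition iota :: "'o \<Rightarrow> 'n" where
  "iota q = th (yon q) q (code q q (Idt A q))"

lemma iota_simps [simp]:
  assumes "q \<in> Obj A"
  shows "iota q \<in> Arr B" "Src B (iota q) = Go q" "Tgt B (iota q) = F (yon q)"
  using yon_presheaf[OF assms] assms by (simp_all add: iota_def)

lemma th_yon: "u \<in> Arr A \<Longrightarrow> th (yon (Tgt A u)) (Src A u) (code (Src A u) (Tgt A u) u) = iota (Tgt A u) \<bullet> Ga u"
  using yon_act(2)[of "Tgt A u" u "Idt A (Tgt A u)"] th_act[OF yon_presheaf, of "Tgt A u" u "code (Tgt A u) (Tgt A u) (Idt A (Tgt A u))"]
  by (simp add: iota_def)

lemma th_yon':
  assumes "q \<in> Obj A" "a \<in> Obj A" "x \<in> elems (yon q) a"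
  shows "th (yon q) a x = iota q \<bullet> Ga (decode a q x)"
proof -
  have x: "x \<in> carrier (vcopy (hom_space A a q))" using assms by simp
  show ?thesis using th_yon[of "decode a q x"] decode_arr[OF assms(2,1) x] by simp
qed

lemma yoneda_cocone:
  assumes "q \<in> Obj A"
  shows "wcocone A B Go Ga (yon q) (Go q) (\<lambda>a x. Ga (decode a q x))"
proof (rule wcoconeI)
  fix a assume "a \<in> Obj A"
  then show "linf (OMap (yon q) a) (hom_space B (Go a) (Go q)) (\<lambda>x. Ga (decode a q x))"
    using assms by (auto simp: linf_def decode_arr decode_add decode_smult G_linear)
qed (use assms in \<open>auto simp: decode_act decode_arr\<close>)

text \<open>The co-Yoneda lemma: \<open>Go q\<close> carries the cocone of all \<open>Ga u\<close>
  for arrows \<open>u\<close> into \<open>q\<close>. The induced map \<open>h\<close> is inverse to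
  \<open>iota q\<close>, because every leg of \<open>F (yon q)\<close> factors through
  \<open>iota q\<close>.\<close>

lemma iota_iso:
  assumes q: "q \<in> Obj A"
  shows "is_iso B (iota q)"
proof -
  note Y = yon_presheaf[OF q]
  from wcolim_factor[OF colim1[OF Y] yoneda_cocone[OF q]]
  obtain h where h: "h \<in> homset B (F (yon q)) (Go q)"
    and hth: "\<And>a x. a \<in> Obj A \<Longrightarrow> x \<in> elems (yon q) a \<Longrightarrow> h \<bullet> th (yon q) a x = Ga (decode a q x)" by blast
  have 1: "h \<bullet> iota q = I (Go q)" using hth[of q "code q q (Idt A q)"] q by (simp add: iota_def)
  have 2: "iota q \<bullet> h = I (F (yon q))"
  proof (rule epi1[OF Y])
    fix a x assume a: "a \<in> Obj A" "x \<in> elems (yon q) a"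
    have "(iota q \<bullet> h) \<bullet> th (yon q) a x = iota q \<bullet> Ga (decode a q x)"
      using a q h Y hth[OF a] by (simp del: yon_simps)
    then show "(iota q \<bullet> h) \<bullet> th (yon q) a x = I (F (yon q)) \<bullet> th (yon q) a x"
      using th_yon'[OF q a] a Y th_simps[OF Y a] by (simp del: yon_simps)
  qed (use q h Y in simp_all)
  show ?thesis by (rule is_isoI(1)[OF _ h 1 2]) (use q in simp)
qed

lemma phi0_iota: "phi0 = iota (One A)"
  by (simp add: phi0_def iota_def)

lemma phi_lunit:
  fixes M :: "('o, 'm, 'k, 'v) psh"
  assumes M: "presheaf A M"
  shows "amap (day_lunit A M) \<bullet> (phi (yon (One A)) M \<bullet> (phi0 \<diamondop> I (F M))) = I (F M)"
proof (rule epi1[OF M])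
  note Y = yon_presheaf[OF one] and lu = day_lunit[OF M] and am = amap_simps[OF day_lunit(1)[OF M]]
  have st: "NSrc (day_lunit A M) = D (yon (One A)) M" "NTgt (day_lunit A M) = M"
    by (simp_all add: day_lunit_def day_map_def)
  show "amap (day_lunit A M) \<bullet> (phi (yon (One A)) M \<bullet> (phi0 \<diamondop> I (F M))) \<in> homset B (F M) (F M)"
    using M Y am by (simp add: st phi0_iota)
  fix b y assume b: "b \<in> Obj A" "y \<in> elems M b"
  let ?i = "code (One A) (One A) (Idt A (One A))"
  have "(amap (day_lunit A M) \<bullet> (phi (yon (One A)) M \<bullet> (phi0 \<diamondop> I (F M)))) \<bullet> th M b y =
      amap (day_lunit A M) \<bullet> (phi (yon (One A)) M \<bullet> ((phi0 \<diamondop> I (F M)) \<bullet> (I (Go (One A)) \<diamondop> th M b y)))"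
    using b M Y am by (simp add: st phi0_iota)
  also have "(phi0 \<diamondop> I (F M)) \<bullet> (I (Go (One A)) \<diamondop> th M b y) = th (yon (One A)) (One A) ?i \<diamondop> th M b y"
    using b M Y by (subst B.tarr_cmp) (simp_all add: phi0_def)
  also have "amap (day_lunit A M) \<bullet> (phi (yon (One A)) M \<bullet> (th (yon (One A)) (One A) ?i \<diamondop> th M b y)) = th M b y"
    using b M Y amap_th[OF lu(1), of b "E (yon (One A)) M b (One A, b, ?i, y, Idt A b)"]
      lu(2)[of b "One A" b ?i y "Idt A b"]
    by (simp add: phi_th tau_def st E_closed[OF Y M] act_idt[OF M])
  finally show "(amap (day_lunit A M) \<bullet> (phi (yon (One A)) M \<bullet> (phi0 \<diamondop> I (F M)))) \<bullet> th M b y = I (F M) \<bullet> th M b y"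
    using b M by simp
qed (use M in simp)

lemma phi_runit:
  fixes M :: "('o, 'm, 'k, 'v) psh"
  assumes M: "presheaf A M"
  shows "amap (day_runit A M) \<bullet> (phi M (yon (One A)) \<bullet> (I (F M) \<diamondop> phi0)) = I (F M)"
proof (rule epi1[OF M])
  note Y = yon_presheaf[OF one] and lu = day_runit[OF M] and am = amap_simps[OF day_runit(1)[OF M]]
  have st: "NSrc (day_runit A M) = D M (yon (One A))" "NTgt (day_runit A M) = M"
    by (simp_all add: day_runit_def day_map_def)
  show "amap (day_runit A M) \<bullet> (phi M (yon (One A)) \<bullet> (I (F M) \<diamondop> phi0)) \<in> homset B (F M) (F M)"
    using M Y am by (simp add: st phi0_iota)
  fix b y assume b: "b \<in> Obj A" "y \<in> elems M b"
  let ?i = "code (One A) (One A) (Idt A (One A))"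
  have "(amap (day_runit A M) \<bullet> (phi M (yon (One A)) \<bullet> (I (F M) \<diamondop> phi0))) \<bullet> th M b y =
      amap (day_runit A M) \<bullet> (phi M (yon (One A)) \<bullet> ((I (F M) \<diamondop> phi0) \<bullet> (th M b y \<diamondop> I (Go (One A)))))"
    using b M Y am by (simp add: st phi0_iota)
  also have "(I (F M) \<diamondop> phi0) \<bullet> (th M b y \<diamondop> I (Go (One A))) = th M b y \<diamondop> th (yon (One A)) (One A) ?i"
    using b M Y by (subst B.tarr_cmp) (simp_all add: phi0_def)
  also have "amap (day_runit A M) \<bullet> (phi M (yon (One A)) \<bullet> (th M b y \<diamondop> th (yon (One A)) (One A) ?i)) = th M b y"
    using b M Y amap_th[OF lu(1), of b "E M (yon (One A)) b (b, One A, y, ?i, Idt A b)"]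
      lu(2)[of b b "One A" y ?i "Idt A b"]
    by (simp add: phi_th tau_def st E_closed[OF M Y] act_idt[OF M])
  finally show "(amap (day_runit A M) \<bullet> (phi M (yon (One A)) \<bullet> (I (F M) \<diamondop> phi0))) \<bullet> th M b y = I (F M) \<bullet> th M b y"
    using b M by simp
qed (use M in simp)

theorem CAS_strong_monoidal: "strong_monoidal_functor (day_cat A) B CAS phi phi0"
  unfolding strong_monoidal_functor_def
proof (intro conjI ballI)
  fix \<sigma> \<tau> :: "('o, 'm, 'k, 'v) psh_map" assume "\<sigma> \<in> Arr (day_cat A)" "\<tau> \<in> Arr (day_cat A)"
  then show "phi (Tgt (day_cat A) \<sigma>) (Tgt (day_cat A) \<tau>) \<bullet> (AMap CAS \<sigma> \<diamondop> AMap CAS \<tau>) =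
      AMap CAS (\<sigma> \<boxtimes>\<^bsub>day_cat A\<^esub> \<tau>) \<bullet> phi (Src (day_cat A) \<sigma>) (Src (day_cat A) \<tau>)"
    using phi_nat day_arr(1) by simp
next
  fix M N P :: "('o, 'm, 'k, 'v) psh" assume "M \<in> Obj (day_cat A)" "N \<in> Obj (day_cat A)" "P \<in> Obj (day_cat A)"
  then show "AMap CAS (Assoc (day_cat A) M N P) \<bullet> phi (M \<star>\<^bsub>day_cat A\<^esub> N) P \<bullet> (phi M N \<diamondop> I (OMap CAS P)) =
      phi M (N \<star>\<^bsub>day_cat A\<^esub> P) \<bullet> (I (OMap CAS M) \<diamondop> phi N P) \<bullet> Assoc B (OMap CAS M) (OMap CAS N) (OMap CAS P)"
    using phi_assoc[of M N P] day_assoc(1) day_presheaf by simp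
next
  fix M :: "('o, 'm, 'k, 'v) psh" assume "M \<in> Obj (day_cat A)"
  then show "AMap CAS (LUnit (day_cat A) M) \<bullet> phi (One (day_cat A)) M \<bullet> (phi0 \<diamondop> I (OMap CAS M)) = LUnit B (OMap CAS M)"
    "AMap CAS (RUnit (day_cat A) M) \<bullet> phi M (One (day_cat A)) \<bullet> (I (OMap CAS M) \<diamondop> phi0) = RUnit B (OMap CAS M)"
    using phi_lunit[of M] phi_runit[of M] day_lunit(1)[of M] day_runit(1)[of M] by simp_all
next
  fix M N :: "('o, 'm, 'k, 'v) psh" assume "M \<in> Obj (day_cat A)" "N \<in> Obj (day_cat A)"
  then show "phi M N \<in> homset B (OMap CAS M \<otimes>\<otimes> OMap CAS N) (OMap CAS (M \<star>\<^bsub>day_cat A\<^esub> N))" "is_iso B (phi M N)"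
    using phi_iso[of M N] day_presheaf by simp_all
qed (use CAS_functor iota_iso[OF one] yon_presheaf[OF one] in \<open>simp_all add: phi0_iota\<close>)

lemma amap_yarr:
  assumes r: "r \<in> Arr A"
  shows "amap (yarr r) \<bullet> iota (Src A r) = iota (Tgt A r) \<bullet> Ga r"
proof -
  have st: "NSrc (yarr r) = yon (Src A r)" "NTgt (yarr r) = yon (Tgt A r)" by (simp_all add: yoneda_arr_def)
  show ?thesis
    using amap_th[OF yarr_map[OF r], of "Src A r" "code (Src A r) (Src A r) (Idt A (Src A r))"]
      yarr_app(2)[OF r, of "Src A r" "Idt A (Src A r)"] th_yon[OF r] r by (simp add: st iota_def)
qed

lemma amap_yoneda_tensor:
  assumes p: "p \<in> Obj A" "q \<in> Obj A"
  shows "amap (yoneda_tensor A p q) \<bullet> (phi (yon p) (yon q) \<bullet> (iota p \<diamondop> iota q)) = iota (p \<star> q)"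
proof -
  have st: "NSrc (yoneda_tensor A p q) = D (yon p) (yon q)" "NTgt (yoneda_tensor A p q) = yon (p \<star> q)"
    by (simp_all add: yoneda_tensor_def day_map_def)
  note Y = yon_presheaf[OF p(1)] yon_presheaf[OF p(2)] and T = yoneda_tensor[OF p]
  let ?e = "E (yon p) (yon q) (p \<star> q) (p, q, code p p (Idt A p), code q q (Idt A q), Idt A (p \<star> q))"
  have "amap (yoneda_tensor A p q) \<bullet> (phi (yon p) (yon q) \<bullet> (iota p \<diamondop> iota q)) =
      amap (yoneda_tensor A p q) \<bullet> th (D (yon p) (yon q)) (p \<star> q) ?e"
    using p Y unfolding iota_def by (simp add: phi_th tau_def)
  also have "\<dots> = iota (p \<star> q)"
    using amap_th[OF T(1), of "p \<star> q" ?e] T(2)[of "p \<star> q" p q "code p p (Idt A p)" "code q q (Idt A q)" "Idt A (p \<star> q)"] p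
    by (simp add: st iota_def E_closed[OF Y])
  finally show ?thesis .
qed

text \<open>The inverse sends an arrow \<open>u\<close> into \<open>p \<star> q\<close> to the class
  of \<open>(p, q, 1, 1, u)\<close>. Its uniqueness is also verified, on components, in order to
  evaluate the definite description in \<open>inv_arr\<close>.\<close>

lemma yoneda_tensor_iso:
  assumes p: "p \<in> Obj A" "q \<in> Obj A"
  defines "T \<equiv> yoneda_tensor A p q :: ('o, 'm, 'k, 'v) psh_map"
  shows "inverse_pair (day_cat A) T (inv_arr (day_cat A) T)"
proof -
  note Y = yon_presheaf[OF p(1)] yon_presheaf[OF p(2)] and T = yoneda_tensor[OF p, folded T_def]
  note P = yon_presheaf[OF tobj[OF p]] and DY = day_presheaf[OF Y]
  have st: "NSrc T = D (yon p) (yon q)" "NTgt T = yon (p \<star> q)" by (simp_all add: T_def yoneda_tensor_def day_map_def)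
  define s where "s c x = E (yon p) (yon q) c (p, q, code p p (Idt A p), code q q (Idt A q), decode c (p \<star> q) x)" for c x
  define S :: "('o, 'm, 'k, 'v) psh_map" where "S = \<lparr>NSrc = yon (p \<star> q), NTgt = D (yon p) (yon q),
    NAt = \<lambda>c\<in>Obj A. \<lparr>LSrc = OMap (yon (p \<star> q)) c, LTgt = OMap (D (yon p) (yon q)) c, LFun = \<lambda>x\<in>elems (yon (p \<star> q)) c. s c x\<rparr>\<rparr>"
  have sS: "app S c x = s c x" if "c \<in> Obj A" "x \<in> elems (yon (p \<star> q)) c" for c x
    using that by (simp add: S_def)
  have lin: "linf (OMap (yon (p \<star> q)) c) (OMap (D (yon p) (yon q)) c) (s c)" if c: "c \<in> Obj A" for c
    using c p by (auto simp: linf_def s_def decode_arr decode_add decode_smult E_closed[OF Y] day_el_rel[OF Y c])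
  have S: "presheaf_map A S"
  proof (rule presheaf_mapI)
    fix c assume c: "c \<in> Obj A"
    show "NAt S c \<in> homset vect_cat (OMap (NSrc S) c) (OMap (NTgt S) c)"
      using c psh_vspace[OF P c] psh_vspace[OF DY c] linf_cong[OF lin[OF c] psh_vspace[OF P c], of "\<lambda>x\<in>elems (yon (p \<star> q)) c. s c x"]
      by (simp add: S_def homset_vect del: in_homset yon_simps)
  next
    fix u x assume u: "u \<in> Arr A" "x \<in> elems (NSrc S) (Tgt A u)"
    then have x: "x \<in> elems (yon (p \<star> q)) (Tgt A u)" by (simp add: S_def)
    have "s (Src A u) (act (yon (p \<star> q)) u x) = act (D (yon p) (yon q)) u (s (Tgt A u) x)"
      using p u(1) x by (simp add: s_def decode_act decode_arr day_act(2)[OF Y])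
    then show "app S (Src A u) (act (NSrc S) u x) = act (NTgt S) u (app S (Tgt A u) x)"
      using sS[OF obj_arr(2)[OF u(1)] x] sS[OF obj_arr(1)[OF u(1)] act_closed[OF P u(1) x]] by (simp add: S_def)
  qed (use P DY in \<open>simp_all add: S_def\<close>)
  have stS: "NSrc S = yon (p \<star> q)" "NTgt S = D (yon p) (yon q)" by (simp_all add: S_def)
  have TS: "app T c (app S c x) = x" if c: "c \<in> Obj A" "x \<in> elems (yon (p \<star> q)) c" for c x
    using that p by (simp add: sS s_def T(2) decode_arr)
  have ST: "app S c (app T c z) = z" if c: "c \<in> Obj A" and z: "z \<in> elems (D (yon p) (yon q)) c" for c z
  proof (rule day_span[OF Y c psh_vspace[OF DY c] _ _ _ z, of "\<lambda>z. app S c (app T c z)" "\<lambda>z. z"])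
    show "linf (OMap (D (yon p) (yon q)) c) (OMap (D (yon p) (yon q)) c) (\<lambda>z. app S c (app T c z))"
      by (rule linf_comp[OF app_linf[OF T(1) c, unfolded st] app_linf[OF S c, unfolded stS]])
    show "linf (OMap (D (yon p) (yon q)) c) (OMap (D (yon p) (yon q)) c) (\<lambda>z. z)" by (simp add: linf_def)
    fix a b x y f assume q': "(a, b, x, y, f) \<in> day_gens A (yon p) (yon q) c"
    then have g: "a \<in> Obj A" "b \<in> Obj A" "x \<in> carrier (vcopy (hom_space A a p))" "y \<in> carrier (vcopy (hom_space A b q))"
      "f \<in> Arr A" "Src A f = c" "Tgt A f = a \<star> b" by auto
    \<comment> \<open>The first two vectors of a generator are restrictions of the universal
      elements along their decoded arrows. The balancing relation then moves these arrows into the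
      last slot, which brings every generator to the form \<open>(p, q, 1, 1, u)\<close>.\<close>
    have act: "act (yon p) (decode a p x) (code p p (Idt A p)) = x" "act (yon q) (decode b q y) (code q q (Idt A q)) = y"
      using yon_act(2)[OF p(1), of "decode a p x" "Idt A p"] yon_act(2)[OF p(2), of "decode b q y" "Idt A q"] p g
      by (simp_all add: decode_arr)
    have "app S c (app T c (E (yon p) (yon q) c (a, b, x, y, f))) =
        E (yon p) (yon q) c (p, q, code p p (Idt A p), code q q (Idt A q), (decode a p x \<boxtimes> decode b q y) \<cdot> f)"
      using T(2)[OF c q'] g p c by (simp add: sS s_def decode_arr code_closed')
    then show "app S c (app T c (E (yon p) (yon q) c (a, b, x, y, f))) = E (yon p) (yon q) c (a, b, x, y, f)"
      using day_el_rel(8)[OF Y c, of "decode a p x" "decode b q y" "code p p (Idt A p)" "code q q (Idt A q)" f] g p act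
      by (simp add: decode_arr)
  qed
  have inv: "inverse_pair (day_cat A) T S"
  proof -
    have "Cmp (day_cat A) S T = Idt (day_cat A) (D (yon p) (yon q))"
      by (rule psh_map_eqI[OF day_cmp[OF klin(1) T(1) S] day_idt[OF DY klin(1)]])
        (use ST in \<open>simp_all add: st stS app_cmp[OF klin(1) T(1) S] del: day_cat_arr(6)\<close>)
    moreover have "Cmp (day_cat A) T S = Idt (day_cat A) (yon (p \<star> q))"
      by (rule psh_map_eqI[OF day_cmp[OF klin(1) S T(1)] day_idt[OF P klin(1)]])
        (use TS in \<open>simp_all add: st stS app_cmp[OF klin(1) S T(1)] del: day_cat_arr(6)\<close>)
    ultimately show ?thesis using S T(1) by (simp add: inverse_pair_def st stS)
  qed
  have "g = S" if "inverse_pair (day_cat A) T g" for g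
  proof -
    have g: "presheaf_map A g" "NSrc g = yon (p \<star> q)" "NTgt g = D (yon p) (yon q)"
      and gT: "Cmp (day_cat A) g T = Idt (day_cat A) (D (yon p) (yon q))"
      using that by (auto simp: inverse_pair_def st)
    show ?thesis
    proof (rule psh_map_eqI[OF g(1) S])
      fix a x assume a: "a \<in> Obj A" "x \<in> elems (NSrc g) a"
      then have x: "x \<in> elems (yon (p \<star> q)) a" by (simp add: g)
      have Sx: "app S a x \<in> elems (D (yon p) (yon q)) a" using app_closed[OF S a(1), unfolded stS, OF x] .
      have "app g a x = app (Cmp (day_cat A) g T) a (app S a x)"
        using app_cmp[OF klin(1) T(1) g(1) _ a(1), of "app S a x"] Sx TS[OF a(1) x] by (simp add: g st del: day_cat_arr)
      then show "app g a x = app S a x" unfolding gT using Sx a by simp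
    qed (simp_all add: g stS)
  qed
  then have "inv_arr (day_cat A) T = S"
    unfolding inv_arr_def using inv by (rule_tac the_equality)
  then show ?thesis using inv by simp
qed

text \<open>\<open>hecke_c\<close> is a conjugate by the canonical map \<open>T\<close>. As
  \<open>amap T\<close> carries the comparison map preceded by
  \<open>iota p \<diamondop> iota q\<close> to \<open>iota (p \<star> q)\<close>, the conjugation
  cancels and \<open>Ga t\<close> is left.\<close>

lemma amap_braiding:
  fixes T :: "('o, 'm, 'k, 'v) psh_map"
  assumes p: "p \<in> Obj A" "q \<in> Obj A" and t: "t \<in> homset A (p \<star> q) (p \<star> q)"
  defines "T \<equiv> yoneda_tensor A p q"
  shows "AMap CAS (Cmp (day_cat A) (inv_arr (day_cat A) T) (Cmp (day_cat A) (yarr t) T)) \<bullet> (phi (yon p) (yon q) \<bullet> (iota p \<diamondop> iota q)) =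
    phi (yon p) (yon q) \<bullet> ((iota p \<diamondop> iota q) \<bullet> Ga t)"
proof -
  note Y = yon_presheaf[OF p(1)] yon_presheaf[OF p(2)] and T = yoneda_tensor(1)[OF p, folded T_def]
  note DY = day_presheaf[OF Y] and P = yon_presheaf[OF tobj[OF p]]
  let ?S = "inv_arr (day_cat A) T" and ?i = "phi (yon p) (yon q) \<bullet> (iota p \<diamondop> iota q)"
  have st: "NSrc T = D (yon p) (yon q)" "NTgt T = yon (p \<star> q)" by (simp_all add: T_def yoneda_tensor_def day_map_def)
  have S: "presheaf_map A ?S" "NSrc ?S = yon (p \<star> q)" "NTgt ?S = D (yon p) (yon q)"
    and STc: "Cmp (day_cat A) ?S T = Idt (day_cat A) (D (yon p) (yon q))"
    using yoneda_tensor_iso[OF p, folded T_def] by (auto simp: inverse_pair_def st)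
  have yt: "presheaf_map A (yarr t)" "NSrc (yarr t) = yon (p \<star> q)" "NTgt (yarr t) = yon (p \<star> q)"
    using yarr_map[of t] t by (auto simp: yoneda_arr_def)
  have ST: "amap ?S \<bullet> amap T = I (F (D (yon p) (yon q)))"
  proof -
    have "amap ?S \<bullet> amap T = amap (Cmp (day_cat A) ?S T)" by (rule amap_cmp[symmetric]) (use T S st in simp_all)
    also have "\<dots> = AMap CAS (Idt (day_cat A) (D (yon p) (yon q)))" using day_idt[OF DY klin(1)] by (simp add: STc)
    also have "\<dots> = I (F (D (yon p) (yon q)))" using klinear_functorD(4)[OF CAS_functor, of "D (yon p) (yon q)"] DY by simp
    finally show ?thesis .
  qed
  have c1: "presheaf_map A (Cmp (day_cat A) (yarr t) T)" by (rule day_cmp[OF klin(1) T yt(1)]) (simp add: yt st)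
  have c2: "presheaf_map A (Cmp (day_cat A) ?S (Cmp (day_cat A) (yarr t) T))" by (rule day_cmp[OF klin(1) c1 S(1)]) (simp add: yt S)
  have "amap (Cmp (day_cat A) ?S (Cmp (day_cat A) (yarr t) T)) = amap ?S \<bullet> (amap (yarr t) \<bullet> amap T)"
    using amap_cmp[OF c1 S(1)] amap_cmp[OF T yt(1)] by (simp add: yt S st)
  moreover have Ti: "amap T \<bullet> ?i = iota (p \<star> q)" using amap_yoneda_tensor[OF p] by (simp add: T_def)
  moreover have "amap (yarr t) \<bullet> iota (p \<star> q) = iota (p \<star> q) \<bullet> Ga t" using amap_yarr[of t] t by simp
  moreover have i: "?i \<in> homset B (Go (p \<star> q)) (F (D (yon p) (yon q)))" using p Y by simp
  ultimately have "amap (Cmp (day_cat A) ?S (Cmp (day_cat A) (yarr t) T)) \<bullet> ?i = amap ?S \<bullet> (iota (p \<star> q) \<bullet> Ga t)"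
    using amap_simps[OF T] amap_simps[OF S(1)] amap_simps[OF yt(1)] by (simp add: S yt st)
  also have "\<dots> = (amap ?S \<bullet> amap T) \<bullet> (?i \<bullet> Ga t)"
    unfolding Ti[symmetric] using amap_simps[OF T] amap_simps[OF S(1)] i t p Y by (simp add: S st)
  also have "\<dots> = ?i \<bullet> Ga t" unfolding ST using i t p Y DY by simp
  finally show ?thesis using c2 p Y t by simp
qed

end


section \<open>The category of endofunctors\<close>

context klinear_category
begin

lemma plus_assoc: "f \<in> homset C a b \<Longrightarrow> g \<in> homset C a b \<Longrightarrow> h \<in> homset C a b \<Longrightarrow> Plus C (Plus C f g) h = Plus C f (Plus C g h)"
  and plus_comm: "f \<in> homset C a b \<Longrightarrow> g \<in> homset C a b \<Longrightarrow> Plus C f g = Plus C g f"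
  and nul_plus: "f \<in> homset C a b \<Longrightarrow> Plus C (Nul C a b) f = f"
  and plus_nul: "f \<in> homset C a b \<Longrightarrow> Plus C f (Nul C a b) = f"
  and scal_add: "f \<in> homset C a b \<Longrightarrow> Scal C (s + t) f = Plus C (Scal C s f) (Scal C t f)"
  and scal_plus: "f \<in> homset C a b \<Longrightarrow> g \<in> homset C a b \<Longrightarrow> Scal C s (Plus C f g) = Plus C (Scal C s f) (Scal C s g)"
  and scal_scal: "f \<in> homset C a b \<Longrightarrow> Scal C (s * t) f = Scal C s (Scal C t f)"
  and scal_one: "f \<in> homset C a b \<Longrightarrow> Scal C 1 f = f"
  and scal_zero: "f \<in> homset C a b \<Longrightarrow> Scal C 0 f = Nul C a b"
  using vs_add_assoc[OF hom_vspace', of f f g h] vs_add_comm[OF hom_vspace', of f f g] vs_zero_left[OF hom_vspace', of f f]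
    vs_zero_right[OF hom_vspace', of f f] vs_smult_add_left[OF hom_vspace', of f f s t] vs_smult_add_right[OF hom_vspace', of f f g s]
    vs_smult_smult[OF hom_vspace', of f f s t] vs_smult_one[OF hom_vspace', of f f] vs_smult_zero[OF hom_vspace', of f f]
  by auto

abbreviation endofunctor :: "('o, 'm, 'o, 'm) ftor \<Rightarrow> bool" where
  "endofunctor \<equiv> klinear_functor C C"

abbreviation endotrans :: "('o, 'm, 'o, 'm) ntrans \<Rightarrow> bool" where
  "endotrans \<equiv> natural_transformation C C"

lemma endo_simps [simp]:
  assumes "endofunctor F"
  shows "a \<in> Obj C \<Longrightarrow> OMap F a \<in> Obj C" "a \<in> Obj C \<Longrightarrow> AMap F (Idt C a) = Idt C (OMap F a)"
    "f \<in> Arr C \<Longrightarrow> AMap F f \<in> Arr C" "f \<in> Arr C \<Longrightarrow> Src C (AMap F f) = OMap F (Src C f)"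
    "f \<in> Arr C \<Longrightarrow> Tgt C (AMap F f) = OMap F (Tgt C f)"
    "f \<in> Arr C \<Longrightarrow> g \<in> Arr C \<Longrightarrow> Src C g = Tgt C f \<Longrightarrow> AMap F (g \<cdot> f) = AMap F g \<cdot> AMap F f"
    "f \<in> Arr C \<Longrightarrow> g \<in> Arr C \<Longrightarrow> Src C g = Src C f \<Longrightarrow> Tgt C g = Tgt C f \<Longrightarrow> AMap F (Plus C f g) = Plus C (AMap F f) (AMap F g)"
    "f \<in> Arr C \<Longrightarrow> AMap F (Scal C s f) = Scal C s (AMap F f)"
  using klinear_functorD[OF assms] by auto

lemma nt_simps [simp]:
  assumes "endotrans \<tau>"
  shows "endofunctor (NSrc \<tau>)" "endofunctor (NTgt \<tau>)"
    "a \<in> Obj C \<Longrightarrow> NAt \<tau> a \<in> Arr C" "a \<in> Obj C \<Longrightarrow> Src C (NAt \<tau> a) = OMap (NSrc \<tau>) a"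
    "a \<in> Obj C \<Longrightarrow> Tgt C (NAt \<tau> a) = OMap (NTgt \<tau>) a"
  using natural_transformationD[OF assms] by auto

lemma nt_nat:
  "endotrans \<tau> \<Longrightarrow> f \<in> Arr C \<Longrightarrow> NAt \<tau> (Tgt C f) \<cdot> AMap (NSrc \<tau>) f = AMap (NTgt \<tau>) f \<cdot> NAt \<tau> (Src C f)"
  by (rule natural_transformationD(5))

lemma nt_eqI:
  assumes "endotrans \<sigma>" "endotrans \<tau>" "NSrc \<sigma> = NSrc \<tau>" "NTgt \<sigma> = NTgt \<tau>" "\<And>a. a \<in> Obj C \<Longrightarrow> NAt \<sigma> a = NAt \<tau> a"
  shows "\<sigma> = \<tau>"
proof -
  have "NAt \<sigma> = NAt \<tau>"
    using natural_transformationD(3)[OF assms(1)] natural_transformationD(3)[OF assms(2)] assms(5) by (rule extensionalityI)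
  then show ?thesis using assms(3,4) by (cases \<sigma>; cases \<tau>) auto
qed

lemma ftor_eqI:
  assumes "endofunctor F" "endofunctor G" "\<And>a. a \<in> Obj C \<Longrightarrow> OMap F a = OMap G a" "\<And>f. f \<in> Arr C \<Longrightarrow> AMap F f = AMap G f"
  shows "F = G"
proof -
  have "OMap F = OMap G" "AMap F = AMap G"
    using klinear_functorD(1,2)[OF assms(1)] klinear_functorD(1,2)[OF assms(2)] assms(3,4) by (auto intro: extensionalityI)
  then show ?thesis by (cases F; cases G) auto
qed

abbreviation End :: "(('o, 'm, 'o, 'm) ftor, ('o, 'm, 'o, 'm) ntrans, 'k) moncat" where
  "End \<equiv> endo_cat C"

lemma End_simps [simp]:
  "F \<in> Obj End \<longleftrightarrow> endofunctor F" "\<tau> \<in> Arr End \<longleftrightarrow> endotrans \<tau>" "Src End = NSrc" "Tgt End = NTgt"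
  "TObj End = ftor_comp C" "One End = ftor_id C"
  "Assoc End F G H = Idt End (ftor_comp C F (ftor_comp C G H))" "LUnit End F = Idt End F" "RUnit End F = Idt End F"
  by (simp_all add: endo_cat_def kcat.defs moncat.defs functor_cat_def)

lemma End_arr [simp]:
  "NSrc (Idt End F) = F" "NTgt (Idt End F) = F" "a \<in> Obj C \<Longrightarrow> NAt (Idt End F) a = Idt C (OMap F a)"
  "NSrc (Cmp End \<tau> \<sigma>) = NSrc \<sigma>" "NTgt (Cmp End \<tau> \<sigma>) = NTgt \<tau>" "a \<in> Obj C \<Longrightarrow> NAt (Cmp End \<tau> \<sigma>) a = NAt \<tau> a \<cdot> NAt \<sigma> a"
  "NSrc (Plus End \<tau> \<sigma>) = NSrc \<tau>" "NTgt (Plus End \<tau> \<sigma>) = NTgt \<tau>" "a \<in> Obj C \<Longrightarrow> NAt (Plus End \<tau> \<sigma>) a = Plus C (NAt \<tau> a) (NAt \<sigma> a)"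
  "NSrc (Scal End s \<tau>) = NSrc \<tau>" "NTgt (Scal End s \<tau>) = NTgt \<tau>" "a \<in> Obj C \<Longrightarrow> NAt (Scal End s \<tau>) a = Scal C s (NAt \<tau> a)"
  "NSrc (Nul End F G) = F" "NTgt (Nul End F G) = G" "a \<in> Obj C \<Longrightarrow> NAt (Nul End F G) a = Nul C (OMap F a) (OMap G a)"
  "NSrc (TArr End \<sigma> \<tau>) = ftor_comp C (NSrc \<sigma>) (NSrc \<tau>)" "NTgt (TArr End \<sigma> \<tau>) = ftor_comp C (NTgt \<sigma>) (NTgt \<tau>)"
  "a \<in> Obj C \<Longrightarrow> NAt (TArr End \<sigma> \<tau>) a = NAt \<sigma> (OMap (NTgt \<tau>) a) \<cdot> AMap (NSrc \<sigma>) (NAt \<tau> a)"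
  "NAt (Idt End F) \<in> extensional (Obj C)" "NAt (Cmp End \<tau> \<sigma>) \<in> extensional (Obj C)"
  "NAt (Plus End \<tau> \<sigma>) \<in> extensional (Obj C)" "NAt (Scal End s \<tau>) \<in> extensional (Obj C)"
  "NAt (Nul End F G) \<in> extensional (Obj C)" "NAt (TArr End \<sigma> \<tau>) \<in> extensional (Obj C)"
  by (simp_all add: endo_cat_def kcat.defs moncat.defs functor_cat_def)

lemma ftor_comp_simps [simp]:
  "a \<in> Obj C \<Longrightarrow> OMap (ftor_comp C F G) a = OMap F (OMap G a)" "f \<in> Arr C \<Longrightarrow> AMap (ftor_comp C F G) f = AMap F (AMap G f)"
  "a \<in> Obj C \<Longrightarrow> OMap (ftor_id C) a = a" "f \<in> Arr C \<Longrightarrow> AMap (ftor_id C) f = f"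
  by (simp_all add: ftor_comp_def ftor_id_def compose_def)

lemma ftor_comp_endo [simp]: "endofunctor F \<Longrightarrow> endofunctor G \<Longrightarrow> endofunctor (ftor_comp C F G)"
  by (rule klinear_functorI) (simp_all, simp_all add: ftor_comp_def)

lemma ftor_id_endo [simp]: "endofunctor (ftor_id C)"
  by (rule klinear_functorI) (simp_all, simp_all add: ftor_id_def)

lemma nt_idt [simp]: "endofunctor F \<Longrightarrow> endotrans (Idt End F)"
  by (rule natural_transformationI) simp_all

lemma nt_cmp [simp]:
  assumes "endotrans \<sigma>" "endotrans \<tau>" "NSrc \<tau> = NTgt \<sigma>"
  shows "endotrans (Cmp End \<tau> \<sigma>)"
proof (rule natural_transformationI)
  fix f assume f: "f \<in> Arr C"
  have "(NAt \<tau> (Tgt C f) \<cdot> NAt \<sigma> (Tgt C f)) \<cdot> AMap (NSrc \<sigma>) f = NAt \<tau> (Tgt C f) \<cdot> (AMap (NTgt \<sigma>) f \<cdot> NAt \<sigma> (Src C f))"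
    using assms f nt_nat[OF assms(1) f] by simp
  also have "\<dots> = (NAt \<tau> (Tgt C f) \<cdot> AMap (NSrc \<tau>) f) \<cdot> NAt \<sigma> (Src C f)" using assms f by simp
  also have "\<dots> = AMap (NTgt \<tau>) f \<cdot> (NAt \<tau> (Src C f) \<cdot> NAt \<sigma> (Src C f))" using assms f nt_nat[OF assms(2) f] by simp
  finally show "NAt (Cmp End \<tau> \<sigma>) (Tgt C f) \<cdot> AMap (NSrc (Cmp End \<tau> \<sigma>)) f = AMap (NTgt (Cmp End \<tau> \<sigma>)) f \<cdot> NAt (Cmp End \<tau> \<sigma>) (Src C f)"
    using f by simp
qed (use assms in simp_all)

lemma nt_plus [simp]: "endotrans \<sigma> \<Longrightarrow> endotrans \<tau> \<Longrightarrow> NSrc \<tau> = NSrc \<sigma> \<Longrightarrow> NTgt \<tau> = NTgt \<sigma> \<Longrightarrow> endotrans (Plus End \<sigma> \<tau>)"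
  using nt_nat[of \<sigma>] nt_nat[of \<tau>] by (intro natural_transformationI) (simp_all add: cmp_linear)

lemma nt_scal [simp]: "endotrans \<sigma> \<Longrightarrow> endotrans (Scal End s \<sigma>)"
  using nt_nat[of \<sigma>] by (intro natural_transformationI) (simp_all add: cmp_linear)

text \<open>A zero arrow is the scalar 0 times itself, and scalars pass through composition.\<close>

lemma cmp_nul:
  shows "f \<in> Arr C \<Longrightarrow> a = Tgt C f \<Longrightarrow> b \<in> Obj C \<Longrightarrow> Nul C a b \<cdot> f = Nul C (Src C f) b"
    and "f \<in> Arr C \<Longrightarrow> b = Src C f \<Longrightarrow> a \<in> Obj C \<Longrightarrow> f \<cdot> Nul C a b = Nul C a (Tgt C f)"
proof -
  have z: "Nul C a b = Scal C 0 (Nul C a b)" if "a \<in> Obj C" "b \<in> Obj C" for a b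
    by (rule scal_zero[symmetric]) (use that in simp)
  show "Nul C a b \<cdot> f = Nul C (Src C f) b" if "f \<in> Arr C" "a = Tgt C f" "b \<in> Obj C"
  proof -
    have "Nul C a b \<cdot> f = Scal C 0 (Nul C a b \<cdot> f)" using that by (subst z) (simp_all add: cmp_scal_left)
    then show ?thesis using scal_zero[of "Nul C a b \<cdot> f" "Src C f" b] that by simp
  qed
  show "f \<cdot> Nul C a b = Nul C a (Tgt C f)" if "f \<in> Arr C" "b = Src C f" "a \<in> Obj C"
  proof -
    have "f \<cdot> Nul C a b = Scal C 0 (f \<cdot> Nul C a b)" using that by (subst z) (simp_all add: cmp_scal_right)
    then show ?thesis using scal_zero[of "f \<cdot> Nul C a b" a "Tgt C f"] that by simp
  qed
qed

lemma nt_nul [simp]: "endofunctor F \<Longrightarrow> endofunctor G \<Longrightarrow> endotrans (Nul End F G)"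
  by (intro natural_transformationI) (simp_all add: cmp_nul)

lemma nt_tarr [simp]:
  assumes \<sigma>: "endotrans \<sigma>" and \<tau>: "endotrans \<tau>"
  shows "endotrans (TArr End \<sigma> \<tau>)"
proof (rule natural_transformationI)
  fix f assume f: "f \<in> Arr C"
  let ?F = "NSrc \<sigma>" and ?G' = "NTgt \<tau>" and ?G = "NSrc \<tau>" and ?F' = "NTgt \<sigma>"
  have "(NAt \<sigma> (OMap ?G' (Tgt C f)) \<cdot> AMap ?F (NAt \<tau> (Tgt C f))) \<cdot> AMap ?F (AMap ?G f) =
      NAt \<sigma> (OMap ?G' (Tgt C f)) \<cdot> AMap ?F (NAt \<tau> (Tgt C f) \<cdot> AMap ?G f)"
    using \<sigma> \<tau> f by simp
  also have "\<dots> = (NAt \<sigma> (Tgt C (AMap ?G' f)) \<cdot> AMap ?F (AMap ?G' f)) \<cdot> AMap ?F (NAt \<tau> (Src C f))"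
    using \<sigma> \<tau> f by (simp add: nt_nat[OF \<tau>])
  also have "\<dots> = AMap ?F' (AMap ?G' f) \<cdot> (NAt \<sigma> (OMap ?G' (Src C f)) \<cdot> AMap ?F (NAt \<tau> (Src C f)))"
    using \<sigma> \<tau> f by (subst nt_nat[OF \<sigma>]) simp_all
  finally show "NAt (TArr End \<sigma> \<tau>) (Tgt C f) \<cdot> AMap (NSrc (TArr End \<sigma> \<tau>)) f =
      AMap (NTgt (TArr End \<sigma> \<tau>)) f \<cdot> NAt (TArr End \<sigma> \<tau>) (Src C f)"
    using \<sigma> \<tau> f by simp
qed (use \<sigma> \<tau> in simp_all)

lemma End_vspace:
  assumes FG: "endofunctor F" "endofunctor G"
  shows "vspace (hom_space End F G)"
proof -
  note ls = plus_assoc[of _ "OMap F a" "OMap G a" for a] plus_comm[of _ "OMap F a" "OMap G a" for a]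
    nul_plus[of _ "OMap F a" "OMap G a" for a] scal_add[of _ "OMap F a" "OMap G a" for a] scal_plus[of _ "OMap F a" "OMap G a" for a]
    scal_scal[of _ "OMap F a" "OMap G a" for a] scal_one[of _ "OMap F a" "OMap G a" for a] scal_zero[of _ "OMap F a" "OMap G a" for a]
  have lc: "Plus C f (Plus C g h) = Plus C g (Plus C f h)"
    if "f \<in> homset C (OMap F a) (OMap G a)" "g \<in> homset C (OMap F a) (OMap G a)" "h \<in> homset C (OMap F a) (OMap G a)" for f g h a
    using plus_assoc[OF that] plus_assoc[OF that(2,1,3)] plus_comm[OF that(1,2)] by simp
  show ?thesis
    by (rule vspaceI; simp add: FG; (rule nt_eqI)?) (use FG in \<open>simp_all add: ls lc plus_nul[of _ "OMap F a" "OMap G a" for a]\<close>)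
qed

lemma End_klinear: "klinear_category End"
proof (rule klinear_category.intro)
  show "vspace (hom_space End F G)" if "F \<in> Obj End" "G \<in> Obj End" for F G :: "('o, 'm, 'o, 'm) ftor"
    using that by (simp add: End_vspace)
next
  fix f g h a b c d assume "f \<in> homset End a b" "g \<in> homset End b c" "h \<in> homset End c d"
  then show "(h \<cdot>\<^bsub>End\<^esub> g) \<cdot>\<^bsub>End\<^esub> f = h \<cdot>\<^bsub>End\<^esub> (g \<cdot>\<^bsub>End\<^esub> f)" by (intro nt_eqI) auto
next
  fix f a b assume "f \<in> homset End a b"
  then show "f \<cdot>\<^bsub>End\<^esub> Idt End a = f \<and> Idt End b \<cdot>\<^bsub>End\<^esub> f = f" by (intro conjI nt_eqI) auto
next
  fix f f' g g' a b c assume "f \<in> homset End a b" "f' \<in> homset End a b" "g \<in> homset End b c" "g' \<in> homset End b c"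
  then show "g \<cdot>\<^bsub>End\<^esub> Plus End f f' = Plus End (g \<cdot>\<^bsub>End\<^esub> f) (g \<cdot>\<^bsub>End\<^esub> f') \<and>
      Plus End g g' \<cdot>\<^bsub>End\<^esub> f = Plus End (g \<cdot>\<^bsub>End\<^esub> f) (g' \<cdot>\<^bsub>End\<^esub> f)"
    by (intro conjI nt_eqI) (auto simp: cmp_linear)
next
  fix f g a b c s assume "f \<in> homset End a b" "g \<in> homset End b c"
  then show "g \<cdot>\<^bsub>End\<^esub> Scal End s f = Scal End s (g \<cdot>\<^bsub>End\<^esub> f) \<and> Scal End s g \<cdot>\<^bsub>End\<^esub> f = Scal End s (g \<cdot>\<^bsub>End\<^esub> f)"
    by (intro conjI nt_eqI) (auto simp: cmp_linear)
qed auto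

lemma End_strict: "strict_monoidal End"
proof -
  interpret E: klinear_category End by (rule End_klinear)
  have comp_assoc: "ftor_comp C (ftor_comp C F G) H = ftor_comp C F (ftor_comp C G H)"
    if "endofunctor F" "endofunctor G" "endofunctor H" for F G H
    by (rule ftor_eqI) (use that in simp_all)
  have comp_id: "ftor_comp C (ftor_id C) F = F" "ftor_comp C F (ftor_id C) = F" if "endofunctor F" for F
    by (rule ftor_eqI; use that in simp)+
  show ?thesis
  proof (rule strict_monoidal.intro[OF End_klinear], rule strict_monoidal_axioms.intro)
    fix f f' g g' assume "f \<in> Arr End" "f' \<in> Arr End" "g \<in> Arr End" "g' \<in> Arr End" "Src End f' = Tgt End f" "Src End g' = Tgt End g"
    then have *: "endotrans f" "endotrans f'" "endotrans g" "endotrans g'" "NSrc f' = NTgt f" "NSrc g' = NTgt g" by simp_all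
    show "(f' \<boxtimes>\<^bsub>End\<^esub> g') \<cdot>\<^bsub>End\<^esub> (f \<boxtimes>\<^bsub>End\<^esub> g) = (f' \<cdot>\<^bsub>End\<^esub> f) \<boxtimes>\<^bsub>End\<^esub> (g' \<cdot>\<^bsub>End\<^esub> g)"
    proof (rule nt_eqI)
      fix a assume a: "a \<in> Obj C"
      \<comment> \<open>The interchange law for transformations comes down to naturality of
        \<open>f\<close> at the components of \<open>g'\<close>, applied to the two middle
        factors.\<close>
      have "(NAt f' (OMap (NTgt g') a) \<cdot> AMap (NTgt f) (NAt g' a)) \<cdot> (NAt f (OMap (NTgt g) a) \<cdot> AMap (NSrc f) (NAt g a)) =
          NAt f' (OMap (NTgt g') a) \<cdot> ((AMap (NTgt f) (NAt g' a) \<cdot> NAt f (Src C (NAt g' a))) \<cdot> AMap (NSrc f) (NAt g a))"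
        using * a by simp
      also have "AMap (NTgt f) (NAt g' a) \<cdot> NAt f (Src C (NAt g' a)) = NAt f (Tgt C (NAt g' a)) \<cdot> AMap (NSrc f) (NAt g' a)"
        using * a by (subst nt_nat) simp_all
      finally show "NAt ((f' \<boxtimes>\<^bsub>End\<^esub> g') \<cdot>\<^bsub>End\<^esub> (f \<boxtimes>\<^bsub>End\<^esub> g)) a = NAt ((f' \<cdot>\<^bsub>End\<^esub> f) \<boxtimes>\<^bsub>End\<^esub> (g' \<cdot>\<^bsub>End\<^esub> g)) a"
        using * a by simp
    qed (use * in simp_all)
  next
    fix f g h assume "f \<in> Arr End" "g \<in> Arr End" "h \<in> Arr End"
    then show "(f \<boxtimes>\<^bsub>End\<^esub> g) \<boxtimes>\<^bsub>End\<^esub> h = f \<boxtimes>\<^bsub>End\<^esub> (g \<boxtimes>\<^bsub>End\<^esub> h)"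
      by (intro nt_eqI) (simp_all add: comp_assoc)
  next
    fix f assume "f \<in> Arr End"
    then show "Idt End (One End) \<boxtimes>\<^bsub>End\<^esub> f = f" "f \<boxtimes>\<^bsub>End\<^esub> Idt End (One End) = f"
      by (intro nt_eqI; simp add: comp_id)+
  next
    fix a b assume "a \<in> Obj End" "b \<in> Obj End"
    then show "Idt End a \<boxtimes>\<^bsub>End\<^esub> Idt End b = Idt End (a \<star>\<^bsub>End\<^esub> b)" by (intro nt_eqI) simp_all
  next
    fix f f' g assume "f \<in> Arr End" "f' \<in> Arr End" "g \<in> Arr End" "Src End f' = Src End f" "Tgt End f' = Tgt End f"
    then show "Plus End f f' \<boxtimes>\<^bsub>End\<^esub> g = Plus End (f \<boxtimes>\<^bsub>End\<^esub> g) (f' \<boxtimes>\<^bsub>End\<^esub> g)" by (intro nt_eqI) (simp_all add: cmp_linear)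
  next
    fix f g g' assume "f \<in> Arr End" "g \<in> Arr End" "g' \<in> Arr End" "Src End g' = Src End g" "Tgt End g' = Tgt End g"
    then show "f \<boxtimes>\<^bsub>End\<^esub> Plus End g g' = Plus End (f \<boxtimes>\<^bsub>End\<^esub> g) (f \<boxtimes>\<^bsub>End\<^esub> g')" by (intro nt_eqI) (simp_all add: cmp_linear)
  next
    fix f g s assume "f \<in> Arr End" "g \<in> Arr End"
    then show "Scal End s f \<boxtimes>\<^bsub>End\<^esub> g = Scal End s (f \<boxtimes>\<^bsub>End\<^esub> g)" "f \<boxtimes>\<^bsub>End\<^esub> Scal End s g = Scal End s (f \<boxtimes>\<^bsub>End\<^esub> g)"
      by (intro nt_eqI; simp add: cmp_linear)+
  qed (simp_all add: comp_assoc comp_id)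
qed

end


section \<open>Existence of weighted colimits\<close>

lemma is_coproduct_reindex:
  assumes b: "bij_betw e I J" and c: "is_coproduct C J (\<lambda>i. d (inv_into I e i)) s j"
  shows "is_coproduct C I d s (\<lambda>i. j (e i))"
proof -
  have eJ: "e i \<in> J" "inv_into I e (e i) = i" if "i \<in> I" for i
    using b that by (auto simp: bij_betw_def)
  have Je: "\<exists>i\<in>I. x = e i" if "x \<in> J" for x using b that by (auto simp: bij_betw_def)
  show ?thesis unfolding is_coproduct_def
  proof (intro conjI ballI allI impI)
    fix i assume i: "i \<in> I"
    have "j (e i) \<in> homset C (d (inv_into I e (e i))) s" using c eJ(1)[OF i] unfolding is_coproduct_def by blast
    then show "j (e i) \<in> homset C (d i) s" using eJ[OF i] by simp
  next
    fix z u assume z: "z \<in> Obj C" and u: "\<forall>i\<in>I. u i \<in> homset C (d i) z"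
    have "\<forall>i\<in>J. u (inv_into I e i) \<in> homset C (d (inv_into I e i)) z"
      using u Je eJ by (metis)
    then have "\<exists>!w. w \<in> homset C s z \<and> (\<forall>i\<in>J. w \<cdot>\<^bsub>C\<^esub> j i = u (inv_into I e i))"
      by (rule mp[OF spec[OF bspec[OF conjunct2[OF conjunct2[OF c[unfolded is_coproduct_def]]] z]]])
    moreover have "(\<forall>i\<in>J. w \<cdot>\<^bsub>C\<^esub> j i = u (inv_into I e i)) \<longleftrightarrow> (\<forall>i\<in>I. w \<cdot>\<^bsub>C\<^esub> j (e i) = u i)" for w
      using Je eJ by metis
    ultimately show "\<exists>!w. w \<in> homset C s z \<and> (\<forall>i\<in>I. w \<cdot>\<^bsub>C\<^esub> j (e i) = u i)" by simp
  qed (use c in \<open>simp add: is_coproduct_def\<close>)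
qed

text \<open>Cocompleteness and cocontinuity are stated for index sets inside \<open>'v\<close>; an
  injection carries both over to every small index set. Existence and preservation are asserted
  together, so that they concern the same coproduct.\<close>

lemma small_coproduct:
  assumes C: "small_cocomplete TYPE('v) C" and I: "small TYPE('v) I" and d: "d ` I \<subseteq> Obj C"
  shows "\<exists>s j. is_coproduct C I d s j \<and>
    (\<forall>D H. small_cocontinuous TYPE('v) C D H \<longrightarrow> is_coproduct D I (\<lambda>i. OMap H (d i)) (OMap H s) (\<lambda>i. AMap H (j i)))"
proof -
  obtain e :: "_ \<Rightarrow> 'v" where e: "inj_on e I" using I by (auto simp: small_def)
  then have b: "bij_betw e I (e ` I)" by (simp add: bij_betw_def)
  have d': "(\<lambda>i. d (inv_into I e i)) ` (e ` I) \<subseteq> Obj C" using d e by auto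
  then obtain s j where sj: "is_coproduct C (e ` I) (\<lambda>i. d (inv_into I e i)) s j"
    using C unfolding small_cocomplete_def by blast
  have "is_coproduct D I (\<lambda>i. OMap H (d i)) (OMap H s) (\<lambda>i. AMap H (j (e i)))" if "small_cocontinuous TYPE('v) C D H" for D H
  proof (rule is_coproduct_reindex[OF b, of D "\<lambda>i. OMap H (d i)" "OMap H s" "\<lambda>i. AMap H (j i)"])
    show "is_coproduct D (e ` I) (\<lambda>i. OMap H (d (inv_into I e i))) (OMap H s) (\<lambda>i. AMap H (j i))"
      using that d' sj unfolding small_cocontinuous_def by blast
  qed
  then show ?thesis using is_coproduct_reindex[OF b sj] by blast
qed


lemma (in universe) small_Plus:
  assumes "small TYPE('v) A" "small TYPE('v) B"
  shows "small TYPE('v) (A <+> B)"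
proof -
  obtain e :: "'a \<Rightarrow> 'v" and e' :: "'b \<Rightarrow> 'v" where e: "inj_on e A" "inj_on e' B" using assms by (auto simp: small_def)
  let ?f = "case_sum (\<lambda>x. (True, e x)) (\<lambda>y. (False, e' y))"
  have "inj_on ?f (A <+> B)"
  proof (rule inj_onI)
    fix x y assume "x \<in> A <+> B" "y \<in> A <+> B" "?f x = ?f y"
    then show "x = y" using e by (auto elim!: PlusE dest: inj_onD)
  qed
  moreover have "small TYPE('v) (UNIV :: (bool \<times> 'v) set)"
    using small_Times[OF small_countable[of "UNIV :: bool set"] small_UNIV[of UNIV]] by simp
  then have "small TYPE('v) (?f ` (A <+> B))" by (rule small_subset) simp
  ultimately show ?thesis by (rule small_inj)
qed

text \<open>The weighted colimit is the coequalizer of two maps into the coproduct of the \<open>ko a\<close> over all pairs of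
  an object \<open>a\<close> and an element of \<open>M a\<close>; the three kinds of relations express additivity, homogeneity and
  naturality of the cocone.\<close>

definition wc_index :: "('o, 'm, 'k::field, 'z) kcat_scheme \<Rightarrow> ('o, 'm, 'k, 'v) psh \<Rightarrow> ('o \<times> 'v) set" where
  "wc_index A M = {(a, x). a \<in> Obj A \<and> x \<in> elems M a}"

definition wc_rels ::
  "('o, 'm, 'k::field, 'z) kcat_scheme \<Rightarrow> ('o, 'm, 'k, 'v) psh \<Rightarrow> ('o \<times> 'v \<times> 'v + 'k \<times> 'o \<times> 'v + 'm \<times> 'v) set" where
  "wc_rels A M = {(a, x, y). a \<in> Obj A \<and> x \<in> elems M a \<and> y \<in> elems M a} <+>
     ({(s, a, x). a \<in> Obj A \<and> x \<in> elems M a} <+> {(u, x). u \<in> Arr A \<and> x \<in> elems M (Tgt A u)})"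

lemma wc_rels_simps [simp]:
  "Inl (a, x, y) \<in> wc_rels A M \<longleftrightarrow> a \<in> Obj A \<and> x \<in> elems M a \<and> y \<in> elems M a"
  "Inr (Inl (s, a, x)) \<in> wc_rels A M \<longleftrightarrow> a \<in> Obj A \<and> x \<in> elems M a"
  "Inr (Inr (u, x)) \<in> wc_rels A M \<longleftrightarrow> u \<in> Arr A \<and> x \<in> elems M (Tgt A u)"
  by (auto simp: wc_rels_def)

definition wc_src :: "('o, 'm, 'k::field, 'z) kcat_scheme \<Rightarrow> ('o \<Rightarrow> 'p) \<Rightarrow> 'o \<times> 'v \<times> 'v + 'k \<times> 'o \<times> 'v + 'm \<times> 'v \<Rightarrow> 'p" where
  "wc_src A ko = case_sum (\<lambda>(a, x, y). ko a) (case_sum (\<lambda>(s, a, x). ko a) (\<lambda>(u, x). ko (Src A u)))"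

definition wc_left where
  "wc_left A M j = case_sum (\<lambda>(a, x, y). j (a, x \<oplus>\<^bsub>OMap M a\<^esub> y))
     (case_sum (\<lambda>(s, a, x). j (a, s \<odot>\<^bsub>OMap M a\<^esub> x)) (\<lambda>(u, x). j (Src A u, act M u x)))"

definition wc_right where
  "wc_right A C ka j = case_sum (\<lambda>(a, x, y). Plus C (j (a, x)) (j (a, y)))
     (case_sum (\<lambda>(s, a, x). Scal C s (j (a, x))) (\<lambda>(u, x). Cmp C (j (Tgt A u, x)) (ka u)))"

lemma is_coproductD:
  assumes "is_coproduct C I d s j"
  shows "s \<in> Obj C" "i \<in> I \<Longrightarrow> j i \<in> homset C (d i) s"
    and "z \<in> Obj C \<Longrightarrow> (\<And>i. i \<in> I \<Longrightarrow> u i \<in> homset C (d i) z) \<Longrightarrow> \<exists>!w. w \<in> homset C s z \<and> (\<forall>i\<in>I. w \<cdot>\<^bsub>C\<^esub> j i = u i)"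
proof -
  note c = assms[unfolded is_coproduct_def]
  show "s \<in> Obj C" by (rule conjunct1[OF c])
  show "i \<in> I \<Longrightarrow> j i \<in> homset C (d i) s" by (rule bspec[OF conjunct1[OF conjunct2[OF c]]])
  assume z: "z \<in> Obj C" and u: "\<And>i. i \<in> I \<Longrightarrow> u i \<in> homset C (d i) z"
  show "\<exists>!w. w \<in> homset C s z \<and> (\<forall>i\<in>I. w \<cdot>\<^bsub>C\<^esub> j i = u i)"
    by (rule mp[OF spec[OF bspec[OF conjunct2[OF conjunct2[OF c]] z]]]) (rule ballI, rule u)
qed

lemma is_coequalizerD:
  assumes "is_coequalizer C f g q"
  shows "q \<in> Arr C" "Src C q = Tgt C f" "q \<cdot>\<^bsub>C\<^esub> f = q \<cdot>\<^bsub>C\<^esub> g"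
    and "r \<in> Arr C \<Longrightarrow> Src C r = Tgt C f \<Longrightarrow> r \<cdot>\<^bsub>C\<^esub> f = r \<cdot>\<^bsub>C\<^esub> g \<Longrightarrow>
      \<exists>!w. w \<in> homset C (Tgt C q) (Tgt C r) \<and> w \<cdot>\<^bsub>C\<^esub> q = r"
proof -
  note c = assms[unfolded is_coequalizer_def]
  show "q \<in> Arr C" "Src C q = Tgt C f" "q \<cdot>\<^bsub>C\<^esub> f = q \<cdot>\<^bsub>C\<^esub> g"
    using c by (simp_all only:)
  assume r: "r \<in> Arr C" "Src C r = Tgt C f" "r \<cdot>\<^bsub>C\<^esub> f = r \<cdot>\<^bsub>C\<^esub> g"
  show "\<exists>!w. w \<in> homset C (Tgt C q) (Tgt C r) \<and> w \<cdot>\<^bsub>C\<^esub> q = r"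
    by (rule mp[OF bspec[OF conjunct2[OF conjunct2[OF conjunct2[OF c]]] r(1)]]) (simp only: r)
qed

text \<open>The coproducts, the two arrows and the coequalizer are given rather than chosen, so that
  the lemma applies a second time to their images under a cocontinuous functor.\<close>

lemma wcolim_coequalizer:
  fixes A :: "('o, 'm, 'k::field, 'y) kcat_scheme" and C :: "('p, 'n, 'k, 'z) kcat_scheme" and M :: "('o, 'm, 'k, 'v) psh"
  assumes A: "klinear_category A" and C: "klinear_category C" and M: "presheaf A M"
    and ko: "\<And>a. a \<in> Obj A \<Longrightarrow> ko a \<in> Obj C" and ka: "\<And>u. u \<in> Arr A \<Longrightarrow> ka u \<in> homset C (ko (Src A u)) (ko (Tgt A u))"
    and s: "is_coproduct C (wc_index A M) (\<lambda>i. ko (fst i)) s j"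
    and s': "is_coproduct C (wc_rels A M) (wc_src A ko) s' j'"
    and f: "f \<in> homset C s' s" "\<And>r. r \<in> wc_rels A M \<Longrightarrow> Cmp C f (j' r) = wc_left A M j r"
    and g: "g \<in> homset C s' s" "\<And>r. r \<in> wc_rels A M \<Longrightarrow> Cmp C g (j' r) = wc_right A C ka j r"
    and q: "is_coequalizer C f g q"
  shows "wcolim A C ko ka M (Tgt C q) (\<lambda>a x. Cmp C q (j (a, x)))"
proof -
  interpret A: klinear_category A by fact
  interpret C: klinear_category C by fact
  note qD = is_coequalizerD[OF q]
  have q': "q \<in> Arr C" "Src C q = s" and fg: "f \<in> Arr C" "Src C f = s'" "Tgt C f = s" "g \<in> Arr C" "Src C g = s'" "Tgt C g = s"
    using qD f g by auto
  have j: "j (a, x) \<in> Arr C" "Src C (j (a, x)) = ko a" "Tgt C (j (a, x)) = s" if "a \<in> Obj A" "x \<in> elems M a" for a x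
    using is_coproductD(2)[OF s, of "(a, x)"] that by (auto simp: wc_index_def)
  have j': "j' r \<in> Arr C" "Src C (j' r) = wc_src A ko r" "Tgt C (j' r) = s'" if "r \<in> wc_rels A M" for r
    using is_coproductD(2)[OF s' that] by auto
  have ka': "ka u \<in> Arr C" "Src C (ka u) = ko (Src A u)" "Tgt C (ka u) = ko (Tgt A u)" if "u \<in> Arr A" for u
    using ka[OF that] by auto
  \<comment> \<open>Restricted to the summand of a relation, the equation of the coequalizer becomes
    that relation for the legs.\<close>
  have rel: "Cmp C q (wc_left A M j r) = Cmp C q (wc_right A C ka j r)" if r: "r \<in> wc_rels A M" for r
  proof -
    have "Cmp C (Cmp C q f) (j' r) = Cmp C (Cmp C q g) (j' r)" using qD(3) by simp
    then show ?thesis using q' fg j'[OF r] f(2)[OF r] g(2)[OF r] by simp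
  qed
  show ?thesis unfolding wcolim_def
  proof (intro conjI allI impI)
    show "wcocone A C ko ka M (Tgt C q) (\<lambda>a x. Cmp C q (j (a, x)))"
    proof (rule wcoconeI)
      fix a assume a: "a \<in> Obj A"
      show "linf (OMap M a) (hom_space C (ko a) (Tgt C q)) (\<lambda>x. Cmp C q (j (a, x)))"
        unfolding linf_def
        using a q' j rel[of "Inl (a, x, y)" for x y] rel[of "Inr (Inl (s, a, x))" for s x]
        by (simp add: wc_left_def wc_right_def C.cmp_linear)
    next
      fix u x assume u: "u \<in> Arr A" "x \<in> elems M (Tgt A u)"
      then show "Cmp C q (j (Src A u, act M u x)) = Cmp C (Cmp C q (j (Tgt A u, x))) (ka u)"
        using q' j[of "Tgt A u" x] ka'[OF u(1)] rel[of "Inr (Inr (u, x))"]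
        by (simp add: wc_left_def wc_right_def)
    qed (use q' in simp)
  next
    fix z' \<theta>' assume c: "wcocone A C ko ka M z' \<theta>'"
    note z' = wcoconeD(1)[OF c]
    have "\<exists>!w. w \<in> homset C s z' \<and> (\<forall>i\<in>wc_index A M. Cmp C w (j i) = \<theta>' (fst i) (snd i))"
      by (rule is_coproductD(3)[OF s z']) (use wcoconeD'[OF c] in \<open>auto simp: wc_index_def\<close>)
    then obtain w where w0: "w \<in> homset C s z' \<and> (\<forall>i\<in>wc_index A M. Cmp C w (j i) = \<theta>' (fst i) (snd i))"
      and w0': "\<forall>w'. w' \<in> homset C s z' \<and> (\<forall>i\<in>wc_index A M. Cmp C w' (j i) = \<theta>' (fst i) (snd i)) \<longrightarrow> w' = w"
      by (rule ex1E)
    have wj: "Cmp C w (j (a, x)) = \<theta>' a x" if "a \<in> Obj A" "x \<in> elems M a" for a x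
      using bspec[OF conjunct2[OF w0], of "(a, x)"] that by (simp add: wc_index_def)
    note w = conjunct1[OF w0] wj
    have wu: "w' = w" if "w' \<in> homset C s z'" "\<forall>i\<in>wc_index A M. Cmp C w' (j i) = \<theta>' (fst i) (snd i)" for w'
      by (rule mp[OF spec[OF w0'] conjI[OF that]])
    have wlr: "Cmp C w (wc_left A M j r) = Cmp C w (wc_right A C ka j r)" if r: "r \<in> wc_rels A M" for r
    proof -
      consider a x y where "r = Inl (a, x, y)" "a \<in> Obj A" "x \<in> elems M a" "y \<in> elems M a"
        | t a x where "r = Inr (Inl (t, a, x))" "a \<in> Obj A" "x \<in> elems M a"
        | u x where "r = Inr (Inr (u, x))" "u \<in> Arr A" "x \<in> elems M (Tgt A u)"
        using r by (auto simp: wc_rels_def)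
      then show ?thesis
      proof cases
        case 1
        then show ?thesis using w(1) j vs_add_closed[OF A.psh_vspace[OF M 1(2)]]
          by (simp add: wc_left_def wc_right_def C.cmp_linear w(2) wcoconeD'(4)[OF c])
      next
        case 2
        then show ?thesis using w(1) j vs_smult_closed[OF A.psh_vspace[OF M 2(2)]]
          by (simp add: wc_left_def wc_right_def C.cmp_linear w(2) wcoconeD'(5)[OF c])
      next
        case 3
        have "Cmp C w (Cmp C (j (Tgt A u, x)) (ka u)) = Cmp C (Cmp C w (j (Tgt A u, x))) (ka u)"
          using 3 w(1) j ka' by simp
        then show ?thesis using 3 A.act_closed[OF M 3(2,3)]
          by (simp add: wc_left_def wc_right_def w(2) wcoconeD(3)[OF c])
      qed
    qed
    \<comment> \<open>The two composites agree on every summand of the coproduct of relations and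
      are therefore equal.\<close>
    have wf: "Cmp C w f = Cmp C w g"
    proof -
      have *: "Cmp C w (wc_left A M j r) \<in> homset C (wc_src A ko r) z'" if r: "r \<in> wc_rels A M" for r
        using f(2)[OF r, symmetric] w(1) fg j'[OF r] by simp
      have "\<exists>!v. v \<in> homset C s' z' \<and> (\<forall>r\<in>wc_rels A M. Cmp C v (j' r) = Cmp C w (wc_left A M j r))"
        by (rule is_coproductD(3)[OF s' z' *])
      moreover have "Cmp C w f \<in> homset C s' z'" "Cmp C w g \<in> homset C s' z'" using w(1) fg by simp_all
      moreover have "Cmp C (Cmp C w f) (j' r) = Cmp C w (wc_left A M j r)" "Cmp C (Cmp C w g) (j' r) = Cmp C w (wc_left A M j r)"
        if "r \<in> wc_rels A M" for r
        using w(1) fg j'[OF that] f(2)[OF that] g(2)[OF that] wlr[OF that] by simp_all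
      ultimately show ?thesis by metis
    qed
    have "\<exists>!h. h \<in> homset C (Tgt C q) (Tgt C w) \<and> Cmp C h q = w"
      by (rule qD(4)) (use w(1) fg wf in auto)
    then obtain h where h0: "h \<in> homset C (Tgt C q) (Tgt C w) \<and> Cmp C h q = w"
      and h0': "\<forall>h'. h' \<in> homset C (Tgt C q) (Tgt C w) \<and> Cmp C h' q = w \<longrightarrow> h' = h" by (rule ex1E)
    have h: "h \<in> homset C (Tgt C q) z'" "Cmp C h q = w" using h0 w(1) by simp_all
    have hu: "h' = h" if "h' \<in> homset C (Tgt C q) z'" "Cmp C h' q = w" for h'
      by (rule mp[OF spec[OF h0']]) (use that w(1) in simp)
    show "\<exists>!h. h \<in> homset C (Tgt C q) z' \<and> (\<forall>a\<in>Obj A. \<forall>x\<in>elems M a. Cmp C h (Cmp C q (j (a, x))) = \<theta>' a x)"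
    proof (rule ex1I[of _ h], intro conjI ballI)
      fix a x assume a: "a \<in> Obj A" "x \<in> elems M a"
      have "Cmp C h (Cmp C q (j (a, x))) = Cmp C (Cmp C h q) (j (a, x))" using h(1) q' j[OF a] by simp
      then show "Cmp C h (Cmp C q (j (a, x))) = \<theta>' a x" using h(2) w(2)[OF a] by simp
    next
      fix h' assume h': "h' \<in> homset C (Tgt C q) z' \<and> (\<forall>a\<in>Obj A. \<forall>x\<in>elems M a. Cmp C h' (Cmp C q (j (a, x))) = \<theta>' a x)"
      have "Cmp C h' q = w"
      proof (rule wu)
        show "Cmp C h' q \<in> homset C s z'" using h' q' by simp
        show "\<forall>i\<in>wc_index A M. Cmp C (Cmp C h' q) (j i) = \<theta>' (fst i) (snd i)"
          using h' q' j by (auto simp: wc_index_def)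
      qed
      then show "h' = h" using hu h' by blast
    qed (rule h(1))
  qed
qed

text \<open>Preservation is part of the statement because it concerns this particular colimit: a
  cocontinuous functor preserves the coproducts and the coequalizer from which it is built.\<close>

lemma (in small_category) wcolim_exists:
  fixes C :: "('p, 'n, 'k, 'y) kcat_scheme" and M :: "('o, 'm, 'k, 'v) psh"
  assumes C: "klinear_category C" and cc: "small_cocomplete TYPE('v) C" and M: "presheaf A M"
    and ko: "\<And>a. a \<in> Obj A \<Longrightarrow> ko a \<in> Obj C" and ka: "\<And>u. u \<in> Arr A \<Longrightarrow> ka u \<in> homset C (ko (Src A u)) (ko (Tgt A u))"
  shows "\<exists>z \<theta>. wcolim A C ko ka M z \<theta> \<and>
    (\<forall>H. klinear_functor C C H \<longrightarrow> small_cocontinuous TYPE('v) C C H \<longrightarrow>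
       wcolim A C (\<lambda>a. OMap H (ko a)) (\<lambda>u. AMap H (ka u)) M (OMap H z) (\<lambda>a x. AMap H (\<theta> a x)))"
proof -
  interpret C: klinear_category C by fact
  have sI: "small TYPE('v) (wc_index A M)"
    by (rule small_subset[OF small_Times[OF small_obj small_UNIV[of UNIV]]]) (auto simp: wc_index_def)
  have sR: "small TYPE('v) (wc_rels A M)"
  proof -
    have "small TYPE('v) ((Obj A \<times> UNIV \<times> UNIV) <+> (((UNIV :: 'k set) \<times> Obj A \<times> UNIV) <+> (Arr A \<times> UNIV)) ::
        ('o \<times> 'v \<times> 'v + 'k \<times> 'o \<times> 'v + 'm \<times> 'v) set)"
      by (intro small_Plus small_Times small_obj small_arr small_field small_UNIV)
    then show ?thesis by (rule small_subset) (auto simp: wc_rels_def)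
  qed
  have rs: "wc_src A ko r \<in> Obj C" if "r \<in> wc_rels A M" for r
    using that ko by (auto simp: wc_rels_def wc_src_def)
  obtain s j where s: "is_coproduct C (wc_index A M) (\<lambda>i. ko (fst i)) s j"
    and sH: "\<And>H. small_cocontinuous TYPE('v) C C H \<Longrightarrow>
      is_coproduct C (wc_index A M) (\<lambda>i. OMap H (ko (fst i))) (OMap H s) (\<lambda>i. AMap H (j i))"
  proof -
    have "(\<lambda>i. ko (fst i)) ` wc_index A M \<subseteq> Obj C" using ko by (auto simp: wc_index_def)
    from small_coproduct[OF cc sI this] show ?thesis using that by blast
  qed
  obtain s' j' where s': "is_coproduct C (wc_rels A M) (wc_src A ko) s' j'"
    and s'H: "\<And>H. small_cocontinuous TYPE('v) C C H \<Longrightarrow>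
      is_coproduct C (wc_rels A M) (\<lambda>r. OMap H (wc_src A ko r)) (OMap H s') (\<lambda>r. AMap H (j' r))"
  proof -
    have "wc_src A ko ` wc_rels A M \<subseteq> Obj C" using rs by auto
    from small_coproduct[OF cc sR this] show ?thesis using that by blast
  qed
  have j: "j (a, x) \<in> Arr C" "Src C (j (a, x)) = ko a" "Tgt C (j (a, x)) = s" if "a \<in> Obj A" "x \<in> elems M a" for a x
    using is_coproductD(2)[OF s, of "(a, x)"] that by (auto simp: wc_index_def)
  have j': "j' r \<in> homset C (wc_src A ko r) s'" if "r \<in> wc_rels A M" for r by (rule is_coproductD(2)[OF s' that])
  note vs = vs_add_closed[OF psh_vspace[OF M]] vs_smult_closed[OF psh_vspace[OF M]] act_closed[OF M]
  have ka': "ka u \<in> Arr C" "Src C (ka u) = ko (Src A u)" "Tgt C (ka u) = ko (Tgt A u)" if "u \<in> Arr A" for u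
    using ka[OF that] by auto
  have lr: "wc_left A M j r \<in> homset C (wc_src A ko r) s" "wc_right A C ka j r \<in> homset C (wc_src A ko r) s"
    if "r \<in> wc_rels A M" for r
    using that by (auto simp: wc_rels_def wc_left_def wc_right_def wc_src_def j ka' vs)
  obtain f where f: "f \<in> homset C s' s" "\<And>r. r \<in> wc_rels A M \<Longrightarrow> Cmp C f (j' r) = wc_left A M j r"
    using is_coproductD(3)[OF s' is_coproductD(1)[OF s] lr(1)] by blast
  obtain g where g: "g \<in> homset C s' s" "\<And>r. r \<in> wc_rels A M \<Longrightarrow> Cmp C g (j' r) = wc_right A C ka j r"
    using is_coproductD(3)[OF s' is_coproductD(1)[OF s] lr(2)] by blast
  obtain q where q: "is_coequalizer C f g q" using cc f(1) g(1) unfolding small_cocomplete_def by blast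
  note qD = is_coequalizerD[OF q]
  \<comment> \<open>Being linear, \<open>H\<close> maps both parallel arrows to arrows of the same
    shape for the image diagram, sums and multiples in \<open>wc_right\<close> included; the
    construction is then repeated in the image.\<close>
  have "wcolim A C (\<lambda>a. OMap H (ko a)) (\<lambda>u. AMap H (ka u)) M (OMap H (Tgt C q)) (\<lambda>a x. AMap H (Cmp C q (j (a, x))))"
    if H: "klinear_functor C C H" and Hc: "small_cocontinuous TYPE('v) C C H" for H
  proof -
    note Hs = C.endo_simps[OF H]
    have "is_coequalizer C (AMap H f) (AMap H g) (AMap H q)"
      using Hc q f(1) g(1) unfolding small_cocontinuous_def by blast
    then have "wcolim A C (\<lambda>a. OMap H (ko a)) (\<lambda>u. AMap H (ka u)) M (Tgt C (AMap H q)) (\<lambda>a x. Cmp C (AMap H q) (AMap H (j (a, x))))"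
    proof (rule wcolim_coequalizer[OF klinear_category_axioms C M, rotated -1])
      show "is_coproduct C (wc_index A M) (\<lambda>i. OMap H (ko (fst i))) (OMap H s) (\<lambda>i. AMap H (j i))" by (rule sH[OF Hc])
      have "(wc_src A (\<lambda>a. OMap H (ko a)) :: 'o \<times> 'v \<times> 'v + 'k \<times> 'o \<times> 'v + 'm \<times> 'v \<Rightarrow> 'p) = (\<lambda>r. OMap H (wc_src A ko r))"
        by (auto simp: wc_src_def fun_eq_iff split: sum.split)
      then show "is_coproduct C (wc_rels A M) (wc_src A (\<lambda>a. OMap H (ko a))) (OMap H s') (\<lambda>r. AMap H (j' r))"
        using s'H[OF Hc] by (simp only:)
      fix r assume r: "r \<in> wc_rels A M"
      have 1: "Cmp C (AMap H f) (AMap H (j' r)) = AMap H (wc_left A M j r)" "Cmp C (AMap H g) (AMap H (j' r)) = AMap H (wc_right A C ka j r)"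
        using f g j'[OF r] Hs(6)[of "j' r" f] Hs(6)[of "j' r" g] r by simp_all
      have 2: "AMap H (wc_left A M j r) = wc_left A M (\<lambda>i. AMap H (j i)) r"
        by (auto simp: wc_left_def split: sum.split)
      have 3: "AMap H (wc_right A C ka j r) = wc_right A C (\<lambda>u. AMap H (ka u)) (\<lambda>i. AMap H (j i)) r"
        using r by (auto simp: wc_right_def wc_rels_def Hs j ka')
      show "Cmp C (AMap H f) (AMap H (j' r)) = wc_left A M (\<lambda>i. AMap H (j i)) r"
        "Cmp C (AMap H g) (AMap H (j' r)) = wc_right A C (\<lambda>u. AMap H (ka u)) (\<lambda>i. AMap H (j i)) r"
        using 1 2 3 by simp_all
    qed (use f g ko ka' Hs in simp_all)
    then have "wcolim A C (\<lambda>a. OMap H (ko a)) (\<lambda>u. AMap H (ka u)) M (OMap H (Tgt C q)) (\<lambda>a x. Cmp C (AMap H q) (AMap H (j (a, x))))"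
      using Hs qD(1) by simp
    then show ?thesis
      by (rule wcolim_cong) (use Hs qD f(1) j M klinear_category_axioms in simp_all)
  qed
  moreover have "wcolim A C ko ka M (Tgt C q) (\<lambda>a x. Cmp C q (j (a, x)))"
    by (rule wcolim_coequalizer[OF klinear_category_axioms C M ko ka s s' f g q])
  ultimately show ?thesis by blast
qed


context small_category
begin

text \<open>The co-Yoneda lemma in explicit form: a cocone on a represented presheaf is determined
  by its value at the universal element. The functor laws of the diagram are listed one by one
  because it is used for the values of composites of endofunctors at an object.\<close>

lemma yoneda_wcolim:
  fixes C :: "('p, 'n, 'k, 'y) kcat_scheme"
  assumes C: "klinear_category C" and p: "p \<in> Obj A"
    and ko: "\<And>a. a \<in> Obj A \<Longrightarrow> ko a \<in> Obj C" and ka: "\<And>u. u \<in> Arr A \<Longrightarrow> ka u \<in> homset C (ko (Src A u)) (ko (Tgt A u))"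
    and idt: "\<And>a. a \<in> Obj A \<Longrightarrow> ka (Idt A a) = Idt C (ko a)"
    and cmp: "\<And>u v. u \<in> Arr A \<Longrightarrow> v \<in> Arr A \<Longrightarrow> Src A v = Tgt A u \<Longrightarrow> ka (Cmp A v u) = Cmp C (ka v) (ka u)"
    and plus: "\<And>u v. u \<in> Arr A \<Longrightarrow> v \<in> Arr A \<Longrightarrow> Src A v = Src A u \<Longrightarrow> Tgt A v = Tgt A u \<Longrightarrow> ka (Plus A u v) = Plus C (ka u) (ka v)"
    and scal: "\<And>u s. u \<in> Arr A \<Longrightarrow> ka (Scal A s u) = Scal C s (ka u)"
  shows "wcolim A C ko ka (yon p) (ko p) (\<lambda>a x. ka (decode a p x))"
proof -
  interpret C: klinear_category C by fact
  have ka': "ka u \<in> Arr C" "Src C (ka u) = ko (Src A u)" "Tgt C (ka u) = ko (Tgt A u)" if "u \<in> Arr A" for u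
    using ka[OF that] by auto
  show ?thesis unfolding wcolim_def
  proof (intro conjI allI impI)
    show "wcocone A C ko ka (yon p) (ko p) (\<lambda>a x. ka (decode a p x))"
    proof (rule wcoconeI)
      fix a assume "a \<in> Obj A"
      then show "linf (OMap (yon p) a) (hom_space C (ko a) (ko p)) (\<lambda>x. ka (decode a p x))"
        using p by (auto simp: linf_def decode_arr decode_add decode_smult plus scal ka')
    qed (use p ko in \<open>auto simp: decode_act decode_arr cmp\<close>)
    fix z' \<theta>' assume c: "wcocone A C ko ka (yon p) z' \<theta>'"
    let ?i = "code p p (Idt A p)"
    have i: "?i \<in> elems (yon p) p" using p by (simp add: code_closed')
    note h = wcoconeD'[OF c p i]
    show "\<exists>!h. h \<in> homset C (ko p) z' \<and> (\<forall>a\<in>Obj A. \<forall>x\<in>elems (yon p) a. Cmp C h (ka (decode a p x)) = \<theta>' a x)"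
    proof (rule ex1I[of _ "\<theta>' p ?i"], intro conjI ballI)
      show "\<theta>' p ?i \<in> homset C (ko p) z'" using h by simp
      fix a x assume a: "a \<in> Obj A" and x: "x \<in> elems (yon p) a"
      then have u: "decode a p x \<in> Arr A" "Src A (decode a p x) = a" "Tgt A (decode a p x) = p" "code a p (decode a p x) = x"
        using decode_arr[OF a p] by auto
      show "Cmp C (\<theta>' p ?i) (ka (decode a p x)) = \<theta>' a x"
        using wcoconeD(3)[OF c u(1), unfolded u, OF i] yon_act(2)[OF p u(1), of "Idt A p"] u p by simp
    next
      fix h' assume h': "h' \<in> homset C (ko p) z' \<and> (\<forall>a\<in>Obj A. \<forall>x\<in>elems (yon p) a. Cmp C h' (ka (decode a p x)) = \<theta>' a x)"
      then have "Cmp C h' (ka (decode p p ?i)) = \<theta>' p ?i" using p i by blast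
      then show "h' = \<theta>' p ?i" using h' p ko by (simp add: idt)
    qed
  qed
qed

end

section \<open>Pointwise weighted colimits of endofunctors\<close>

locale endo_action = small_monoidal A U + C: klinear_category C
  for A :: "('o, 'm, 'k::field, 'z) moncat_scheme" (structure) and U :: "'v itself"
    and C :: "('p, 'n, 'k, 'y) kcat_scheme" +
  fixes G :: "('o, 'm, ('p, 'n, 'p, 'n) ftor, ('p, 'n, 'p, 'n) ntrans) ftor"
  assumes G: "klinear_functor A C.End G"
    and G_tobj: "a \<in> Obj A \<Longrightarrow> b \<in> Obj A \<Longrightarrow> OMap G (a \<star> b) = ftor_comp C (OMap G a) (OMap G b)"
    and G_tarr: "f \<in> Arr A \<Longrightarrow> g \<in> Arr A \<Longrightarrow> AMap G (f \<boxtimes> g) = AMap G f \<boxtimes>\<^bsub>C.End\<^esub> AMap G g"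
    and G_one: "OMap G (One A) = ftor_id C"
    and cc: "small_cocomplete TYPE('v) C"
    and cont: "a \<in> Obj A \<Longrightarrow> small_cocontinuous TYPE('v) C C (OMap G a)"
begin

abbreviation Go where "Go \<equiv> OMap G"
abbreviation Ga where "Ga \<equiv> AMap G"
abbreviation comp (infixr "\<bullet>" 70) where "g \<bullet> f \<equiv> Cmp C g f"

sublocale E: strict_monoidal C.End
  by (rule C.End_strict)

lemma G_simps [simp]:
  "a \<in> Obj A \<Longrightarrow> C.endofunctor (Go a)" "a \<in> Obj A \<Longrightarrow> Ga (Idt A a) = Idt C.End (Go a)"
  "u \<in> Arr A \<Longrightarrow> C.endotrans (Ga u)" "u \<in> Arr A \<Longrightarrow> NSrc (Ga u) = Go (Src A u)" "u \<in> Arr A \<Longrightarrow> NTgt (Ga u) = Go (Tgt A u)"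
  "u \<in> Arr A \<Longrightarrow> v \<in> Arr A \<Longrightarrow> Src A v = Tgt A u \<Longrightarrow> Ga (v \<cdot> u) = Cmp C.End (Ga v) (Ga u)"
  "u \<in> Arr A \<Longrightarrow> v \<in> Arr A \<Longrightarrow> Src A v = Src A u \<Longrightarrow> Tgt A v = Tgt A u \<Longrightarrow> Ga (Plus A u v) = Plus C.End (Ga u) (Ga v)"
  "u \<in> Arr A \<Longrightarrow> Ga (Scal A s u) = Scal C.End s (Ga u)"
  using klinear_functorD[OF G] by auto

text \<open>Weighted colimits of \<open>G\<close> in the category of endofunctors that are computed pointwise and preserved by all \<open>G n\<close>.\<close>

definition good :: "('o, 'm, 'k, 'v) psh \<Rightarrow> ('p, 'n, 'p, 'n) ftor \<Rightarrow> ('o \<Rightarrow> 'v \<Rightarrow> ('p, 'n, 'p, 'n) ntrans) \<Rightarrow> bool" where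
  "good M F t \<longleftrightarrow> C.endofunctor F \<and>
     (\<forall>a\<in>Obj A. \<forall>x\<in>elems M a. t a x \<in> homset C.End (Go a) F) \<and>
     (\<forall>n\<in>Obj A. \<forall>Y\<in>Obj C. wcolim A C (\<lambda>a. OMap (Go n) (OMap (Go a) Y)) (\<lambda>u. AMap (Go n) (NAt (Ga u) Y)) M
        (OMap (Go n) (OMap F Y)) (\<lambda>a x. AMap (Go n) (NAt (t a x) Y)))"

text \<open>Makes it possible to let the value at the represented presheaf be \<open>Go p\<close>
  itself and not only an isomorphic functor.\<close>

lemma good_yoneda:
  assumes p: "p \<in> Obj A"
  shows "good (yon p) (Go p) (\<lambda>a x. Ga (decode a p x))"
  unfolding good_def
proof (intro conjI ballI)
  fix n Y assume n: "n \<in> Obj A" and Y: "Y \<in> Obj C"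
  show "wcolim A C (\<lambda>a. OMap (Go n) (OMap (Go a) Y)) (\<lambda>u. AMap (Go n) (NAt (Ga u) Y)) (yon p)
        (OMap (Go n) (OMap (Go p) Y)) (\<lambda>a x. AMap (Go n) (NAt (Ga (decode a p x)) Y))"
    by (rule yoneda_wcolim[OF C.klinear_category_axioms p, of "\<lambda>a. OMap (Go n) (OMap (Go a) Y)" "\<lambda>u. AMap (Go n) (NAt (Ga u) Y)"])
      (use n Y in simp_all)
next
  fix a x assume a: "a \<in> Obj A" and x: "x \<in> elems (yon p) a"
  then have u: "decode a p x \<in> Arr A" "Src A (decode a p x) = a" "Tgt A (decode a p x) = p"
    using decode_arr[OF a p] by auto
  then show "Ga (decode a p x) \<in> homset C.End (Go a) (Go p)" by simp
qed (use p in simp)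

lemma good_exists:
  assumes M: "presheaf A M"
  shows "\<exists>F t. good M F t"
proof -
  let ?P = "\<lambda>Y z \<theta>. wcolim A C (\<lambda>a. OMap (Go a) Y) (\<lambda>u. NAt (Ga u) Y) M z \<theta> \<and>
    (\<forall>H. klinear_functor C C H \<longrightarrow> small_cocontinuous TYPE('v) C C H \<longrightarrow>
       wcolim A C (\<lambda>a. OMap H (OMap (Go a) Y)) (\<lambda>u. AMap H (NAt (Ga u) Y)) M (OMap H z) (\<lambda>a x. AMap H (\<theta> a x)))"
  \<comment> \<open>For each \<open>Y\<close> the colimit is chosen together with its preservation
    by all cocontinuous functors, since \<open>good\<close> asks for preservation of this very
    colimit by the \<open>Go n\<close>.\<close>
  have "\<forall>Y\<in>Obj C. \<exists>p. ?P Y (fst p) (snd p)"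
  proof
    fix Y assume Y: "Y \<in> Obj C"
    have "\<exists>z \<theta>. ?P Y z \<theta>"
      by (rule wcolim_exists[OF C.klinear_category_axioms cc M]) (use Y in simp_all)
    then obtain z \<theta> where "?P Y z \<theta>" by blast
    then show "\<exists>p. ?P Y (fst p) (snd p)" by (intro exI[of _ "(z, \<theta>)"]) simp
  qed
  from bchoice[OF this] obtain q where q: "\<forall>Y\<in>Obj C. ?P Y (fst (q Y)) (snd (q Y))" by (rule exE)
  define W where "W Y = fst (q Y)" for Y
  define T where "T Y = snd (q Y)" for Y
  have WT: "wcolim A C (\<lambda>a. OMap (Go a) Y) (\<lambda>u. NAt (Ga u) Y) M (W Y) (T Y)" if "Y \<in> Obj C" for Y
    unfolding W_def T_def by (rule conjunct1[OF bspec[OF q that]])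
  have WTH: "\<And>H. klinear_functor C C H \<Longrightarrow> small_cocontinuous TYPE('v) C C H \<Longrightarrow>
       wcolim A C (\<lambda>a. OMap H (OMap (Go a) Y)) (\<lambda>u. AMap H (NAt (Ga u) Y)) M (OMap H (W Y)) (\<lambda>a x. AMap H (T Y a x))"
    if "Y \<in> Obj C" for Y
    unfolding W_def T_def by (rule mp[OF mp[OF spec[OF conjunct2[OF bspec[OF q that]]]]])
  note Tc = wcolim_cocone[OF WT]
  have T: "T Y a x \<in> Arr C" "Src C (T Y a x) = OMap (Go a) Y" "Tgt C (T Y a x) = W Y" if "Y \<in> Obj C" "a \<in> Obj A" "x \<in> elems M a" for Y a x
    using wcoconeD'[OF Tc[OF that(1)] that(2,3)] by auto
  have W: "W Y \<in> Obj C" if "Y \<in> Obj C" for Y by (rule wcoconeD(1)[OF Tc[OF that]])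
  have epi: "h = h'" if "Y \<in> Obj C" "h \<in> homset C (W Y) z" "h' \<in> homset C (W Y) z"
    "\<And>a x. a \<in> Obj A \<Longrightarrow> x \<in> elems M a \<Longrightarrow> h \<bullet> T Y a x = h' \<bullet> T Y a x" for Y h h' z
    by (rule wcolim_epi[OF C.klinear_category_axioms WT[OF that(1)] _ klinear_category_axioms that(2,3)])
      (use that(1) in simp, rule that(4))
  \<comment> \<open>The effect on an arrow: the only arrow between the chosen colimits that is
    compatible with the legs. Identity, composition and linearity all follow by testing on the
    legs.\<close>
  define m where "m f = (THE h. h \<in> homset C (W (Src C f)) (W (Tgt C f)) \<and>
    (\<forall>a\<in>Obj A. \<forall>x\<in>elems M a. h \<bullet> T (Src C f) a x = T (Tgt C f) a x \<bullet> AMap (Go a) f))" for f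
  have m0: "m f \<in> homset C (W (Src C f)) (W (Tgt C f)) \<and>
    (\<forall>a\<in>Obj A. \<forall>x\<in>elems M a. m f \<bullet> T (Src C f) a x = T (Tgt C f) a x \<bullet> AMap (Go a) f)" if f: "f \<in> Arr C" for f
  proof -
    note Y = C.obj_arr[OF f]
    have "wcocone A C (\<lambda>a. OMap (Go a) (Src C f)) (\<lambda>u. NAt (Ga u) (Src C f)) M (W (Tgt C f)) (\<lambda>a x. T (Tgt C f) a x \<bullet> AMap (Go a) f)"
    proof (rule wcoconeI)
      fix a assume a: "a \<in> Obj A"
      then show "linf (OMap M a) (hom_space C (OMap (Go a) (Src C f)) (W (Tgt C f))) (\<lambda>x. T (Tgt C f) a x \<bullet> AMap (Go a) f)"
        using f T[OF Y(2) a] wcoconeD'(4,5)[OF Tc[OF Y(2)] a] by (simp add: linf_def C.cmp_linear)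
    next
      fix u x assume u: "u \<in> Arr A" "x \<in> elems M (Tgt A u)"
      have "T (Tgt C f) (Src A u) (act M u x) \<bullet> AMap (Go (Src A u)) f = T (Tgt C f) (Tgt A u) x \<bullet> (NAt (Ga u) (Tgt C f) \<bullet> AMap (NSrc (Ga u)) f)"
        using u f T[OF Y(2) _ u(2)] wcoconeD(3)[OF Tc[OF Y(2)] u] by simp
      also have "\<dots> = (T (Tgt C f) (Tgt A u) x \<bullet> AMap (Go (Tgt A u)) f) \<bullet> NAt (Ga u) (Src C f)"
        using u f T[OF Y(2) _ u(2)] C.nt_nat[of "Ga u" f] by simp
      finally show "T (Tgt C f) (Src A u) (act M u x) \<bullet> AMap (Go (Src A u)) f =
          (T (Tgt C f) (Tgt A u) x \<bullet> AMap (Go (Tgt A u)) f) \<bullet> NAt (Ga u) (Src C f)" .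
    qed (use W Y in simp)
    from wcolim_factor[OF WT[OF Y(1)] this] show ?thesis unfolding m_def by (rule theI')
  qed
  have m: "m f \<in> Arr C" "Src C (m f) = W (Src C f)" "Tgt C (m f) = W (Tgt C f)"
    "a \<in> Obj A \<Longrightarrow> x \<in> elems M a \<Longrightarrow> m f \<bullet> T (Src C f) a x = T (Tgt C f) a x \<bullet> AMap (Go a) f" if "f \<in> Arr C" for f a x
    using m0[OF that] by auto
  define F where "F = \<lparr>OMap = (\<lambda>Y\<in>Obj C. W Y), AMap = (\<lambda>f\<in>Arr C. m f)\<rparr>"
  have FW [simp]: "Y \<in> Obj C \<Longrightarrow> OMap F Y = W Y" and Fm [simp]: "f \<in> Arr C \<Longrightarrow> AMap F f = m f" for Y f by (simp_all add: F_def)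
  have F: "C.endofunctor F"
  proof (rule klinear_functorI)
    fix Y assume Y: "Y \<in> Obj C"
    have "m (Idt C Y) = Idt C (W Y)"
      by (rule epi[OF Y, of _ "W Y"]) (use Y W m(1-3)[of "Idt C Y"] m(4)[of "Idt C Y"] T[OF Y] in simp_all)
    then show "AMap F (Idt C Y) = Idt C (OMap F Y)" using Y by simp
  next
    fix f g assume fg: "f \<in> Arr C" "g \<in> Arr C" "Src C g = Tgt C f"
    have "m (g \<bullet> f) = m g \<bullet> m f"
    proof (rule epi[of "Src C f" _ "W (Tgt C g)"])
      fix a x assume a: "a \<in> Obj A" "x \<in> elems M a"
      have "(m g \<bullet> m f) \<bullet> T (Src C f) a x = m g \<bullet> (T (Src C g) a x \<bullet> AMap (Go a) f)"
        using fg a m T[OF _ a] by simp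
      also have "\<dots> = (m g \<bullet> T (Src C g) a x) \<bullet> AMap (Go a) f" using fg a m(1-3)[OF fg(2)] T[OF _ a] by simp
      also have "\<dots> = m (g \<bullet> f) \<bullet> T (Src C f) a x"
        using fg a m(4)[OF fg(2) a] m(4)[of "g \<bullet> f" a x] T[OF _ a] by simp
      finally show "m (g \<bullet> f) \<bullet> T (Src C f) a x = (m g \<bullet> m f) \<bullet> T (Src C f) a x" by simp
    qed (use fg m in simp_all)
    then show "AMap F (g \<bullet> f) = AMap F g \<bullet> AMap F f" using fg by simp
  next
    fix f g assume fg: "f \<in> Arr C" "g \<in> Arr C" "Src C g = Src C f" "Tgt C g = Tgt C f"
    have "m (Plus C f g) = Plus C (m f) (m g)"
      by (rule epi[of "Src C f" _ "W (Tgt C f)"])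
        (use fg m(1-3)[of f] m(1-3)[of g] m(1-3)[of "Plus C f g"] m(4)[of f] m(4)[of g] m(4)[of "Plus C f g"] T
          in \<open>simp_all add: C.cmp_linear\<close>)
    then show "AMap F (Plus C f g) = Plus C (AMap F f) (AMap F g)" using fg by simp
  next
    fix f s assume f: "f \<in> Arr C"
    have "m (Scal C s f) = Scal C s (m f)"
      by (rule epi[of "Src C f" _ "W (Tgt C f)"])
        (use f m(1-3)[of f] m(1-3)[of "Scal C s f"] m(4)[of f] m(4)[of "Scal C s f"] T in \<open>simp_all add: C.cmp_linear\<close>)
    then show "AMap F (Scal C s f) = Scal C s (AMap F f)" using f by simp
  qed (use W m in simp_all, simp_all add: F_def)
  define t where "t a x = \<lparr>NSrc = Go a, NTgt = F, NAt = (\<lambda>Y\<in>Obj C. T Y a x)\<rparr>" for a x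
  have tY [simp]: "Y \<in> Obj C \<Longrightarrow> NAt (t a x) Y = T Y a x" for Y a x by (simp add: t_def)
  have t: "t a x \<in> homset C.End (Go a) F" if a: "a \<in> Obj A" "x \<in> elems M a" for a x
  proof -
    have "C.endotrans (t a x)"
      by (rule natural_transformationI) (use a F T[OF _ a] m in \<open>simp_all\<close>, simp_all add: t_def)
    then show ?thesis by (simp add: t_def)
  qed
  have "good M F t" unfolding good_def
    using F t WTH[OF _ _ cont] by simp
  then show ?thesis by blast
qed

text \<open>Composing with \<open>Z\<close> on the right only evaluates the pointwise colimits at
  \<open>OMap Z Y\<close>, and composing with \<open>Go n\<close> on the left is covered by
  \<open>good\<close>. A factorisation is assembled from the pointwise ones.\<close>

lemma wcolim_endo:
  assumes M: "presheaf A M" and g: "good M F t" and n: "n \<in> Obj A" and Z: "C.endofunctor Z"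
  shows "wcolim A C.End (\<lambda>a. Go n \<star>\<^bsub>C.End\<^esub> (Go a \<star>\<^bsub>C.End\<^esub> Z)) (\<lambda>u. Idt C.End (Go n) \<boxtimes>\<^bsub>C.End\<^esub> (Ga u \<boxtimes>\<^bsub>C.End\<^esub> Idt C.End Z)) M
        (Go n \<star>\<^bsub>C.End\<^esub> (F \<star>\<^bsub>C.End\<^esub> Z)) (\<lambda>a x. Idt C.End (Go n) \<boxtimes>\<^bsub>C.End\<^esub> (t a x \<boxtimes>\<^bsub>C.End\<^esub> Idt C.End Z))"
proof -
  have F: "C.endofunctor F" using g by (simp add: good_def)
  have t: "C.endotrans (t a x)" "NSrc (t a x) = Go a" "NTgt (t a x) = F" if "a \<in> Obj A" "x \<in> elems M a" for a x
    using g that by (auto simp: good_def)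
  have col: "wcolim A C (\<lambda>a. OMap (Go n) (OMap (Go a) Y)) (\<lambda>u. AMap (Go n) (NAt (Ga u) Y)) M
        (OMap (Go n) (OMap F Y)) (\<lambda>a x. AMap (Go n) (NAt (t a x) Y))" if "n \<in> Obj A" "Y \<in> Obj C" for n Y
    using g that unfolding good_def by blast
  \<comment> \<open>\<open>Go\<close> sends the unit object to the identity functor, so the instance
    at the unit is the cocone of \<open>t\<close> itself.\<close>
  note c1 = wcolim_cocone[OF col[OF one]]
  have cl: "x \<in> elems M a \<Longrightarrow> y \<in> elems M a \<Longrightarrow> x \<oplus>\<^bsub>OMap M a\<^esub> y \<in> elems M a" "x \<in> elems M a \<Longrightarrow> s \<odot>\<^bsub>OMap M a\<^esub> x \<in> elems M a"
    if "a \<in> Obj A" for a x y s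
    using vs_closed[OF psh_vspace[OF M that]] by auto
  have t_add: "t a (x \<oplus>\<^bsub>OMap M a\<^esub> y) = Plus C.End (t a x) (t a y)" if "a \<in> Obj A" "x \<in> elems M a" "y \<in> elems M a" for a x y
    by (rule C.nt_eqI) (use that t cl wcoconeD'(4)[OF c1 that(1,2)] in \<open>simp_all add: G_one\<close>)
  have t_smult: "t a (s \<odot>\<^bsub>OMap M a\<^esub> x) = Scal C.End s (t a x)" if "a \<in> Obj A" "x \<in> elems M a" for a x s
    by (rule C.nt_eqI) (use that t cl wcoconeD'(5)[OF c1 that(1,2)] in \<open>simp_all add: G_one\<close>)
  have t_act: "t (Src A u) (act M u x) = Cmp C.End (t (Tgt A u) x) (Ga u)" if "u \<in> Arr A" "x \<in> elems M (Tgt A u)" for u x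
    by (rule C.nt_eqI) (use that t act_closed[OF M that] wcoconeD(3)[OF c1 that] in \<open>simp_all add: G_one\<close>)
  let ?ko = "\<lambda>a. Go n \<star>\<^bsub>C.End\<^esub> (Go a \<star>\<^bsub>C.End\<^esub> Z)" and ?ka = "\<lambda>u. Idt C.End (Go n) \<boxtimes>\<^bsub>C.End\<^esub> (Ga u \<boxtimes>\<^bsub>C.End\<^esub> Idt C.End Z)"
    and ?t = "\<lambda>a x. Idt C.End (Go n) \<boxtimes>\<^bsub>C.End\<^esub> (t a x \<boxtimes>\<^bsub>C.End\<^esub> Idt C.End Z)"
  let ?F = "ftor_comp C (Go n) (ftor_comp C F Z)"
  have cY: "wcolim A C (\<lambda>a. OMap (?ko a) Y) (\<lambda>u. NAt (?ka u) Y) M (OMap ?F Y) (\<lambda>a x. NAt (?t a x) Y)" if Y: "Y \<in> Obj C" for Y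
  proof -
    have FY: "OMap ?F Y = OMap (Go n) (OMap F (OMap Z Y))" using Y by simp
    show ?thesis unfolding FY
      by (rule wcolim_cong[OF col[OF n, of "OMap Z Y"]])
        (use n Z F Y t M klinear_category_axioms in simp_all)
  qed
  have ka: "NAt (?ka u) Y \<in> homset C (OMap (?ko (Src A u)) Y) (OMap (?ko (Tgt A u)) Y)" if "u \<in> Arr A" "Y \<in> Obj C" for u Y
    using n Z that by simp
  have epi: "h = h'" if "Y \<in> Obj C" "h \<in> homset C (OMap ?F Y) z" "h' \<in> homset C (OMap ?F Y) z"
    "\<And>a x. a \<in> Obj A \<Longrightarrow> x \<in> elems M a \<Longrightarrow> h \<bullet> NAt (?t a x) Y = h' \<bullet> NAt (?t a x) Y" for Y h h' z
    by (rule wcolim_epi[OF C.klinear_category_axioms cY[OF that(1)] _ klinear_category_axioms that(2,3)])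
      (rule ka, assumption, rule that(1), rule that(4))
  have tt: "C.endotrans (?t a x)" "NSrc (?t a x) = ?ko a" "NTgt (?t a x) = ?F" if "a \<in> Obj A" "x \<in> elems M a" for a x
    using that n Z t by simp_all
  show ?thesis unfolding wcolim_def
  proof (intro conjI allI impI)
    show "wcocone A C.End ?ko ?ka M (Go n \<star>\<^bsub>C.End\<^esub> (F \<star>\<^bsub>C.End\<^esub> Z)) ?t"
    proof (rule wcoconeI)
      fix a assume a: "a \<in> Obj A"
      show "linf (OMap M a) (hom_space C.End (?ko a) (Go n \<star>\<^bsub>C.End\<^esub> (F \<star>\<^bsub>C.End\<^esub> Z))) (?t a)"
        unfolding linf_def using a n Z t tt by (auto simp: t_add t_smult E.tarr_linear)
    next
      fix u x assume u: "u \<in> Arr A" "x \<in> elems M (Tgt A u)"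
      then show "?t (Src A u) (act M u x) = Cmp C.End (?t (Tgt A u) x) (?ka u)"
        using n Z t by (subst E.tarr_cmp; simp add: t_act; subst E.tarr_cmp; simp)
    qed (use n Z F in simp)
  next
    fix z \<theta> assume c: "wcocone A C.End ?ko ?ka M z \<theta>"
    have z: "C.endofunctor z" using wcoconeD(1)[OF c] by simp
    have th: "C.endotrans (\<theta> a x)" "NSrc (\<theta> a x) = ?ko a" "NTgt (\<theta> a x) = z" if "a \<in> Obj A" "x \<in> elems M a" for a x
      using wcoconeD'(1-3)[OF c that] by auto
    define h where "h Y = (THE h. h \<in> homset C (OMap ?F Y) (OMap z Y) \<and>
      (\<forall>a\<in>Obj A. \<forall>x\<in>elems M a. h \<bullet> NAt (?t a x) Y = NAt (\<theta> a x) Y))" for Y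
    have h0: "h Y \<in> homset C (OMap ?F Y) (OMap z Y) \<and> (\<forall>a\<in>Obj A. \<forall>x\<in>elems M a. h Y \<bullet> NAt (?t a x) Y = NAt (\<theta> a x) Y)"
      if Y: "Y \<in> Obj C" for Y
    proof -
      have "wcocone A C (\<lambda>a. OMap (?ko a) Y) (\<lambda>u. NAt (?ka u) Y) M (OMap z Y) (\<lambda>a x. NAt (\<theta> a x) Y)"
      proof (rule wcoconeI)
        fix a assume a: "a \<in> Obj A"
        show "linf (OMap M a) (hom_space C (OMap (?ko a) Y) (OMap z Y)) (\<lambda>x. NAt (\<theta> a x) Y)"
          unfolding linf_def using a Y th wcoconeD'(4,5)[OF c a] by simp
      next
        fix u x assume u: "u \<in> Arr A" "x \<in> elems M (Tgt A u)"
        then show "NAt (\<theta> (Src A u) (act M u x)) Y = NAt (\<theta> (Tgt A u) x) Y \<bullet> NAt (?ka u) Y"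
          unfolding wcoconeD(3)[OF c u] using Y by (simp only: C.End_arr)
      qed (use z Y in simp)
      from wcolim_factor[OF cY[OF Y] this] show ?thesis unfolding h_def by (rule theI')
    qed
    have h: "h Y \<in> Arr C" "Src C (h Y) = OMap ?F Y" "Tgt C (h Y) = OMap z Y"
      "a \<in> Obj A \<Longrightarrow> x \<in> elems M a \<Longrightarrow> h Y \<bullet> NAt (?t a x) Y = NAt (\<theta> a x) Y" if "Y \<in> Obj C" for Y a x
      using h0[OF that] by auto
    define H where "H = \<lparr>NSrc = ?F, NTgt = z, NAt = (\<lambda>Y\<in>Obj C. h Y)\<rparr>"
    have FF: "C.endofunctor ?F" using n F Z by simp
    have H: "C.endotrans H"
    proof (rule natural_transformationI)
      fix f assume f: "f \<in> Arr C"
      \<comment> \<open>Pointwise factorisations are natural because the legs at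
        \<open>Src C f\<close> are jointly epic: on a leg the equation follows from naturality of
        the legs and of \<open>\<theta> a x\<close>.\<close>
      have "h (Tgt C f) \<bullet> AMap ?F f = AMap z f \<bullet> h (Src C f)"
      proof (rule epi[of "Src C f" _ "OMap z (Tgt C f)"])
        fix a x assume a: "a \<in> Obj A" "x \<in> elems M a"
        have 1: "NAt (?t a x) Y \<in> homset C (OMap (?ko a) Y) (OMap ?F Y)" if "Y \<in> Obj C" for Y
          using C.nt_simps(3-5)[OF tt(1)[OF a] that] tt[OF a] by simp
        have "(h (Tgt C f) \<bullet> AMap ?F f) \<bullet> NAt (?t a x) (Src C f) = h (Tgt C f) \<bullet> (AMap (NTgt (?t a x)) f \<bullet> NAt (?t a x) (Src C f))"
          using f FF h(1-3) 1[of "Src C f"] tt[OF a] by (simp del: C.ftor_comp_simps C.End_arr)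
        also have "\<dots> = h (Tgt C f) \<bullet> (NAt (?t a x) (Tgt C f) \<bullet> AMap (NSrc (?t a x)) f)"
          by (simp only: C.nt_nat[OF tt(1)[OF a] f])
        also have "\<dots> = (h (Tgt C f) \<bullet> NAt (?t a x) (Tgt C f)) \<bullet> AMap (NSrc (?t a x)) f"
          by (rule C.cmp_assoc'[symmetric]) (use f h(1-3) 1[of "Tgt C f"] tt[OF a] C.nt_simps(1)[OF tt(1)[OF a]] in \<open>simp_all del: C.ftor_comp_simps C.End_arr\<close>)
        also have "\<dots> = NAt (\<theta> a x) (Tgt C f) \<bullet> AMap (NSrc (\<theta> a x)) f"
          using f by (simp only: h(4)[OF _ a] tt[OF a] th[OF a] C.obj_arr)
        also have "\<dots> = AMap z f \<bullet> (h (Src C f) \<bullet> NAt (?t a x) (Src C f))"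
          using C.nt_nat[OF th(1)[OF a] f] by (simp only: th[OF a] h(4)[OF C.obj_arr(1)[OF f] a])
        also have "\<dots> = (AMap z f \<bullet> h (Src C f)) \<bullet> NAt (?t a x) (Src C f)"
          by (rule C.cmp_assoc'[symmetric]) (use f z h(1-3) 1[of "Src C f"] in \<open>simp_all del: C.ftor_comp_simps C.End_arr\<close>)
        finally show "(h (Tgt C f) \<bullet> AMap ?F f) \<bullet> NAt (?t a x) (Src C f) = (AMap z f \<bullet> h (Src C f)) \<bullet> NAt (?t a x) (Src C f)" .
      qed (use f FF z h(1-3) in \<open>simp_all del: C.ftor_comp_simps\<close>)
      then show "NAt H (Tgt C f) \<bullet> AMap (NSrc H) f = AMap (NTgt H) f \<bullet> NAt H (Src C f)" using f by (simp add: H_def)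
    qed (use FF z h(1-3) in \<open>simp_all add: H_def del: C.ftor_comp_simps\<close>)
    show "\<exists>!h. h \<in> homset C.End (Go n \<star>\<^bsub>C.End\<^esub> (F \<star>\<^bsub>C.End\<^esub> Z)) z \<and> (\<forall>a\<in>Obj A. \<forall>x\<in>elems M a. Cmp C.End h (?t a x) = \<theta> a x)"
    proof (rule ex1I[of _ H], intro conjI ballI)
      show "H \<in> homset C.End (Go n \<star>\<^bsub>C.End\<^esub> (F \<star>\<^bsub>C.End\<^esub> Z)) z" using H by (simp add: H_def)
      fix a x assume a: "a \<in> Obj A" "x \<in> elems M a"
      show "Cmp C.End H (?t a x) = \<theta> a x"
      proof (rule C.nt_eqI)
        show "C.endotrans (Cmp C.End H (?t a x))" by (rule C.nt_cmp[OF tt(1)[OF a] H]) (simp add: H_def tt[OF a] del: C.End_arr)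
        fix Y assume Y: "Y \<in> Obj C"
        show "NAt (Cmp C.End H (?t a x)) Y = NAt (\<theta> a x) Y" using h(4)[OF Y a] Y by (simp only: C.End_arr(6)) (simp add: H_def)
      qed (use th[OF a] tt[OF a] in \<open>simp_all add: H_def del: C.End_arr(16,17)\<close>)
    next
      fix H' assume H': "H' \<in> homset C.End (Go n \<star>\<^bsub>C.End\<^esub> (F \<star>\<^bsub>C.End\<^esub> Z)) z \<and> (\<forall>a\<in>Obj A. \<forall>x\<in>elems M a. Cmp C.End H' (?t a x) = \<theta> a x)"
      then have H'': "C.endotrans H'" "NSrc H' = ?F" "NTgt H' = z" by simp_all
      show "H' = H"
      proof (rule C.nt_eqI[OF H''(1) H])
        fix Y assume Y: "Y \<in> Obj C"
        have "NAt H' Y = h Y"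
        proof (rule epi[OF Y, of _ "OMap z Y"])
          fix a x assume a: "a \<in> Obj A" "x \<in> elems M a"
          have "NAt (Cmp C.End H' (?t a x)) Y = NAt (\<theta> a x) Y" using H' a by simp
          then show "NAt H' Y \<bullet> NAt (?t a x) Y = h Y \<bullet> NAt (?t a x) Y" using h(4)[OF Y a] Y by (simp only: C.End_arr(6))
        qed (use C.nt_simps(3-5)[OF H''(1) Y] H'' h(1-3)[OF Y] in \<open>simp_all del: C.ftor_comp_simps\<close>)
        then show "NAt H' Y = NAt H Y" using Y by (simp add: H_def)
      qed (use H'' in \<open>simp_all add: H_def\<close>)
    qed
  qed
qed

theorem induced_functor:
  assumes p: "p \<in> Obj A"
  shows "\<exists>K \<phi> \<phi>0. strong_monoidal_functor (day_cat A) C.End K \<phi> \<phi>0 \<and> OMap K (yon p) = Go p \<and>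
    (\<forall>r\<in>homset A p p. AMap K (yarr r) = Ga r) \<and>
    (\<forall>t\<in>homset A (p \<star> p) (p \<star> p).
      Cmp C.End (AMap K (Cmp (day_cat A) (inv_arr (day_cat A) (yoneda_tensor A p p)) (Cmp (day_cat A) (yarr t) (yoneda_tensor A p p))))
        (\<phi> (yon p) (yon p)) = Cmp C.End (\<phi> (yon p) (yon p)) (Ga t))"
proof -
  \<comment> \<open>The exceptional value at \<open>yon p\<close> makes \<open>iota p\<close> an
    identity, which turns the isomorphisms for the generator into equalities. At all other
    presheaves any good colimit will do.\<close>
  define Ft where "Ft M = (if M = yon p then (Go p, \<lambda>a x. Ga (decode a p x)) else (SOME Ft. good M (fst Ft) (snd Ft)))" for M
  have good: "good M (fst (Ft M)) (snd (Ft M))" if M: "presheaf A M" for M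
  proof (cases "M = yon p")
    case True
    then show ?thesis using good_yoneda[OF p] by (simp add: Ft_def)
  next
    case False
    obtain F t where "good M F t" using good_exists[OF M] by blast
    then have "\<exists>Ft. good M (fst Ft) (snd Ft)" by (intro exI[of _ "(F, t)"]) simp
    from someI_ex[OF this] show ?thesis using False by (simp add: Ft_def)
  qed
  interpret K: cas A "TYPE('v)" C.End G "\<lambda>M. fst (Ft M)" "\<lambda>M. snd (Ft M)"
  proof (intro cas.intro cas_axioms.intro)
    show "small_monoidal TYPE('v) A" by (rule small_monoidal_axioms)
    show "strict_monoidal C.End" by (rule C.End_strict)
    fix M :: "('o, 'm, 'k, 'v) psh" assume M: "presheaf A M"
    show "fst (Ft M) \<in> Obj C.End" using good[OF M] by (simp add: good_def)
    show "snd (Ft M) a x \<in> homset C.End (Go a) (fst (Ft M))" if "a \<in> Obj A" "x \<in> elems M a" for a x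
      using good[OF M] that by (simp add: good_def)
    show "wcolim A C.End (\<lambda>a. Go n \<star>\<^bsub>C.End\<^esub> (Go a \<star>\<^bsub>C.End\<^esub> Z)) (\<lambda>u. Idt C.End (Go n) \<boxtimes>\<^bsub>C.End\<^esub> (Ga u \<boxtimes>\<^bsub>C.End\<^esub> Idt C.End Z)) M
        (Go n \<star>\<^bsub>C.End\<^esub> (fst (Ft M) \<star>\<^bsub>C.End\<^esub> Z)) (\<lambda>a x. Idt C.End (Go n) \<boxtimes>\<^bsub>C.End\<^esub> (snd (Ft M) a x \<boxtimes>\<^bsub>C.End\<^esub> Idt C.End Z))"
      if "n \<in> Obj A" "Z \<in> Obj C.End" for n Z
      using wcolim_endo[OF M good[OF M] that(1), of Z] that(2) by simp
  qed (simp_all add: G G_tobj G_tarr G_one)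
  note Y = yon_presheaf[OF p]
  have Fp: "fst (Ft (yon p)) = Go p" by (simp add: Ft_def)
  have Ftp: "snd (Ft (yon p)) = (\<lambda>a x. Ga (decode a p x))" by (simp add: Ft_def)
  have iota: "K.iota p = Idt C.End (Go p)" using p by (simp add: K.iota_def Ftp)
  have 1: "OMap K.CAS (yon p) = Go p" using Y by (simp add: Fp)
  have 2: "AMap K.CAS (yarr r) = Ga r" if r: "r \<in> homset A p p" for r
  proof -
    have st: "NSrc (yarr r) = yon p" "NTgt (yarr r) = yon p" using r by (simp_all add: yoneda_arr_def)
    have yr: "presheaf_map A (yarr r)" by (rule yarr_map) (use r in simp)
    show ?thesis using K.amap_yarr[of r] r yr K.amap_simps[OF yr] p by (simp add: iota st Fp)
  qed
  have 3: "Cmp C.End (AMap K.CAS (Cmp (day_cat A) (inv_arr (day_cat A) (yoneda_tensor A p p)) (Cmp (day_cat A) (yarr t) (yoneda_tensor A p p))))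
        (K.phi (yon p) (yon p)) = Cmp C.End (K.phi (yon p) (yon p)) (Ga t)" if t: "t \<in> homset A (p \<star> p) (p \<star> p)" for t
  proof -
    have ii: "K.iota p \<boxtimes>\<^bsub>C.End\<^esub> K.iota p = Idt C.End (ftor_comp C (Go p) (Go p))"
      unfolding iota using p E.tarr_idt[of "Go p" "Go p"] by simp
    have ph: "Cmp C.End (K.phi (yon p) (yon p)) (Idt C.End (ftor_comp C (Go p) (Go p))) = K.phi (yon p) (yon p)"
      by (rule E.cmp_idt'(1)) (use K.phi_simps[OF Y Y] in \<open>simp_all add: Fp\<close>)
    have gt: "Cmp C.End (Idt C.End (ftor_comp C (Go p) (Go p))) (Ga t) = Ga t"
      by (rule E.cmp_idt'(2)) (use t p in \<open>simp_all add: G_tobj\<close>)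
    show ?thesis using K.amap_braiding[OF p p t] unfolding ii ph gt .
  qed
  show ?thesis using K.CAS_strong_monoidal 1 2 3 by blast
qed

end


section \<open>The Hecke category as a strict monoidal category\<close>

lemma letters_simps [simp]: "letters 0 = []" "letters (v + w) = letters v @ letters w"
  by (simp_all add: zero_word_def plus_word_def)

lemma free_algebra_simps [simp]:
  "p \<otimes>\<^bsub>free_algebra n\<^esub> q = p * q" "p \<oplus>\<^bsub>free_algebra n\<^esub> q = p + q" "\<one>\<^bsub>free_algebra n\<^esub> = 1" "\<zero>\<^bsub>free_algebra n\<^esub> = 0"
  by (simp_all add: free_algebra_def)

abbreviation fa :: "nat \<Rightarrow> (word \<Rightarrow>\<^sub>0 'k::field) set" where
  "fa n \<equiv> carrier (free_algebra n)"

lemma fa_iff: "p \<in> fa n \<longleftrightarrow> (\<forall>w\<in>Poly_Mapping.keys p. set (letters w) \<subseteq> hgens n)"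
  by (simp add: free_algebra_def)

lemma fa_closed [simp]:
  fixes p q :: "word \<Rightarrow>\<^sub>0 'k::field"
  shows "p \<in> fa n \<Longrightarrow> q \<in> fa n \<Longrightarrow> p + q \<in> fa n" "p \<in> fa n \<Longrightarrow> q \<in> fa n \<Longrightarrow> p * q \<in> fa n"
    "p \<in> fa n \<Longrightarrow> q \<in> fa n \<Longrightarrow> p - q \<in> fa n" "p \<in> fa n \<Longrightarrow> - p \<in> fa n" "0 \<in> (fa n :: (word \<Rightarrow>\<^sub>0 'k) set)" "1 \<in> (fa n :: (word \<Rightarrow>\<^sub>0 'k) set)"
proof -
  show "p \<in> fa n \<Longrightarrow> q \<in> fa n \<Longrightarrow> p + q \<in> fa n" using keys_add[of p q] by (auto simp: fa_iff)
  show "p \<in> fa n \<Longrightarrow> q \<in> fa n \<Longrightarrow> p - q \<in> fa n" using keys_diff[of p q] by (auto simp: fa_iff)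
  show "p \<in> fa n \<Longrightarrow> - p \<in> fa n" by (auto simp: fa_iff)
  show "0 \<in> (fa n :: (word \<Rightarrow>\<^sub>0 'k) set)" by (simp add: fa_iff)
  show "1 \<in> (fa n :: (word \<Rightarrow>\<^sub>0 'k) set)" by (simp add: fa_iff single_one[symmetric] del: single_one)
  assume pq: "p \<in> fa n" "q \<in> fa n"
  show "p * q \<in> fa n" unfolding fa_iff
  proof
    fix w assume "w \<in> Poly_Mapping.keys (p * q)"
    then obtain u v where "w = u + v" "u \<in> Poly_Mapping.keys p" "v \<in> Poly_Mapping.keys q" using keys_mult[of p q] by blast
    then show "set (letters w) \<subseteq> hgens n" using pq by (auto simp: fa_iff)
  qed
qed

lemma fa_single [simp]: "c = 0 \<or> set (letters w) \<subseteq> hgens n \<Longrightarrow> sgl w c \<in> fa n"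
  by (auto simp: fa_iff)

lemma ring_fa: "ring (free_algebra n :: (word \<Rightarrow>\<^sub>0 'k::field) ring)"
proof (rule ringI)
  have neg: "\<exists>y\<in>fa n. y \<oplus>\<^bsub>free_algebra n\<^esub> x = \<zero>\<^bsub>free_algebra n\<^esub>" if "x \<in> fa n" for x :: "word \<Rightarrow>\<^sub>0 'k"
    by (rule bexI[of _ "- x"]) (use that in simp_all)
  show "abelian_group (free_algebra n :: (word \<Rightarrow>\<^sub>0 'k) ring)"
  proof (rule abelian_groupI)
    show "x \<oplus>\<^bsub>free_algebra n\<^esub> y = y \<oplus>\<^bsub>free_algebra n\<^esub> x" for x y :: "word \<Rightarrow>\<^sub>0 'k" by (simp add: add.commute)
  qed (simp_all add: add.assoc neg[simplified])
  show "Group.monoid (free_algebra n :: (word \<Rightarrow>\<^sub>0 'k) ring)"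
    by (rule monoidI) (simp_all add: mult.assoc)
qed (simp_all add: distrib_left distrib_right)

lemma pscale_mult: "pscale s p = sgl 0 s * (p :: word \<Rightarrow>\<^sub>0 'k::field)"
  by (rule free_space_induct[of p UNIV]) (simp_all add: pscale_simps distrib_left mult_single mult.assoc[symmetric] )

lemma single_central: "sgl 0 s * p = p * sgl (0 :: word) (s :: 'k::field)"
  by (rule free_space_induct[of p UNIV]) (simp_all add: distrib_left distrib_right mult_single mult.commute)

lemma single_word: "sgl (Word (g # gs)) (1 :: 'k::field) = sgl (Word [g]) 1 * sgl (Word gs) 1"
  by (simp add: mult_single plus_word_def)

text \<open>Reduces statements compatible with products and linear combinations to single letters. A
  scalar appears as the constant polynomial \<open>sgl 0 s\<close>, the empty word being the 0 of
  the monoid of words.\<close>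

lemma fa_induct [consumes 1, case_names one gen mult add scale]:
  fixes p :: "word \<Rightarrow>\<^sub>0 'k::field"
  assumes p: "p \<in> fa n" and one: "Q 1" and gen: "\<And>g. g \<in> hgens n \<Longrightarrow> Q (sgl (Word [g]) 1)"
    and mult: "\<And>p q. p \<in> fa n \<Longrightarrow> q \<in> fa n \<Longrightarrow> Q p \<Longrightarrow> Q q \<Longrightarrow> Q (p * q)"
    and add: "\<And>p q. p \<in> fa n \<Longrightarrow> q \<in> fa n \<Longrightarrow> Q p \<Longrightarrow> Q q \<Longrightarrow> Q (p + q)"
    and scale: "\<And>p s. p \<in> fa n \<Longrightarrow> Q p \<Longrightarrow> Q (sgl 0 s * p)"
  shows "Q p"
proof -
  have word: "Q (sgl (Word gs) 1)" if "set gs \<subseteq> hgens n" for gs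
    using that
  proof (induction gs)
    case Nil
    have "sgl (Word []) (1 :: 'k) = 1" unfolding zero_word_def[symmetric] by simp
    then show ?case using one by simp
  next
    case (Cons g gs)
    then show ?case unfolding single_word[of g gs] by (intro mult gen) auto
  qed
  have "Poly_Mapping.keys p \<subseteq> {w. set (letters w) \<subseteq> hgens n}" using p by (auto simp: fa_iff)
  then have "p \<in> fa n \<and> Q p"
  proof (induction rule: free_space_induct)
    case zero
    then show ?case using scale[OF _ one, of 0] by (simp add: fa_closed(6))
  next
    case (add s w q)
    then have w: "sgl w (1 :: 'k) \<in> fa n" "Q (sgl w 1)"
      using word[of "letters w"] by (cases w; simp)+
    have "sgl 0 s \<in> fa n" by simp
    then have "sgl 0 s * sgl w (1 :: 'k) \<in> fa n" "Q (sgl 0 s * sgl w 1)"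
      using w scale by (blast intro: fa_closed(2))+
    then show ?case unfolding pscale_mult using add assms(5) by (blast intro: fa_closed(1))
  qed
  then show ?thesis by simp
qed

subsection \<open>The shift\<close>

definition shift_word :: "nat \<Rightarrow> word \<Rightarrow> word" where
  "shift_word m w = Word (map (shift_gen m) (letters w))"

lemma shift_superset:
  assumes "finite K" "Poly_Mapping.keys p \<subseteq> K"
  shows "shift m p = (\<Sum>w\<in>K. sgl (shift_word m w) (Poly_Mapping.lookup p w))"
  unfolding shift_def shift_word_def
  by (rule sum.mono_neutral_left) (use assms in \<open>auto simp: in_keys_iff\<close>)

lemma shift_add: "shift m (p + q) = shift m p + shift m q"
proof -
  let ?K = "Poly_Mapping.keys p \<union> Poly_Mapping.keys q"
  show ?thesis
    using keys_add[of p q]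
    by (simp add: shift_superset[of ?K] lookup_add single_add sum.distrib)
qed

lemma shift_zero [simp]: "shift m 0 = 0"
  by (simp add: shift_def)

lemma shift_single: "shift m (sgl w c) = sgl (shift_word m w) c"
  by (simp add: shift_superset[of "{w}"])

lemma shift_word_simps: "shift_word m (v + w) = shift_word m v + shift_word m w" "shift_word m 0 = 0"
  by (simp_all add: shift_word_def plus_word_def zero_word_def)

lemma shift_mult: "shift m (p * q) = shift m p * shift m q"
proof (rule free_space_induct[of p UNIV])
  fix s w p assume IH: "shift m (p * q) = shift m p * shift m q"
  have "shift m (sgl w c * q) = shift m (sgl w c) * shift m q" for w c
    by (rule free_space_induct[of q UNIV])
       (simp_all add: distrib_left shift_add mult_single shift_single shift_word_simps)
  then show "shift m ((pscale s (sgl w 1) + p) * q) = shift m (pscale s (sgl w 1) + p) * shift m q"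
    using IH by (simp add: distrib_right shift_add)
qed simp_all

lemma shift_one [simp]: "shift m 1 = 1"
  using shift_single[of m 0 1] by (simp add: shift_word_simps)

lemma shift_diff: "shift m (p - q) = shift m p - shift m q"
  using shift_add[of m "p - q" q] by (simp add: algebra_simps)

lemma shift_gen_shift: "shift_gen m (shift_gen n g) = shift_gen (n + m) g"
  by (cases g) simp_all

lemma shift_shift: "shift m (shift n p) = shift (n + m) p"
  by (rule free_space_induct[of p UNIV])
     (simp_all add: shift_add shift_single shift_word_def comp_def shift_gen_shift)

lemma shift_gen_zero: "shift_gen 0 = id"
proof
  show "shift_gen 0 g = id g" for g by (cases g) simp_all
qed

lemma shift_0 [simp]: "shift 0 p = p"
  by (rule free_space_induct[of p UNIV])
     (simp_all add: shift_add shift_single shift_word_def shift_gen_zero)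

lemma shift_tt [simp]: "shift m (tt i) = tt (i + m)" "shift m (yy i) = yy (i + m)"
  by (simp_all add: tt_def yy_def shift_single shift_word_def)

lemma hgens_mono: "hgens m \<subseteq> hgens (m + n)"
  by (auto simp: hgens_def)

lemma hgens_shift: "g \<in> hgens n \<Longrightarrow> shift_gen m g \<in> hgens (m + n)"
  by (auto simp: hgens_def)

lemma fa_mono: "p \<in> fa m \<Longrightarrow> p \<in> fa (m + n)"
  using hgens_mono[of m n] by (auto simp: fa_iff)

lemma fa_shift: "p \<in> fa n \<Longrightarrow> shift m p \<in> fa (m + n)"
proof (induction rule: fa_induct)
  case (gen g)
  then show ?case using hgens_shift[OF gen] by (simp add: shift_single shift_word_def)
qed (simp_all add: shift_mult shift_add shift_single shift_word_simps)

lemma fa_tt [simp]: "i \<in> {1..<n} \<Longrightarrow> tt i \<in> fa n" "i \<in> {1..n} \<Longrightarrow> yy i \<in> fa n"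
  by (auto simp: tt_def yy_def hgens_def)

subsection \<open>The Hecke algebras\<close>

lemma hecke_rels_fa: "hecke_rels n \<subseteq> (fa n :: (word \<Rightarrow>\<^sub>0 'k::field) set)"
  unfolding hecke_rels_def by auto

context
  fixes n :: nat
begin

interpretation R: Ring.ring "free_algebra n :: (word \<Rightarrow>\<^sub>0 'k::field) ring" by (rule ring_fa)

lemma hecke_ideal: "ideal (hecke_ideal n) (free_algebra n :: (word \<Rightarrow>\<^sub>0 'k::field) ring)"
  unfolding hecke_ideal_def by (rule R.genideal_ideal[OF hecke_rels_fa])

interpretation I: ideal "hecke_ideal n" "free_algebra n :: (word \<Rightarrow>\<^sub>0 'k::field) ring" by (rule hecke_ideal)

lemma hecke_ideal_fa: "p \<in> hecke_ideal n \<Longrightarrow> p \<in> (fa n :: (word \<Rightarrow>\<^sub>0 'k::field) set)"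
  using I.a_subset by blast

lemma hecke_ideal_rel: "p \<in> hecke_rels n \<Longrightarrow> (p :: word \<Rightarrow>\<^sub>0 'k::field) \<in> hecke_ideal n"
  unfolding hecke_ideal_def using R.genideal_self[OF hecke_rels_fa] by blast

lemma hecke_ideal_add: "p \<in> hecke_ideal n \<Longrightarrow> q \<in> hecke_ideal n \<Longrightarrow> (p + q :: word \<Rightarrow>\<^sub>0 'k::field) \<in> hecke_ideal n"
  using I.a_closed[of p q] by simp

lemma hecke_ideal_mult:
  "p \<in> hecke_ideal n \<Longrightarrow> q \<in> fa n \<Longrightarrow> (q * p :: word \<Rightarrow>\<^sub>0 'k::field) \<in> hecke_ideal n"
  "p \<in> hecke_ideal n \<Longrightarrow> q \<in> fa n \<Longrightarrow> (p * q :: word \<Rightarrow>\<^sub>0 'k::field) \<in> hecke_ideal n"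
  using I.I_l_closed[of p q] I.I_r_closed[of p q] by simp_all

lemma hecke_ideal_zero: "(0 :: word \<Rightarrow>\<^sub>0 'k::field) \<in> hecke_ideal n"
  using I.zero_closed by simp

lemma hecke_ideal_minus: "p \<in> hecke_ideal n \<Longrightarrow> (- p :: word \<Rightarrow>\<^sub>0 'k::field) \<in> hecke_ideal n"
  using hecke_ideal_mult(1)[of p "- 1"] by simp

lemma hcls_coset: "hcls n p = (\<lambda>r. r + p) ` (hecke_ideal n :: (word \<Rightarrow>\<^sub>0 'k::field) set)"
  by (auto simp: hcls_def a_r_coset_def' image_def)

lemma hcls_eq: "hcls n p = hcls n q \<longleftrightarrow> (p - q :: word \<Rightarrow>\<^sub>0 'k::field) \<in> hecke_ideal n"
proof
  assume "hcls n p = hcls n q"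
  then have "0 + p \<in> (\<lambda>r. r + q) ` hecke_ideal n" unfolding hcls_coset by (metis image_eqI hecke_ideal_zero)
  then show "p - q \<in> hecke_ideal n" by auto
next
  assume pq: "p - q \<in> hecke_ideal n"
  have "r + p \<in> (\<lambda>r. r + q) ` hecke_ideal n" "r + q \<in> (\<lambda>r. r + p) ` hecke_ideal n" if "r \<in> hecke_ideal n" for r
    using hecke_ideal_add[OF that pq] hecke_ideal_add[OF that hecke_ideal_minus[OF pq]]
    by (simp_all add: image_iff bexI[of _ "r + (p - q)"] bexI[of _ "r + (q - p)"])
  then show "hcls n p = hcls n q" unfolding hcls_coset by auto
qed

lemma hcls_self: "(p :: word \<Rightarrow>\<^sub>0 'k::field) \<in> hcls n p"
  unfolding hcls_coset by (rule image_eqI[of _ _ 0]) (simp_all add: hecke_ideal_zero)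

lemma hcls_mem: "q \<in> hcls n p \<Longrightarrow> hcls n q = hcls n (p :: word \<Rightarrow>\<^sub>0 'k::field)"
  unfolding hcls_eq by (auto simp: hcls_coset)

lemma hcls_ops:
  "p \<in> fa n \<Longrightarrow> hcls n p \<in> carrier (hecke_algebra n :: 'k::field hecke ring)"
  "p \<in> fa n \<Longrightarrow> q \<in> fa n \<Longrightarrow> hcls n p \<otimes>\<^bsub>hecke_algebra n :: 'k::field hecke ring\<^esub> hcls n q = hcls n (p * q)"
  "p \<in> fa n \<Longrightarrow> q \<in> fa n \<Longrightarrow> hcls n p \<oplus>\<^bsub>hecke_algebra n :: 'k::field hecke ring\<^esub> hcls n q = hcls n (p + q)"
  "\<one>\<^bsub>hecke_algebra n :: 'k::field hecke ring\<^esub> = hcls n 1" "\<zero>\<^bsub>hecke_algebra n :: 'k::field hecke ring\<^esub> = hcls n 0"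
  using ring_hom_closed[OF I.rcos_ring_hom, of p] ring_hom_mult[OF I.rcos_ring_hom, of p q] ring_hom_add[OF I.rcos_ring_hom, of p q]
    ring_hom_one[OF I.rcos_ring_hom, symmetric] ring_hom_zero[OF I.rcos_ring_hom R.ring_axioms I.quotient_is_ring, symmetric]
  by (simp_all add: hcls_def hecke_algebra_def)

lemma hcls_surj: "a \<in> carrier (hecke_algebra n :: 'k::field hecke ring) \<longleftrightarrow> (\<exists>p\<in>fa n. a = hcls n p)"
  by (auto simp: hecke_algebra_def FactRing_def A_RCOSETS_def' hcls_def)

lemma hecke_scale: "p \<in> fa n \<Longrightarrow> hecke_scale n s (hcls n p) = hcls n (sgl 0 s * (p :: word \<Rightarrow>\<^sub>0 'k::field))"
  by (simp add: hecke_scale_def hcls_ops)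

text \<open>The preimage of an ideal is an ideal, so it contains the Hecke ideal as soon as it
  contains the relations. The uses are the inclusion and the shift, with a larger Hecke ideal as
  \<open>J\<close>, and the action on the powers of an object, with the zero ideal.\<close>

lemma hecke_ideal_hom:
  fixes S :: "('s, 't) ring_scheme"
  assumes S: "Ring.ring S" and h: "ring_hom_ring (free_algebra n :: (word \<Rightarrow>\<^sub>0 'k::field) ring) S h" and J: "ideal J S"
    and rel: "\<And>r. r \<in> hecke_rels n \<Longrightarrow> h r \<in> J" and p: "p \<in> hecke_ideal n"
  shows "h p \<in> J"
proof -
  have "hecke_ideal n \<subseteq> {r \<in> fa n. h r \<in> J}"
    unfolding hecke_ideal_def
    by (rule R.genideal_minimal[OF ring_hom_ring.ideal_vimage[OF h J]]) (use rel hecke_rels_fa in auto)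
  then show ?thesis using p by blast
qed

end

lemma hecke_rels_mono: "hecke_rels m \<subseteq> hecke_rels (m + n)"
  unfolding hecke_rels_def by (intro Un_mono Collect_mono) (fastforce+)

lemma hecke_rels_cases:
  assumes "r \<in> hecke_rels n"
  obtains
    (1) i where "r = tt i * tt i - 1" "i \<in> {1..<n}"
    | (2) i where "r = tt i * tt (i + 1) * tt i - tt (i + 1) * tt i * tt (i + 1)" "i \<in> {1..<n}" "i + 1 \<in> {1..<n}"
    | (3) i j where "r = tt i * tt j - tt j * tt i" "i \<in> {1..<n}" "j \<in> {1..<n}" "\<bar>int i - int j\<bar> > 1"
    | (4) i where "r = yy i * tt i - tt i * yy (i + 1) - 1" "i \<in> {1..<n}"
    | (5) i j where "r = yy i * yy j - yy j * yy i" "i \<in> {1..n}" "j \<in> {1..n}"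
    | (6) i j where "r = tt i * yy j - yy j * tt i" "i \<in> {1..<n}" "j \<in> {1..n}" "j \<noteq> i" "j \<noteq> i + 1"
  using assms unfolding hecke_rels_def by blast

lemma hecke_rels_shift:
  assumes "r \<in> hecke_rels n"
  shows "shift m r \<in> hecke_rels (m + n)"
proof -
  note sh = shift_diff shift_mult shift_tt shift_one
  show ?thesis
    using assms
  proof (cases rule: hecke_rels_cases)
    case (1 i)
    then have "shift m r = tt (i + m) * tt (i + m) - 1" "i + m \<in> {1..<m + n}" by (auto simp: sh)
    then show ?thesis unfolding hecke_rels_def by blast
  next
    case (2 i)
    then have "shift m r = tt (i + m) * tt ((i + m) + 1) * tt (i + m) - tt ((i + m) + 1) * tt (i + m) * tt ((i + m) + 1)"
      "i + m \<in> {1..<m + n}" "(i + m) + 1 \<in> {1..<m + n}" by (auto simp: sh)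
    then show ?thesis unfolding hecke_rels_def by blast
  next
    case (3 i j)
    then have "shift m r = tt (i + m) * tt (j + m) - tt (j + m) * tt (i + m)" "i + m \<in> {1..<m + n}" "j + m \<in> {1..<m + n}"
      "\<bar>int (i + m) - int (j + m)\<bar> > 1" by (auto simp: sh)
    then show ?thesis unfolding hecke_rels_def by blast
  next
    case (4 i)
    then have "shift m r = yy (i + m) * tt (i + m) - tt (i + m) * yy ((i + m) + 1) - 1" "i + m \<in> {1..<m + n}" by (auto simp: sh)
    then show ?thesis unfolding hecke_rels_def by blast
  next
    case (5 i j)
    then have "shift m r = yy (i + m) * yy (j + m) - yy (j + m) * yy (i + m)" "i + m \<in> {1..m + n}" "j + m \<in> {1..m + n}" by (auto simp: sh)
    then show ?thesis unfolding hecke_rels_def by blast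
  next
    case (6 i j)
    then have "shift m r = tt (i + m) * yy (j + m) - yy (j + m) * tt (i + m)" "i + m \<in> {1..<m + n}" "j + m \<in> {1..m + n}"
      "j + m \<noteq> i + m" "j + m \<noteq> (i + m) + 1" by (auto simp: sh)
    then show ?thesis unfolding hecke_rels_def by blast
  qed
qed

lemma hecke_ideal_mono: "(p :: word \<Rightarrow>\<^sub>0 'k::field) \<in> hecke_ideal m \<Longrightarrow> p \<in> hecke_ideal (m + n)"
  by (rule hecke_ideal_hom[OF ring_fa ring_hom_ringI[OF ring_fa ring_fa] hecke_ideal, where h="\<lambda>p. p"])
     (auto simp: fa_mono intro: hecke_ideal_rel subsetD[OF hecke_rels_mono])

lemma hecke_ideal_shift: "(p :: word \<Rightarrow>\<^sub>0 'k::field) \<in> hecke_ideal n \<Longrightarrow> shift m p \<in> hecke_ideal (m + n)"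
  by (rule hecke_ideal_hom[OF ring_fa ring_hom_ringI[OF ring_fa ring_fa] hecke_ideal, where h="shift m"])
     (auto simp: fa_shift shift_add shift_mult hecke_ideal_rel hecke_rels_shift)

lemma hcls_cong:
  fixes p q :: "word \<Rightarrow>\<^sub>0 'k::field"
  assumes "p \<in> fa n" "q \<in> fa n" "p' \<in> fa n" "q' \<in> fa n" "hcls n p = hcls n p'" "hcls n q = hcls n q'"
  shows "hcls n (p * q) = hcls n (p' * q')"
  using hcls_ops(2)[OF assms(1,2)] hcls_ops(2)[OF assms(3,4)] assms(5,6) by simp

text \<open>The letters act on the disjoint ranges of strands \<open>1..m\<close> and
  \<open>m+1..m+n\<close>; for two letters \<open>GenT\<close>, the bounds \<open>i < m\<close> and
  \<open>1 \<le> j\<close> make \<open>i\<close> and \<open>j + m\<close> differ by at least two.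
  Each mixed commutator occurs among the relations with one sign only, hence the
  disjunction.\<close>

lemma hcls_gen_commute:
  assumes g: "g \<in> hgens m" and h: "h \<in> hgens n"
  defines "p \<equiv> sgl (Word [g]) (1 :: 'k::field)" and "q \<equiv> sgl (Word [shift_gen m h]) (1 :: 'k)"
  shows "hcls (m + n) (p * q) = hcls (m + n) (q * p)"
proof -
  have "p * q - q * p \<in> hecke_rels (m + n) \<or> q * p - p * q \<in> hecke_rels (m + n)"
  proof (cases g)
    case (GenT i)
    show ?thesis
    proof (cases h)
      case (GenT j)
      have "p = tt i" "q = tt (j + m)" by (simp_all add: p_def q_def \<open>g = GenT i\<close> \<open>h = GenT j\<close> tt_def)
      moreover have "i \<in> {1..<m + n}" "j + m \<in> {1..<m + n}" "\<bar>int i - int (j + m)\<bar> > 1"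
        using g h \<open>g = GenT i\<close> \<open>h = GenT j\<close> by (auto simp: hgens_def)
      ultimately show ?thesis unfolding hecke_rels_def by blast
    next
      case (GenY j)
      have "p = tt i" "q = yy (j + m)" by (simp_all add: p_def q_def \<open>g = GenT i\<close> \<open>h = GenY j\<close> tt_def yy_def)
      moreover have "i \<in> {1..<m + n}" "j + m \<in> {1..m + n}" "j + m \<noteq> i" "j + m \<noteq> i + 1"
        using g h \<open>g = GenT i\<close> \<open>h = GenY j\<close> by (auto simp: hgens_def)
      ultimately show ?thesis unfolding hecke_rels_def by blast
    qed
  next
    case (GenY i)
    show ?thesis
    proof (cases h)
      case (GenT j)
      have "p = yy i" "q = tt (j + m)" by (simp_all add: p_def q_def \<open>g = GenY i\<close> \<open>h = GenT j\<close> tt_def yy_def)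
      moreover have "j + m \<in> {1..<m + n}" "i \<in> {1..m + n}" "i \<noteq> j + m" "i \<noteq> (j + m) + 1"
        using g h \<open>g = GenY i\<close> \<open>h = GenT j\<close> by (auto simp: hgens_def)
      ultimately show ?thesis unfolding hecke_rels_def by blast
    next
      case (GenY j)
      have "p = yy i" "q = yy (j + m)" by (simp_all add: p_def q_def \<open>g = GenY i\<close> \<open>h = GenY j\<close> yy_def)
      moreover have "j + m \<in> {1..m + n}" "i \<in> {1..m + n}"
        using g h \<open>g = GenY i\<close> \<open>h = GenY j\<close> by (auto simp: hgens_def)
      ultimately show ?thesis unfolding hecke_rels_def by blast
    qed
  qed
  then have "p * q - q * p \<in> hecke_ideal (m + n) \<or> q * p - p * q \<in> hecke_ideal (m + n)"
    using hecke_ideal_rel by blast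
  then show ?thesis unfolding hcls_eq[symmetric] by (elim disjE) (erule sym | assumption)+
qed

text \<open>Formulated for a homomorphism \<open>f\<close> because it is used for the inclusion of
  the first block and for the shift of the second.\<close>

lemma hcls_commute_induct:
  fixes p x :: "word \<Rightarrow>\<^sub>0 'k::field"
  assumes p: "p \<in> fa m" and x: "x \<in> fa (m + n)" and f: "\<And>p. p \<in> fa m \<Longrightarrow> f p \<in> fa (m + n)"
    and hom: "\<And>p q. f (p * q) = f p * f q" "\<And>p q. f (p + q) = f p + f q" "f 1 = 1" "\<And>s. f (sgl 0 s) = sgl 0 s"
    and gen: "\<And>g. g \<in> hgens m \<Longrightarrow> hcls (m + n) (f (sgl (Word [g]) 1) * x) = hcls (m + n) (x * f (sgl (Word [g]) 1))"
  shows "hcls (m + n) (f p * x) = hcls (m + n) (x * f p)"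
  using p
proof (induction rule: fa_induct)
  case (mult p q)
  note c = f[OF mult(1)] f[OF mult(2)] x
  have "hcls (m + n) ((f p * f q) * x) = hcls (m + n) (f p * (x * f q))"
    unfolding mult.assoc by (rule hcls_cong) (use c mult in simp_all)
  also have "\<dots> = hcls (m + n) ((x * f p) * f q)"
    unfolding mult.assoc[symmetric] by (rule hcls_cong) (use c mult in simp_all)
  finally show ?case by (simp add: hom mult.assoc)
next
  case (add p q)
  then show ?case
    using f x by (simp add: hom distrib_left distrib_right hcls_ops(3)[symmetric])
next
  case (scale p s)
  have "hcls (m + n) (sgl 0 s * (f p * x)) = hcls (m + n) (sgl 0 s * (x * f p))"
    by (rule hcls_cong) (use f[OF scale(1)] x scale(2) in simp_all)
  moreover have "x * (sgl 0 s * f p) = sgl 0 s * (x * f p)"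
    by (simp only: mult.assoc[symmetric] single_central[of s x])
  ultimately show ?case by (simp add: hom mult.assoc)
qed (use gen in \<open>simp_all add: hom\<close>)

text \<open>Two inductions from the case of two letters: over \<open>p\<close> for a fixed shifted
  letter, and then over \<open>q\<close> for the given \<open>p\<close>, with the roles of the two
  blocks exchanged.\<close>

lemma hcls_commute:
  fixes p q :: "word \<Rightarrow>\<^sub>0 'k::field"
  assumes p: "p \<in> fa m" and q: "q \<in> fa n"
  shows "hcls (m + n) (p * shift m q) = hcls (m + n) (shift m q * p)"
proof -
  have gen: "hcls (m + n) (p * sgl (Word [shift_gen m h]) 1) = hcls (m + n) (sgl (Word [shift_gen m h]) 1 * p)"
    if h: "h \<in> hgens n" for h
  proof (rule hcls_commute_induct[OF p, of "sgl (Word [shift_gen m h]) 1" n "\<lambda>p. p"])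
    show "sgl (Word [shift_gen m h]) 1 \<in> fa (m + n)" using hgens_shift[OF h] by simp
    show "\<And>g. g \<in> hgens m \<Longrightarrow> hcls (m + n) (sgl (Word [g]) 1 * sgl (Word [shift_gen m h]) 1) =
        hcls (m + n) (sgl (Word [shift_gen m h]) 1 * sgl (Word [g]) (1 :: 'k))"
      by (rule hcls_gen_commute[OF _ h])
  qed (simp_all add: fa_mono)
  have "hcls (n + m) (shift m q * p) = hcls (n + m) (p * shift m q)"
    by (rule hcls_commute_induct[OF q, of p m "shift m"])
      (use fa_mono[OF p, of n] fa_shift[of _ n m] gen in \<open>simp_all add: add.commute shift_mult shift_add shift_single shift_word_simps shift_word_def zero_word_def\<close>)
  then show ?thesis by (simp add: add.commute)
qed

text \<open>The cosets united in \<open>hecke_mu\<close> coincide because the Hecke ideals are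
  respected by the inclusion of \<open>m\<close> strands into \<open>m + n\<close> and by the
  shift.\<close>

lemma hecke_mu:
  fixes p q :: "word \<Rightarrow>\<^sub>0 'k::field"
  assumes p: "p \<in> fa m" and q: "q \<in> fa n"
  shows "hecke_mu m n (hcls m p) (hcls n q) = hcls (m + n) (p * shift m q)"
proof -
  have "hcls (m + n) (p' * shift m q') = hcls (m + n) (p * shift m q)" if "p' \<in> hcls m p" "q' \<in> hcls n q" for p' q'
  proof -
    have d: "p' - p \<in> hecke_ideal m" "q' - q \<in> hecke_ideal n"
      using hcls_mem[OF that(1)] hcls_mem[OF that(2)] by (simp_all add: hcls_eq)
    then have c: "p' \<in> fa m" "q' \<in> fa n"
      using fa_closed(1)[OF hecke_ideal_fa[OF d(1)] p] fa_closed(1)[OF hecke_ideal_fa[OF d(2)] q] by simp_all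
    show ?thesis
      by (rule hcls_cong)
        (use c p q hecke_ideal_mono[OF d(1), of n] hecke_ideal_shift[OF d(2), of m] in \<open>simp_all add: hcls_eq fa_mono fa_shift shift_diff[symmetric]\<close>)
  qed
  then show ?thesis unfolding hecke_mu_def using hcls_self[of p m] hcls_self[of q n] by blast
qed


subsection \<open>The category of Hecke algebras\<close>

text \<open>A presentation of all arrows by polynomials: the class of \<open>p\<close> if the
  objects agree, and the only arrow, whatever \<open>p\<close> is, if they differ. Operations on
  arrows become operations on polynomials.\<close>

definition har :: "nat \<Rightarrow> nat \<Rightarrow> (word \<Rightarrow>\<^sub>0 'k::field) \<Rightarrow> 'k hecke_arr" where
  "har m n p = (if m = n then (n, n, hcls n p) else hecke_nul m n)"

lemma har_bar [simp]:
  "Obj hecke_bar = UNIV" "Src hecke_bar (har m n p) = m" "Tgt hecke_bar (har m n p) = n"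
  "Idt hecke_bar n = har n n 1" "Nul hecke_bar m n = har m n 0"
  "TObj hecke_bar = (+)" "One hecke_bar = 0" "Assoc hecke_bar a b c = har (a + b + c) (a + b + c) 1"
  "LUnit hecke_bar n = har n n 1" "RUnit hecke_bar n = har n n 1"
  by (simp_all add: hecke_bar_def har_def hecke_nul_def hcls_ops)

lemma har_arr: "f \<in> Arr hecke_bar \<longleftrightarrow> (\<exists>m n. \<exists>p\<in>fa m. f = har m n (p :: word \<Rightarrow>\<^sub>0 'k::field))"
proof
  assume f: "f \<in> Arr hecke_bar"
  obtain m n a where a: "f = (m, n, a)" by (cases f)
  show "\<exists>m n. \<exists>p\<in>fa m. f = har m n p"
  proof (cases "m = n")
    case True
    then obtain p where "p \<in> fa m" "a = hcls m p" using f a hcls_surj[of a m] by (auto simp: hecke_bar_def hecke_hom_def)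
    then have "f = har m n p" using a True by (simp add: har_def)
    then show ?thesis using \<open>p \<in> fa m\<close> by blast
  next
    case False
    then have "f = har m n 0" using f a by (simp add: har_def hecke_nul_def hecke_bar_def hecke_hom_def)
    then show ?thesis using fa_closed(5) by blast
  qed
qed (auto simp: har_def hecke_nul_def hecke_bar_def hecke_hom_def hcls_ops split: if_splits)

lemma harI [simp]: "p \<in> fa m \<Longrightarrow> har m n (p :: word \<Rightarrow>\<^sub>0 'k::field) \<in> Arr hecke_bar"
  unfolding har_arr by blast

lemma har_hom:
  assumes f: "f \<in> homset hecke_bar a b"
  shows "\<exists>p\<in>fa a. f = har a b (p :: word \<Rightarrow>\<^sub>0 'k::field)"
proof -
  obtain m n p where "p \<in> fa m" "f = har m n (p :: word \<Rightarrow>\<^sub>0 'k)" using f har_arr[of f] by auto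
  then show ?thesis using f by auto
qed

lemma har_homE:
  assumes "f \<in> homset hecke_bar a b"
  obtains p where "p \<in> fa a" "f = har a b (p :: word \<Rightarrow>\<^sub>0 'k::field)"
  using har_hom[OF assms] by (elim bexE) (rule that)

lemma har_neq: "m \<noteq> n \<Longrightarrow> har m n p = har m n q"
  by (simp add: har_def)

lemma har_cmp:
  fixes p q :: "word \<Rightarrow>\<^sub>0 'k::field"
  shows "p \<in> fa m \<Longrightarrow> q \<in> fa n \<Longrightarrow> Cmp hecke_bar (har n r q) (har m n p) = har m r (if m = n \<and> n = r then q * p else 0)"
  by (auto simp: har_def hecke_bar_def hecke_nul_def hcls_ops)

lemma har_plus:
  fixes p q :: "word \<Rightarrow>\<^sub>0 'k::field"
  shows "p \<in> fa m \<Longrightarrow> q \<in> fa m \<Longrightarrow> Plus hecke_bar (har m n p) (har m n q) = har m n (p + q)"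
  by (auto simp: har_def hecke_bar_def hecke_nul_def hcls_ops)

lemma har_scal:
  fixes p :: "word \<Rightarrow>\<^sub>0 'k::field"
  shows "p \<in> fa m \<Longrightarrow> Scal hecke_bar s (har m n p) = har m n (sgl 0 s * p)"
  by (auto simp: har_def hecke_bar_def hecke_nul_def hecke_scale)

lemma har_tarr:
  fixes p q :: "word \<Rightarrow>\<^sub>0 'k::field"
  shows "p \<in> fa m \<Longrightarrow> q \<in> fa n \<Longrightarrow>
    TArr hecke_bar (har m m' p) (har n n' q) = har (m + n) (m' + n') (if m = m' \<and> n = n' then p * shift m q else 0)"
  by (auto simp: har_def hecke_bar_def hecke_nul_def hcls_ops hecke_mu)

lemma mult_single_left: "p * (sgl 0 s * q) = sgl (0 :: word) (s :: 'k::field) * (p * q)"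
  by (simp only: mult.assoc[symmetric] single_central[of s p])

lemmas har_ops = har_cmp har_plus har_scal har_tarr

lemma hecke_klinear: "klinear_category (hecke_bar :: (nat, 'k::field hecke_arr, 'k) moncat)"
proof (rule klinear_category.intro)
  fix a b :: nat
  note har = har_hom[of _ a b, folded hom_space_simps(1)]
  let ?V = "hom_space (hecke_bar :: (nat, 'k hecke_arr, 'k) moncat) a b"
  show "vspace ?V"
  proof (rule vspaceI)
    show "\<zero>\<^bsub>?V\<^esub> \<in> carrier ?V" by simp
    fix x assume x: "x \<in> carrier ?V"
    obtain p where p: "p \<in> fa a" "x = har a b p" using har[OF x] by blast
    show "\<zero>\<^bsub>?V\<^esub> \<oplus>\<^bsub>?V\<^esub> x = x" "s \<odot>\<^bsub>?V\<^esub> x \<in> carrier ?V"  for s using p by (simp_all add: har_ops)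
    show "1 \<odot>\<^bsub>?V\<^esub> x = x" "0 \<odot>\<^bsub>?V\<^esub> x = \<zero>\<^bsub>?V\<^esub>" using p by (simp_all add: har_ops)
    show "(s + t) \<odot>\<^bsub>?V\<^esub> x = s \<odot>\<^bsub>?V\<^esub> x \<oplus>\<^bsub>?V\<^esub> t \<odot>\<^bsub>?V\<^esub> x" for s t
      using p by (simp add: har_ops single_add distrib_right)
    show "(s * t) \<odot>\<^bsub>?V\<^esub> x = s \<odot>\<^bsub>?V\<^esub> (t \<odot>\<^bsub>?V\<^esub> x)" for s t
      using p by (simp add: har_ops mult.assoc[symmetric] mult_single)
    fix y assume y: "y \<in> carrier ?V"
    obtain q where q: "q \<in> fa a" "y = har a b q" using har[OF y] by blast
    show "x \<oplus>\<^bsub>?V\<^esub> y \<in> carrier ?V" using p q by (simp add: har_ops)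
    show "x \<oplus>\<^bsub>?V\<^esub> y = y \<oplus>\<^bsub>?V\<^esub> x" using p q by (simp add: har_ops add.commute)
    show "s \<odot>\<^bsub>?V\<^esub> (x \<oplus>\<^bsub>?V\<^esub> y) = s \<odot>\<^bsub>?V\<^esub> x \<oplus>\<^bsub>?V\<^esub> s \<odot>\<^bsub>?V\<^esub> y" for s
      using p q by (simp add: har_ops distrib_left)
    fix z assume z: "z \<in> carrier ?V"
    obtain r where r: "r \<in> fa a" "z = har a b r" using har[OF z] by blast
    show "(x \<oplus>\<^bsub>?V\<^esub> y) \<oplus>\<^bsub>?V\<^esub> z = x \<oplus>\<^bsub>?V\<^esub> (y \<oplus>\<^bsub>?V\<^esub> z)" using p q r by (simp add: har_ops add.assoc)
  qed
next
  fix f g :: "'k hecke_arr" and a b c :: nat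
  assume fg: "f \<in> homset hecke_bar a b" "g \<in> homset hecke_bar b c"
  from fg(1) obtain p where p: "p \<in> fa a" "f = har a b p" by (rule har_homE)
  from fg(2) obtain q where q: "q \<in> fa b" "g = har b c q" by (rule har_homE)
  show "g \<cdot>\<^bsub>hecke_bar\<^esub> f \<in> homset hecke_bar a c" using p q by (cases "a = b \<and> b = c") (auto simp: har_ops)
  show "g \<cdot>\<^bsub>hecke_bar\<^esub> Scal hecke_bar s f = Scal hecke_bar s (g \<cdot>\<^bsub>hecke_bar\<^esub> f) \<and>
      Scal hecke_bar s g \<cdot>\<^bsub>hecke_bar\<^esub> f = Scal hecke_bar s (g \<cdot>\<^bsub>hecke_bar\<^esub> f)" for s
    using p q by (cases "a = b \<and> b = c") (auto simp: har_ops mult.assoc mult_single_left)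
  show "(h \<cdot>\<^bsub>hecke_bar\<^esub> g) \<cdot>\<^bsub>hecke_bar\<^esub> f = h \<cdot>\<^bsub>hecke_bar\<^esub> (g \<cdot>\<^bsub>hecke_bar\<^esub> f)" if h: "h \<in> homset hecke_bar c d" for h d
  proof -
    from h obtain r where r: "r \<in> fa c" "h = har c d r" by (rule har_homE)
    then show ?thesis using p q by (cases "a = b"; cases "b = c"; cases "c = d") (simp_all add: har_ops mult.assoc)
  qed
  fix f' g' :: "'k hecke_arr" assume fg': "f' \<in> homset hecke_bar a b" "g' \<in> homset hecke_bar b c"
  from fg'(1) obtain p' where p': "p' \<in> fa a" "f' = har a b p'" by (rule har_homE)
  from fg'(2) obtain q' where q': "q' \<in> fa b" "g' = har b c q'" by (rule har_homE)
  show "g \<cdot>\<^bsub>hecke_bar\<^esub> Plus hecke_bar f f' = Plus hecke_bar (g \<cdot>\<^bsub>hecke_bar\<^esub> f) (g \<cdot>\<^bsub>hecke_bar\<^esub> f') \<and>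
      Plus hecke_bar g g' \<cdot>\<^bsub>hecke_bar\<^esub> f = Plus hecke_bar (g \<cdot>\<^bsub>hecke_bar\<^esub> f) (g' \<cdot>\<^bsub>hecke_bar\<^esub> f)"
    using p q p' q' by (cases "a = b"; cases "b = c") (simp_all add: har_ops distrib_left distrib_right)
next
  fix f :: "'k hecke_arr" and a b :: nat
  assume "f \<in> homset hecke_bar a b"
  then obtain p where "p \<in> fa a" "f = har a b p" by (rule har_homE)
  then show "f \<cdot>\<^bsub>hecke_bar\<^esub> Idt hecke_bar a = f \<and> Idt hecke_bar b \<cdot>\<^bsub>hecke_bar\<^esub> f = f"
    by (auto simp: har_ops intro: har_neq)
qed simp_all

lemma hecke_strict: "strict_monoidal (hecke_bar :: (nat, 'k::field hecke_arr, 'k) moncat)"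
proof (rule strict_monoidal.intro[OF hecke_klinear], rule strict_monoidal_axioms.intro)
  fix f g :: "'k hecke_arr"
  assume fg: "f \<in> Arr hecke_bar" "g \<in> Arr hecke_bar"
  obtain a a' p where f: "p \<in> fa a" "f = har a a' p" using fg(1) unfolding har_arr by blast
  obtain b b' q where g: "q \<in> fa b" "g = har b b' q" using fg(2) unfolding har_arr by blast
  show "TArr hecke_bar f g \<in> Arr hecke_bar" "Src hecke_bar (TArr hecke_bar f g) = TObj hecke_bar (Src hecke_bar f) (Src hecke_bar g)"
    "Tgt hecke_bar (TArr hecke_bar f g) = TObj hecke_bar (Tgt hecke_bar f) (Tgt hecke_bar g)"
    using f g fa_mono[OF f(1), of b] fa_shift[OF g(1), of a] by (auto simp: har_ops)
  show "TArr hecke_bar (Scal hecke_bar s f) g = Scal hecke_bar s (TArr hecke_bar f g)"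
    "TArr hecke_bar f (Scal hecke_bar s g) = Scal hecke_bar s (TArr hecke_bar f g)" for s
    using f g fa_mono[OF f(1), of b] fa_shift[OF g(1), of a]
    by (auto simp: har_ops shift_mult shift_single shift_word_simps mult.assoc mult_single_left)
  show "TArr hecke_bar (TArr hecke_bar f g) h = TArr hecke_bar f (TArr hecke_bar g h)" if h: "h \<in> Arr hecke_bar" for h
  proof -
    obtain c c' r where h: "r \<in> fa c" "h = har c c' r" using h unfolding har_arr by blast
    show ?thesis
      using f g h fa_mono[OF f(1), of b] fa_shift[OF g(1), of a] fa_mono[OF g(1), of c] fa_shift[OF h(1), of b]
      by (auto simp: har_ops shift_mult shift_shift mult.assoc add.commute add.left_commute)
  qed
  show "Plus hecke_bar f f' \<boxtimes>\<^bsub>hecke_bar\<^esub> g = Plus hecke_bar (f \<boxtimes>\<^bsub>hecke_bar\<^esub> g) (f' \<boxtimes>\<^bsub>hecke_bar\<^esub> g)"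
    if f': "f' \<in> Arr hecke_bar" "Src hecke_bar f' = Src hecke_bar f" "Tgt hecke_bar f' = Tgt hecke_bar f" for f'
  proof -
    have "f' \<in> homset hecke_bar a a'" using f' f by simp
    then obtain p' where "p' \<in> fa a" "f' = har a a' p'" by (rule har_homE)
    then show ?thesis
      using f g fa_mono[OF f(1), of b] fa_mono[of p' a b] fa_shift[OF g(1), of a] by (auto simp: har_ops distrib_right)
  qed
  show "f \<boxtimes>\<^bsub>hecke_bar\<^esub> Plus hecke_bar g g' = Plus hecke_bar (f \<boxtimes>\<^bsub>hecke_bar\<^esub> g) (f \<boxtimes>\<^bsub>hecke_bar\<^esub> g')"
    if g': "g' \<in> Arr hecke_bar" "Src hecke_bar g' = Src hecke_bar g" "Tgt hecke_bar g' = Tgt hecke_bar g" for g'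
  proof -
    have "g' \<in> homset hecke_bar b b'" using g' g by simp
    then obtain q' where "q' \<in> fa b" "g' = har b b' q'" by (rule har_homE)
    then show ?thesis
      using f g fa_mono[OF f(1), of b] fa_shift[OF g(1), of a] fa_shift[of q' b a] by (auto simp: har_ops shift_add distrib_left)
  qed
  fix f' g' :: "'k hecke_arr"
  assume fg': "f' \<in> Arr hecke_bar" "g' \<in> Arr hecke_bar" "Src hecke_bar f' = Tgt hecke_bar f" "Src hecke_bar g' = Tgt hecke_bar g"
  define a'' b'' where "a'' = Tgt hecke_bar f'" and "b'' = Tgt hecke_bar g'"
  have "f' \<in> homset hecke_bar a' a''" "g' \<in> homset hecke_bar b' b''" using fg' f(2) g(2) by (simp_all add: a''_def b''_def)
  note h = this
  from h(1) obtain p' where f': "p' \<in> fa a'" "f' = har a' a'' p'" by (rule har_homE)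
  from h(2) obtain q' where g': "q' \<in> fa b'" "g' = har b' b'' q'" by (rule har_homE)
  note fa = fa_mono[OF f(1), of b] fa_shift[OF g(1), of a] fa_mono[OF f'(1), of b'] fa_shift[OF g'(1), of a']
  \<comment> \<open>The one case of the interchange law with content: the middle factors
    \<open>p\<close> and \<open>shift a q'\<close> commute because they act on disjoint
    strands.\<close>
  have comm: "har (a + b) (a + b) ((p' * shift a q') * (p * shift a q)) = har (a + b) (a + b) ((p' * p) * (shift a q' * shift a q))"
    if "a' = a" "b' = b"
  proof -
    note fa = fa[unfolded that]
    have "hcls (a + b) ((shift a q' * p) * shift a q) = hcls (a + b) ((p * shift a q') * shift a q)"
      by (rule hcls_cong[OF _ fa(2) _ fa(2) hcls_commute[OF f(1) g'(1)[unfolded that], symmetric] refl]) (simp_all add: fa)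
    then have "hcls (a + b) (p' * ((shift a q' * p) * shift a q)) = hcls (a + b) (p' * ((p * shift a q') * shift a q))"
      by (intro hcls_cong[OF fa(3) _ fa(3) _ refl]) (simp_all add: fa)
    then show ?thesis by (simp add: har_def mult.assoc)
  qed
  have tarr: "TArr hecke_bar f g = har (a + b) (a' + b') (if a = a' \<and> b = b' then p * shift a q else 0)"
    "TArr hecke_bar f' g' = har (a' + b') (a'' + b'') (if a' = a'' \<and> b' = b'' then p' * shift a' q' else 0)"
    unfolding f(2) g(2) f'(2) g'(2) by (rule har_tarr[OF f(1) g(1)], rule har_tarr[OF f'(1) g'(1)])
  have cmp: "f' \<cdot>\<^bsub>hecke_bar\<^esub> f = har a a'' (if a = a' \<and> a' = a'' then p' * p else 0)"
    "g' \<cdot>\<^bsub>hecke_bar\<^esub> g = har b b'' (if b = b' \<and> b' = b'' then q' * q else 0)"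
    unfolding f(2) g(2) f'(2) g'(2) by (rule har_cmp[OF f(1) f'(1)], rule har_cmp[OF g(1) g'(1)])
  show "TArr hecke_bar f' g' \<cdot>\<^bsub>hecke_bar\<^esub> TArr hecke_bar f g = TArr hecke_bar (f' \<cdot>\<^bsub>hecke_bar\<^esub> f) (g' \<cdot>\<^bsub>hecke_bar\<^esub> g)"
  proof (cases "a' = a \<and> b' = b \<and> a'' = a \<and> b'' = b")
    case True
    then have e: "a' = a" "b' = b" "a'' = a" "b'' = b" by simp_all
    show ?thesis
      unfolding tarr cmp using f(1) g(1) f'(1) g'(1) fa comm[OF e(1,2)] unfolding e by (simp add: har_ops shift_mult)
  next
    case False
    \<comment> \<open>As soon as one of the four arrows changes its object, both sides are zero,
      even when the total numbers of strands \<open>a + b\<close> and \<open>a'' + b''\<close>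
      agree.\<close>
    have "TArr hecke_bar f' g' \<cdot>\<^bsub>hecke_bar\<^esub> TArr hecke_bar f g = har (a + b) (a'' + b'') 0"
    proof -
      have m: "(if a = a' \<and> b = b' then p * shift a q else 0) \<in> fa (a + b)"
        "(if a' = a'' \<and> b' = b'' then p' * shift a' q' else 0) \<in> fa (a' + b')"
        using fa_closed(2)[OF fa(1,2)] fa_closed(2)[OF fa(3,4)] by auto
      from False consider "\<not> (a = a' \<and> b = b')" | "\<not> (a' = a'' \<and> b' = b'')" by blast
      then have "(if a' = a'' \<and> b' = b'' then p' * shift a' q' else 0) * (if a = a' \<and> b = b' then p * shift a q else 0) = 0"
        by cases (simp_all only: if_False mult_zero_left mult_zero_right shift_zero if_cancel)
      then show ?thesis unfolding tarr har_cmp[OF m] by simp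
    qed
    moreover have "TArr hecke_bar (f' \<cdot>\<^bsub>hecke_bar\<^esub> f) (g' \<cdot>\<^bsub>hecke_bar\<^esub> g) = har (a + b) (a'' + b'') 0"
    proof -
      have m: "(if a = a' \<and> a' = a'' then p' * p else 0) \<in> fa a" "(if b = b' \<and> b' = b'' then q' * q else 0) \<in> fa b"
        using f(1) g(1) f'(1) g'(1) by (auto)
      from False consider "\<not> (a = a' \<and> a' = a'')" | "\<not> (b = b' \<and> b' = b'')" by blast
      then have "(if a = a'' \<and> b = b'' then (if a = a' \<and> a' = a'' then p' * p else 0) * shift a (if b = b' \<and> b' = b'' then q' * q else 0) else 0) = 0"
        by cases (simp_all only: if_False mult_zero_left mult_zero_right shift_zero if_cancel)
      then show ?thesis unfolding cmp har_tarr[OF m] by simp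
    qed
    ultimately show ?thesis by simp
  qed
next
  fix f :: "'k hecke_arr"
  assume "f \<in> Arr hecke_bar"
  then obtain a a' p where f: "p \<in> fa a" "f = har a a' p" unfolding har_arr by blast
  then show "Idt hecke_bar (One hecke_bar) \<boxtimes>\<^bsub>hecke_bar\<^esub> f = f" "f \<boxtimes>\<^bsub>hecke_bar\<^esub> Idt hecke_bar (One hecke_bar) = f"
    by (auto simp: har_ops intro: har_neq)
qed (simp_all add: har_ops add.assoc)

instance gen :: countable by countable_datatype

text \<open>There are countably many words, so polynomials are small as soon as the field is, and
  every arrow is the image of a triple of two numbers and a polynomial.\<close>

lemma (in universe) hecke_small:
  assumes k: "small TYPE('v) (UNIV :: 'k::field set)"
  shows "small_monoidal TYPE('v) (hecke_bar :: (nat, 'k hecke_arr, 'k) moncat)"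
proof (rule small_monoidal.intro[OF hecke_strict], rule small_category.intro[OF hecke_klinear universe_axioms], rule small_category_axioms.intro)
  show "small TYPE('v) (Obj (hecke_bar :: (nat, 'k hecke_arr, 'k) moncat))" by (rule small_countable) simp
  have inj: "inj letters" by (rule injI) (simp add: word.expand)
  have "countable (UNIV :: word set)" by (rule countable_image_inj_on[OF _ inj]) (rule countableI_type)
  then have "small TYPE('v) {p :: word \<Rightarrow>\<^sub>0 'k. Poly_Mapping.keys p \<subseteq> UNIV}" by (intro small_free[OF small_countable k])
  then have "small TYPE('v) ((UNIV :: nat set) \<times> (UNIV :: nat set) \<times> {p :: word \<Rightarrow>\<^sub>0 'k. Poly_Mapping.keys p \<subseteq> UNIV})"
    by (intro small_Times[OF small_countable small_Times[OF small_countable]]) simp_all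
  then have "small TYPE('v) ((\<lambda>(m, n, p). har m n p) ` ((UNIV :: nat set) \<times> (UNIV :: nat set) \<times> {p :: word \<Rightarrow>\<^sub>0 'k. Poly_Mapping.keys p \<subseteq> UNIV}))"
    by (rule small_image)
  then show "small TYPE('v) (Arr (hecke_bar :: (nat, 'k hecke_arr, 'k) moncat))"
  proof (rule small_subset, intro subsetI)
    fix f assume "f \<in> Arr (hecke_bar :: (nat, 'k hecke_arr, 'k) moncat)"
    then obtain m n p where "f = har m n p" unfolding har_arr by blast
    then show "f \<in> (\<lambda>(m, n, p). har m n p) ` ((UNIV :: nat set) \<times> (UNIV :: nat set) \<times> {p :: word \<Rightarrow>\<^sub>0 'k. Poly_Mapping.keys p \<subseteq> UNIV})"
      by (intro image_eqI[of _ _ "(m, n, p)"]) simp_all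
  qed
qed (rule k)


section \<open>Monoidal functors from the category of Hecke algebras\<close>

lemma strict_functor_strong:
  assumes A: "strict_monoidal A" and D: "strict_monoidal D" and G: "klinear_functor A D G"
    and tobj: "\<And>a b. a \<in> Obj A \<Longrightarrow> b \<in> Obj A \<Longrightarrow> OMap G (TObj A a b) = TObj D (OMap G a) (OMap G b)"
    and tarr: "\<And>f g. f \<in> Arr A \<Longrightarrow> g \<in> Arr A \<Longrightarrow> AMap G (TArr A f g) = TArr D (AMap G f) (AMap G g)"
    and one: "OMap G (One A) = One D"
  shows "strong_monoidal_functor A D G (\<lambda>a b. Idt D (OMap G (TObj A a b))) (Idt D (One D))"
proof -
  interpret A: strict_monoidal A by (rule A)
  interpret D: strict_monoidal D by (rule D)
  note g = klinear_functorD[OF G]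
  have [simp]: "a \<in> Obj A \<Longrightarrow> OMap G a \<in> Obj D" "a \<in> Obj A \<Longrightarrow> AMap G (Idt A a) = Idt D (OMap G a)"
    "f \<in> Arr A \<Longrightarrow> AMap G f \<in> Arr D" "f \<in> Arr A \<Longrightarrow> Src D (AMap G f) = OMap G (Src A f)"
    "f \<in> Arr A \<Longrightarrow> Tgt D (AMap G f) = OMap G (Tgt A f)" for a f
    using g(3,4,5) by auto
  have iso: "is_iso D (Idt D a)" if "a \<in> Obj D" for a
    by (rule is_isoI[of _ _ a a "Idt D a"]) (use that in simp_all)
  show ?thesis
    unfolding strong_monoidal_functor_def
    by (intro conjI ballI) (simp_all add: G tobj tarr one iso)
qed

context strict_monoidal
begin

lemma nul_tarr:
  assumes "f \<in> Arr C" "a \<in> Obj C" "b \<in> Obj C"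
  shows "Nul C a b \<boxtimes> f = Nul C (a \<star> Src C f) (b \<star> Tgt C f)" "f \<boxtimes> Nul C a b = Nul C (Src C f \<star> a) (Tgt C f \<star> b)"
  using tarr_scal_left[of "Nul C a b" f 0] tarr_scal_right[of f "Nul C a b" 0] assms
    scal_zero[of "Nul C a b" a b] scal_zero[of "Nul C a b \<boxtimes> f" "a \<star> Src C f" "b \<star> Tgt C f"]
    scal_zero[of "f \<boxtimes> Nul C a b" "Src C f \<star> a" "Tgt C f \<star> b"]
  by simp_all

end

section \<open>Representations of the Hecke algebras on the powers of an object\<close>

locale hecke_triple = strict_monoidal D
  for D :: "('p, 'n, 'k::field, 'z) moncat_scheme" (structure) +
  fixes ob :: 'p and x c :: 'n
  assumes ob [simp]: "ob \<in> Obj D"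
    and x [simp]: "x \<in> Arr D" "Src D x = ob" "Tgt D x = ob"
    and c [simp]: "c \<in> Arr D" "Src D c = ob \<star> ob" "Tgt D c = ob \<star> ob"
    and c_square: "c \<cdot> c = Idt D (ob \<star> ob)"
    and braid: "(c \<boxtimes> Idt D ob) \<cdot> (Idt D ob \<boxtimes> c) \<cdot> (c \<boxtimes> Idt D ob) = (Idt D ob \<boxtimes> c) \<cdot> (c \<boxtimes> Idt D ob) \<cdot> (Idt D ob \<boxtimes> c)"
    and cross: "(x \<boxtimes> Idt D ob) \<cdot> c = Plus D (c \<cdot> (Idt D ob \<boxtimes> x)) (Idt D (ob \<star> ob))"
begin

primrec pw :: "nat \<Rightarrow> 'p" where
  "pw 0 = One D"
| "pw (Suc n) = ob \<star> pw n"

lemma pw_obj [simp]: "pw n \<in> Obj D"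
  by (induction n) simp_all

lemma pw_add: "pw (m + n) = pw m \<star> pw n"
  by (induction m) simp_all

lemma pw_one: "pw (Suc 0) = ob" "pw 1 = ob" "pw 2 = ob \<star> ob"
  by (simp_all add: numeral_2_eq_2)

text \<open>\<open>f\<close> acting on a block of consecutive strands, with \<open>a\<close> strands
  to its left and \<open>b\<close> to its right.\<close>

definition lft :: "nat \<Rightarrow> 'n \<Rightarrow> nat \<Rightarrow> 'n" where
  "lft a f b = Idt D (pw a) \<boxtimes> (f \<boxtimes> Idt D (pw b))"

abbreviation E :: "nat \<Rightarrow> 'n set" where
  "E n \<equiv> homset D (pw n) (pw n)"

lemma E_idt: "Idt D (pw n) \<in> E n"
  and E_cmp: "f \<in> E n \<Longrightarrow> g \<in> E n \<Longrightarrow> g \<cdot> f \<in> E n"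
  by simp_all

lemma lft_E: "f \<in> E k \<Longrightarrow> n = a + k + b \<Longrightarrow> lft a f b \<in> E n"
  unfolding lft_def by (simp add: pw_add)

lemma lft_cmp: "f \<in> E k \<Longrightarrow> g \<in> E k \<Longrightarrow> lft a g b \<cdot> lft a f b = lft a (g \<cdot> f) b"
  unfolding lft_def by (simp add: tarr_cmp)

lemma lft_plus: "f \<in> E k \<Longrightarrow> g \<in> E k \<Longrightarrow> lft a (Plus D g f) b = Plus D (lft a g b) (lft a f b)"
  unfolding lft_def by (simp add: tarr_linear)

lemma lft_idt: "n = a + k + b \<Longrightarrow> lft a (Idt D (pw k)) b = Idt D (pw n)"
  unfolding lft_def by (simp add: pw_add)

lemma lft_right: "f \<in> E k \<Longrightarrow> lft a (f \<boxtimes> Idt D (pw d)) b = lft a f (d + b)"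
  and lft_left: "f \<in> E k \<Longrightarrow> lft a (Idt D (pw d) \<boxtimes> f) b = lft (a + d) f b"
  unfolding lft_def by (simp_all add: pw_add tarr_idt[symmetric] del: tarr_idt)

text \<open>The two blocks are disjoint, with \<open>d\<close> strands between them. After padding,
  both operators are images under the same \<open>lft\<close> of operators on the strands from the
  first block to the second, and there the interchange law applies.\<close>

lemma lft_commute:
  assumes f: "f \<in> E k" and g: "g \<in> E l" and a: "a + k \<le> a'" "a + k + b = a' + l + b'"
  shows "lft a f b \<cdot> lft a' g b' = lft a' g b' \<cdot> lft a f b"
proof -
  define d where "d = a' - (a + k)"
  have d: "a' = a + (k + d)" "b = (d + l) + b'" using a by (simp_all add: d_def)
  have l: "lft a f b = lft a (f \<boxtimes> Idt D (pw (d + l))) b'" "lft a' g b' = lft a (Idt D (pw (k + d)) \<boxtimes> g) b'"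
    unfolding d(2) lft_right[OF f] unfolding d(1) lft_left[OF g] by simp_all
  have m: "f \<boxtimes> Idt D (pw (d + l)) \<in> E (k + d + l)" "Idt D (pw (k + d)) \<boxtimes> g \<in> E (k + d + l)"
    using f g by (simp_all add: pw_add)
  have r: "f \<boxtimes> Idt D (pw (d + l)) = (f \<boxtimes> Idt D (pw d)) \<boxtimes> Idt D (pw l)"
    using f by (simp add: pw_add tarr_idt[symmetric] del: tarr_idt)
  have "(f \<boxtimes> Idt D (pw (d + l))) \<cdot> (Idt D (pw (k + d)) \<boxtimes> g) = (Idt D (pw (k + d)) \<boxtimes> g) \<cdot> (f \<boxtimes> Idt D (pw (d + l)))"
    unfolding r using f g by (subst (1 2) tarr_cmp) (simp_all add: pw_add)
  then show ?thesis unfolding l lft_cmp[OF m] lft_cmp[OF m(2,1)] by simp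
qed

text \<open>The generator \<open>t_i\<close> moves the strands \<open>i\<close> and
  \<open>i + 1\<close>, so \<open>i - 1\<close> strands lie to its left and \<open>n - i - 1\<close>
  to its right; \<open>y_i\<close> moves only strand \<open>i\<close>. For letters in
  \<open>hgens n\<close> the natural subtractions are not truncated.\<close>

fun gv :: "nat \<Rightarrow> gen \<Rightarrow> 'n" where
  "gv n (GenT i) = lft (i - 1) c (n - i - 1)"
| "gv n (GenY i) = lft (i - 1) x (n - i)"

lemma cE: "c \<in> E 2" and xE: "x \<in> E 1"
  by (simp_all add: numeral_2_eq_2)

lemma gv_E: "g \<in> hgens n \<Longrightarrow> gv n g \<in> E n"
  unfolding hgens_def by (cases g; auto simp del: in_homset intro!: lft_E[OF cE] lft_E[OF xE])

definition wv :: "nat \<Rightarrow> word \<Rightarrow> 'n" where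
  "wv n w = foldr (\<lambda>g a. gv n g \<cdot> a) (letters w) (Idt D (pw n))"

lemma wv_E: "set (letters w) \<subseteq> hgens n \<Longrightarrow> wv n w \<in> E n"
proof -
  have "foldr (\<lambda>g a. gv n g \<cdot> a) gs (Idt D (pw n)) \<in> E n" if "set gs \<subseteq> hgens n" for gs
    using that by (induction gs) (auto simp del: in_homset intro!: E_cmp E_idt gv_E)
  then show "set (letters w) \<subseteq> hgens n \<Longrightarrow> wv n w \<in> E n" unfolding wv_def by blast
qed

lemma wv_plus: "set (letters v) \<subseteq> hgens n \<Longrightarrow> set (letters w) \<subseteq> hgens n \<Longrightarrow> wv n (v + w) = wv n v \<cdot> wv n w"
proof -
  assume v: "set (letters v) \<subseteq> hgens n" and w: "set (letters w) \<subseteq> hgens n"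
  have "foldr (\<lambda>g a. gv n g \<cdot> a) gs (wv n w) = foldr (\<lambda>g a. gv n g \<cdot> a) gs (Idt D (pw n)) \<cdot> wv n w" if "set gs \<subseteq> hgens n" for gs
    using that
  proof (induction gs)
    case Nil
    then show ?case using wv_E[OF w] by simp
  next
    case (Cons g gs)
    then have "gv n g \<in> E n" "foldr (\<lambda>g a. gv n g \<cdot> a) gs (Idt D (pw n)) \<in> E n"
      using gv_E wv_E[of "Word gs" n] by (simp_all add: wv_def del: in_homset)
    then show ?case using Cons wv_E[OF w] by simp
  qed
  then show ?thesis using v by (simp add: wv_def)
qed

definition rho :: "nat \<Rightarrow> (word \<Rightarrow>\<^sub>0 'k) \<Rightarrow> 'n" where
  "rho n = (SOME T. linf (free_space {w. set (letters w) \<subseteq> hgens n}) (hom_space D (pw n) (pw n)) T \<and>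
     (\<forall>w\<in>{w. set (letters w) \<subseteq> hgens n}. T (sgl w 1) = wv n w))"

lemma rho:
  shows rho_linf: "linf (free_space {w. set (letters w) \<subseteq> hgens n}) (hom_space D (pw n) (pw n)) (rho n)"
    and rho_word: "set (letters w) \<subseteq> hgens n \<Longrightarrow> rho n (sgl w 1) = wv n w"
proof -
  have "\<exists>T. linf (free_space {w. set (letters w) \<subseteq> hgens n}) (hom_space D (pw n) (pw n)) T \<and>
     (\<forall>w\<in>{w. set (letters w) \<subseteq> hgens n}. T (sgl w (1 :: 'k)) = wv n w)"
    by (rule free_ext[OF hom_vspace]) (use wv_E in simp_all)
  from someI_ex[OF this, folded rho_def]
  show "linf (free_space {w. set (letters w) \<subseteq> hgens n}) (hom_space D (pw n) (pw n)) (rho n)"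
    and "set (letters w) \<subseteq> hgens n \<Longrightarrow> rho n (sgl w 1) = wv n w"
    by auto
qed

lemma fa_free: "p \<in> fa n \<longleftrightarrow> p \<in> carrier (free_space {w. set (letters w) \<subseteq> hgens n})"
  by (auto simp: fa_iff)

lemma rho_E: "p \<in> fa n \<Longrightarrow> rho n p \<in> E n"
  using linf_closed[OF rho_linf, of p n] by (auto simp: fa_free)

lemma rho_add: "p \<in> fa n \<Longrightarrow> q \<in> fa n \<Longrightarrow> rho n (p + q) = Plus D (rho n p) (rho n q)"
  using linf_add[OF rho_linf, of p n q] by (simp add: fa_free)

lemma rho_pscale: "p \<in> fa n \<Longrightarrow> rho n (pscale s p) = Scal D s (rho n p)"
  using linf_smult[OF rho_linf, of p n s] by (simp add: fa_free)

lemma rho_scale: "p \<in> fa n \<Longrightarrow> rho n (sgl 0 s * p) = Scal D s (rho n p)"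
  using rho_pscale[of p n s] by (simp add: pscale_mult)

lemma rho_zero: "rho n 0 = Nul D (pw n) (pw n)"
  using linf_zero[OF vspace_free hom_vspace rho_linf, of n] by simp

lemma rho_one: "rho n 1 = Idt D (pw n)"
  using rho_word[of 0 n] by (simp add: wv_def)

lemma rho_gen: "g \<in> hgens n \<Longrightarrow> rho n (sgl (Word [g]) 1) = gv n g"
  using rho_word[of "Word [g]" n] gv_E[of g n] by (simp add: wv_def)

lemma rho_single: "set (letters w) \<subseteq> hgens n \<Longrightarrow> rho n (sgl w s) = Scal D s (wv n w)"
  using rho_pscale[of "sgl w 1" n s] by (simp add: rho_word pscale_simps)

text \<open>Both sides are linear in each argument, and for two words the equation is
  \<open>wv_plus\<close>; the supports of the two polynomials are handled by separate inductions,
  the second argument first.\<close>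

lemma rho_mult:
  assumes p: "p \<in> fa n" and q: "q \<in> fa n"
  shows "rho n (p * q) = rho n p \<cdot> rho n q"
proof -
  have word: "rho n (sgl v 1 * q) = rho n (sgl v 1) \<cdot> rho n q"
    if v: "set (letters v) \<subseteq> hgens n" for v
  proof -
    have "Poly_Mapping.keys q \<subseteq> {w. set (letters w) \<subseteq> hgens n}" using q by (auto simp: fa_iff)
    then have "q \<in> fa n \<and> rho n (sgl v 1 * q) = rho n (sgl v 1) \<cdot> rho n q"
    proof (induction rule: free_space_induct)
      case zero
      then show ?case using wv_E[OF v] by (simp add: rho_zero rho_word[OF v] cmp_nul)
    next
      case (add s w r)
      have w: "sgl w (1 :: 'k) \<in> fa n" "sgl (v + w) (1 :: 'k) \<in> fa n"
        "sgl v (1 :: 'k) \<in> fa n" "pscale s (sgl w (1 :: 'k)) \<in> fa n"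
        "pscale s (sgl (v + w) (1 :: 'k)) \<in> fa n"
        using add(1) v by (simp_all add: pscale_simps)
      have "sgl v 1 * (pscale s (sgl w 1) + r) =
          pscale s (sgl (v + w) 1) + sgl v 1 * r"
        by (simp add: distrib_left pscale_simps mult_single)
      then show ?case
        using add w wv_E[of w n] wv_E[OF v] scal_one[OF wv_E[OF v]] rho_E[of r n] v wv_plus[of v n w]
        by (simp add: rho_add rho_single cmp_linear)
    qed
    then show ?thesis by blast
  qed
  have "Poly_Mapping.keys p \<subseteq> {w. set (letters w) \<subseteq> hgens n}" using p by (auto simp: fa_iff)
  then have "p \<in> fa n \<and> rho n (p * q) = rho n p \<cdot> rho n q"
  proof (induction rule: free_space_induct)
    case zero
    then show ?case using rho_E[OF q] by (simp add: rho_zero cmp_nul)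
  next
    case (add s w r)
    have w: "sgl w (1 :: 'k) \<in> fa n" "pscale s (sgl w (1 :: 'k)) \<in> fa n"
      using add(1) by (simp_all add: pscale_simps)
    have "(pscale s (sgl w 1) + r) * q = pscale s (sgl w 1 * q) + r * q"
      by (simp add: distrib_right pscale_mult mult.assoc)
    moreover have "pscale s (sgl w 1 * q) \<in> fa n"
      unfolding pscale_mult using w(1) q by simp
    ultimately show ?case
      using add w q rho_E[OF w(1)] rho_E[OF q] rho_E[of r n] word[of w] rho_pscale[OF w(1), of s, unfolded pscale_simps]
      by (simp add: rho_add rho_pscale cmp_linear)
  qed
  then show ?thesis by blast
qed

lemma rho_tt: "i \<in> {1..<n} \<Longrightarrow> rho n (tt i) = lft (i - 1) c (n - i - 1)"
  and rho_yy: "i \<in> {1..n} \<Longrightarrow> rho n (yy i) = lft (i - 1) x (n - i)"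
  using rho_gen[of "GenT i" n] rho_gen[of "GenY i" n] by (simp_all add: tt_def yy_def hgens_def)

lemma rho_diff:
  assumes "p \<in> fa n" "q \<in> fa n" "rho n p = rho n q"
  shows "rho n (p - q) = Nul D (pw n) (pw n)"
proof -
  \<comment> \<open>\<open>rho\<close> is known to respect sums and multiples, so the difference is
    written as a sum with the multiple by -1.\<close>
  have e: "p - q = p + pscale (- 1) q" by (simp add: pscale_mult single_uminus)
  have "pscale (- 1) q \<in> fa n" unfolding pscale_mult using assms by simp
  then have "rho n (p - q) = Plus D (Scal D 1 (rho n q)) (Scal D (- 1) (rho n q))"
    unfolding e using assms rho_E[OF assms(2)] by (simp add: rho_add rho_pscale scal_one)
  also have "\<dots> = Scal D (1 + - 1) (rho n q)" using rho_E[OF assms(2)] by (rule scal_add[symmetric])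
  finally show ?thesis using scal_zero[OF rho_E[OF assms(2)]] by simp
qed

lemma rho_rel:
  assumes "r \<in> hecke_rels n"
  shows "rho n r = Nul D (pw n) (pw n)"
proof -
  show ?thesis
    using assms
  proof (cases rule: hecke_rels_cases)
    case (1 i)
    have "lft (i - 1) c (n - i - 1) \<cdot> lft (i - 1) c (n - i - 1) = Idt D (pw n)"
      unfolding lft_cmp[OF cE cE] c_square pw_one(3)[symmetric] by (rule lft_idt) (use 1 in auto)
    then show ?thesis unfolding 1(1) using 1(2) by (intro rho_diff) (simp_all add: rho_mult rho_tt rho_one)
  next
    case (2 i)
    \<comment> \<open>The relation takes place on the strands \<open>i\<close>,
      \<open>i + 1\<close>, \<open>i + 2\<close>; \<open>a\<close> strands precede them and
      \<open>b\<close> follow. On these three strands it is the assumption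
      \<open>braid\<close>.\<close>
    define a b where "a = i - 1" and "b = n - i - 2"
    have m: "c \<boxtimes> Idt D ob \<in> E 3" "Idt D ob \<boxtimes> c \<in> E 3" by (simp_all add: numeral_3_eq_3)
    have t: "rho n (tt i) = lft a (c \<boxtimes> Idt D ob) b" "rho n (tt (i + 1)) = lft a (Idt D ob \<boxtimes> c) b"
      using 2 lft_right[OF cE, of a 1 b] lft_left[OF cE, of a 1 b]
      by (simp_all add: rho_tt a_def b_def del: in_homset) (simp_all add: Suc_diff_Suc numeral_2_eq_2)
    note E = E_cmp[OF m(1) m(2)] E_cmp[OF m(2) m(1)]
    have "rho n (tt i * tt (i + 1) * tt i) = rho n (tt i) \<cdot> (rho n (tt (i + 1)) \<cdot> rho n (tt i))"
      "rho n (tt (i + 1) * tt i * tt (i + 1)) = rho n (tt (i + 1)) \<cdot> (rho n (tt i) \<cdot> rho n (tt (i + 1)))"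
      using 2 by (simp_all add: rho_mult mult.assoc)
    then have "rho n (tt i * tt (i + 1) * tt i) = rho n (tt (i + 1) * tt i * tt (i + 1))"
      unfolding t lft_cmp[OF m(1) m(2)] lft_cmp[OF m(2) m(1)] lft_cmp[OF E(1) m(1)] lft_cmp[OF E(2) m(2)] using braid by simp
    then show ?thesis unfolding 2(1) using 2(2,3) by (intro rho_diff) simp_all
  next
    case (3 i j)
    have "lft (i - 1) c (n - i - 1) \<cdot> lft (j - 1) c (n - j - 1) = lft (j - 1) c (n - j - 1) \<cdot> lft (i - 1) c (n - i - 1)"
    proof (cases "i < j")
      case True
      then show ?thesis by (intro lft_commute[OF cE cE]) (use 3 in auto)
    next
      case False
      then show ?thesis by (intro lft_commute[OF cE cE, symmetric]) (use 3 in auto)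
    qed
    then show ?thesis unfolding 3(1) using 3(2,3) by (intro rho_diff) (simp_all add: rho_mult rho_tt)
  next
    case (4 i)
    \<comment> \<open>Here only the strands \<open>i\<close> and \<open>i + 1\<close> are involved:
      \<open>y_i\<close> acts on the first of them and \<open>y_{i+1}\<close> on the second, so the
      relation is the image under \<open>lft\<close> of the assumption \<open>cross\<close>.\<close>
    define a b where "a = i - 1" and "b = n - i - 1"
    have m: "x \<boxtimes> Idt D ob \<in> E 2" "Idt D ob \<boxtimes> x \<in> E 2" by (simp_all add: numeral_2_eq_2)
    have y: "rho n (yy i) = lft a (x \<boxtimes> Idt D ob) b" "rho n (yy (i + 1)) = lft a (Idt D ob \<boxtimes> x) b"
      using 4 lft_right[OF xE, of a 1 b] lft_left[OF xE, of a 1 b]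
      by (simp_all add: rho_yy a_def b_def del: in_homset) (simp_all add: Suc_diff_Suc)
    have t: "rho n (tt i) = lft a c b" using 4 by (simp add: rho_tt a_def b_def)
    have id: "lft a (Idt D (ob \<star> ob)) b = Idt D (pw n)"
      unfolding pw_one(3)[symmetric] by (rule lft_idt) (use 4 in \<open>auto simp: a_def b_def\<close>)
    have "rho n (yy i * tt i) = rho n (yy i) \<cdot> rho n (tt i)" using 4 by (simp add: rho_mult)
    also have "\<dots> = lft a (Plus D (c \<cdot> (Idt D ob \<boxtimes> x)) (Idt D (ob \<star> ob))) b"
      unfolding y t lft_cmp[OF cE m(1)] cross ..
    also have "\<dots> = Plus D (lft a (c \<cdot> (Idt D ob \<boxtimes> x)) b) (Idt D (pw n))"
      unfolding id[symmetric] by (rule lft_plus[of _ 2]) (simp_all add: numeral_2_eq_2)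
    also have "lft a (c \<cdot> (Idt D ob \<boxtimes> x)) b = rho n (tt i * yy (i + 1))"
      using 4 by (simp add: rho_mult y[simplified] t lft_cmp[OF m(2) cE] del: in_homset)
    also have "Plus D (rho n (tt i * yy (i + 1))) (Idt D (pw n)) = rho n (tt i * yy (i + 1) + 1)"
      using 4 by (simp add: rho_add rho_one)
    finally have "rho n (yy i * tt i) = rho n (tt i * yy (i + 1) + 1)" .
    then have "rho n (yy i * tt i - (tt i * yy (i + 1) + 1)) = Nul D (pw n) (pw n)"
      using 4 by (intro rho_diff) simp_all
    then show ?thesis unfolding 4(1) by (simp add: diff_diff_eq)
  next
    case (5 i j)
    have "lft (i - 1) x (n - i) \<cdot> lft (j - 1) x (n - j) = lft (j - 1) x (n - j) \<cdot> lft (i - 1) x (n - i)"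
    proof (cases i j rule: linorder_cases)
      case less
      then show ?thesis by (intro lft_commute[OF xE xE]) (use 5 in auto)
    next
      case greater
      then show ?thesis by (intro lft_commute[OF xE xE, symmetric]) (use 5 in auto)
    qed simp
    then show ?thesis unfolding 5(1) using 5(2,3) by (intro rho_diff) (simp_all add: rho_mult rho_yy)
  next
    case (6 i j)
    have "lft (i - 1) c (n - i - 1) \<cdot> lft (j - 1) x (n - j) = lft (j - 1) x (n - j) \<cdot> lft (i - 1) c (n - i - 1)"
    proof (cases "i < j")
      case True
      then show ?thesis by (intro lft_commute[OF cE xE]) (use 6 in auto)
    next
      case False
      then show ?thesis by (intro lft_commute[OF xE cE, symmetric]) (use 6 in auto)
    qed
    then show ?thesis unfolding 6(1) using 6(2,3) by (intro rho_diff) (simp_all add: rho_mult rho_yy rho_tt)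
  qed
qed

text \<open>The endomorphism ring of \<open>pw n\<close>, in the form needed to apply
  \<open>hecke_ideal_hom\<close> to \<open>rho n\<close> and the zero ideal.\<close>

definition ER :: "nat \<Rightarrow> 'n ring" where
  "ER n = \<lparr>carrier = E n, mult = Cmp D, one = Idt D (pw n), zero = Nul D (pw n) (pw n), add = Plus D\<rparr>"

lemma ER_simps: "carrier (ER n) = E n" "mult (ER n) = Cmp D" "one (ER n) = Idt D (pw n)" "zero (ER n) = Nul D (pw n) (pw n)" "add (ER n) = Plus D"
  by (simp_all add: ER_def)

lemma ring_ER: "Ring.ring (ER n)"
proof (rule ringI)
  show "abelian_group (ER n)"
  proof (rule abelian_groupI)
    fix f assume "f \<in> carrier (ER n)"
    then have f: "f \<in> E n" by (simp add: ER_simps)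
    have "Plus D (Scal D (- 1) f) (Scal D 1 f) = Scal D (- 1 + 1) f" by (rule scal_add[OF f, symmetric])
    then have "Plus D (Scal D (- 1) f) f = Nul D (pw n) (pw n)" using scal_one[OF f] scal_zero[OF f] by simp
    moreover have "Scal D (- 1) f \<in> E n" using f by simp
    ultimately show "\<exists>y\<in>carrier (ER n). y \<oplus>\<^bsub>ER n\<^esub> f = \<zero>\<^bsub>ER n\<^esub>" by (auto simp only: ER_simps)
  next
    fix f g assume "f \<in> carrier (ER n)" "g \<in> carrier (ER n)"
    then have fg: "f \<in> E n" "g \<in> E n" by (simp_all only: ER_simps)
    show "f \<oplus>\<^bsub>ER n\<^esub> g \<in> carrier (ER n)" using fg by (simp add: ER_simps)
    show "f \<oplus>\<^bsub>ER n\<^esub> g = g \<oplus>\<^bsub>ER n\<^esub> f" unfolding ER_simps by (rule plus_comm[OF fg])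
    show "f \<oplus>\<^bsub>ER n\<^esub> g \<oplus>\<^bsub>ER n\<^esub> h = f \<oplus>\<^bsub>ER n\<^esub> (g \<oplus>\<^bsub>ER n\<^esub> h)" if "h \<in> carrier (ER n)" for h
      using that unfolding ER_simps by (rule plus_assoc[OF fg])
  next
    show "\<zero>\<^bsub>ER n\<^esub> \<in> carrier (ER n)" by (simp add: ER_simps)
    show "\<zero>\<^bsub>ER n\<^esub> \<oplus>\<^bsub>ER n\<^esub> f = f" if "f \<in> carrier (ER n)" for f
      using that unfolding ER_simps by (rule nul_plus)
  qed
  show "Group.monoid (ER n)"
    by (rule monoidI) (simp_all add: ER_simps)
qed (simp_all add: ER_simps cmp_linear)

lemma rho_ideal:
  assumes p: "p \<in> hecke_ideal n"
  shows "rho n p = Nul D (pw n) (pw n)"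
proof -
  have h: "ring_hom_ring (free_algebra n) (ER n) (rho n)"
    by (rule ring_hom_ringI[OF ring_fa ring_ER]) (simp_all add: ER_simps rho_E rho_mult rho_add rho_one del: in_homset)
  have "rho n p \<in> {\<zero>\<^bsub>ER n\<^esub>}"
    by (rule hecke_ideal_hom[OF ring_ER h ring.zeroideal[OF ring_ER] _ p]) (simp add: ER_simps rho_rel)
  then show ?thesis by (simp add: ER_simps)
qed

lemma rho_cls:
  assumes "p \<in> fa n" "q \<in> fa n" "hcls n p = hcls n q"
  shows "rho n p = rho n q"
proof -
  have pq: "p - q \<in> hecke_ideal n" using assms(3) by (simp add: hcls_eq)
  have "rho n p = rho n ((p - q) + q)" by simp
  also have "\<dots> = Plus D (rho n (p - q)) (rho n q)" by (rule rho_add) (use assms in simp_all)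
  finally show ?thesis unfolding rho_ideal[OF pq] using nul_plus[OF rho_E[OF assms(2)]] by simp
qed

text \<open>With \<open>rho_right\<close> this is the compatibility of \<open>rho\<close> with the
  homomorphisms \<open>\<mu>\<close> from two algebras to one. On letters it is a count of strands,
  and \<open>tarr_cmp\<close> carries it over to products.\<close>

lemma rho_left: "p \<in> fa m \<Longrightarrow> rho (m + n) p = rho m p \<boxtimes> Idt D (pw n)"
proof (induction rule: fa_induct)
  case (gen g)
  have "gv (m + n) g = gv m g \<boxtimes> Idt D (pw n)"
  proof (cases g)
    case (GenT i)
    then have "m + n - i - 1 = (m - i - 1) + n" using gen by (auto simp: hgens_def)
    then show ?thesis using GenT by (simp add: lft_def pw_add[of _ n] tarr_idt[symmetric] del: tarr_idt)
  next
    case (GenY i)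
    then have "m + n - i = (m - i) + n" using gen by (auto simp: hgens_def)
    then show ?thesis using GenY by (simp add: lft_def pw_add[of _ n] tarr_idt[symmetric] del: tarr_idt)
  qed
  then show ?case using gen hgens_mono[of m n] by (simp add: rho_gen subsetD)
next
  case (mult p q)
  then show ?case using rho_E[OF mult(1)] rho_E[OF mult(2)] by (simp add: rho_mult fa_mono tarr_cmp)
next
  case (add p q)
  then show ?case using rho_E[OF add(1)] rho_E[OF add(2)] by (simp add: rho_add fa_mono tarr_linear)
next
  case (scale p s)
  then show ?case using rho_E[OF scale(1)] by (simp add: rho_scale fa_mono tarr_linear)
qed (simp add: rho_one pw_add)

lemma rho_right: "q \<in> fa n \<Longrightarrow> rho (m + n) (shift m q) = Idt D (pw m) \<boxtimes> rho n q"
proof (induction rule: fa_induct)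
  case (gen g)
  have "gv (m + n) (shift_gen m g) = Idt D (pw m) \<boxtimes> gv n g"
  proof (cases g)
    case (GenT i)
    then have "i + m - 1 = m + (i - 1)" "m + n - (i + m) - 1 = n - i - 1" using gen by (auto simp: hgens_def)
    then show ?thesis using GenT by (simp add: lft_def pw_add tarr_idt[symmetric] del: tarr_idt)
  next
    case (GenY i)
    then have "i + m - 1 = m + (i - 1)" "m + n - (i + m) = n - i" using gen by (auto simp: hgens_def)
    then show ?thesis using GenY by (simp add: lft_def pw_add tarr_idt[symmetric] del: tarr_idt)
  qed
  then show ?case using gen hgens_shift[OF gen] by (simp add: rho_gen shift_single shift_word_def)
next
  case (mult p q)
  then show ?case using rho_E[OF mult(1)] rho_E[OF mult(2)] by (simp add: rho_mult fa_shift shift_mult tarr_cmp)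
next
  case (add p q)
  then show ?case using rho_E[OF add(1)] rho_E[OF add(2)] by (simp add: rho_add fa_shift shift_add tarr_linear)
next
  case (scale p s)
  then show ?case using rho_E[OF scale(1)] by (simp add: rho_scale fa_shift shift_mult shift_single shift_word_simps tarr_linear)
qed (simp add: rho_one pw_add)

text \<open>An arrow carries a coset, so a representative is chosen; by \<open>rho_cls\<close> its
  value does not depend on the choice, and \<open>G_har\<close> gives the resulting rule.\<close>

definition G :: "(nat, 'k hecke_arr, 'p, 'n) ftor" where
  "G = \<lparr>OMap = pw, AMap = (\<lambda>f\<in>Arr hecke_bar.
     if Src hecke_bar f = Tgt hecke_bar f then rho (Src hecke_bar f) (SOME p. p \<in> fa (Src hecke_bar f) \<and> f = har (Src hecke_bar f) (Src hecke_bar f) p)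
     else Nul D (pw (Src hecke_bar f)) (pw (Tgt hecke_bar f)))\<rparr>"

lemma G_har:
  assumes p: "p \<in> fa m"
  shows "AMap G (har m n p) = (if m = n then rho n p else Nul D (pw m) (pw n))"
proof (cases "m = n")
  case True
  let ?P = "\<lambda>q. q \<in> fa n \<and> har n n p = har n n q"
  have "?P (SOME q. ?P q)" by (rule someI[of ?P p]) (use p True in simp)
  then have "rho n p = rho n (SOME q. ?P q)" using p True by (intro rho_cls) (simp_all add: har_def)
  then show ?thesis using p True by (simp add: G_def)
qed (use p in \<open>simp add: G_def\<close>)

lemma G_obj [simp]: "OMap G = pw"
  by (simp add: G_def)

lemma G_tarr:
  assumes "f \<in> Arr hecke_bar" "g \<in> Arr hecke_bar"
  shows "AMap G (f \<boxtimes>\<^bsub>hecke_bar\<^esub> g) = AMap G f \<boxtimes> AMap G g"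
proof -
  obtain a a' p where f: "p \<in> fa a" "f = har a a' p" using assms(1) unfolding har_arr by blast
  obtain b b' q where g: "q \<in> fa b" "g = har b b' q" using assms(2) unfolding har_arr by blast
  note E = rho_E[OF f(1)] rho_E[OF g(1)]
  have m: "p * shift a q \<in> fa (a + b)" using fa_mono[OF f(1), of b] fa_shift[OF g(1), of a] by simp
  \<comment> \<open>It may happen that \<open>a + b = a' + b'\<close> although
    \<open>a \<noteq> a'\<close>; the tensor product is then the class of 0 and not an arrow between
    different objects, but its image is zero in both cases.\<close>
  have z: "AMap G (har (a + b) (a' + b') 0) = Nul D (pw (a + b)) (pw (a' + b'))"
    by (simp add: G_har rho_zero)
  consider "a = a'" "b = b'" | "a \<noteq> a'" | "a = a'" "b \<noteq> b'" by blast
  then show ?thesis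
  proof cases
    case 1
    have "AMap G (f \<boxtimes>\<^bsub>hecke_bar\<^esub> g) = rho (a + b) (p * shift a q)"
      unfolding f(2) g(2) using f(1) g(1) m by (simp add: har_tarr G_har flip: 1)
    also have "\<dots> = rho a p \<boxtimes> rho b q"
      using E by (simp add: rho_mult fa_mono[OF f(1)] fa_shift[OF g(1)] rho_left[OF f(1)] rho_right[OF g(1)] tarr_cmp)
    finally show ?thesis unfolding f(2) g(2) using f(1) g(1) by (simp add: G_har flip: 1)
  next
    case 2
    have "AMap G g \<in> Arr D" "Src D (AMap G g) = pw b" "Tgt D (AMap G g) = pw b'"
      unfolding g(2) using E g(1) by (auto simp: G_har)
    then show ?thesis unfolding f(2) using f(1) g(1) 2 z by (simp add: g(2) har_tarr G_har nul_tarr pw_add)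
  next
    case 3
    have "AMap G f \<in> Arr D" "Src D (AMap G f) = pw a" "Tgt D (AMap G f) = pw a'"
      unfolding f(2) using E f(1) by (auto simp: G_har)
    then show ?thesis unfolding g(2) using f(1) g(1) 3 z by (simp add: f(2) har_tarr G_har nul_tarr pw_add)
  qed
qed

lemma G_functor: "klinear_functor hecke_bar D G"
proof (rule klinear_functorI)
  show "OMap G \<in> extensional (Obj hecke_bar)" by simp
  show "AMap G \<in> extensional (Arr hecke_bar)" by (simp add: G_def)
  show "AMap G (Idt hecke_bar a) = Idt D (OMap G a)" for a by (simp add: G_har rho_one)
  fix f :: "'k hecke_arr"
  assume f: "f \<in> Arr hecke_bar"
  obtain m n p where p: "p \<in> fa m" "f = har m n p" using f unfolding har_arr by blast
  note E = rho_E[OF p(1)]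
  show "AMap G f \<in> homset D (OMap G (Src hecke_bar f)) (OMap G (Tgt hecke_bar f))"
    using p E by (auto simp: G_har)
  have sp: "sgl 0 s * p \<in> fa m" for s using p by simp
  show "AMap G (Scal hecke_bar s f) = Scal D s (AMap G f)" for s
  proof (cases "m = n")
    case True
    then show ?thesis using p sp[of s] by (simp add: har_scal G_har rho_scale)
  next
    case False
    have "Nul D (pw m) (pw n) = Scal D 0 (Nul D (pw m) (pw n))" by (rule scal_zero[symmetric]) simp
    then have "Scal D s (Nul D (pw m) (pw n)) = Nul D (pw m) (pw n)"
      using scal_scal[of "Nul D (pw m) (pw n)" "pw m" "pw n" s 0] by simp
    then show ?thesis using p sp[of s] False by (simp add: har_scal G_har)
  qed
  fix g :: "'k hecke_arr"
  assume g: "g \<in> Arr hecke_bar"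
  show "AMap G (g \<cdot>\<^bsub>hecke_bar\<^esub> f) = AMap G g \<cdot> AMap G f" if s: "Src hecke_bar g = Tgt hecke_bar f"
  proof -
    obtain n' r q where g': "q \<in> fa n'" "g = har n' r q" using g unfolding har_arr by blast
    have q: "q \<in> fa n" "g = har n r q" using g' s p(2) by simp_all
    note F = rho_E[OF q(1)]
    consider "m = n" "n = r" | "m \<noteq> n" | "m = n" "n \<noteq> r" by blast
    then show ?thesis
    proof cases
      case 1
      have "q * p \<in> fa m" using p q 1 by simp
      then show ?thesis unfolding p(2) q(2) using p(1) q(1) by (simp add: har_cmp G_har rho_mult 1)
    next
      case 2
      have z: "AMap G (har m r 0) = Nul D (pw m) (pw r)" by (simp add: G_har rho_zero)
      have "AMap G g \<in> Arr D" "Src D (AMap G g) = pw n" "Tgt D (AMap G g) = pw r"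
        unfolding q(2) using F q(1) by (auto simp: G_har)
      then show ?thesis unfolding p(2) using p(1) q(1) 2 z by (simp add: q(2) har_cmp G_har cmp_nul)
    next
      case 3
      have z: "AMap G (har m r 0) = Nul D (pw m) (pw r)" by (simp add: G_har rho_zero)
      have "AMap G f \<in> Arr D" "Src D (AMap G f) = pw m" "Tgt D (AMap G f) = pw n"
        unfolding p(2) using E p(1) by (auto simp: G_har)
      then show ?thesis unfolding q(2) using p(1) q(1) 3 z by (simp add: p(2) har_cmp G_har cmp_nul)
    qed
  qed
  show "AMap G (Plus hecke_bar f g) = Plus D (AMap G f) (AMap G g)"
    if s: "Src hecke_bar g = Src hecke_bar f" "Tgt hecke_bar g = Tgt hecke_bar f"
  proof -
    have "g \<in> homset hecke_bar m n" using g s p(2) by simp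
    then obtain q where q: "q \<in> fa m" "g = har m n q" by (rule har_homE)
    have pq: "p + q \<in> fa m" using p q by simp
    show ?thesis
      unfolding p(2) q(2) using p(1) q(1) pq nul_plus[of "Nul D (pw m) (pw n)" "pw m" "pw n"]
      by (cases "m = n") (simp_all add: har_plus G_har rho_add)
  qed
qed simp

lemma G_y1: "AMap G hecke_y1 = x" and G_t1: "AMap G hecke_t1 = c"
proof -
  have "(hecke_y1 :: 'k hecke_arr) = har 1 1 (yy 1)" "(hecke_t1 :: 'k hecke_arr) = har 2 2 (tt 1)" by (simp_all add: hecke_y1_def hecke_t1_def har_def)
  note e = this
  show "AMap G hecke_y1 = x" unfolding e by (subst G_har) (simp_all add: rho_yy lft_def)
  show "AMap G hecke_t1 = c" unfolding e by (subst G_har) (simp_all add: rho_tt lft_def)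
qed

end


section \<open>Chorded categories\<close>

context klinear_category
begin

lemma iso_cancel_left:
  assumes "is_iso C a" "a \<in> Arr C" "f \<in> Arr C" "g \<in> Arr C" "Tgt C f = Src C a" "Tgt C g = Src C a" "a \<cdot> f = a \<cdot> g"
  shows "f = g"
proof -
  have "(inv_arr C a \<cdot> a) \<cdot> f = (inv_arr C a \<cdot> a) \<cdot> g" using assms by (simp del: inv_arr_simps(4,5))
  then show ?thesis using assms by simp
qed

lemma iso_cancel_right:
  assumes "is_iso C a" "a \<in> Arr C" "f \<in> Arr C" "g \<in> Arr C" "Src C f = Tgt C a" "Src C g = Tgt C a" "f \<cdot> a = g \<cdot> a"
  shows "f = g"
proof -
  have "f \<cdot> (a \<cdot> inv_arr C a) = (f \<cdot> a) \<cdot> inv_arr C a" "g \<cdot> (a \<cdot> inv_arr C a) = (g \<cdot> a) \<cdot> inv_arr C a"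
    using assms(1-6) by (simp_all del: inv_arr_simps(4,5))
  then have "f \<cdot> (a \<cdot> inv_arr C a) = g \<cdot> (a \<cdot> inv_arr C a)" unfolding assms(7) by simp
  then show ?thesis using assms by simp
qed

end

context klinear_monoidal_category
begin

lemma mon_arr [simp]:
  "a \<in> Obj C \<Longrightarrow> b \<in> Obj C \<Longrightarrow> a \<star> b \<in> Obj C"
  "f \<in> Arr C \<Longrightarrow> g \<in> Arr C \<Longrightarrow> f \<boxtimes> g \<in> Arr C"
  "f \<in> Arr C \<Longrightarrow> g \<in> Arr C \<Longrightarrow> Src C (f \<boxtimes> g) = Src C f \<star> Src C g"
  "f \<in> Arr C \<Longrightarrow> g \<in> Arr C \<Longrightarrow> Tgt C (f \<boxtimes> g) = Tgt C f \<star> Tgt C g"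
  using tobj[of a b] tarr[of f "Src C f" "Tgt C f" g "Src C g" "Tgt C g"] by auto

lemma assoc_arr [simp]:
  assumes "a \<in> Obj C" "b \<in> Obj C" "c \<in> Obj C"
  shows "Assoc C a b c \<in> Arr C" "Src C (Assoc C a b c) = (a \<star> b) \<star> c" "Tgt C (Assoc C a b c) = a \<star> (b \<star> c)"
    "is_iso C (Assoc C a b c)"
  using assoc[OF assms] by auto

lemma tarr_cmp':
  "f \<in> Arr C \<Longrightarrow> f' \<in> Arr C \<Longrightarrow> g \<in> Arr C \<Longrightarrow> g' \<in> Arr C \<Longrightarrow> Src C f' = Tgt C f \<Longrightarrow> Src C g' = Tgt C g \<Longrightarrow>
    (f' \<boxtimes> g') \<cdot> (f \<boxtimes> g) = (f' \<cdot> f) \<boxtimes> (g' \<cdot> g)"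
  by (rule tarr_cmp[symmetric]) auto

lemma assoc_nat':
  "f \<in> Arr C \<Longrightarrow> g \<in> Arr C \<Longrightarrow> h \<in> Arr C \<Longrightarrow>
    Assoc C (Tgt C f) (Tgt C g) (Tgt C h) \<cdot> ((f \<boxtimes> g) \<boxtimes> h) = (f \<boxtimes> (g \<boxtimes> h)) \<cdot> Assoc C (Src C f) (Src C g) (Src C h)"
  by (rule assoc_nat) auto

lemma tensor_right_endo:
  assumes X: "X \<in> Obj C"
  shows "endofunctor (tensor_right C X)"
    and "Y \<in> Obj C \<Longrightarrow> OMap (tensor_right C X) Y = Y \<star> X" "f \<in> Arr C \<Longrightarrow> AMap (tensor_right C X) f = f \<boxtimes> Idt C X"
proof -
  have [simp]: "\<And>Y. Y \<in> Obj C \<Longrightarrow> OMap (tensor_right C X) Y = Y \<star> X" "\<And>f. f \<in> Arr C \<Longrightarrow> AMap (tensor_right C X) f = f \<boxtimes> Idt C X"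
    by (simp_all add: tensor_right_def)
  show "endofunctor (tensor_right C X)"
  proof (rule klinear_functorI)
    show "AMap (tensor_right C X) (Plus C f g) = Plus C (AMap (tensor_right C X) f) (AMap (tensor_right C X) g)"
      if "f \<in> Arr C" "g \<in> Arr C" "Src C g = Src C f" "Tgt C g = Tgt C f" for f g
      using that X tarr_plus[of f "Src C f" "Tgt C f" g "Idt C X" X X "Idt C X"] by simp
  qed (simp_all add: X tarr_idt tarr_cmp' tarr_scal, simp_all add: tensor_right_def)
  show "Y \<in> Obj C \<Longrightarrow> OMap (tensor_right C X) Y = Y \<star> X" "f \<in> Arr C \<Longrightarrow> AMap (tensor_right C X) f = f \<boxtimes> Idt C X" by simp_all
qed

end

section \<open>Tensoring by a degenerate Hecke object\<close>

locale hecke_object = chorded_category C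
  for C :: "('o, 'm, 'k::field, 'z) chordcat_scheme" (structure) +
  fixes X :: 'o and l :: 'k
  assumes X [simp]: "X \<in> Obj C" and l: "l \<noteq> 0" and chord_X: "Chord C X X = Scal C l (Sym C X X)"
begin

lemma sym_arr [simp]:
  assumes "a \<in> Obj C" "b \<in> Obj C"
  shows "Sym C a b \<in> Arr C" "Src C (Sym C a b) = a \<star> b" "Tgt C (Sym C a b) = b \<star> a" "is_iso C (Sym C a b)"
  using sym[OF assms] is_isoI(1)[of "Sym C a b" C "a \<star> b" "b \<star> a" "Sym C b a"] sym[OF assms(2,1)] sym_sym[OF assms] sym_sym[OF assms(2,1)]
  by auto

lemma chord_arr [simp]:
  assumes "a \<in> Obj C" "b \<in> Obj C"
  shows "Chord C a b \<in> Arr C" "Src C (Chord C a b) = a \<star> b" "Tgt C (Chord C a b) = a \<star> b"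
  using chord[OF assms] by auto

abbreviation "s \<equiv> Sym C X X"
abbreviation "I \<equiv> Idt C"

definition cc :: "'o \<Rightarrow> 'm" where
  "cc Y = inv_arr C (Assoc C Y X X) \<cdot> (I Y \<boxtimes> s) \<cdot> Assoc C Y X X"

lemma cc_arr [simp]:
  assumes "Y \<in> Obj C"
  shows "cc Y \<in> Arr C" "Src C (cc Y) = (Y \<star> X) \<star> X" "Tgt C (cc Y) = (Y \<star> X) \<star> X"
  using assms by (simp_all add: cc_def)

text \<open>Identities for \<open>cc\<close> are checked after composition with the associator,
  where \<open>cc Y\<close> turns into \<open>I Y \<boxtimes> s\<close>.\<close>

lemma assoc_cc: "Y \<in> Obj C \<Longrightarrow> Assoc C Y X X \<cdot> cc Y = (I Y \<boxtimes> s) \<cdot> Assoc C Y X X"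
  using cmp_assoc'[of "(I Y \<boxtimes> s) \<cdot> Assoc C Y X X" "inv_arr C (Assoc C Y X X)" "Assoc C Y X X"]
  by (simp add: cc_def del: cmp_assoc')

lemma cc_eqI:
  assumes Y: "Y \<in> Obj C" and f: "f \<in> Arr C" "g \<in> Arr C" "Tgt C f = (Y \<star> X) \<star> X" "Tgt C g = (Y \<star> X) \<star> X"
    and eq: "Assoc C Y X X \<cdot> f = Assoc C Y X X \<cdot> g"
  shows "f = g"
  by (rule iso_cancel_left[of "Assoc C Y X X"]) (use assms in simp_all)

lemma cc_cc: 
  assumes Y: "Y \<in> Obj C"
  shows "cc Y \<cdot> cc Y = I ((Y \<star> X) \<star> X)"
proof (rule cc_eqI[OF Y])
  have "Assoc C Y X X \<cdot> (cc Y \<cdot> cc Y) = (Assoc C Y X X \<cdot> cc Y) \<cdot> cc Y" using Y by simp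
  also have "\<dots> = (I Y \<boxtimes> s) \<cdot> (Assoc C Y X X \<cdot> cc Y)" by (subst assoc_cc[OF Y]) (use Y in simp)
  also have "\<dots> = ((I Y \<boxtimes> s) \<cdot> (I Y \<boxtimes> s)) \<cdot> Assoc C Y X X" unfolding assoc_cc[OF Y] using Y by simp
  also have "(I Y \<boxtimes> s) \<cdot> (I Y \<boxtimes> s) = I (Y \<star> (X \<star> X))" using Y by (simp add: tarr_cmp' sym_sym tarr_idt)
  finally show "Assoc C Y X X \<cdot> (cc Y \<cdot> cc Y) = Assoc C Y X X \<cdot> I ((Y \<star> X) \<star> X)" using Y by simp
qed (use Y in simp_all)

lemma cc_nat:
  assumes f: "f \<in> Arr C"
  shows "cc (Tgt C f) \<cdot> ((f \<boxtimes> I X) \<boxtimes> I X) = ((f \<boxtimes> I X) \<boxtimes> I X) \<cdot> cc (Src C f)"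
proof (rule cc_eqI[of "Tgt C f"])
  let ?a = "Assoc C (Tgt C f) X X" and ?a' = "Assoc C (Src C f) X X" and ?f = "(f \<boxtimes> I X) \<boxtimes> I X"
  have nat: "?a \<cdot> ?f = (f \<boxtimes> I (X \<star> X)) \<cdot> ?a'" using assoc_nat'[of f "I X" "I X"] f by (simp add: tarr_idt)
  have "?a \<cdot> (cc (Tgt C f) \<cdot> ?f) = (?a \<cdot> cc (Tgt C f)) \<cdot> ?f" using f by simp
  also have "\<dots> = (I (Tgt C f) \<boxtimes> s) \<cdot> (?a \<cdot> ?f)" using f by (subst assoc_cc) simp_all
  also have "\<dots> = ((I (Tgt C f) \<boxtimes> s) \<cdot> (f \<boxtimes> I (X \<star> X))) \<cdot> ?a'" unfolding nat using f by simp
  also have "(I (Tgt C f) \<boxtimes> s) \<cdot> (f \<boxtimes> I (X \<star> X)) = (f \<boxtimes> I (X \<star> X)) \<cdot> (I (Src C f) \<boxtimes> s)" using f by (simp add: tarr_cmp')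
  also have "((f \<boxtimes> I (X \<star> X)) \<cdot> (I (Src C f) \<boxtimes> s)) \<cdot> ?a' = (f \<boxtimes> I (X \<star> X)) \<cdot> (?a' \<cdot> cc (Src C f))"
    using f by (subst assoc_cc) simp_all
  also have "\<dots> = ((f \<boxtimes> I (X \<star> X)) \<cdot> ?a') \<cdot> cc (Src C f)" using f by simp
  finally show "?a \<cdot> (cc (Tgt C f) \<cdot> ?f) = ?a \<cdot> (?f \<cdot> cc (Src C f))" unfolding nat[symmetric] using f by simp
qed (use f in simp_all)

text \<open>By the hexagon, the symmetry of \<open>X\<close> with \<open>X \<star> X\<close> is
  \<open>s1 \<cdot> s2\<close> up to an associator. Its naturality with respect to \<open>s\<close>
  turns a factor \<open>s1\<close> on the right into a factor \<open>s2\<close> on the left.\<close>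

lemma sym_braid:
  defines "s1 \<equiv> I X \<boxtimes> s" and "s2 \<equiv> Assoc C X X X \<cdot> (s \<boxtimes> I X) \<cdot> inv_arr C (Assoc C X X X)"
  shows "s1 \<cdot> s2 \<cdot> s1 = s2 \<cdot> s1 \<cdot> s2"
proof -
  let ?a = "Assoc C X X X" and ?S = "Sym C X (X \<star> X)"
  have [simp]: "s1 \<in> Arr C" "Src C s1 = X \<star> (X \<star> X)" "Tgt C s1 = X \<star> (X \<star> X)"
    "s2 \<in> Arr C" "Src C s2 = X \<star> (X \<star> X)" "Tgt C s2 = X \<star> (X \<star> X)"
    by (simp_all add: s1_def s2_def)
  have s2: "s2 \<cdot> ?a = ?a \<cdot> (s \<boxtimes> I X)" by (simp add: s2_def)
  have S: "?a \<cdot> ?S = s1 \<cdot> s2"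
  proof (rule iso_cancel_right[of ?a])
    have "(?a \<cdot> ?S) \<cdot> ?a = s1 \<cdot> (?a \<cdot> (s \<boxtimes> I X))" using hexagon[of X X X] by (simp add: s1_def)
    then show "(?a \<cdot> ?S) \<cdot> ?a = (s1 \<cdot> s2) \<cdot> ?a" unfolding s2[symmetric] by simp
  qed simp_all
  have n: "?S \<cdot> s1 = (s \<boxtimes> I X) \<cdot> ?S" unfolding s1_def by (rule sym_nat) simp_all
  have "s1 \<cdot> s2 \<cdot> s1 = (s1 \<cdot> s2) \<cdot> s1" by simp
  also have "\<dots> = ?a \<cdot> (?S \<cdot> s1)" unfolding S[symmetric] by simp
  also have "\<dots> = (?a \<cdot> (s \<boxtimes> I X)) \<cdot> ?S" unfolding n by simp
  also have "\<dots> = s2 \<cdot> (?a \<cdot> ?S)" unfolding s2[symmetric] by simp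
  finally show ?thesis unfolding S .
qed

text \<open>Conjugation by the rebracketing \<open>P\<close> turns the two operators into
  \<open>I Y \<boxtimes> s1\<close> and \<open>I Y \<boxtimes> s2\<close>, for which
  \<open>sym_braid\<close> applies. The pentagon provides two factorisations of \<open>P\<close>,
  and each operator passes easily through one of them.\<close>

lemma cc_braid:
  assumes Y: "Y \<in> Obj C"
  shows "cc (Y \<star> X) \<cdot> (cc Y \<boxtimes> I X) \<cdot> cc (Y \<star> X) = (cc Y \<boxtimes> I X) \<cdot> cc (Y \<star> X) \<cdot> (cc Y \<boxtimes> I X)"
proof -
  define s1 s2 where "s1 = I X \<boxtimes> s" and "s2 = Assoc C X X X \<cdot> (s \<boxtimes> I X) \<cdot> inv_arr C (Assoc C X X X)"
  have [simp]: "s1 \<in> Arr C" "Src C s1 = X \<star> (X \<star> X)" "Tgt C s1 = X \<star> (X \<star> X)"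
    "s2 \<in> Arr C" "Src C s2 = X \<star> (X \<star> X)" "Tgt C s2 = X \<star> (X \<star> X)"
    by (simp_all add: s1_def s2_def)
  have braid: "s1 \<cdot> s2 \<cdot> s1 = s2 \<cdot> s1 \<cdot> s2" unfolding s1_def s2_def by (rule sym_braid)
  let ?a = "Assoc C Y X (X \<star> X)" and ?b = "Assoc C (Y \<star> X) X X"
  define P where "P = ?a \<cdot> ?b"
  have P [simp]: "P \<in> Arr C" "Src C P = ((Y \<star> X) \<star> X) \<star> X" "Tgt C P = Y \<star> (X \<star> (X \<star> X))"
    using Y by (simp_all add: P_def)
  have pent: "P = (I Y \<boxtimes> Assoc C X X X) \<cdot> Assoc C Y (X \<star> X) X \<cdot> (Assoc C Y X X \<boxtimes> I X)"
    unfolding P_def by (rule pentagon) (use Y in simp_all)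
  have P1: "P \<cdot> cc (Y \<star> X) = (I Y \<boxtimes> s1) \<cdot> P"
  proof -
    have "P \<cdot> cc (Y \<star> X) = ?a \<cdot> (?b \<cdot> cc (Y \<star> X))" unfolding P_def using Y by simp
    also have "\<dots> = (?a \<cdot> ((I Y \<boxtimes> I X) \<boxtimes> s)) \<cdot> ?b" using Y by (simp add: assoc_cc tarr_idt)
    also have "?a \<cdot> ((I Y \<boxtimes> I X) \<boxtimes> s) = (I Y \<boxtimes> s1) \<cdot> ?a" using assoc_nat'[of "I Y" "I X" s] Y by (simp add: s1_def)
    finally show ?thesis unfolding P_def using Y by simp
  qed
  have P2: "P \<cdot> (cc Y \<boxtimes> I X) = (I Y \<boxtimes> s2) \<cdot> P"
  proof -
    let ?c = "Assoc C X X X" and ?d = "Assoc C Y (X \<star> X) X" and ?e = "Assoc C Y X X \<boxtimes> I X"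
    have "P \<cdot> (cc Y \<boxtimes> I X) = (I Y \<boxtimes> ?c) \<cdot> (?d \<cdot> (?e \<cdot> (cc Y \<boxtimes> I X)))" unfolding pent using Y by simp
    also have "?e \<cdot> (cc Y \<boxtimes> I X) = ((I Y \<boxtimes> s) \<boxtimes> I X) \<cdot> ?e" using Y by (simp add: tarr_cmp' assoc_cc)
    also have "?d \<cdot> (((I Y \<boxtimes> s) \<boxtimes> I X) \<cdot> ?e) = (?d \<cdot> ((I Y \<boxtimes> s) \<boxtimes> I X)) \<cdot> ?e" using Y by simp
    also have "?d \<cdot> ((I Y \<boxtimes> s) \<boxtimes> I X) = (I Y \<boxtimes> (s \<boxtimes> I X)) \<cdot> ?d" using assoc_nat'[of "I Y" s "I X"] Y by simp
    also have "(I Y \<boxtimes> ?c) \<cdot> (((I Y \<boxtimes> (s \<boxtimes> I X)) \<cdot> ?d) \<cdot> ?e) = ((I Y \<boxtimes> ?c) \<cdot> (I Y \<boxtimes> (s \<boxtimes> I X))) \<cdot> (?d \<cdot> ?e)" using Y by simp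
    also have "(I Y \<boxtimes> ?c) \<cdot> (I Y \<boxtimes> (s \<boxtimes> I X)) = (I Y \<boxtimes> s2) \<cdot> (I Y \<boxtimes> ?c)" using Y by (simp add: tarr_cmp' s2_def)
    finally show ?thesis unfolding pent using Y by simp
  qed
  have Y3: "P \<cdot> (f \<cdot> g \<cdot> h) = ((I Y \<boxtimes> f') \<cdot> (I Y \<boxtimes> g') \<cdot> (I Y \<boxtimes> h')) \<cdot> P"
    if "P \<cdot> f = (I Y \<boxtimes> f') \<cdot> P" "P \<cdot> g = (I Y \<boxtimes> g') \<cdot> P" "P \<cdot> h = (I Y \<boxtimes> h') \<cdot> P"
      "f \<in> homset C (((Y \<star> X) \<star> X) \<star> X) (((Y \<star> X) \<star> X) \<star> X)" "g \<in> homset C (((Y \<star> X) \<star> X) \<star> X) (((Y \<star> X) \<star> X) \<star> X)"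
      "h \<in> homset C (((Y \<star> X) \<star> X) \<star> X) (((Y \<star> X) \<star> X) \<star> X)"
      "f' \<in> homset C (X \<star> (X \<star> X)) (X \<star> (X \<star> X))" "g' \<in> homset C (X \<star> (X \<star> X)) (X \<star> (X \<star> X))" "h' \<in> homset C (X \<star> (X \<star> X)) (X \<star> (X \<star> X))"
    for f g h f' g' h'
  proof -
    have "P \<cdot> (f \<cdot> g \<cdot> h) = (P \<cdot> f) \<cdot> (g \<cdot> h)" using that(4-) by simp
    also have "\<dots> = (I Y \<boxtimes> f') \<cdot> ((P \<cdot> g) \<cdot> h)" unfolding that(1) using that(4-) Y by simp
    also have "\<dots> = (I Y \<boxtimes> f') \<cdot> ((I Y \<boxtimes> g') \<cdot> (P \<cdot> h))" unfolding that(2) using that(4-) Y by simp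
    finally show ?thesis unfolding that(3) using that(4-) Y by simp
  qed
  let ?f = "cc (Y \<star> X) \<cdot> (cc Y \<boxtimes> I X) \<cdot> cc (Y \<star> X)" and ?g = "(cc Y \<boxtimes> I X) \<cdot> cc (Y \<star> X) \<cdot> (cc Y \<boxtimes> I X)"
  have fg: "?f \<in> Arr C" "?g \<in> Arr C" "Tgt C ?f = Src C P" "Tgt C ?g = Src C P" using Y by simp_all
  have "P \<cdot> ?f = ((I Y \<boxtimes> s1) \<cdot> (I Y \<boxtimes> s2) \<cdot> (I Y \<boxtimes> s1)) \<cdot> P" by (rule Y3[OF P1 P2 P1]) (use Y in simp_all)
  also have "(I Y \<boxtimes> s1) \<cdot> (I Y \<boxtimes> s2) \<cdot> (I Y \<boxtimes> s1) = (I Y \<boxtimes> s2) \<cdot> (I Y \<boxtimes> s1) \<cdot> (I Y \<boxtimes> s2)"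
    using Y by (simp add: tarr_cmp' braid)
  also have "\<dots> \<cdot> P = P \<cdot> ?g" by (rule Y3[OF P2 P1 P2, symmetric]) (use Y in simp_all)
  finally have "?a \<cdot> (?b \<cdot> ?f) = ?a \<cdot> (?b \<cdot> ?g)" unfolding P_def using Y by simp
  then have "?b \<cdot> ?f = ?b \<cdot> ?g" by (rule iso_cancel_left[rotated -1]) (use Y in simp_all)
  then show ?thesis by (rule iso_cancel_left[rotated -1]) (use Y in simp_all)
qed

text \<open>The chord of \<open>Y \<otimes> X\<close> with \<open>X\<close> is read off from that of \<open>X\<close> with \<open>Y \<otimes> X\<close>, to which the chording
  axiom applies; its second summand contains the chord of \<open>X\<close> with itself.\<close>

lemma chord_cross:
  assumes Y: "Y \<in> Obj C"
  shows "Chord C (Y \<star> X) X \<cdot> cc Y = Plus C (cc Y \<cdot> (Chord C Y X \<boxtimes> I X)) (Scal C l (I ((Y \<star> X) \<star> X)))"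
proof -
  define A where "A = Y \<star> X"
  have A [simp]: "A \<in> Obj C" using Y by (simp add: A_def)
  let ?h = "Chord C A X" and ?B = "Sym C X A" and ?\<sigma> = "Sym C X Y" and ?a = "Assoc C X Y X" and ?b = "Assoc C X X Y"
  have AX: "A \<star> X = (Y \<star> X) \<star> X" by (simp add: A_def)
  note As = A_def[symmetric]
  \<comment> \<open>The hexagon for \<open>X\<close>, \<open>Y\<close>, \<open>X\<close>: moving
    \<open>X\<close> past \<open>Y \<star> X\<close> means moving it past \<open>Y\<close> and then
    exchanging the last two factors, which is \<open>cc Y\<close>.\<close>
  have H1: "?B \<cdot> ?a = cc Y \<cdot> (?\<sigma> \<boxtimes> I X)"
  proof (rule cc_eqI[OF Y])
    have "Assoc C Y X X \<cdot> (?B \<cdot> ?a) = ((I Y \<boxtimes> s) \<cdot> Assoc C Y X X) \<cdot> (?\<sigma> \<boxtimes> I X)"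
      using hexagon[of X Y X] Y by (simp add: A_def)
    then show "Assoc C Y X X \<cdot> (?B \<cdot> ?a) = Assoc C Y X X \<cdot> (cc Y \<cdot> (?\<sigma> \<boxtimes> I X))"
      unfolding assoc_cc[OF Y, symmetric] using Y by simp
  qed (use Y in \<open>simp_all add: A_def\<close>)
  \<comment> \<open>The same equation solved for the other side, which is possible because
    \<open>cc Y\<close> is an involution.\<close>
  have H2: "(?\<sigma> \<boxtimes> I X) \<cdot> inv_arr C ?a = cc Y \<cdot> ?B"
  proof (rule iso_cancel_right[of ?a])
    have "(cc Y \<cdot> ?B) \<cdot> ?a = cc Y \<cdot> (?B \<cdot> ?a)" using Y by (simp add: A_def)
    also have "\<dots> = (cc Y \<cdot> cc Y) \<cdot> (?\<sigma> \<boxtimes> I X)" unfolding H1 using Y by simp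
    also have "\<dots> = ((?\<sigma> \<boxtimes> I X) \<cdot> inv_arr C ?a) \<cdot> ?a" unfolding cc_cc[OF Y] using Y by simp
    finally show "((?\<sigma> \<boxtimes> I X) \<cdot> inv_arr C ?a) \<cdot> ?a = (cc Y \<cdot> ?B) \<cdot> ?a" ..
  qed (use Y in \<open>simp_all add: A_def\<close>)
  define P1 where "P1 = ?a \<cdot> (Chord C X Y \<boxtimes> I X) \<cdot> inv_arr C ?a"
  define P2 where "P2 = inv_arr C (I X \<boxtimes> Sym C Y X) \<cdot> (?b \<cdot> (Chord C X X \<boxtimes> I Y) \<cdot> inv_arr C ?b) \<cdot> (I X \<boxtimes> Sym C Y X)"
  have inv: "inv_arr C (I X \<boxtimes> Sym C Y X) = I X \<boxtimes> ?\<sigma>"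
    by (intro inv_arr_eq is_isoI(2)[of _ _ "X \<star> (Y \<star> X)" "X \<star> (X \<star> Y)"]) (use Y in \<open>simp_all add: tarr_cmp' sym_sym tarr_idt\<close>)
  have tensor: "Chord C X A = Plus C P1 P2"
    unfolding A_def P1_def P2_def by (rule chord_tensor) (use Y in simp_all)
  have P1: "P1 \<in> Arr C" "Src C P1 = X \<star> A" "Tgt C P1 = X \<star> A" "P2 \<in> Arr C" "Src C P2 = X \<star> A" "Tgt C P2 = X \<star> A"
    using Y by (simp_all add: P1_def P2_def inv A_def)
  \<comment> \<open>In the first summand of the chording axiom the symmetry replaces the chord of
    \<open>X\<close> and \<open>Y\<close> by that of \<open>Y\<close> and \<open>X\<close>;
    \<open>H1\<close> and \<open>H2\<close> each contribute one factor \<open>cc Y\<close>.\<close>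
  have BP1: "?B \<cdot> P1 = (cc Y \<cdot> (Chord C Y X \<boxtimes> I X) \<cdot> cc Y) \<cdot> ?B"
  proof -
    have "?B \<cdot> P1 = (?B \<cdot> ?a) \<cdot> ((Chord C X Y \<boxtimes> I X) \<cdot> inv_arr C ?a)" using Y by (simp add: P1_def A_def)
    also have "\<dots> = cc Y \<cdot> (((?\<sigma> \<boxtimes> I X) \<cdot> (Chord C X Y \<boxtimes> I X)) \<cdot> inv_arr C ?a)" unfolding H1 using Y by simp
    also have "(?\<sigma> \<boxtimes> I X) \<cdot> (Chord C X Y \<boxtimes> I X) = (Chord C Y X \<boxtimes> I X) \<cdot> (?\<sigma> \<boxtimes> I X)"
      using Y chord_sym[of X Y] by (simp add: tarr_cmp')
    also have "cc Y \<cdot> (((Chord C Y X \<boxtimes> I X) \<cdot> (?\<sigma> \<boxtimes> I X)) \<cdot> inv_arr C ?a) = (cc Y \<cdot> (Chord C Y X \<boxtimes> I X)) \<cdot> ((?\<sigma> \<boxtimes> I X) \<cdot> inv_arr C ?a)"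
      using Y by simp
    finally show ?thesis unfolding H2 using Y by (simp add: A_def)
  qed
  \<comment> \<open>\<open>Q\<close> carries \<open>Y\<close> to the front past both copies of
    \<open>X\<close> and exchanges these copies. It intertwines \<open>s\<close> on the source with
    \<open>cc Y\<close> on the target, as \<open>cQ\<close> shows.\<close>
  define Q where "Q = ?B \<cdot> (I X \<boxtimes> ?\<sigma>) \<cdot> ?b"
  have Q: "Q \<in> Arr C" "Src C Q = (X \<star> X) \<star> Y" "Tgt C Q = (Y \<star> X) \<star> X" using Y by (simp_all add: Q_def A_def)
  have QQ: "Q = cc Y \<cdot> (Q \<cdot> (s \<boxtimes> I Y))"
  proof -
    have hex: "(I X \<boxtimes> ?\<sigma>) \<cdot> ?b \<cdot> (s \<boxtimes> I Y) = ?a \<cdot> Sym C X (X \<star> Y) \<cdot> ?b" using hexagon[of X X Y] Y by simp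
    have nat: "?B \<cdot> (I X \<boxtimes> ?\<sigma>) = (?\<sigma> \<boxtimes> I X) \<cdot> Sym C X (X \<star> Y)" unfolding A_def by (rule sym_nat) (use Y in simp_all)
    have "cc Y \<cdot> (Q \<cdot> (s \<boxtimes> I Y)) = cc Y \<cdot> (?B \<cdot> ((I X \<boxtimes> ?\<sigma>) \<cdot> ?b \<cdot> (s \<boxtimes> I Y)))" unfolding Q_def using Y by (simp add: A_def)
    also have "\<dots> = cc Y \<cdot> ((?B \<cdot> ?a) \<cdot> (Sym C X (X \<star> Y) \<cdot> ?b))" unfolding hex using Y by (simp add: A_def)
    also have "\<dots> = (cc Y \<cdot> cc Y) \<cdot> (((?\<sigma> \<boxtimes> I X) \<cdot> Sym C X (X \<star> Y)) \<cdot> ?b)" unfolding H1 using Y by simp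
    also have "\<dots> = Q" unfolding nat[symmetric] cc_cc[OF Y] using Y by (simp add: Q_def A_def)
    finally show ?thesis ..
  qed
  have cQ: "cc Y \<cdot> Q = Q \<cdot> (s \<boxtimes> I Y)"
  proof -
    have "cc Y \<cdot> Q = (cc Y \<cdot> cc Y) \<cdot> (Q \<cdot> (s \<boxtimes> I Y))" by (subst QQ) (use Y Q in simp)
    then show ?thesis unfolding cc_cc[OF Y] using Y Q by simp
  qed
  \<comment> \<open>Degeneracy of \<open>X\<close> enters here: in the second summand the chord of
    \<open>X\<close> with itself is \<open>l\<close> times \<open>s\<close>, and \<open>Q\<close>
    converts this \<open>s\<close> into \<open>cc Y\<close>, so that the summand becomes a multiple
    of \<open>cc Y\<close>.\<close>
  have BP2: "?B \<cdot> P2 = Scal C l (cc Y) \<cdot> ?B"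
  proof -
    have "?B \<cdot> P2 = Scal C l ((Q \<cdot> (s \<boxtimes> I Y)) \<cdot> (inv_arr C ?b \<cdot> (I X \<boxtimes> Sym C Y X)))"
      unfolding P2_def inv Q_def chord_X using Y by (simp add: tarr_scal cmp_linear A_def)
    also have "(Q \<cdot> (s \<boxtimes> I Y)) \<cdot> (inv_arr C ?b \<cdot> (I X \<boxtimes> Sym C Y X)) = cc Y \<cdot> (Q \<cdot> (inv_arr C ?b \<cdot> (I X \<boxtimes> Sym C Y X)))"
      unfolding cQ[symmetric] using Y Q by simp
    also have "Q \<cdot> (inv_arr C ?b \<cdot> (I X \<boxtimes> Sym C Y X)) = ?B \<cdot> ((I X \<boxtimes> ?\<sigma>) \<cdot> ((?b \<cdot> inv_arr C ?b) \<cdot> (I X \<boxtimes> Sym C Y X)))"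
      unfolding Q_def using Y by (simp add: A_def del: inv_arr_simps(5))
    also have "\<dots> = ?B" using Y by (simp add: A_def tarr_cmp' sym_sym tarr_idt)
    finally show ?thesis using Y by (simp add: cmp_linear A_def)
  qed
  \<comment> \<open>The chording axiom for \<open>X\<close> and \<open>Y \<star> X\<close> is
    transported along the symmetry, which is then cancelled. Multiplication by the involution
    \<open>cc Y\<close> gives the required form.\<close>
  have "?h \<cdot> ?B = ?B \<cdot> Chord C X A" by (rule chord_sym) simp_all
  also have "\<dots> = Plus C (?B \<cdot> P1) (?B \<cdot> P2)" unfolding tensor using P1 by (simp add: cmp_linear)
  also have "\<dots> = Plus C (cc Y \<cdot> (Chord C Y X \<boxtimes> I X) \<cdot> cc Y) (Scal C l (cc Y)) \<cdot> ?B"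
    unfolding BP1 BP2 using Y by (subst cmp_plus_left) (simp_all add: A_def)
  finally have "?h = Plus C (cc Y \<cdot> (Chord C Y X \<boxtimes> I X) \<cdot> cc Y) (Scal C l (cc Y))"
    by (rule iso_cancel_right[rotated -1]) (use Y in \<open>simp_all add: A_def\<close>)
  then have "?h \<cdot> cc Y = Plus C (cc Y \<cdot> (Chord C Y X \<boxtimes> I X) \<cdot> (cc Y \<cdot> cc Y)) (Scal C l (cc Y \<cdot> cc Y))"
    using Y by (simp add: cmp_linear)
  then show ?thesis unfolding cc_cc[OF Y] A_def using Y by simp
qed

abbreviation T :: "('o, 'm, 'o, 'm) ftor" where "T \<equiv> tensor_right C X"

lemma T_simps [simp]: "endofunctor T" "Y \<in> Obj C \<Longrightarrow> OMap T Y = Y \<star> X" "f \<in> Arr C \<Longrightarrow> AMap T f = f \<boxtimes> I X"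
  by (simp_all add: tensor_right_endo)

lemma tensor_sym_simps [simp]:
  "NSrc (tensor_sym C X) = ftor_comp C T T" "NTgt (tensor_sym C X) = ftor_comp C T T" "Y \<in> Obj C \<Longrightarrow> NAt (tensor_sym C X) Y = cc Y"
  "NSrc (tensor_chord C X l) = T" "NTgt (tensor_chord C X l) = T" "Y \<in> Obj C \<Longrightarrow> NAt (tensor_chord C X l) Y = Scal C (inverse l) (Chord C Y X)"
  by (simp_all add: tensor_sym_def tensor_chord_def cc_def)

lemma tensor_nt [simp]: "endotrans (tensor_sym C X)" "endotrans (tensor_chord C X l)"
proof -
  show "endotrans (tensor_sym C X)"
    by (rule natural_transformationI) (simp_all add: cc_nat, simp add: tensor_sym_def)
  have "Chord C (Tgt C f) X \<cdot> (f \<boxtimes> I X) = (f \<boxtimes> I X) \<cdot> Chord C (Src C f) X" if "f \<in> Arr C" for f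
    by (rule chord_nat) (use that in simp_all)
  then show "endotrans (tensor_chord C X l)"
    by (intro natural_transformationI) (simp_all add: cmp_linear, simp add: tensor_chord_def)
qed

text \<open>In a composite of endofunctors the right factor is applied first. Up to the scalar, the
  chord tensored with the identity of \<open>T\<close> therefore has the component
  \<open>Chord C (Y \<star> X) X\<close>, and in the other order the component
  \<open>Chord C Y X \<boxtimes> I X\<close>. With these components \<open>chord_cross\<close> is
  the relation \<open>cross\<close> and not its mirror image.\<close>

lemma hecke_triple: "hecke_triple End T (tensor_chord C X l) (tensor_sym C X)"
proof (rule hecke_triple.intro[OF End_strict], rule hecke_triple_axioms.intro)
  interpret E: strict_monoidal End by (rule End_strict)
  show "tensor_sym C X \<cdot>\<^bsub>End\<^esub> tensor_sym C X = Idt End (T \<star>\<^bsub>End\<^esub> T)"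
    by (rule nt_eqI) (simp_all add: cc_cc)
  show "(tensor_sym C X \<boxtimes>\<^bsub>End\<^esub> Idt End T) \<cdot>\<^bsub>End\<^esub> (Idt End T \<boxtimes>\<^bsub>End\<^esub> tensor_sym C X) \<cdot>\<^bsub>End\<^esub> (tensor_sym C X \<boxtimes>\<^bsub>End\<^esub> Idt End T) =
      (Idt End T \<boxtimes>\<^bsub>End\<^esub> tensor_sym C X) \<cdot>\<^bsub>End\<^esub> (tensor_sym C X \<boxtimes>\<^bsub>End\<^esub> Idt End T) \<cdot>\<^bsub>End\<^esub> (Idt End T \<boxtimes>\<^bsub>End\<^esub> tensor_sym C X)"
  proof (rule nt_eqI)
    show "NSrc ((tensor_sym C X \<boxtimes>\<^bsub>End\<^esub> Idt End T) \<cdot>\<^bsub>End\<^esub> (Idt End T \<boxtimes>\<^bsub>End\<^esub> tensor_sym C X) \<cdot>\<^bsub>End\<^esub> (tensor_sym C X \<boxtimes>\<^bsub>End\<^esub> Idt End T)) =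
      NSrc ((Idt End T \<boxtimes>\<^bsub>End\<^esub> tensor_sym C X) \<cdot>\<^bsub>End\<^esub> (tensor_sym C X \<boxtimes>\<^bsub>End\<^esub> Idt End T) \<cdot>\<^bsub>End\<^esub> (Idt End T \<boxtimes>\<^bsub>End\<^esub> tensor_sym C X))"
      and "NTgt ((tensor_sym C X \<boxtimes>\<^bsub>End\<^esub> Idt End T) \<cdot>\<^bsub>End\<^esub> (Idt End T \<boxtimes>\<^bsub>End\<^esub> tensor_sym C X) \<cdot>\<^bsub>End\<^esub> (tensor_sym C X \<boxtimes>\<^bsub>End\<^esub> Idt End T)) =
      NTgt ((Idt End T \<boxtimes>\<^bsub>End\<^esub> tensor_sym C X) \<cdot>\<^bsub>End\<^esub> (tensor_sym C X \<boxtimes>\<^bsub>End\<^esub> Idt End T) \<cdot>\<^bsub>End\<^esub> (Idt End T \<boxtimes>\<^bsub>End\<^esub> tensor_sym C X))"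
      using E.tobj_assoc[of T T T] by simp_all
  qed (use E.tobj_assoc[of T T T] in \<open>simp_all add: cc_braid tarr_idt\<close>)
  show "(tensor_chord C X l \<boxtimes>\<^bsub>End\<^esub> Idt End T) \<cdot>\<^bsub>End\<^esub> tensor_sym C X =
      Plus End (tensor_sym C X \<cdot>\<^bsub>End\<^esub> (Idt End T \<boxtimes>\<^bsub>End\<^esub> tensor_chord C X l)) (Idt End (T \<star>\<^bsub>End\<^esub> T))"
  proof (rule nt_eqI)
    fix Y assume "Y \<in> Obj C"
    then have Y: "Y \<in> Obj C" .
    let ?h = "Chord C (Y \<star> X) X" and ?j = "Chord C Y X \<boxtimes> I X"
    \<comment> \<open>The factor \<open>inverse l\<close> in \<open>tensor_chord\<close> normalises
      the multiple \<open>l\<close> of the identity in \<open>chord_cross\<close> to the identity;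
      this is where \<open>l\<close> has to be nonzero.\<close>
    have "Scal C (inverse l) (?h \<cdot> cc Y) = Plus C (Scal C (inverse l) (cc Y \<cdot> ?j)) (Scal C (inverse l) (Scal C l (I ((Y \<star> X) \<star> X))))"
      unfolding chord_cross[OF Y] by (rule scal_plus) (use Y in auto)
    also have "Scal C (inverse l) (Scal C l (I ((Y \<star> X) \<star> X))) = I ((Y \<star> X) \<star> X)"
      using scal_scal[of "I ((Y \<star> X) \<star> X)" "(Y \<star> X) \<star> X" "(Y \<star> X) \<star> X" "inverse l" l] scal_one[of "I ((Y \<star> X) \<star> X)"] l Y by simp
    finally show "NAt ((tensor_chord C X l \<boxtimes>\<^bsub>End\<^esub> Idt End T) \<cdot>\<^bsub>End\<^esub> tensor_sym C X) Y =
        NAt (Plus End (tensor_sym C X \<cdot>\<^bsub>End\<^esub> (Idt End T \<boxtimes>\<^bsub>End\<^esub> tensor_chord C X l)) (Idt End (T \<star>\<^bsub>End\<^esub> T))) Y"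
      using Y by (simp add: cmp_linear tarr_idt tarr_scal)
  qed simp_all
qed simp_all

end


section \<open>Cocontinuity of the powers of an endofunctor, and the proposition\<close>

lemma small_cocontinuous_id:
  assumes "klinear_category C"
  shows "small_cocontinuous TYPE('v) C C (ftor_id C)"
proof -
  interpret klinear_category C by (rule assms)
  have c: "is_coproduct C I (\<lambda>i. OMap (ftor_id C) (d i)) (OMap (ftor_id C) s) (\<lambda>i. AMap (ftor_id C) (j i))"
    if d: "d ` I \<subseteq> Obj C" and c: "is_coproduct C I d s j" for I :: "'v set" and d s j
  proof -
    have e: "\<And>i. i \<in> I \<Longrightarrow> OMap (ftor_id C) (d i) = d i" "OMap (ftor_id C) s = s" "\<And>i. i \<in> I \<Longrightarrow> AMap (ftor_id C) (j i) = j i"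
      using d c by (auto simp: is_coproduct_def)
    show ?thesis using c unfolding is_coproduct_def by (simp add: e del: in_homset cong: ball_cong)
  qed
  have q: "is_coequalizer C (AMap (ftor_id C) f) (AMap (ftor_id C) g) (AMap (ftor_id C) q)"
    if "f \<in> homset C a b" "g \<in> homset C a b" "is_coequalizer C f g q" for a b f g q
  proof -
    have "q \<in> Arr C" using that(3) by (simp add: is_coequalizer_def)
    then show ?thesis using that by simp
  qed
  show ?thesis unfolding small_cocontinuous_def using c q by blast
qed

lemma small_cocontinuous_comp:
  assumes C: "klinear_category C" and FG: "klinear_functor C C F" "klinear_functor C C G"
    and cF: "small_cocontinuous TYPE('v) C C F" and cG: "small_cocontinuous TYPE('v) C C G"
  shows "small_cocontinuous TYPE('v) C C (ftor_comp C F G)"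
proof -
  interpret klinear_category C by (rule C)
  have c: "is_coproduct C I (\<lambda>i. OMap (ftor_comp C F G) (d i)) (OMap (ftor_comp C F G) s) (\<lambda>i. AMap (ftor_comp C F G) (j i))"
    if d: "d ` I \<subseteq> Obj C" and c: "is_coproduct C I d s j" for I :: "'v set" and d s j
  proof -
    have e: "\<And>i. i \<in> I \<Longrightarrow> OMap (ftor_comp C F G) (d i) = OMap F (OMap G (d i))"
      "OMap (ftor_comp C F G) s = OMap F (OMap G s)" "\<And>i. i \<in> I \<Longrightarrow> AMap (ftor_comp C F G) (j i) = AMap F (AMap G (j i))"
      using d c by (auto simp: is_coproduct_def)
    have "is_coproduct C I (\<lambda>i. OMap G (d i)) (OMap G s) (\<lambda>i. AMap G (j i))"
      using cG d c unfolding small_cocontinuous_def by blast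
    moreover have "(\<lambda>i. OMap G (d i)) ` I \<subseteq> Obj C" using d FG(2) by auto
    ultimately have "is_coproduct C I (\<lambda>i. OMap F (OMap G (d i))) (OMap F (OMap G s)) (\<lambda>i. AMap F (AMap G (j i)))"
      using cF unfolding small_cocontinuous_def by blast
    then show ?thesis unfolding is_coproduct_def by (simp add: e del: in_homset cong: ball_cong)
  qed
  have q: "is_coequalizer C (AMap (ftor_comp C F G) f) (AMap (ftor_comp C F G) g) (AMap (ftor_comp C F G) q)"
    if f: "f \<in> homset C a b" "g \<in> homset C a b" and q: "is_coequalizer C f g q" for a b f g q
  proof -
    have "q \<in> Arr C" using q by (simp add: is_coequalizer_def)
    have "is_coequalizer C (AMap G f) (AMap G g) (AMap G q)"
      using cG f q unfolding small_cocontinuous_def by blast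
    moreover have "AMap G f \<in> homset C (OMap G a) (OMap G b)" "AMap G g \<in> homset C (OMap G a) (OMap G b)"
      using f FG by auto
    ultimately have "is_coequalizer C (AMap F (AMap G f)) (AMap F (AMap G g)) (AMap F (AMap G q))"
      using cF unfolding small_cocontinuous_def by blast
    then show ?thesis using f \<open>q \<in> Arr C\<close> by simp
  qed
  show ?thesis unfolding small_cocontinuous_def using c q by blast
qed

text \<open>The functor exists on the objects \<open>[n]\<close> without further hypotheses; its
  extension to all presheaves is built from colimits in \<open>C\<close>, whence the two halves. The
  equations for the third member of the triple contain the comparison map because the image of a
  tensor square is only isomorphic to the square of the image.\<close>

theorem proposition8p8:
  fixes C :: "('o, 'm, 'k::field) chordcat" and X :: 'o and l :: 'k
  assumes "chorded_category C"
    and "degenerate_Hecke_object C X"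
    and "l \<noteq> 0" and "Chord C X X = Scal C l (Sym C X X)"
  shows
    "(\<exists>G \<gamma> \<gamma>0. strong_monoidal_functor hecke_bar (endo_cat C) G \<gamma> \<gamma>0 \<and>
        OMap G 1 = tensor_right C X \<and>
        AMap G hecke_y1 = tensor_chord C X l \<and>
        AMap G hecke_t1 \<cdot>\<^bsub>endo_cat C\<^esub> \<gamma> 1 1 = \<gamma> 1 1 \<cdot>\<^bsub>endo_cat C\<^esub> tensor_sym C X)
     \<and>
     (infinite (UNIV :: 'v set) \<and> (\<exists>i :: 'k \<Rightarrow> 'v. inj i) \<and>
      small_cocomplete TYPE('v) C \<and> small_cocontinuous TYPE('v) C C (tensor_right C X) \<longrightarrow>
      (\<exists>(CAS :: ((nat, 'k hecke_arr, 'k, 'v) psh, (nat, 'k hecke_arr, 'k, 'v) psh_map,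
                 ('o, 'm, 'o, 'm) ftor, ('o, 'm, 'o, 'm) ntrans) ftor) \<phi> \<phi>0.
        strong_monoidal_functor hecke_cat (endo_cat C) CAS \<phi> \<phi>0 \<and>
        OMap CAS hecke_gen = tensor_right C X \<and>
        AMap CAS hecke_x = tensor_chord C X l \<and>
        AMap CAS hecke_c \<cdot>\<^bsub>endo_cat C\<^esub> \<phi> hecke_gen hecke_gen =
          \<phi> hecke_gen hecke_gen \<cdot>\<^bsub>endo_cat C\<^esub> tensor_sym C X))"
proof -
  have ho: "hecke_object C X l"
    using assms by (intro hecke_object.intro hecke_object_axioms.intro) (simp_all add: degenerate_Hecke_object_def)
  interpret C: hecke_object C X l by (rule ho)
  interpret H: hecke_triple "endo_cat C" "tensor_right C X" "tensor_chord C X l" "tensor_sym C X" by (rule C.hecke_triple)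
  let ?H = "hecke_bar :: (nat, 'k hecke_arr, 'k) moncat"
  have G1: "OMap H.G 1 = tensor_right C X" using H.pw_one(2) by simp
  have t1: "hecke_t1 \<in> homset ?H 2 2" "hecke_y1 \<in> homset ?H 1 1"
  proof -
    have "(hecke_y1 :: 'k hecke_arr) = har 1 1 (yy 1)" "(hecke_t1 :: 'k hecke_arr) = har 2 2 (tt 1)" by (simp_all add: hecke_y1_def hecke_t1_def har_def)
    note e = this
    show "hecke_t1 \<in> homset ?H 2 2" "hecke_y1 \<in> homset ?H 1 1"
      unfolding e by simp_all
  qed
  let ?\<gamma> = "\<lambda>a b :: nat. Idt (endo_cat C) (OMap H.G (TObj ?H a b))"
  let ?u = "Idt (endo_cat C) (One (endo_cat C))"
  have G_tobj: "OMap H.G (a \<star>\<^bsub>?H\<^esub> b) = OMap H.G a \<star>\<^bsub>endo_cat C\<^esub> OMap H.G b" for a b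
    by (simp add: H.pw_add)
  have "strong_monoidal_functor hecke_bar (endo_cat C) H.G ?\<gamma> ?u"
    by (rule strict_functor_strong[OF hecke_strict C.End_strict H.G_functor G_tobj H.G_tarr]) simp_all
  \<comment> \<open>\<open>G\<close> is strict, so the comparison map at \<open>(1, 1)\<close> is an
    identity and the equation reduces to the value of \<open>G\<close> at
    \<open>hecke_t1\<close>.\<close>
  moreover have "AMap H.G hecke_t1 \<cdot>\<^bsub>endo_cat C\<^esub> ?\<gamma> 1 1 = ?\<gamma> 1 1 \<cdot>\<^bsub>endo_cat C\<^esub> tensor_sym C X"
  proof -
    have "?\<gamma> 1 1 = Idt (endo_cat C) (tensor_right C X \<star>\<^bsub>endo_cat C\<^esub> tensor_right C X)"
      unfolding G_tobj G1 ..
    then show ?thesis unfolding H.G_t1 using H.c by (simp only: H.cmp_idt')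
  qed
  ultimately have part1: "strong_monoidal_functor hecke_bar (endo_cat C) H.G ?\<gamma> ?u \<and>
        OMap H.G 1 = tensor_right C X \<and> AMap H.G hecke_y1 = tensor_chord C X l \<and>
        AMap H.G hecke_t1 \<cdot>\<^bsub>endo_cat C\<^esub> ?\<gamma> 1 1 = ?\<gamma> 1 1 \<cdot>\<^bsub>endo_cat C\<^esub> tensor_sym C X"
    using G1 H.G_y1 by blast
  have part2: "\<exists>(CAS :: ((nat, 'k hecke_arr, 'k, 'v) psh, (nat, 'k hecke_arr, 'k, 'v) psh_map,
                 ('o, 'm, 'o, 'm) ftor, ('o, 'm, 'o, 'm) ntrans) ftor) \<phi> \<phi>0.
        strong_monoidal_functor hecke_cat (endo_cat C) CAS \<phi> \<phi>0 \<and>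
        OMap CAS hecke_gen = tensor_right C X \<and>
        AMap CAS hecke_x = tensor_chord C X l \<and>
        AMap CAS hecke_c \<cdot>\<^bsub>endo_cat C\<^esub> \<phi> hecke_gen hecke_gen =
          \<phi> hecke_gen hecke_gen \<cdot>\<^bsub>endo_cat C\<^esub> tensor_sym C X"
    if inf: "infinite (UNIV :: 'v set)" and inj: "\<exists>i :: 'k \<Rightarrow> 'v. inj i"
      and cc: "small_cocomplete TYPE('v) C" and ct: "small_cocontinuous TYPE('v) C C (tensor_right C X)"
  proof -
    interpret V: universe "TYPE('v)" by (rule universe.intro[OF inf])
    have k: "small TYPE('v) (UNIV :: 'k set)" using inj by (auto simp: small_def)
    \<comment> \<open>Cocontinuity of tensoring by \<open>X\<close> passes to its iterated
      composites, which are the values of \<open>G\<close> on objects.\<close>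
    have cont: "small_cocontinuous TYPE('v) C C (H.pw n)" for n
    proof (induction n)
      case 0
      show ?case using small_cocontinuous_id[OF C.klinear_category_axioms] by simp
    next
      case (Suc n)
      have "klinear_functor C C (H.pw n)" using H.pw_obj[of n] by simp
      then show ?case using small_cocontinuous_comp[OF C.klinear_category_axioms C.T_simps(1) _ ct Suc] by simp
    qed
    have act: "endo_action TYPE('v) ?H C H.G"
    proof (rule endo_action.intro[OF V.hecke_small[OF k] C.klinear_category_axioms], rule endo_action_axioms.intro)
      show "klinear_functor hecke_bar (endo_cat C) H.G" by (rule H.G_functor)
      show "AMap H.G (f \<boxtimes>\<^bsub>hecke_bar\<^esub> g) = AMap H.G f \<boxtimes>\<^bsub>endo_cat C\<^esub> AMap H.G g"
        if "f \<in> Arr hecke_bar" "g \<in> Arr hecke_bar" for f g using that by (rule H.G_tarr)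
      show "small_cocontinuous TYPE('v) C C (OMap H.G a)" for a using cont by simp
    qed (simp_all add: H.pw_add cc)
    have one: "(1 :: nat) \<in> Obj ?H" by simp
    obtain K \<phi> \<phi>0 where K: "strong_monoidal_functor (day_cat ?H) (endo_cat C) K \<phi> \<phi>0"
      "OMap K (yoneda hecke_bar 1 :: (nat, 'k hecke_arr, 'k, 'v) psh) = OMap H.G 1"
      "\<forall>r\<in>homset ?H 1 1. AMap K (yoneda_arr hecke_bar r) = AMap H.G r"
      "\<forall>t\<in>homset ?H (1 \<star>\<^bsub>?H\<^esub> 1) (1 \<star>\<^bsub>?H\<^esub> 1).
        AMap K (inv_arr (day_cat hecke_bar) (yoneda_tensor hecke_bar 1 1) \<cdot>\<^bsub>day_cat hecke_bar\<^esub> (yoneda_arr hecke_bar t \<cdot>\<^bsub>day_cat hecke_bar\<^esub> yoneda_tensor hecke_bar 1 1))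
          \<cdot>\<^bsub>endo_cat C\<^esub> \<phi> (yoneda hecke_bar 1) (yoneda hecke_bar 1) = \<phi> (yoneda hecke_bar 1) (yoneda hecke_bar 1) \<cdot>\<^bsub>endo_cat C\<^esub> AMap H.G t"
      using endo_action.induced_functor[OF act one] by (elim exE conjE) (rule that; assumption)
    have t2: "hecke_t1 \<in> homset ?H (1 \<star>\<^bsub>?H\<^esub> 1) (1 \<star>\<^bsub>?H\<^esub> 1)"
      using t1(1) by (simp add: numeral_2_eq_2)
    note c = bspec[OF K(4) t2, unfolded H.G_t1]
    note x = bspec[OF K(3) t1(2), unfolded H.G_y1]
    show ?thesis
      unfolding hecke_cat_def hecke_gen_def hecke_x_def hecke_c_def
      by (rule exI[of _ K], rule exI[of _ \<phi>], rule exI[of _ \<phi>0], intro conjI) (rule K(1), rule K(2)[unfolded G1], rule x, rule c)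
  qed
  show ?thesis
    by (rule conjI, rule exI[of _ H.G], rule exI[of _ ?\<gamma>], rule exI[of _ ?u], rule part1) (intro impI, elim conjE, rule part2)
qed

end
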